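(* Let $n\ge1$. (a) Let $0<\beta<\infty$ and let $\alpha_0,\ldots,\alpha_{n-2},e^{i\phi}$ be independent with $\alpha_k\sim\Theta(\beta(k+1)+1)$, $0\le k\le n-2$, and $e^{i\phi}\sim\Theta(1)$. Assume the reflection coefficient $R_a$ is independent of $\alpha_0,\ldots,\alpha_{n-2},\phi$ with a distribution on $(0,1)$ of the form $$F(R_a)\,\beta n\,(1-R_a^2)^{\frac{\beta}{2}n-1}R_a\,dR_a,$$ where $F$ is any function that makes this a probability distribution. Then the eigenvalues $z_1,\ldots,z_n$ of $\mathcal{C}(\alpha_0,\ldots,\alpha_{n-2},R_ae^{i\phi})$ are distributed in $\mathbb{D}^n$ with the joint distribution $$\frac{\beta^n}{(2\pi)^n}\prod_{j,k=1}^n(1-z_j\bar z_k)^{\frac{\beta}{2}-1}\prod_{j<k}|z_k-z_j|^2\,F\Big(\Big|\prod_{j=1}^nz_j\Big|\Big)\,d^2z_1\cdots d^2z_n.$$ (b) Let $0<\beta<\infty$ and let $\alpha_0,\ldots,\alpha_{n-2},\sigma$ be independent with $\alpha_k\sim B\left(\frac{\beta(k+1)}{4},\frac{\beta(k+1)}{4}\right)$, $0\le k\le n-2$, and $\sigma\sim B(0,0)$. Assume the reflection coefficient $R_a$ is independent of $\alpha_0,\ldots,\alpha_{n-2},\sigma$ with a distribution on $(0,1)$ of the form $$G(R_a)\,\frac{2\Gamma(\frac{\beta}{4}n+\frac12)}{\sqrt\pi\,\Gamma(\frac{\beta}{4}n)}(1-R_a^2)^{\frac{\beta}{4}n-1}\,dR_a,$$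 where $G$ is any function that makes this a probability distribution. Then the eigenvalues $z_1,\ldots,z_n$ of $\mathcal{C}(\alpha_0,\ldots,\alpha_{n-2},R_a\sigma)$ are distributed in $\mathbb{D}^n$ with the joint distribution $$\frac1{P_n}\prod_{j,k=1}^n(1-z_j\bar z_k)^{\frac{\beta}{4}-\frac12}\prod_{j=1}^n\frac{1}{\sqrt{1-z_j^2}}\prod_{j<k}|z_k-z_j|\,G\Big(\Big|\prod_{j=1}^nz_j\Big|\Big)\,|dz_1\wedge dz_2\wedge\cdots\wedge dz_n|,$$ where, with $a=b=-1+\frac\beta4$, $$P_n=2^{n(a+b+1)+\frac{\beta}{4}n(n-1)}\prod_{j=0}^{\lfloor\frac{n-1}{2}\rfloor}\frac{\Gamma(a+1+\frac{\beta}{2}j)\,\Gamma(b+1+\frac{\beta}{2}j)}{\Gamma\left(a+b+2+\frac{\beta}{2}\left(\lfloor\frac n2\rfloor+j\right)\right)}\prod_{j=1}^{\lfloor\frac n2\rfloor}\Gamma\left(\tfrac{\beta}{2}j\right).$$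
   Context: $\mathbb{D}=\{z\in\mathbb{C}:|z|<1\}$, $d^2z$ is two-dimensional Lebesgue measure, powers are principal. In (a) the joint law is the symmetric one: the unordered collection of eigenvalues has the law of the unordered collection of $n$ points with the stated density. Distributions. For $s,t>0$, $B(s,t)$ has density $\frac{2^{1-s-t}\Gamma(s+t)}{\Gamma(s)\Gamma(t)}(1-x)^{s-1}(1+x)^{t-1}$ on $(-1,1)$; $B(0,0)$ takes values $\pm1$ with probability $1/2$ each. For $\nu>1$, $\Theta(\nu)$ has density $\frac{\nu-1}{2\pi}(1-|z|^2)^{(\nu-3)/2}d^2z$ on $\mathbb{D}$; $\Theta(1)$ is uniform on the unit circle. CMV matrix: given $\alpha_0,\ldots,\alpha_{n-2}\in\mathbb{D}$, $\alpha_{n-1}\in\overline{\mathbb{D}}$, let $\rho_k=\sqrt{1-|\alpha_k|^2}$, $\Xi_k=\begin{bmatrix}\bar\alpha_k&\rho_k\\\rho_k&-\alpha_k\end{bmatrix}$ for $0\le k\le n-2$, $\Xi_{-1}=[1]$, $\Xi_{n-1}=[\bar\alpha_{n-1}]$, $\mathcal{L}=\operatorname{diag}(\Xi_0,\Xi_2,\ldots)$, $\mathcal{M}=\operatorname{diag}(\Xi_{-1},\Xi_1,\Xi_3,\ldots)$ ($n\times n$), and $\mathcal{C}(\alpha_0,\ldots,\alpha_{n-1})=\mathcal{L}\mathcal{M}$. Reference measure in (b): for $L,M\ge0$ with $L+2M=n$ let $D_{L,M}$ be the set of tuples $(x_1,\ldots,x_L,x_{L+1}\pm iy_{L+1},\ldots,x_{L+M}\pm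 iy_{L+M})\in\mathbb{D}^n$ with $-1<x_1<\cdots<x_L<1$, $-1<x_{L+1}<\cdots<x_{L+M}<1$, $y_{L+1},\ldots,y_{L+M}>0$, and $D=\bigcup_{L+2M=n}D_{L,M}$. For $f$ non-negative on $D$ and invariant under permutations of its arguments, $f(z_1,\ldots,z_n)|dz_1\wedge\cdots\wedge dz_n|$ is the measure on $D$ whose restriction to $D_{L,M}$ is $2^Mf(x_1,\ldots,x_L,x_{L+1}\pm iy_{L+1},\ldots,x_{L+M}\pm iy_{L+M})\,dx_1\cdots dx_{L+M}\,dy_{L+1}\cdots dy_{L+M}$. *)

theory Defs
  imports "HOL-Probability.Probability" "Jordan_Normal_Form.Char_Poly"
begin

definition Theta_dist :: "real \<Rightarrow> complex measure" where
  "Theta_dist \<nu> =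
     (if \<nu> = 1 then distr (uniform_measure lborel {0..<2 * pi}) borel cis
      else density lborel (\<lambda>z. if norm z < 1
             then ennreal ((\<nu> - 1) / (2 * pi) * (1 - (norm z)\<^sup>2) powr ((\<nu> - 3) / 2)) else 0))"

definition B_dist :: "real \<Rightarrow> real \<Rightarrow> real measure" where
  "B_dist s t =
     (if s = 0 \<and> t = 0 then distr (measure_pmf (pmf_of_set {-1, 1})) borel (\<lambda>x. x)
      else density lborel (\<lambda>x. if -1 < x \<and> x < 1
             then ennreal (2 powr (1 - s - t) * Gamma (s + t) / (Gamma s * Gamma t)
                    * (1 - x) powr (s - 1) * (1 + x) powr (t - 1)) else 0))"

text \<open>Two-variable independence as in the library's \<open>indep_var\<close>, which however forces both random
  variables to have the same value type.\<close>

definition indep_rv ::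
    "'w measure \<Rightarrow> 'a measure \<Rightarrow> ('w \<Rightarrow> 'a) \<Rightarrow> 'b measure \<Rightarrow> ('w \<Rightarrow> 'b) \<Rightarrow> bool" where
  "indep_rv M N X N' Y \<longleftrightarrow>
     X \<in> measurable M N \<and> Y \<in> measurable M N' \<and>
     prob_space.indep_set M {X -` A \<inter> space M |A. A \<in> sets N} {Y -` B \<inter> space M |B. B \<in> sets N'}"

definition CMV_block :: "nat \<Rightarrow> (nat \<Rightarrow> complex) \<Rightarrow> nat \<Rightarrow> complex mat" where
  "CMV_block n \<alpha> k =
     (let \<rho> = complex_of_real (sqrt (1 - (norm (\<alpha> k))\<^sup>2)) in
      if Suc k < n then mat_of_rows_list 2 [[cnj (\<alpha> k), \<rho>], [\<rho>, - \<alpha> k]]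
      else mat_of_rows_list 1 [[cnj (\<alpha> k)]])"

text \<open>The leading \<open>1\<close>-by-\<open>1\<close> identity block of \<open>CMV_M\<close> is \<open>\<Xi>\<^sub>-\<^sub>1\<close>.  The truncated last block
  (index \<open>n - 1\<close>) ends up in \<open>CMV_L\<close> or in \<open>CMV_M\<close> according to the parity of \<open>n\<close>.\<close>

definition CMV_L :: "nat \<Rightarrow> (nat \<Rightarrow> complex) \<Rightarrow> complex mat" where
  "CMV_L n \<alpha> = diag_block_mat (map (CMV_block n \<alpha>) (filter even [0..<n]))"

definition CMV_M :: "nat \<Rightarrow> (nat \<Rightarrow> complex) \<Rightarrow> complex mat" where
  "CMV_M n \<alpha> = diag_block_mat (1\<^sub>m 1 # map (CMV_block n \<alpha>) (filter odd [0..<n]))"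

definition CMV :: "nat \<Rightarrow> (nat \<Rightarrow> complex) \<Rightarrow> complex mat" where
  "CMV n \<alpha> = CMV_L n \<alpha> * CMV_M n \<alpha>"

definition eigenvalue_mset :: "complex mat \<Rightarrow> complex multiset" where
  "eigenvalue_mset A = proots (char_poly A)"

definition unordered :: "nat \<Rightarrow> (nat \<Rightarrow> complex) \<Rightarrow> complex multiset" where
  "unordered n z = image_mset z (mset_set {..<n})"

text \<open>Multisets of size \<open>n\<close> with the quotient \<open>\<sigma>\<close>-algebra: a set of multisets is measurable iff the
  set of all its orderings is a Borel subset of \<open>\<complex>\<close> to the power \<open>n\<close>.\<close>

definition unordered_borel :: "nat \<Rightarrow> complex multiset measure" where
  "unordered_borel n =
     sigma {X. size X = n}
       {A. A \<subseteq> {X. size X = n} \<and>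
           {z \<in> space (Pi\<^sub>M {..<n} (\<lambda>_. borel :: complex measure)). unordered n z \<in> A}
             \<in> sets (Pi\<^sub>M {..<n} (\<lambda>_. borel :: complex measure))}"

text \<open>Indices are shifted by one: \<open>x\<^sub>1, \<dots>, x\<^sub>L\<^sub>+\<^sub>M\<close> are \<open>x 0, \<dots>, x (L + M - 1)\<close>, and
  \<open>y\<^sub>L\<^sub>+\<^sub>1, \<dots>, y\<^sub>L\<^sub>+\<^sub>M\<close> are \<open>y L, \<dots>, y (L + M - 1)\<close>.  The pair \<open>x\<^sub>i \<plusminus> i y\<^sub>i\<close> occupies two
  consecutive positions of the tuple.\<close>

definition conj_tuple :: "nat \<Rightarrow> nat \<Rightarrow> (nat \<Rightarrow> real) \<Rightarrow> (nat \<Rightarrow> real) \<Rightarrow> nat \<Rightarrow> complex" where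
  "conj_tuple L M x y = (\<lambda>j\<in>{..<L + 2 * M}.
     if j < L then complex_of_real (x j)
     else let i = L + (j - L) div 2
          in Complex (x i) (if even (j - L) then y i else - y i))"

definition D_coords :: "nat \<Rightarrow> nat \<Rightarrow> ((nat \<Rightarrow> real) \<times> (nat \<Rightarrow> real)) set" where
  "D_coords L M = {(x, y).
     (\<forall>i<L + M. -1 < x i \<and> x i < 1) \<and>
     strict_mono_on {..<L} x \<and> strict_mono_on {L..<L + M} x \<and>
     (\<forall>i\<in>{L..<L + M}. 0 < y i) \<and>
     (\<forall>j<L + 2 * M. norm (conj_tuple L M x y j) < 1)}"

definition wedge_measure_part ::
    "nat \<Rightarrow> nat \<Rightarrow> ((nat \<Rightarrow> complex) \<Rightarrow> real) \<Rightarrow> (nat \<Rightarrow> complex) measure" where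
  "wedge_measure_part L M f =
     distr
       (density
          (Pi\<^sub>M {..<L + M} (\<lambda>_. lborel :: real measure)
            \<Otimes>\<^sub>M Pi\<^sub>M {L..<L + M} (\<lambda>_. lborel :: real measure))
          (\<lambda>(x, y). if (x, y) \<in> D_coords L M
                    then ennreal (2 ^ M * f (conj_tuple L M x y)) else 0))
       (Pi\<^sub>M {..<L + 2 * M} (\<lambda>_. borel :: complex measure))
       (\<lambda>(x, y). conj_tuple L M x y)"

text \<open>The measure \<open>f |dz\<^sub>1 \<and> \<dots> \<and> dz\<^sub>n|\<close>, regarded as a measure on all of \<open>n\<close>-dimensional complex
  space that is concentrated on the disjoint union of the sets \<open>D\<^sub>L\<^sub>,\<^sub>M\<close> with \<open>L + 2 M = n\<close>.\<close>

definition wedge_measure ::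
    "nat \<Rightarrow> ((nat \<Rightarrow> complex) \<Rightarrow> real) \<Rightarrow> (nat \<Rightarrow> complex) measure" where
  "wedge_measure n f =
     measure_of (space (Pi\<^sub>M {..<n} (\<lambda>_. borel :: complex measure)))
       (sets (Pi\<^sub>M {..<n} (\<lambda>_. borel :: complex measure)))
       (\<lambda>A. \<Sum>M\<le>n div 2. emeasure (wedge_measure_part (n - 2 * M) M f) A)"

text \<open>All powers and square roots are principal; they are complex numbers, but the factors come in
  complex conjugate pairs (\<open>(j, k)\<close> with \<open>(k, j)\<close>, and in the real case \<open>z\<^sub>j\<close> with its conjugate), so
  at the points where the densities are used the products are positive reals and \<open>Re\<close> only
  changes the type.\<close>

definition circular_density ::
    "nat \<Rightarrow> real \<Rightarrow> (real \<Rightarrow> real) \<Rightarrow> (nat \<Rightarrow> complex) \<Rightarrow> real" where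
  "circular_density n \<beta> F z =
     \<beta> ^ n / (2 * pi) ^ n
     * Re (\<Prod>j<n. \<Prod>k<n. (1 - z j * cnj (z k)) powr complex_of_real (\<beta> / 2 - 1))
     * (\<Prod>k<n. \<Prod>j<k. (norm (z k - z j))\<^sup>2)
     * F (norm (\<Prod>j<n. z j))"

definition P_const :: "nat \<Rightarrow> real \<Rightarrow> real" where
  "P_const n \<beta> = (let a = -1 + \<beta> / 4; b = -1 + \<beta> / 4 in
     2 powr (real n * (a + b + 1) + \<beta> / 4 * real n * (real n - 1))
     * (\<Prod>j=0..(n - 1) div 2.
          Gamma (a + 1 + \<beta> / 2 * real j) * Gamma (b + 1 + \<beta> / 2 * real j)
          / Gamma (a + b + 2 + \<beta> / 2 * (real (n div 2) + real j)))
     * (\<Prod>j=1..n div 2. Gamma (\<beta> / 2 * real j)))"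

definition orthogonal_density ::
    "nat \<Rightarrow> real \<Rightarrow> (real \<Rightarrow> real) \<Rightarrow> (nat \<Rightarrow> complex) \<Rightarrow> real" where
  "orthogonal_density n \<beta> G z =
     1 / P_const n \<beta>
     * Re ((\<Prod>j<n. \<Prod>k<n. (1 - z j * cnj (z k)) powr complex_of_real (\<beta> / 4 - 1 / 2))
           * (\<Prod>j<n. 1 / csqrt (1 - (z j)\<^sup>2)))
     * (\<Prod>k<n. \<Prod>j<k. norm (z k - z j))
     * G (norm (\<Prod>j<n. z j))"

end

theory Submission
  imports Defs
begin

text \<open>
The characteristic polynomial of the CMV matrix is the last polynomial \<open>\<Phi>\<^sub>n\<close> of the Szego recursion
\<open>\<Phi>\<^sub>k\<^sub>+\<^sub>1(z) = z \<Phi>\<^sub>k(z) - cnj \<alpha>\<^sub>k \<Phi>\<^sub>k\<^sup>*(z)\<close>, where \<open>\<Phi>\<^sub>k\<^sup>*\<close> is the reversed polynomial (\<open>char_poly_CMV\<close>). So the law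
of the eigenvalues is obtained from the law of the reflection coefficients \<open>\<alpha>\<^sub>k\<close> by two changes of
variables: from the \<open>\<alpha>\<^sub>k\<close> to the coefficients of \<open>\<Phi>\<^sub>n\<close>, and from these coefficients to the roots.

The first map is built up one step at a time; a step with parameter \<open>\<alpha>\<^sub>k\<close> is real linear in the
coefficients of \<open>\<Phi>\<^sub>k\<close> and its determinant is explicit (\<open>szego_integral\<close>). By the argument of Schur and
Cohn it maps the tuples with all \<open>|\<alpha>\<^sub>k| < 1\<close> onto the polynomials with all roots in the open disc
(\<open>schur_cohn_step\<close>, \<open>in_disc_last\<close>). The second map is Vieta's. Its Jacobian is the squared Vandermonde
product in the complex case (\<open>vieta_integral_complex\<close>) and the Vandermonde product in the real case,
where the roots are listed as increasing real roots followed by conjugate pairs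
(\<open>vieta_integral_real\<close>). Both formulas are proved by adding one root, or one conjugate pair, at a time:
division by the new linear or quadratic factor is a unipotent change of the coefficients, and what
remains is an area formula in dimension one or two.

The density in terms of the \<open>\<alpha>\<^sub>k\<close> is turned into one in terms of the roots by three identities: the
product of all \<open>1 - z\<^sub>j cnj z\<^sub>k\<close> equals the product of the \<open>(1 - |\<alpha>\<^sub>k|\<^sup>2) ^ (k + 1)\<close>
(\<open>schur_cohn_det_szego\<close>); for real \<open>\<alpha>\<^sub>k\<close> the product of the \<open>1 - z\<^sub>j\<^sup>2\<close> is \<open>\<Phi>\<^sub>n(1) \<Phi>\<^sub>n(-1)\<close> up to sign,
again a product over \<open>k\<close> (\<open>real_axis_factor_szego\<close>); and the product of the roots has modulus
\<open>|\<alpha>\<^sub>n\<^sub>-\<^sub>1|\<close>. The exponents then match factor by factor, and Legendre's duplication formula gives the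
constant in the real case (\<open>prod_B_const\<close>).
\<close>

abbreviation vol :: "nat \<Rightarrow> (nat \<Rightarrow> 'a::euclidean_space) measure" where
 "vol n \<equiv> PiM {..<n} (\<lambda>_. lborel)"

abbreviation tuples :: "nat \<Rightarrow> (nat \<Rightarrow> 'a::topological_space) measure" where
 "tuples n \<equiv> PiM {..<n} (\<lambda>_. borel)"

lemmas meas_o = measurable_compose

section \<open>Area formulas\<close>

lemma ennreal_eqI_finite:
 fixes a b :: ennreal
 assumes "!!m. 0 <= m ==> a = ennreal m \<longleftrightarrow> b = ennreal m"
 shows "a = b"
 by (metis assms ennreal_cases)

text \<open>The library relates finite measures to finite integrals of the Jacobian. Two extended reals that equal the same finite numbers are equal.\<close>
lemma emeasure_image_vec:
 fixes f :: "real^'n::{finite,wellorder} => real^'n::_"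
 assumes S: "S \<in> sets borel" and der: "!!x. x \<in> S ==> (f has_derivative f' x) (at x within S)"
 and inj: "inj_on f S" and fS: "f ` S \<in> sets borel"
 and D [measurable]: "D \<in> borel_measurable borel" and D_eq: "!!x. x \<in> S ==> D x = \<bar>Determinants.det (matrix (f' x))\<bar>"
 shows "emeasure lborel (f ` S) = (\<integral>\<^sup>+x. ennreal (D x) * indicator S x \<partial>lborel)" (is "?lhs = ?rhs")
proof (rule ennreal_eqI_finite)
 fix m :: real assume m: "0 <= m"
 note [measurable] = S
 have SL: "S \<in> sets lebesgue" using S by simp
 have "emeasure lborel (f ` S) = ennreal m \<longleftrightarrow> ((%x. 1::real) has_integral m) (f ` S)"
 using fS m by (simp add: has_integral_iff_emeasure_lborel)
 also have "... \<longleftrightarrow> f ` S \<in> lmeasurable & measure lebesgue (f ` S) = m"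
 by (auto simp: lmeasurable_iff_integrable_on lmeasure_integral has_integral_iff)
 also have "... \<longleftrightarrow> ((%x. \<bar>Determinants.det (matrix (f' x))\<bar>) has_integral m) S"
 by (rule has_measure_differentiable_image[OF SL der inj])
 also have "... \<longleftrightarrow> (D has_integral m) S"
 by (rule has_integral_cong) (simp add: D_eq)
 also have "... \<longleftrightarrow> ((%x. \<bar>D x\<bar> * indicator S x) has_integral m) UNIV"
 by (subst has_integral_restrict_UNIV[symmetric], rule has_integral_cong)
 (auto simp: D_eq)
 also have "... \<longleftrightarrow> (\<integral>\<^sup>+x. ennreal (\<bar>D x\<bar> * indicator S x) \<partial>lborel) = ennreal m"
 using nn_integral_has_integral_lborel[of "%x. \<bar>D x\<bar> * indicator S x" m]
 nn_integral_has_integral[of "%x. \<bar>D x\<bar> * indicator S x" m] m by auto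
 also have "(\<integral>\<^sup>+x. ennreal (\<bar>D x\<bar> * indicator S x) \<partial>lborel) = ?rhs"
 by (rule nn_integral_cong) (auto simp: D_eq indicator_def)
 finally show "emeasure lborel (f ` S) = ennreal m \<longleftrightarrow> ?rhs = ennreal m" .
qed

lemma emeasure_image_real:
 fixes f :: "real => real"
 assumes S: "S \<in> sets borel" and der: "!!x. x \<in> S ==> (f has_field_derivative f' x) (at x within S)"
 and inj: "inj_on f S" and fS: "f ` S \<in> sets borel"
 and D [measurable]: "D \<in> borel_measurable borel" and D_eq: "!!x. x \<in> S ==> D x = \<bar>f' x\<bar>"
 shows "emeasure lborel (f ` S) = (\<integral>\<^sup>+x. ennreal (D x) * indicator S x \<partial>lborel)" (is "?lhs = ?rhs")
proof (rule ennreal_eqI_finite)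
 fix m :: real assume m: "0 <= m"
 note [measurable] = S
 have SL: "S \<in> sets lebesgue" using S by simp
 have "emeasure lborel (f ` S) = ennreal m \<longleftrightarrow> ((%x. 1::real) has_integral m) (f ` S)"
 using fS m by (simp add: has_integral_iff_emeasure_lborel)
 also have "... \<longleftrightarrow> (%x. 1::real) absolutely_integrable_on (f ` S) & integral (f ` S) (%x. 1::real) = m"
 by (auto simp: absolutely_integrable_on_iff_nonneg has_integral_iff)
 also have "... \<longleftrightarrow> (%x. \<bar>f' x\<bar> *\<^sub>R (1::real)) absolutely_integrable_on S & integral S (%x. \<bar>f' x\<bar> *\<^sub>R (1::real)) = m"
 by (rule sym, rule has_absolute_integral_change_of_variables_real[OF SL der inj])
 also have "... \<longleftrightarrow> ((%x. \<bar>f' x\<bar>) has_integral m) S"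
 by (auto simp: absolutely_integrable_on_iff_nonneg has_integral_iff)
 also have "... \<longleftrightarrow> (D has_integral m) S"
 by (rule has_integral_cong) (simp add: D_eq)
 also have "... \<longleftrightarrow> ((%x. \<bar>D x\<bar> * indicator S x) has_integral m) UNIV"
 by (subst has_integral_restrict_UNIV[symmetric], rule has_integral_cong)
 (auto simp: D_eq)
 also have "... \<longleftrightarrow> (\<integral>\<^sup>+x. ennreal (\<bar>D x\<bar> * indicator S x) \<partial>lborel) = ennreal m"
 using nn_integral_has_integral_lborel[of "%x. \<bar>D x\<bar> * indicator S x" m]
 nn_integral_has_integral[of "%x. \<bar>D x\<bar> * indicator S x" m] m by auto
 also have "(\<integral>\<^sup>+x. ennreal (\<bar>D x\<bar> * indicator S x) \<partial>lborel) = ?rhs"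
 by (rule nn_integral_cong) (auto simp: D_eq indicator_def)
 finally show "emeasure lborel (f ` S) = ennreal m \<longleftrightarrow> ?rhs = ennreal m" .
qed

definition vec_of_complex :: "complex => real^2" where
 "vec_of_complex z = vector [Re z, Im z]"

definition complex_of_vec :: "real^2 => complex" where
 "complex_of_vec v = Complex (v $ 1) (v $ 2)"

lemma complex_of_vec_inverse [simp]: "complex_of_vec (vec_of_complex z) = z"
 by (simp add: vec_of_complex_def complex_of_vec_def complex_eq_iff)

lemma vec_of_complex_inverse [simp]: "vec_of_complex (complex_of_vec v) = v"
 by (simp add: vec_of_complex_def complex_of_vec_def Finite_Cartesian_Product.vec_eq_iff forall_2)

lemma linear_complex_of_vec: "linear complex_of_vec"
 by (rule linearI) (simp_all add: complex_of_vec_def complex_eq_iff)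

lemma linear_vec_of_complex: "linear vec_of_complex"
 by (rule linearI) (simp_all add: vec_of_complex_def Finite_Cartesian_Product.vec_eq_iff forall_2)

lemma measurable_complex_of_vec [measurable]: "complex_of_vec \<in> borel_measurable borel"
 by (intro borel_measurable_continuous_onI linear_continuous_on
  linear_complex_of_vec[unfolded linear_conv_bounded_linear])

lemma distr_complex_of_vec: "distr lborel borel complex_of_vec = lborel"
proof (rule lborel_eqI[symmetric])
 fix l u :: complex
 assume le: "!!b. b \<in> Basis ==> l \<bullet> b <= u \<bullet> b"
 have le': "Re l <= Re u" "Im l <= Im u"
 using le[of 1] le[of \<i>] by (auto simp: Basis_complex_def inner_complex_def)
 have "complex_of_vec -` box l u = box (vec_of_complex l) (vec_of_complex u)"
 by (auto simp: complex_of_vec_def vec_of_complex_def in_box_complex_iff mem_box_cart forall_2)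
 then have "emeasure (distr lborel borel complex_of_vec) (box l u) = emeasure lborel (box (vec_of_complex l) (vec_of_complex u))"
 by (simp add: emeasure_distr)
 also have "... = ennreal (\<Prod>b\<in>Basis. (vec_of_complex u - vec_of_complex l) \<bullet> b)"
 proof (rule emeasure_lborel_box)
 have "ALL i. vec_of_complex l $ i <= vec_of_complex u $ i"
 using le' by (simp add: forall_2 vec_of_complex_def)
 then show "vec_of_complex l \<bullet> b <= vec_of_complex u \<bullet> b" if "b \<in> Basis" for b
 using that by (auto simp: Basis_vec_def inner_axis)
 qed
 also have "(\<Prod>b\<in>Basis. (vec_of_complex u - vec_of_complex l) \<bullet> b) = (Re u - Re l) * (Im u - Im l)"
 proof -
 have B: "(Basis :: (real^2) set) = {axis 1 1, axis 2 1}"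
 by (auto simp: Basis_vec_def) (metis exhaust_2)
 have "axis 1 1 ~= (axis 2 1 :: real^2)" by (simp add: axis_eq_axis)
 then show ?thesis unfolding B by (simp add: inner_axis vec_of_complex_def)
 qed
 also have "... = (\<Prod>b\<in>Basis. (u - l) \<bullet> b)"
 by (simp add: Basis_complex_def inner_complex_def)
 finally show "emeasure (distr lborel borel complex_of_vec) (box l u) = (\<Prod>b\<in>Basis. (u - l) \<bullet> b)" .
qed simp

lemma emeasure_image_complex:
 fixes f :: "complex => complex"
 assumes S: "S \<in> sets borel"
 and der: "!!x. x \<in> S ==> (f has_derivative (%v. of_real (Re v) * P x + of_real (Im v) * Q x)) (at x within S)"
 and inj: "inj_on f S" and fS: "f ` S \<in> sets borel"
 and D [measurable]: "D \<in> borel_measurable borel"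
 and D_eq: "!!x. x \<in> S ==> D x = \<bar>Re (P x) * Im (Q x) - Im (P x) * Re (Q x)\<bar>"
 shows "emeasure lborel (f ` S) = (\<integral>\<^sup>+x. ennreal (D x) * indicator S x \<partial>lborel)"
proof -
 define S' where "S' = complex_of_vec -` S"
 define g where "g = vec_of_complex \<circ> f \<circ> complex_of_vec"
 define g' where "g' v = vec_of_complex \<circ> (%w. of_real (Re w) * P (complex_of_vec v) + of_real (Im w) * Q (complex_of_vec v)) \<circ> complex_of_vec" for v
 have S'm: "S' \<in> sets borel" unfolding S'_def using S by (rule measurable_sets_borel[OF measurable_complex_of_vec])
 have gS: "g ` S' = complex_of_vec -` (f ` S)"
 proof (intro equalityI subsetI)
 fix v assume "v \<in> complex_of_vec -` (f ` S)"
 then obtain s where s: "s \<in> S" "complex_of_vec v = f s" by auto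
 then have "v = g (vec_of_complex s)"
 unfolding g_def by (metis comp_apply complex_of_vec_inverse vec_of_complex_inverse)
 then show "v \<in> g ` S'" using s by (auto simp: S'_def)
 qed (auto simp: g_def S'_def)
 have gS': "g ` S' \<in> sets borel" unfolding gS using fS by (rule measurable_sets_borel[OF measurable_complex_of_vec])
 have S'S: "complex_of_vec ` S' = S" unfolding S'_def
 by (metis complex_of_vec_inverse surjI surj_image_vimage_eq)
 have gder: "(g has_derivative g' v) (at v within S')" if "v \<in> S'" for v
 proof -
 have "complex_of_vec v \<in> S" using that by (simp add: S'_def)
 have 1: "(complex_of_vec has_derivative complex_of_vec) (at v within S')"
 by (intro bounded_linear_imp_has_derivative linear_complex_of_vec[unfolded linear_conv_bounded_linear])
 have 2: "(vec_of_complex has_derivative vec_of_complex) (at y within T)" for y T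
 by (intro bounded_linear_imp_has_derivative linear_vec_of_complex[unfolded linear_conv_bounded_linear])
 have 3: "((f \<circ> complex_of_vec) has_derivative (%w. of_real (Re w) * P (complex_of_vec v) + of_real (Im w) * Q (complex_of_vec v)) \<circ> complex_of_vec) (at v within S')"
 by (rule diff_chain_within[OF 1]) (use der[OF \<open>complex_of_vec v \<in> S\<close>] S'S in auto)
 show ?thesis unfolding g_def g'_def comp_assoc
 by (rule diff_chain_within[OF 3[unfolded comp_assoc] 2])
 qed
 have ginj: "inj_on g S'"
 using inj unfolding g_def S'_def inj_on_def
 by (metis complex_of_vec_inverse comp_apply vec_of_complex_inverse vimageE)
 have det: "D (complex_of_vec v) = \<bar>Determinants.det (matrix (g' v))\<bar>" if "v \<in> S'" for v
 proof -
 have "complex_of_vec v \<in> S" using that by (simp add: S'_def)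
 then show ?thesis
 by (simp add: mult.commute D_eq det_2 matrix_def g'_def vec_of_complex_def complex_of_vec_def axis_def)
 qed
 have "emeasure lborel (f ` S) = emeasure (distr lborel borel complex_of_vec) (f ` S)"
 by (simp add: distr_complex_of_vec)
 also have "... = emeasure lborel (g ` S')"
 using fS by (simp add: emeasure_distr gS)
 also have "... = (\<integral>\<^sup>+v. ennreal (D (complex_of_vec v)) * indicator S' v \<partial>lborel)"
 by (rule emeasure_image_vec[OF S'm gder ginj gS' _ det]) measurable
 also have "... = (\<integral>\<^sup>+v. ennreal (D (complex_of_vec v)) * indicator S (complex_of_vec v) \<partial>lborel)"
 by (simp add: S'_def indicator_def)
 also have "... = (\<integral>\<^sup>+x. ennreal (D x) * indicator S x \<partial>distr lborel borel complex_of_vec)"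
 using S by (subst nn_integral_distr) auto
 finally show ?thesis by (simp add: distr_complex_of_vec)
qed

lemma area_formula_injective:
 fixes f :: "'a::euclidean_space => 'a"
 assumes B: "open B" and cont: "continuous_on B f" and inj: "inj_on f B"
 and J [measurable]: "J \<in> borel_measurable borel"
 and img: "!!A. [|A \<in> sets borel; A \<subseteq> B; f ` A \<in> sets borel|]
 ==> emeasure lborel (f ` A) = (\<integral>\<^sup>+x. J x * indicator A x \<partial>lborel)"
 and A: "A \<in> sets borel" "A \<subseteq> B"
 and h [measurable]: "h \<in> borel_measurable borel"
 obtains k where "k \<in> borel_measurable borel"
 "!!w. w \<in> A ==> k (f w) = h w" "!!z. z \<notin> f ` A ==> k z = 0"
 "(\<integral>\<^sup>+x. h x * J x * indicator A x \<partial>lborel) = (\<integral>\<^sup>+z. k z \<partial>(lborel::'a measure))"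
proof -
 define g where "g = inv_into B f"
 have "homeomorphism B (f ` B) f g"
 unfolding g_def using B cont inj by (simp add: continuous_on_inverse_open homeomorphism_def)
 then have gc: "continuous_on (f ` B) g" by (simp add: homeomorphism_def)
 have oB: "open (f ` B)" using invariance_of_domain[OF cont B inj] .
 have gf: "g (f w) = w" if "w \<in> B" for w using that inj by (simp add: g_def)
 note [measurable] = A(1) borel_open[OF B] borel_open[OF oB]
 define fe where "fe x = (if x \<in> B then f x else 0)" for x
 define ge where "ge x = (if x \<in> f ` B then g x else 0)" for x
 have fe[measurable]: "fe \<in> borel_measurable borel" unfolding fe_def
 using cont by (intro borel_measurable_continuous_on_if) auto
 have ge[measurable]: "ge \<in> borel_measurable borel" unfolding ge_def
 using gc by (intro borel_measurable_continuous_on_if) auto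
 have im: "f ` C = f ` B \<inter> ge -` C" if "C \<subseteq> B" for C
 using that gf by (auto simp: ge_def)
 have imb: "f ` C \<in> sets borel" if "C \<in> sets borel" "C \<subseteq> B" for C
 unfolding im[OF that(2)] using measurable_sets_borel[OF ge that(1)] by auto
 have fA[measurable]: "f ` A \<in> sets borel" using A imb by auto
 define k where "k z = h (ge z) * indicator (f ` A) z" for z
 have [measurable]: "k \<in> borel_measurable borel" unfolding k_def by measurable
 have d: "distr (density lborel (%x. J x * indicator A x)) borel fe = density lborel (indicator (f ` A))"
 (is "?L = ?R")
 proof (rule measure_eqI)
 fix E assume "E \<in> sets ?L"
 then have E[measurable]: "E \<in> sets borel" by simp
 have fi: "f ` (A \<inter> fe -` E) = E \<inter> f ` A" using A(2) by (auto simp: fe_def)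
 have [measurable]: "A \<inter> fe -` E \<in> sets borel" using measurable_sets_borel[OF fe E] by auto
 have "emeasure ?L E = (\<integral>\<^sup>+x. J x * indicator A x * indicator (fe -` E) x \<partial>lborel)"
 using measurable_sets_borel[OF fe E] by (simp add: emeasure_distr emeasure_density)
 also have "... = (\<integral>\<^sup>+x. J x * indicator (A \<inter> fe -` E) x \<partial>lborel)"
 by (rule nn_integral_cong) (auto simp: indicator_def)
 also have "... = emeasure lborel (f ` (A \<inter> fe -` E))"
 by (rule img[symmetric]) (use A(2) imb[of "A \<inter> fe -` E"] in auto)
 also have "... = emeasure ?R E"
 unfolding fi using fA by (subst emeasure_density) (auto simp: indicator_inter_arith[symmetric] Int_commute)
 finally show "emeasure ?L E = emeasure ?R E" .
 qed simp
 have "(\<integral>\<^sup>+x. h x * J x * indicator A x \<partial>lborel) = (\<integral>\<^sup>+x. (J x * indicator A x) * k (fe x) \<partial>lborel)"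
 by (rule nn_integral_cong) (use A(2) gf in "auto simp: indicator_def k_def fe_def ge_def mult_ac")
 also have "... = (\<integral>\<^sup>+z. k z \<partial>?L)"
 by (simp add: nn_integral_distr nn_integral_density)
 also have "... = (\<integral>\<^sup>+z. indicator (f ` A) z * k z \<partial>lborel)"
 unfolding d using fA by (subst nn_integral_density) auto
 also have "... = (\<integral>\<^sup>+z. k z \<partial>lborel)"
 by (rule nn_integral_cong) (auto simp: k_def indicator_def)
 finally have 1: "(\<integral>\<^sup>+x. h x * J x * indicator A x \<partial>lborel) = (\<integral>\<^sup>+z. k z \<partial>(lborel::'a measure))" .
 have 2: "k (f w) = h w" if "w \<in> A" for w
 using that A(2) gf[of w] by (auto simp: k_def ge_def)
 show thesis by (rule that[OF _ 2 _ 1]) (auto simp: k_def)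
qed

text \<open>The points with \<open>J x \<noteq> 0\<close> are cut into countably many Borel pieces on which \<open>f\<close> is injective. The others do not contribute on the left, and almost every fibre avoids them.\<close>
lemma area_formula:
 fixes f :: "'a::euclidean_space => 'a"
 assumes S: "open S" and cont: "continuous_on S f"
 and J [measurable]: "J \<in> borel_measurable borel"
 and img: "!!A. [|A \<in> sets borel; A \<subseteq> S; inj_on f A; f ` A \<in> sets borel|]
 ==> emeasure lborel (f ` A) = (\<integral>\<^sup>+x. J x * indicator A x \<partial>lborel)"
 and loc: "!!x. [|x \<in> S; J x ~= 0|] ==> \<exists>r>0. ball x r \<subseteq> S & inj_on f (ball x r)"
 and fib: "AE z in lborel. finite {w \<in> S. f w = z} & (\<forall>w\<in>S. f w = z --> J w ~= 0)"
 and h [measurable]: "h \<in> borel_measurable borel"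
 shows "(\<integral>\<^sup>+x. h x * J x * indicator S x \<partial>lborel) = (\<integral>\<^sup>+z. (\<Sum>w\<in>{w \<in> S. f w = z}. h w) \<partial>lborel)"
proof -
 note [measurable] = borel_open[OF S]
 define \<F> where "\<F> = {ball x r | x r. ball x r \<subseteq> S & inj_on f (ball x r)}"
 obtain \<F>' where F': "\<F>' \<subseteq> \<F>" "countable \<F>'" "\<Union>\<F>' = \<Union>\<F>"
 using Lindelof[of \<F>] unfolding \<F>_def by (smt (verit, best) mem_Collect_eq open_ball)
 define B where "B = from_nat_into (insert {} \<F>')"
 have rB: "range B = insert {} \<F>'"
 unfolding B_def using F'(2) by (intro range_from_nat_into) auto
 have Bi: "open (B i)" "B i \<subseteq> S" "inj_on f (B i)" for i
 proof -
 have "B i \<in> insert {} \<F>" using rB F'(1) by auto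
 then show "open (B i)" "B i \<subseteq> S" "inj_on f (B i)" by (auto simp: \<F>_def)
 qed
 have UB: "(\<Union>i. B i) = \<Union>\<F>" using rB F'(3) by auto
 have cov: "x \<in> (\<Union>i. B i)" if "x \<in> S" "J x ~= 0" for x
 proof -
 obtain r::real where "r > 0" "ball x r \<subseteq> S" "inj_on f (ball x r)" using loc[OF \<open>x \<in> S\<close> \<open>J x ~= 0\<close>] by blast
 then show ?thesis unfolding UB \<F>_def by (intro UnionI[of "ball x r"]) auto
 qed
 define A where "A = disjointed B"
 have [measurable]: "A i \<in> sets borel" for i
 proof -
 have "range (disjointed B) \<subseteq> sets borel"
 by (rule sets.range_disjointed_sets) (use Bi(1) in auto)
 then show ?thesis by (auto simp: A_def)
 qed
 have AB: "A i \<subseteq> B i" for i unfolding A_def by (rule disjointed_subset)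
 have UA: "(\<Union>i. A i) = (\<Union>i. B i)" unfolding A_def by (rule UN_disjointed_eq)
 have dis: "disjoint_family A" unfolding A_def by (rule disjoint_family_disjointed)
 have ind: "(\<Sum>i. indicator (A i) x) = (indicator (\<Union>i. B i) x :: ennreal)" for x
 using suminf_indicator[OF dis] by (simp add: UA)
 have "\<exists>k. k \<in> borel_measurable borel & (\<forall>w\<in>A i. k (f w) = h w) & (ALL z. z \<notin> f ` A i --> k z = 0)
 & (\<integral>\<^sup>+x. h x * J x * indicator (A i) x \<partial>lborel) = (\<integral>\<^sup>+z. k z \<partial>lborel)" (is "\<exists>k. ?P i k") for i
 proof -
 have c: "continuous_on (B i) f" using Bi(2) by (rule continuous_on_subset[OF cont])
 have m: "emeasure lborel (f ` C) = (\<integral>\<^sup>+x. J x * indicator C x \<partial>lborel)"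
 if "C \<in> sets borel" "C \<subseteq> B i" "f ` C \<in> sets borel" for C
 using that Bi(2)[of i] Bi(3)[of i] by (intro img) (auto intro: inj_on_subset)
 have Am: "A i \<in> sets borel" by measurable
 show ?thesis
 proof (rule area_formula_injective[OF Bi(1)[of i] c Bi(3)[of i] J m Am AB[of i] h])
 fix k assume "k \<in> borel_measurable borel" "!!w. w \<in> A i ==> k (f w) = h w" "!!z. z \<notin> f ` A i ==> k z = 0"
  "(\<integral>\<^sup>+x. h x * J x * indicator (A i) x \<partial>lborel) = (\<integral>\<^sup>+z. k z \<partial>lborel)"
 then have "?P i k" by simp
 then show "\<exists>k. ?P i k" by (rule exI[where P = "?P i" and x = k])
 qed
 qed
 then have "ALL i. \<exists>k. ?P i k" by (rule allI)
 from choice[OF this] obtain k where Pk: "ALL i. ?P i (k i)" by (rule exE)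
 have k: "!!i. k i \<in> borel_measurable borel" "!!i w. w \<in> A i ==> k i (f w) = h w"
 "!!i z. z \<notin> f ` A i ==> k i z = 0"
 "!!i. (\<integral>\<^sup>+x. h x * J x * indicator (A i) x \<partial>lborel) = (\<integral>\<^sup>+z. k i z \<partial>lborel)"
 by (use Pk in blast)+
 note [measurable] = k(1)
 have "(\<integral>\<^sup>+x. h x * J x * indicator S x \<partial>lborel) = (\<integral>\<^sup>+x. (\<Sum>i. h x * J x * indicator (A i) x) \<partial>lborel)"
 proof (rule nn_integral_cong)
 fix x show "h x * J x * indicator S x = (\<Sum>i. h x * J x * indicator (A i) x)"
 proof -
 have "(\<Sum>i. h x * J x * indicator (A i) x) = h x * J x * indicator (\<Union>i. B i) x"
  by (simp only: ennreal_suminf_cmult ind)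
 moreover have "(\<Union>i. B i) \<subseteq> S" using Bi(2) by blast
 moreover have "h x * J x * indicator S x = h x * J x * indicator (\<Union>i. B i) x"
 proof (cases "x \<in> S & J x ~= 0")
  case True
  then have "x \<in> (\<Union>i. B i)" using cov by blast
  then show ?thesis using True by (simp only: indicator_simps)
 next
  case False
  have "J x = 0 \<or> x \<notin> (\<Union>i. B i) & x \<notin> S" using False Bi(2) by blast
  then show ?thesis by (elim disjE conjE) (simp_all only: indicator_simps mult_zero_right mult_zero_left not_False_eq_True simp_thms)
 qed
 ultimately show ?thesis by simp
 qed
 qed
 also have "... = (\<Sum>i. \<integral>\<^sup>+x. h x * J x * indicator (A i) x \<partial>lborel)"
 by (rule nn_integral_suminf) measurable
 also have "... = (\<integral>\<^sup>+z. (\<Sum>i. k i z) \<partial>lborel)"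
 unfolding k(4) by (rule nn_integral_suminf[symmetric]) (use k(1) in simp)
 also have "... = (\<integral>\<^sup>+z. (\<Sum>w\<in>{w \<in> S. f w = z}. h w) \<partial>lborel)"
 proof (rule nn_integral_cong_AE, use fib in eventually_elim)
 fix z assume z: "finite {w \<in> S. f w = z} & (\<forall>w\<in>S. f w = z --> J w ~= 0)"
 have AS: "A i \<subseteq> S" for i using AB Bi(2) by blast
 have one: "k i z = (\<Sum>w\<in>{w \<in> S. f w = z}. h w * indicator (A i) w)" for i
 proof (cases "z \<in> f ` A i")
 case True
 then obtain w where w: "w \<in> A i" "z = f w" by auto
 have eq: "w' = w" if "w' \<in> A i" "f w' = z" for w'
  using that w Bi(3)[of i] AB[of i] by (auto simp: inj_on_def)
 have "(\<Sum>v\<in>{w \<in> S. f w = z}. h v * indicator (A i) v) = (\<Sum>v\<in>{w}. h v * indicator (A i) v)"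
 proof (intro sum.mono_neutral_right ballI)
  show "finite {w \<in> S. f w = z}" using z by (rule conjunct1)
  show "{w} \<subseteq> {w \<in> S. f w = z}" using w AS by blast
  fix v assume "v \<in> {w \<in> S. f w = z} - {w}"
  then have "v \<notin> A i" using eq by blast
  then show "h v * indicator (A i) v = 0" by simp
 qed
 then show ?thesis using w k(2)[OF w(1)] by simp
 next
 case False
 have "(\<Sum>w\<in>{w \<in> S. f w = z}. h w * indicator (A i) w) = 0"
 proof (intro sum.neutral ballI)
  fix v assume "v \<in> {w \<in> S. f w = z}"
  then have "v \<notin> A i" using False by blast
  then show "h v * indicator (A i) v = 0" by simp
 qed
 then show ?thesis using k(3)[OF False] by simp
 qed
 have "(\<Sum>i. k i z) = (\<Sum>w\<in>{w \<in> S. f w = z}. (\<Sum>i. h w * indicator (A i) w))"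
 unfolding one by (rule suminf_sum) simp
 also have "... = (\<Sum>w\<in>{w \<in> S. f w = z}. h w)"
 proof (rule sum.cong[OF refl])
 fix w assume "w \<in> {w \<in> S. f w = z}"
 then have "w \<in> (\<Union>i. B i)" using z cov by blast
 then show "(\<Sum>i. h w * indicator (A i) w) = h w"
  by (simp only: ennreal_suminf_cmult ind indicator_simps) simp
 qed
 finally show "(\<Sum>i. k i z) = (\<Sum>w\<in>{w \<in> S. f w = z}. h w)" .
 qed
 finally show ?thesis .
qed

text \<open>\<open>P\<close> and \<open>Q\<close> are the partial derivatives in the real and imaginary direction; maps of the plane that are not holomorphic occur for conjugate pairs, polar coordinates and reflections.\<close>
lemma area_formula_complex:
 fixes f P Q :: "complex => complex"
 assumes S: "open S"
 and der: "!!x. x \<in> S ==> (f has_derivative (%v. of_real (Re v) * P x + of_real (Im v) * Q x)) (at x)"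
 and P: "continuous_on S P" and Q: "continuous_on S Q"
 and fib: "AE z in lborel. finite {w \<in> S. f w = z} &
 (\<forall>w\<in>S. f w = z --> Re (P w) * Im (Q w) - Im (P w) * Re (Q w) ~= 0)"
 and h [measurable]: "h \<in> borel_measurable borel"
 shows "(\<integral>\<^sup>+x. h x * ennreal \<bar>Re (P x) * Im (Q x) - Im (P x) * Re (Q x)\<bar> * indicator S x \<partial>lborel)
 = (\<integral>\<^sup>+z. (\<Sum>w\<in>{w \<in> S. f w = z}. h w) \<partial>lborel)"
proof -
 note [measurable] = borel_open[OF S]
 define D where "D x = (if x \<in> S then \<bar>Re (P x) * Im (Q x) - Im (P x) * Re (Q x)\<bar> else 0)" for x
 have D[measurable]: "D \<in> borel_measurable borel"
 unfolding D_def using P Q by (intro borel_measurable_continuous_on_if continuous_intros) auto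
 have cont: "continuous_on S f"
 by (rule has_derivative_continuous_on, rule has_derivative_at_withinI, rule der)
 have "(\<integral>\<^sup>+x. h x * ennreal (D x) * indicator S x \<partial>lborel)
 = (\<integral>\<^sup>+z. (\<Sum>w\<in>{w \<in> S. f w = z}. h w) \<partial>lborel)"
 proof (rule area_formula[OF S cont])
 fix A assume "A \<in> sets borel" "A \<subseteq> S" "inj_on f A" "f ` A \<in> sets borel"
 then show "emeasure lborel (f ` A) = (\<integral>\<^sup>+x. ennreal (D x) * indicator A x \<partial>lborel)"
 by (intro emeasure_image_complex[where P=P and Q=Q, OF _ _ _ _ D] has_derivative_at_withinI[OF der])
  (auto simp: D_def)
 next
 fix a assume a: "a \<in> S" "ennreal (D a) ~= 0"
 define d where "d = Re (P a) * Im (Q a) - Im (P a) * Re (Q a)"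
 have d: "d ~= 0" using a by (auto simp: D_def d_def split: if_splits)
 define g' where "g' w = Complex ((Re w * Im (Q a) - Im w * Re (Q a)) / d) ((Re (P a) * Im w - Im (P a) * Re w) / d)" for w
 have g': "bounded_linear g'"
 unfolding linear_conv_bounded_linear[symmetric] g'_def
 by (rule linearI) (simp_all add: complex_eq_iff field_simps add_divide_distrib diff_divide_distrib)
 have inv: "g' \<circ> (%v. of_real (Re v) * P a + of_real (Im v) * Q a) = id"
 proof (rule ext)
 fix v
 have "(Re v * Re (P a) + Im v * Re (Q a)) * Im (Q a) - (Re v * Im (P a) + Im v * Im (Q a)) * Re (Q a) = Re v * d"
  "Re (P a) * (Re v * Im (P a) + Im v * Im (Q a)) - Im (P a) * (Re v * Re (P a) + Im v * Re (Q a)) = Im v * d"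
  by (simp_all add: d_def algebra_simps)
 then show "(g' \<circ> (%v. of_real (Re v) * P a + of_real (Im v) * Q a)) v = id v"
  using d by (simp add: g'_def complex_eq_iff)
 qed
 obtain r where "r > 0" "ball a r \<subseteq> S" "inj_on f (ball a r)"
 proof (rule has_derivative_locally_injective[OF a(1) S g' inv der])
 fix e :: real assume e: "e > 0"
 have "continuous (at a) P" "continuous (at a) Q"
  using P Q a(1) S continuous_on_eq_continuous_at by blast+
 then obtain d1 d2 where d: "d1 > 0" "!!x. dist x a < d1 ==> dist (P x) (P a) < e/3"
  "d2 > 0" "!!x. dist x a < d2 ==> dist (Q x) (Q a) < e/3"
  unfolding continuous_at_eps_delta using e
  by (metis divide_pos_pos zero_less_numeral)
 show "\<exists>d>0. ALL x. dist a x < d -->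
  onorm (%v. (of_real (Re v) * P x + of_real (Im v) * Q x) - (of_real (Re v) * P a + of_real (Im v) * Q a)) < e"
 proof (intro exI[of _ "min d1 d2"] conjI allI impI)
  fix x assume "dist a x < min d1 d2"
  then have x: "norm (P x - P a) < e/3" "norm (Q x - Q a) < e/3"
  using d(2)[of x] d(4)[of x] by (auto simp: dist_norm norm_minus_commute)
  have "onorm (%v. (of_real (Re v) * P x + of_real (Im v) * Q x) - (of_real (Re v) * P a + of_real (Im v) * Q a)) <= 2*e/3"
  proof (rule onorm_le)
  fix v
  have "norm ((of_real (Re v) * P x + of_real (Im v) * Q x) - (of_real (Re v) * P a + of_real (Im v) * Q a))
  = norm (of_real (Re v) * (P x - P a) + of_real (Im v) * (Q x - Q a))"
  by (simp add: algebra_simps)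
  also have "... <= \<bar>Re v\<bar> * norm (P x - P a) + \<bar>Im v\<bar> * norm (Q x - Q a)"
  by (rule order_trans[OF norm_triangle_ineq]) (simp add: norm_mult)
  also have "... <= norm v * (e/3) + norm v * (e/3)"
  using x e by (intro add_mono mult_mono abs_Re_le_cmod abs_Im_le_cmod) auto
  finally show "norm ((of_real (Re v) * P x + of_real (Im v) * Q x) - (of_real (Re v) * P a + of_real (Im v) * Q a)) <= 2*e/3 * norm v"
  by (simp add: field_simps)
  qed
  also have "... < e" using e by simp
  finally show "onorm (%v. (of_real (Re v) * P x + of_real (Im v) * Q x) - (of_real (Re v) * P a + of_real (Im v) * Q a)) < e" .
 qed (use d in auto)
 qed auto
 then show "\<exists>r>0. ball a r \<subseteq> S & inj_on f (ball a r)" by blast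
 next
 show "AE z in lborel. finite {w \<in> S. f w = z} & (\<forall>w\<in>S. f w = z --> ennreal (D w) ~= 0)"
 using fib by eventually_elim (auto simp: D_def)
 qed measurable
 also have "(\<integral>\<^sup>+x. h x * ennreal (D x) * indicator S x \<partial>lborel) =
 (\<integral>\<^sup>+x. h x * ennreal \<bar>Re (P x) * Im (Q x) - Im (P x) * Re (Q x)\<bar> * indicator S x \<partial>lborel)"
 by (rule nn_integral_cong) (auto simp: D_def indicator_def)
 finally show ?thesis .
qed

lemma area_formula_holomorphic:
 fixes f f' :: "complex => complex"
 assumes S: "open S" and der: "!!x. x \<in> S ==> (f has_field_derivative f' x) (at x)"
 and f': "continuous_on S f'"
 and fib: "AE z in lborel. finite {w \<in> S. f w = z} & (\<forall>w\<in>S. f w = z --> f' w ~= 0)"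
 and h [measurable]: "h \<in> borel_measurable borel"
 shows "(\<integral>\<^sup>+x. h x * ennreal ((norm (f' x))\<^sup>2) * indicator S x \<partial>lborel)
 = (\<integral>\<^sup>+z. (\<Sum>w\<in>{w \<in> S. f w = z}. h w) \<partial>lborel)" (is "?lhs = ?rhs")
proof -
 have J: "Re (f' x) * Im (\<i> * f' x) - Im (f' x) * Re (\<i> * f' x) = (norm (f' x))\<^sup>2" for x
 by (simp add: cmod_power2 flip: power2_eq_square)
 have "(\<integral>\<^sup>+x. h x * ennreal \<bar>Re (f' x) * Im (\<i> * f' x) - Im (f' x) * Re (\<i> * f' x)\<bar> * indicator S x \<partial>lborel)
 = ?rhs"
 proof (rule area_formula_complex[OF S _ f'])
 fix x assume "x \<in> S"
 then have "(f has_derivative (*) (f' x)) (at x)" using der by (simp add: has_field_derivative_def)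
 also have "(*) (f' x) = (%v. of_real (Re v) * f' x + of_real (Im v) * (\<i> * f' x))"
 by (auto simp: fun_eq_iff complex_eq_iff)
 finally show "(f has_derivative (%v. of_real (Re v) * f' x + of_real (Im v) * (\<i> * f' x))) (at x)" .
 next
 show "AE z in lborel. finite {w \<in> S. f w = z} &
  (\<forall>w\<in>S. f w = z --> Re (f' w) * Im (\<i> * f' w) - Im (f' w) * Re (\<i> * f' w) ~= 0)"
 unfolding J using fib by eventually_elim auto
 qed (use f' in "auto intro!: continuous_intros")
 then show ?thesis unfolding J by simp
qed

lemma area_formula_real:
 fixes f f' :: "real => real"
 assumes S: "open S" and der: "!!x. x \<in> S ==> (f has_field_derivative f' x) (at x)"
 and f': "continuous_on S f'"
 and fib: "AE z in lborel. finite {w \<in> S. f w = z} & (\<forall>w\<in>S. f w = z --> f' w ~= 0)"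
 and h [measurable]: "h \<in> borel_measurable borel"
 shows "(\<integral>\<^sup>+x. h x * ennreal \<bar>f' x\<bar> * indicator S x \<partial>lborel)
 = (\<integral>\<^sup>+z. (\<Sum>w\<in>{w \<in> S. f w = z}. h w) \<partial>lborel)" (is "?lhs = ?rhs")
proof -
 note [measurable] = borel_open[OF S]
 define D where "D x = (if x \<in> S then \<bar>f' x\<bar> else 0)" for x
 have D[measurable]: "D \<in> borel_measurable borel"
 unfolding D_def using f' by (intro borel_measurable_continuous_on_if continuous_intros) auto
 have cont: "continuous_on S f"
 using der by (meson DERIV_isCont continuous_at_imp_continuous_on)
 have "(\<integral>\<^sup>+x. h x * ennreal (D x) * indicator S x \<partial>lborel)
 = ?rhs"
 proof (rule area_formula[OF S cont])
 fix A assume "A \<in> sets borel" "A \<subseteq> S" "inj_on f A" "f ` A \<in> sets borel"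
 then show "emeasure lborel (f ` A) = (\<integral>\<^sup>+x. ennreal (D x) * indicator A x \<partial>lborel)"
 by (intro emeasure_image_real[where f'=f', OF _ _ _ _ D] has_field_derivative_at_within[OF der])
  (auto simp: D_def)
 next
 fix a assume a: "a \<in> S" "ennreal (D a) ~= 0"
 have d: "f' a ~= 0" using a by (auto simp: D_def split: if_splits)
 have inv: "(%v. v / f' a) \<circ> (%v. f' a * v) = id"
 using d by (auto simp: fun_eq_iff)
 have der': "(f has_derivative (%v. f' x * v)) (at x)" if "x \<in> S" for x
 using der[OF that] by (simp add: has_field_derivative_def)
 obtain r where "r > 0" "ball a r \<subseteq> S" "inj_on f (ball a r)"
 proof (rule has_derivative_locally_injective[OF a(1) S _ inv der'])
 show "bounded_linear (%v. v / f' a)" by (rule bounded_linear_divide)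
 next
 fix e :: real assume e: "e > 0"
 have "continuous (at a) f'"
  using f' a(1) S continuous_on_eq_continuous_at by blast
 then obtain d1 where d: "d1 > 0" "!!x. dist x a < d1 ==> dist (f' x) (f' a) < e/2"
  unfolding continuous_at_eps_delta using e
  by (metis half_gt_zero)
 show "\<exists>d>0. ALL x. dist a x < d --> onorm (%v. f' x * v - f' a * v) < e"
 proof (intro exI[of _ d1] conjI allI impI)
  fix x assume "dist a x < d1"
  then have x: "norm (f' x - f' a) < e/2"
  using d(2)[of x] by (auto simp: dist_norm norm_minus_commute)
  have "onorm (%v. f' x * v - f' a * v) <= e/2"
  proof (rule onorm_le)
  fix v :: real
  have "norm (f' x * v - f' a * v) = norm (f' x - f' a) * norm v"
  by (simp only: norm_mult[symmetric] left_diff_distrib)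
  also have "... <= e/2 * norm v" using x by (intro mult_right_mono) auto
  finally show "norm (f' x * v - f' a * v) <= e/2 * norm v" .
  qed
  also have "... < e" using e by simp
  finally show "onorm (%v. f' x * v - f' a * v) < e" .
 qed (use d in auto)
 qed auto
 then show "\<exists>r>0. ball a r \<subseteq> S & inj_on f (ball a r)" by blast
 next
 show "AE z in lborel. finite {w \<in> S. f w = z} & (\<forall>w\<in>S. f w = z --> ennreal (D w) ~= 0)"
 using fib by eventually_elim (auto simp: D_def)
 qed measurable
 also have "(\<integral>\<^sup>+x. h x * ennreal (D x) * indicator S x \<partial>lborel) =
 ?lhs"
 by (rule nn_integral_cong) (auto simp: D_def indicator_def)
 finally show ?thesis .
qed

lemma distr_Complex: "distr (lborel \<Otimes>\<^sub>M lborel) borel (%(x, y). Complex x y) = lborel"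
proof (rule lborel_eqI[symmetric])
 fix l u :: complex
 assume le: "!!b. b \<in> Basis ==> l \<bullet> b <= u \<bullet> b"
 have le': "Re l <= Re u" "Im l <= Im u"
 using le[of 1] le[of \<i>] by (auto simp: Basis_complex_def inner_complex_def)
 have [measurable]: "(%(x, y). Complex x y) \<in> borel_measurable (lborel \<Otimes>\<^sub>M lborel)"
 unfolding Complex_eq by measurable
 have "(%(x, y). Complex x y) -` box l u = {Re l<..<Re u} \<times> {Im l<..<Im u}"
 by (auto simp: in_box_complex_iff)
 then have "emeasure (distr (lborel \<Otimes>\<^sub>M lborel) borel (%(x, y). Complex x y)) (box l u) =
 emeasure (lborel \<Otimes>\<^sub>M lborel) ({Re l<..<Re u} \<times> {Im l<..<Im u})"
 by (subst emeasure_distr) (auto simp: space_pair_measure)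
 also have "... = ennreal ((Re u - Re l) * (Im u - Im l))"
 using le' by (subst lborel.emeasure_pair_measure_Times) (auto simp: ennreal_mult)
 also have "(Re u - Re l) * (Im u - Im l) = (\<Prod>b\<in>Basis. (u - l) \<bullet> b)"
 by (simp add: Basis_complex_def inner_complex_def)
 finally show "emeasure (distr (lborel \<Otimes>\<^sub>M lborel) borel (%(x, y). Complex x y)) (box l u) = (\<Prod>b\<in>Basis. (u - l) \<bullet> b)" .
qed simp

lemma measurable_Complex [measurable (raw)]:
 assumes "f \<in> borel_measurable M" "g \<in> borel_measurable M"
 shows "(%x. Complex (f x) (g x)) \<in> borel_measurable M"
 unfolding Complex_eq using assms by measurable

lemma nn_integral_Complex:
 assumes [measurable]: "f \<in> borel_measurable borel"
 shows "(\<integral>\<^sup>+z. f z \<partial>lborel) = (\<integral>\<^sup>+x. \<integral>\<^sup>+y. f (Complex x y) \<partial>lborel \<partial>lborel)" (is "?lhs = ?rhs")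
proof -
 have "(\<integral>\<^sup>+z. f z \<partial>lborel) = (\<integral>\<^sup>+z. f z \<partial>distr (lborel \<Otimes>\<^sub>M lborel) borel (%(x, y). Complex x y))"
 by (simp add: distr_Complex)
 also have "... = (\<integral>\<^sup>+x. f (case x of (x, y) => Complex x y) \<partial>(lborel \<Otimes>\<^sub>M lborel))"
 by (rule nn_integral_distr) measurable
 also have "... = ?rhs"
 by (subst lborel.nn_integral_fst[symmetric]) auto
 finally show ?thesis .
qed

lemma AE_Complex:
 assumes [measurable]: "Measurable.pred borel P"
 and "AE x in lborel. AE y in lborel. P (Complex x y)"
 shows "AE z in lborel. P z"
proof -
 have "AE z in distr (lborel \<Otimes>\<^sub>M lborel) borel (%(x, y). Complex x y). P z"
 proof (subst AE_distr_iff)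
 have "Measurable.pred (borel \<Otimes>\<^sub>M borel) (%z. P (Complex (fst z) (snd z)))"
 by measurable
 then have m: "{z. P (Complex (fst z) (snd z))} \<in> sets (borel \<Otimes>\<^sub>M borel)"
 by (simp add: pred_def space_pair_measure)
 have "AE z in lborel \<Otimes>\<^sub>M lborel. P (Complex (fst z) (snd z))"
 by (rule lborel_pair.AE_pair_measure) (use assms(2) m in "auto simp: space_pair_measure")
 then show "AE z in lborel \<Otimes>\<^sub>M lborel. P (case z of (x, y) => Complex x y)"
 by (simp add: case_prod_unfold)
 qed auto
 then show ?thesis unfolding distr_Complex .
qed

section \<open>Area formulas for polynomials\<close>

lemma area_formula_poly_complex:
 fixes P :: "complex poly"
 assumes P: "pderiv P ~= 0" and h [measurable]: "h \<in> borel_measurable borel"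
 shows "(\<integral>\<^sup>+w. h w * ennreal ((norm (poly (pderiv P) w))\<^sup>2) \<partial>lborel)
 = (\<integral>\<^sup>+z. (\<Sum>w\<in>{w. poly P w = z}. h w) \<partial>lborel)"
proof -
 have "(\<integral>\<^sup>+w. h w * ennreal ((norm (poly (pderiv P) w))\<^sup>2) * indicator UNIV w \<partial>lborel)
 = (\<integral>\<^sup>+z. (\<Sum>w\<in>{w \<in> UNIV. poly P w = z}. h w) \<partial>lborel)"
 proof (rule area_formula_holomorphic[OF open_UNIV])
 have "finite (poly P ` {w. poly (pderiv P) w = 0})"
 using P by (intro finite_imageI poly_roots_finite)
 then have "AE z in lborel. z \<notin> poly P ` {w. poly (pderiv P) w = 0}"
 by (intro AE_not_in finite_imp_null_set_lborel)
 then show "AE z in lborel. finite {w \<in> UNIV. poly P w = z} & (\<forall>w\<in>UNIV. poly P w = z --> poly (pderiv P) w ~= 0)"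
 proof eventually_elim
 fix z assume z: "z \<notin> poly P ` {w. poly (pderiv P) w = 0}"
 have "P - [:z:] ~= 0" using P by auto
 then have "finite {w. poly (P - [:z:]) w = 0}" by (rule poly_roots_finite)
 then show "finite {w \<in> UNIV. poly P w = z} & (\<forall>w\<in>UNIV. poly P w = z --> poly (pderiv P) w ~= 0)"
  using z by auto
 qed
 qed (auto intro!: poly_DERIV continuous_intros)
 then show ?thesis by simp
qed

lemma area_formula_poly_real:
 fixes P :: "real poly"
 assumes P: "pderiv P ~= 0" and h [measurable]: "h \<in> borel_measurable borel"
 shows "(\<integral>\<^sup>+w. h w * ennreal \<bar>poly (pderiv P) w\<bar> \<partial>lborel)
 = (\<integral>\<^sup>+z. (\<Sum>w\<in>{w. poly P w = z}. h w) \<partial>lborel)"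
proof -
 have "(\<integral>\<^sup>+w. h w * ennreal \<bar>poly (pderiv P) w\<bar> * indicator UNIV w \<partial>lborel)
 = (\<integral>\<^sup>+z. (\<Sum>w\<in>{w \<in> UNIV. poly P w = z}. h w) \<partial>lborel)"
 proof (rule area_formula_real[OF open_UNIV])
 have "finite (poly P ` {w. poly (pderiv P) w = 0})"
 using P by (intro finite_imageI poly_roots_finite)
 then have "AE z in lborel. z \<notin> poly P ` {w. poly (pderiv P) w = 0}"
 by (intro AE_not_in finite_imp_null_set_lborel)
 then show "AE z in lborel. finite {w \<in> UNIV. poly P w = z} & (\<forall>w\<in>UNIV. poly P w = z --> poly (pderiv P) w ~= 0)"
 proof eventually_elim
 fix z assume z: "z \<notin> poly P ` {w. poly (pderiv P) w = 0}"
 have "P - [:z:] ~= 0" using P by auto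
 then have "finite {w. poly (P - [:z:]) w = 0}" by (rule poly_roots_finite)
 then show "finite {w \<in> UNIV. poly P w = z} & (\<forall>w\<in>UNIV. poly P w = z --> poly (pderiv P) w ~= 0)"
  using z by auto
 qed
 qed (auto intro!: poly_DERIV continuous_intros)
 then show ?thesis by simp
qed

text \<open>For a real polynomial \<open>W\<close> and nonreal \<open>w\<close>, the pair \<open>w, cnj w\<close> consists of roots of \<open>W + b x + a\<close> for exactly one real pair \<open>(a, b)\<close>. This is that pair, encoded as \<open>a + b i\<close>.\<close>
definition pair_remainder :: "complex poly => complex => complex" where
 "pair_remainder W w = Complex (- Im (poly W w) / Im w) (- Re (poly W w) + Im (poly W w) / Im w * Re w)"

lemma pair_remainder_iff:
 assumes "Im w > 0"
 shows "pair_remainder W w = z \<longleftrightarrow> poly (W + [:of_real (Im z), of_real (Re z):]) w = 0"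
proof -
 have "poly (W + [:of_real (Im z), of_real (Re z):]) w = 0 \<longleftrightarrow>
 Re (poly W w) + Im z + Re w * Re z = 0 & Im (poly W w) + Im w * Re z = 0"
 by (simp add: complex_eq_iff add.assoc)
 also have "... \<longleftrightarrow> Re z = - Im (poly W w) / Im w & Im z = - Re (poly W w) - Re w * Re z"
 using assms by (auto simp: field_simps)
 also have "... \<longleftrightarrow> Re z = - Im (poly W w) / Im w & Im z = - Re (poly W w) + Im (poly W w) / Im w * Re w"
 by (rule conj_cong[OF refl]) (simp add: mult.commute)
 also have "... \<longleftrightarrow> pair_remainder W w = z"
 by (auto simp: pair_remainder_def complex_eq_iff)
 finally show ?thesis by simp
qed

text \<open>For each slope \<open>Re z\<close> the derivative has finitely many zeros, and each of them excludes one constant term.\<close>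
lemma AE_affine_perturbation_squarefree:
 fixes W :: "complex poly"
 assumes "degree W \<ge> 2"
 shows "AE z in lborel. ALL w. poly (W + [:of_real (Im z), of_real (Re z):]) w = 0 -->
 poly (pderiv (W + [:of_real (Im z), of_real (Re z):])) w ~= 0"
proof -
 define E where "E k = {z. \<exists>w. w \<in> cball 0 (real k) & (w, z) \<in> {(w, z). poly W w + of_real (Im z) + w * of_real (Re z) = 0
 & poly (pderiv W) w + of_real (Re z) = 0}}" for k
 have cE: "closed (E k)" for k
 unfolding E_def
 proof (rule closed_compact_projection)
 have "closed ((%x::complex\<times>complex. poly W (fst x) + of_real (Im (snd x)) + fst x * of_real (Re (snd x))) -` {0}
 \<inter> (%x. poly (pderiv W) (fst x) + of_real (Re (snd x))) -` {0})"
 by (intro closed_Int continuous_closed_vimage) (auto intro!: continuous_intros)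
 also have "... = {(w, z). poly W w + of_real (Im z) + w * of_real (Re z) = 0
 & poly (pderiv W) w + of_real (Re z) = 0}" by auto
 finally show "closed {(w, z). poly W w + of_real (Im z) + w * of_real (Re z) = 0
 & poly (pderiv W) w + of_real (Re z) = 0}" .
 qed auto
 have pd: "pderiv (W + [:of_real (Im z), of_real (Re z):]) = pderiv W + [:of_real (Re z):]" for z
 by (simp add: pderiv_add pderiv_pCons)
 have iff: "(ALL w. poly (W + [:of_real (Im z), of_real (Re z):]) w = 0 -->
 poly (pderiv (W + [:of_real (Im z), of_real (Re z):])) w ~= 0) \<longleftrightarrow> z \<notin> (\<Union>k. E k)" for z
 proof -
 have c: "w \<in> cball 0 (real (nat \<lceil>norm w\<rceil>))" for w :: complex
 by simp
 have "z \<in> (\<Union>k. E k) \<longleftrightarrow> (\<exists>w. poly W w + of_real (Im z) + w * of_real (Re z) = 0 & poly (pderiv W) w + of_real (Re z) = 0)"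
 unfolding E_def using c by blast
 then show ?thesis unfolding pd by (simp add: add.assoc)
 qed
 have [measurable]: "(\<Union>k. E k) \<in> sets borel"
 using cE by (intro sets.countable_UN) auto
 show ?thesis unfolding iff
 proof (rule AE_Complex)
 show "Measurable.pred borel (%z. z \<notin> (\<Union>k. E k))" by measurable
 have "AE y in lborel. Complex x y \<notin> (\<Union>k. E k)" for x
 proof -
 have "degree (pderiv W) \<ge> 1" using assms by (simp add: degree_pderiv)
 then have "pderiv W + [:of_real x:] ~= 0"
  by (metis One_nat_def degree_add_eq_left degree_pCons_0 degree_0 less_numeral_extra(1) not_one_le_zero order_less_le_trans)
 then have "finite {w. poly (pderiv W + [:of_real x:]) w = 0}" by (rule poly_roots_finite)
 then have "finite ((%w. - Re (poly W w + w * of_real x)) ` {w. poly (pderiv W + [:of_real x:]) w = 0})"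
  by (rule finite_imageI)
 then have "AE y in lborel. y \<notin> (%w. - Re (poly W w + w * of_real x)) ` {w. poly (pderiv W + [:of_real x:]) w = 0}"
  by (intro AE_not_in finite_imp_null_set_lborel)
 then show ?thesis
 proof eventually_elim
  case (elim y)
  show ?case
  proof
  assume "Complex x y \<in> (\<Union>k. E k)"
  then obtain w where w: "poly W w + of_real y + w * of_real x = 0" "poly (pderiv W) w + of_real x = 0"
  by (auto simp: E_def)
  have "y = - Re (poly W w + w * of_real x)"
  using w(1) by (simp add: complex_eq_iff)
  with w(2) elim show False by (auto simp: add.commute)
  qed
 qed
 qed
 then show "AE x in lborel. AE y in lborel. Complex x y \<notin> (\<Union>k. E k)" by simp
 qed
qed

text \<open>The Jacobian of \<open>pair_remainder W\<close> is the squared norm of the derivative of the perturbed polynomial at \<open>w\<close>, divided by the imaginary part of \<open>w\<close>.\<close>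
lemma area_formula_pair_remainder:
 fixes W :: "complex poly"
 assumes W: "degree W \<ge> 2" and h [measurable]: "h \<in> borel_measurable borel"
 shows "(\<integral>\<^sup>+w. h w * ennreal ((norm (poly (pderiv W) w + of_real (Re (pair_remainder W w))))\<^sup>2 / Im w) * indicator {w. Im w > 0} w \<partial>lborel)
 = (\<integral>\<^sup>+z. (\<Sum>w\<in>{w. Im w > 0 & poly (W + [:of_real (Im z), of_real (Re z):]) w = 0}. h w) \<partial>lborel)"
proof -
 define a where "a w = Re (poly (pderiv W) w)" for w
 define b where "b w = Im (poly (pderiv W) w)" for w
 define p where "p w = - Im (poly W w) / Im w" for w
 define P where "P w = Complex (- b w / Im w) (- a w - p w + Re w * b w / Im w)" for w
 define Q where "Q w = Complex (- (a w + p w) / Im w) (b w + Re w * (a w + p w) / Im w)" for w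
 have fw: "pair_remainder W w = of_real (p w) + \<i> * of_real (- Re (poly W w) - p w * Re w)" for w
 by (simp add: pair_remainder_def p_def complex_eq_iff)
 have J: "\<bar>Re (P w) * Im (Q w) - Im (P w) * Re (Q w)\<bar> = (norm (poly (pderiv W) w + of_real (p w)))\<^sup>2 / Im w"
 if "Im w > 0" for w
 proof -
 have "Re (P w) * Im (Q w) - Im (P w) * Re (Q w) = - (((a w + p w)\<^sup>2 + (b w)\<^sup>2) / Im w)"
 using that unfolding P_def Q_def by (simp add: field_simps power2_eq_square)
 then show ?thesis using that
 by (simp add: cmod_power2 a_def b_def)
 qed
 have opn: "open {w. Im w > 0}" by (rule open_halfspace_Im_gt)
 have cP: "continuous_on {w. Im w > 0} P" "continuous_on {w. Im w > 0} Q"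
 unfolding P_def Q_def a_def b_def p_def Complex_eq
 by (auto intro!: continuous_intros)
 have der: "(pair_remainder W has_derivative (%v. of_real (Re v) * P w + of_real (Im v) * Q w)) (at w)"
 if "w \<in> {w. Im w > 0}" for w
 proof -
 have w: "Im w ~= 0" using that by auto
 have dW: "(poly W has_derivative (%v. poly (pderiv W) w * v)) (at w)"
 using poly_DERIV[of W w] by (simp add: has_field_derivative_def)
 have dv: "((%w. Im (poly W w)) has_derivative (%v. Im (poly (pderiv W) w * v))) (at w)"
 using bounded_linear.has_derivative[OF bounded_linear_Im dW] by simp
 have du: "((%w. Re (poly W w)) has_derivative (%v. Re (poly (pderiv W) w * v))) (at w)"
 using bounded_linear.has_derivative[OF bounded_linear_Re dW] by simp
 have dI: "(Im has_derivative Im) (at w)" and dR: "(Re has_derivative Re) (at w)"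
 by (intro bounded_linear_imp_has_derivative bounded_linear_Im bounded_linear_Re)+
 have "(p has_derivative (%v. - (- Im (poly W w) * (inverse (Im w) * Im v * inverse (Im w)) + Im (poly (pderiv W) w * v) / Im w))) (at w)"
 using has_derivative_minus[OF has_derivative_divide[OF dv dI w]] unfolding p_def by simp
 also have "(%v. - (- Im (poly W w) * (inverse (Im w) * Im v * inverse (Im w)) + Im (poly (pderiv W) w * v) / Im w)) =
 (%v. Re v * (- b w / Im w) + Im v * (- (a w + p w) / Im w))"
 using w unfolding a_def b_def p_def by (intro ext) (simp add: field_simps)
 finally have dp: "(p has_derivative (%v. Re v * (- b w / Im w) + Im v * (- (a w + p w) / Im w))) (at w)" .
 define p' where "p' v = Re v * (- b w / Im w) + Im v * (- (a w + p w) / Im w)" for v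
 have "((%w. of_real (p w) + \<i> * of_real (- Re (poly W w) - p w * Re w)) has_derivative
 (%v. of_real (p' v) + \<i> * of_real (- Re (poly (pderiv W) w * v) - (p w * Re v + p' v * Re w)))) (at w)"
 unfolding p'_def
 by (intro has_derivative_add has_derivative_mult_right has_derivative_of_real has_derivative_diff has_derivative_minus
  has_derivative_mult du dp dR)
 also have "(%v. of_real (p' v) + \<i> * of_real (- Re (poly (pderiv W) w * v) - (p w * Re v + p' v * Re w))) =
 (%v. of_real (Re v) * P w + of_real (Im v) * Q w)"
 proof
 fix v
 have "Re v * (- a w - p w + Re w * b w / Im w) + Im v * (b w + Re w * (a w + p w) / Im w)
  = - (a w * Re v - b w * Im v) - (p w * Re v + p' v * Re w)"
  by (simp add: p'_def algebra_simps add_divide_distrib diff_divide_distrib)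
 then show "of_real (p' v) + \<i> * of_real (- Re (poly (pderiv W) w * v) - (p w * Re v + p' v * Re w)) =
  of_real (Re v) * P w + of_real (Im v) * Q w"
  by (simp add: complex_eq_iff P_def Q_def p'_def a_def b_def)
 qed
 finally show ?thesis unfolding fw[abs_def] .
 qed
 have fin: "finite {w \<in> {w. Im w > 0}. pair_remainder W w = z}" for z
 proof -
 have "W + [:of_real (Im z), of_real (Re z):] ~= 0"
 proof
 assume "W + [:of_real (Im z), of_real (Re z):] = 0"
 then have "W = - [:of_real (Im z), of_real (Re z):]" by (rule eq_neg_iff_add_eq_0[THEN iffD2])
 then have "degree W <= 1" by (simp add: degree_pCons_le)
 then show False using W by simp
 qed
 then have "finite {w. poly (W + [:of_real (Im z), of_real (Re z):]) w = 0}" by (rule poly_roots_finite)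
 then show ?thesis by (rule rev_finite_subset) (use pair_remainder_iff in blast)
 qed
 have "AE z in lborel. finite {w \<in> {w. Im w > 0}. pair_remainder W w = z} &
 (\<forall>w\<in>{w. Im w > 0}. pair_remainder W w = z --> Re (P w) * Im (Q w) - Im (P w) * Re (Q w) ~= 0)"
 using AE_affine_perturbation_squarefree[OF W]
 proof eventually_elim
 case (elim z)
 have "Re (P w) * Im (Q w) - Im (P w) * Re (Q w) ~= 0" if "Im w > 0" "pair_remainder W w = z" for w
 proof -
 have "poly (pderiv (W + [:of_real (Im z), of_real (Re z):])) w ~= 0"
  using elim that by (simp add: pair_remainder_iff)
 moreover have "Re z = p w" using that(2) by (auto simp: pair_remainder_def p_def)
 ultimately have "poly (pderiv W) w + of_real (p w) ~= 0"
  by (simp add: pderiv_add pderiv_pCons)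
 then show ?thesis using J[OF that(1)] that(1) by auto
 qed
 then show ?case using fin by auto
 qed
 from area_formula_complex[OF opn der cP this h]
 have "(\<integral>\<^sup>+x. h x * ennreal \<bar>Re (P x) * Im (Q x) - Im (P x) * Re (Q x)\<bar> * indicator {w. Im w > 0} x \<partial>lborel) =
 (\<integral>\<^sup>+z. (\<Sum>w\<in>{w \<in> {w. Im w > 0}. pair_remainder W w = z}. h w) \<partial>lborel)" .
 also have "(\<integral>\<^sup>+x. h x * ennreal \<bar>Re (P x) * Im (Q x) - Im (P x) * Re (Q x)\<bar> * indicator {w. Im w > 0} x \<partial>lborel) =
 (\<integral>\<^sup>+w. h w * ennreal ((norm (poly (pderiv W) w + of_real (Re (pair_remainder W w))))\<^sup>2 / Im w) * indicator {w. Im w > 0} w \<partial>lborel)"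
 by (rule nn_integral_cong) (auto simp: indicator_def J pair_remainder_def p_def)
 finally have eq: "(\<integral>\<^sup>+w. h w * ennreal ((norm (poly (pderiv W) w + of_real (Re (pair_remainder W w))))\<^sup>2 / Im w) * indicator {w. Im w > 0} w \<partial>lborel)
 = (\<integral>\<^sup>+z. (\<Sum>w\<in>{w \<in> {w. Im w > 0}. pair_remainder W w = z}. h w) \<partial>lborel)" .
 have seteq: "{w \<in> {w. Im w > 0}. pair_remainder W w = z} = {w. Im w > 0 & poly (W + [:of_real (Im z), of_real (Re z):]) w = 0}" for z
 using pair_remainder_iff by blast
 show ?thesis using eq unfolding seteq .
qed

section \<open>Monic polynomials by their coefficients\<close>

text \<open>The coefficient of highest index comes last in the tuple, so that lengthening the tuple multiplies the polynomial by the variable and adds a constant term.\<close>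
fun cp :: "nat => (nat => 'a::comm_ring_1) => 'a poly" where
 "cp 0 e = 1"
| "cp (Suc n) e = pCons (e n) (cp n e)"

lemma cp_cong: "(!!j. j < n ==> e j = e' j) ==> cp n e = cp n e'"
 by (induction n) auto

lemma monic_cp: "degree (cp n e) = n & coeff (cp n (e :: nat => 'a::idom)) n = 1"
proof (induction n)
 case (Suc n)
 then have "cp n e ~= 0" by auto
 with Suc show ?case by simp
qed simp

lemma degree_cp [simp]: "degree (cp n (e :: nat => 'a::idom)) = n"
 and lead_coeff_cp [simp]: "coeff (cp n e) n = 1"
 using monic_cp by auto

lemma cp_nonzero [simp]: "cp n (e :: nat => 'a::idom) ~= 0"
 using lead_coeff_cp[of n e] by (metis coeff_0 zero_neq_one)


lemma coeff_cp: "coeff (cp n e) i = (if i < n then e (n - 1 - i) else if i = n then 1 else 0)"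
proof (induction n arbitrary: i)
 case (Suc n)
 then show ?case by (cases i) (auto simp: coeff_pCons)
qed (auto simp: one_pCons coeff_pCons split: nat.split)

lemma monic_eq_cp:
 fixes p :: "'a::idom poly"
 assumes "degree p = n" "lead_coeff p = 1"
 shows "p = cp n (%j. coeff p (n - 1 - j))"
 by (rule poly_eqI) (use assms in "auto simp: coeff_cp coeff_eq_0")

lemma poly_cp_measurable [measurable (raw)]:
 fixes f :: "'b => nat => 'a::{real_normed_field, second_countable_topology}"
 assumes "!!j. j < n ==> (%x. f x j) \<in> borel_measurable M" "g \<in> borel_measurable M"
 shows "(%x. poly (cp n (f x)) (g x)) \<in> borel_measurable M"
 using assms(1)
proof (induction n)
 case (Suc n)
 note [measurable] = Suc.IH[OF Suc.prems[OF less_SucI]] Suc.prems[of n, simplified] assms(2)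
 show ?case by simp
qed simp

interpretation lborels: product_sigma_finite "%_::nat. lborel :: 'a::euclidean_space measure" ..

lemma nn_integral_lborel_shift:
 fixes c :: "'a::euclidean_space"
 assumes [measurable]: "f \<in> borel_measurable borel"
 shows "(\<integral>\<^sup>+y. f (y + c) \<partial>lborel) = (\<integral>\<^sup>+y. f y \<partial>lborel)"
proof -
 have "(\<integral>\<^sup>+y. f y \<partial>lborel) = (\<integral>\<^sup>+y. f y \<partial>distr lborel borel ((+) c))"
 by (simp add: lborel_distr_plus)
 also have "... = (\<integral>\<^sup>+y. f (c + y) \<partial>lborel)" by (rule nn_integral_distr) auto
 finally show ?thesis by (simp add: add.commute)
qed

lemma nn_integral_PiM_Suc:
 assumes "f \<in> borel_measurable (PiM {..<Suc n} (%_. lborel :: 'a::euclidean_space measure))"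
 shows "(\<integral>\<^sup>+x. f x \<partial>PiM {..<Suc n} (%_. lborel :: 'a measure)) =
 (\<integral>\<^sup>+x. \<integral>\<^sup>+y. f (x(n := y)) \<partial>lborel \<partial>vol n)"
 using lborels.product_nn_integral_insert[of "{..<n}" n f] assms by (simp add: lessThan_Suc)

lemma nn_integral_PiM_Suc_rev:
 assumes "f \<in> borel_measurable (PiM {..<Suc n} (%_. lborel :: 'a::euclidean_space measure))"
 shows "(\<integral>\<^sup>+x. f x \<partial>PiM {..<Suc n} (%_. lborel :: 'a measure)) =
 (\<integral>\<^sup>+y. \<integral>\<^sup>+x. f (x(n := y)) \<partial>vol n \<partial>lborel)"
 using lborels.product_nn_integral_insert_rev[of "{..<n}" n f] assms by (simp add: lessThan_Suc)

lemma measurable_fun_upd_Suc [measurable (raw)]: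
 assumes "f \<in> measurable N (PiM {..<n} M)" "g \<in> measurable N (M n)"
 shows "(%x. (f x)(n := g x)) \<in> measurable N (PiM {..<Suc n} M)"
proof -
 have "(%x. (f x)(n := g x)) \<in> measurable N (PiM (insert n {..<n}) M)"
 by (rule measurable_fun_upd[where J = "{..<n}"]) (use assms in auto)
 then show ?thesis by (simp add: lessThan_Suc)
qed

text \<open>Integrate the last coordinate first: for fixed earlier coordinates it is merely translated.\<close>
lemma nn_integral_triangular_shift:
 fixes b :: "nat => (nat => 'a::euclidean_space) => 'a"
 assumes b: "!!j. j < n ==> b j \<in> borel_measurable (vol j)"
 and h: "h \<in> borel_measurable (vol n)"
 shows "(\<integral>\<^sup>+x. h (\<lambda>j\<in>{..<n}. x j + b j (restrict x {..<j})) \<partial>vol n) =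
 (\<integral>\<^sup>+x. h x \<partial>vol n)"
 using assms
proof (induction n arbitrary: h)
 case 0
 then show ?case by (simp add: lborels.nn_integral_empty PiM_empty nn_integral_count_space_finite)
next
 case (Suc n)
 note b = Suc.prems(1) and h[measurable] = Suc.prems(2)
 have [measurable]: "(%x. b j (restrict x {..<j})) \<in> borel_measurable (vol m)" if "j < Suc n" "j <= m" for j m
 proof (rule meas_o[OF _ b[OF that(1)]])
 show "(%x. restrict x {..<j}) \<in> vol m \<rightarrow>\<^sub>M vol j"
 by (rule measurable_restrict_subset) (use that in auto)
 qed
 define T where "T m x = (\<lambda>j\<in>{..<m}. x j + b j (restrict x {..<j}))" for m and x :: "nat => 'a"
 have [measurable]: "T m \<in> vol m \<rightarrow>\<^sub>M vol m" if "m <= Suc n" for m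
 unfolding T_def using that
 by (intro measurable_restrict) (auto intro!: borel_measurable_add)
 have "(\<integral>\<^sup>+x. h (T (Suc n) x) \<partial>vol (Suc n)) =
 (\<integral>\<^sup>+x. \<integral>\<^sup>+y. h (T (Suc n) (x(n := y))) \<partial>lborel \<partial>vol n)"
 by (rule nn_integral_PiM_Suc) measurable
 also have "... = (\<integral>\<^sup>+x. \<integral>\<^sup>+y. h ((T n x)(n := y)) \<partial>lborel \<partial>vol n)"
 proof (rule nn_integral_cong)
 fix x :: "nat => 'a" assume x: "x \<in> space (vol n)"
 have Tx: "T n x \<in> space (vol n)" by (simp add: T_def space_PiM)
 have rx: "restrict x {..<n} = x" using x by (simp add: space_PiM PiE_def extensional_restrict)
 have "T (Suc n) (x(n := y)) = (T n x)(n := y + b n x)" for y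
 proof
 fix j
 have *: "restrict (x(n := y)) {..<j} = restrict x {..<j}" if "j <= n"
  using that by (auto simp: restrict_def)
 consider "j < n" | "j = n" | "j > n" by linarith
 then show "T (Suc n) (x(n := y)) j = ((T n x)(n := y + b n x)) j"
  by cases (auto simp: T_def * rx)
 qed
 then have "(\<integral>\<^sup>+y. h (T (Suc n) (x(n := y))) \<partial>lborel) = (\<integral>\<^sup>+y. h ((T n x)(n := y + b n x)) \<partial>lborel)"
 by simp
 also have "... = (\<integral>\<^sup>+y. h ((T n x)(n := y)) \<partial>lborel)"
 by (rule nn_integral_lborel_shift) (use Tx in measurable)
 finally show "(\<integral>\<^sup>+y. h (T (Suc n) (x(n := y))) \<partial>lborel) = (\<integral>\<^sup>+y. h ((T n x)(n := y)) \<partial>lborel)" .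
 qed
 also have "... = (\<integral>\<^sup>+x. \<integral>\<^sup>+y. h (x(n := y)) \<partial>lborel \<partial>vol n)"
 unfolding T_def
 proof (rule Suc.IH)
 show "(%x. \<integral>\<^sup>+y. h (x(n := y)) \<partial>lborel) \<in> borel_measurable (vol n)" by measurable
 qed (use b in auto)
 also have "... = (\<integral>\<^sup>+x. h x \<partial>vol (Suc n))"
 by (rule nn_integral_PiM_Suc[symmetric]) measurable
 finally show ?case unfolding T_def .
qed

section \<open>Unordered tuples\<close>

abbreviation ctuples :: "nat => (nat => complex) measure" where
 "ctuples n \<equiv> tuples n"

lemma size_unordered [simp]: "size (unordered n z) = n"
 by (simp add: unordered_def)

lemma unordered_cong: "(!!j. j < n ==> z j = z' j) ==> unordered n z = unordered n z'"
 by (auto simp: unordered_def intro!: image_mset_cong)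

lemma unordered_Suc: "unordered (Suc n) z = add_mset (z n) (unordered n z)"
 by (simp add: unordered_def lessThan_Suc)

lemma space_unordered_borel: "space (unordered_borel n) = {X. size X = n}"
 unfolding unordered_borel_def by (rule space_measure_of) auto

lemma unordered_borelI:
 assumes "A \<subseteq> {X. size X = n}" "{z \<in> space (ctuples n). unordered n z \<in> A} \<in> sets (ctuples n)"
 shows "A \<in> sets (unordered_borel n)"
 unfolding unordered_borel_def using assms by (subst sets_measure_of) auto

lemma measurable_unordered [measurable]: "unordered n \<in> ctuples n \<rightarrow>\<^sub>M unordered_borel n"
 unfolding unordered_borel_def
proof (rule measurable_measure_of)
 fix A assume "A \<in> {A. A \<subseteq> {X. size X = n} & {z \<in> space (ctuples n). unordered n z \<in> A} \<in> sets (ctuples n)}"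
 moreover have "unordered n -` A \<inter> space (ctuples n) = {z \<in> space (ctuples n). unordered n z \<in> A}"
 by blast
 ultimately show "unordered n -` A \<inter> space (ctuples n) \<in> sets (ctuples n)" by simp
qed auto

lemma measurable_into_unordered_borel:
 assumes "!!x. x \<in> space N ==> size (f x) = n"
 and "!!A. [|A \<subseteq> {X. size X = n}; {z \<in> space (ctuples n). unordered n z \<in> A} \<in> sets (ctuples n)|]
 ==> f -` A \<inter> space N \<in> sets N"
 shows "f \<in> N \<rightarrow>\<^sub>M unordered_borel n"
 unfolding unordered_borel_def
proof (rule measurable_measure_of)
 show "f \<in> space N \<rightarrow> {X. size X = n}" using assms(1) by (intro funcsetI CollectI)
 fix A assume "A \<in> {A. A \<subseteq> {X. size X = n} & {z \<in> space (ctuples n). unordered n z \<in> A} \<in> sets (ctuples n)}"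
 then show "f -` A \<inter> space N \<in> sets N" by (intro assms(2)) simp_all
qed auto

lemma measurable_from_unordered_borel:
 assumes f: "(%z. f (unordered n z)) \<in> ctuples n \<rightarrow>\<^sub>M N"
 and sp: "!!X. size X = n ==> f X \<in> space N"
 shows "f \<in> unordered_borel n \<rightarrow>\<^sub>M N"
proof (rule measurableI)
 fix A assume A: "A \<in> sets N"
 have "(%z. f (unordered n z)) -` A \<inter> space (ctuples n) \<in> sets (ctuples n)"
 using f A by (rule measurable_sets)
 also have "(%z. f (unordered n z)) -` A \<inter> space (ctuples n) =
 {z \<in> space (ctuples n). unordered n z \<in> f -` A \<inter> space (unordered_borel n)}"
 unfolding space_unordered_borel using size_unordered by blast
 finally show "f -` A \<inter> space (unordered_borel n) \<in> sets (unordered_borel n)"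
 by (intro unordered_borelI) (simp_all add: space_unordered_borel)
qed (use sp in "simp add: space_unordered_borel")

lemma ex_unordered: "\<exists>z. unordered (size X) z = X"
proof -
 obtain xs where xs: "mset xs = X" using ex_mset by blast
 have "unordered (length xs) (nth xs) = mset (map (nth xs) [0..<length xs])"
 by (simp add: unordered_def atLeast0LessThan)
 then have "unordered (size X) (nth xs) = X" unfolding xs[symmetric] by (simp add: map_nth)
 then show ?thesis by (rule exI[where x = "nth xs"])
qed

lemma unordered_eq_imp_permutes:
 assumes "unordered n z = unordered n z'"
 obtains p where "p permutes {..<n}" "!!i. i < n ==> z i = z' (p i)"
proof -
 obtain p where "p permutes {..<n}" "\<forall>i\<in>{..<n}. z i = z' (p i)"
 by (rule image_mset_eq_implies_permutes[OF finite_lessThan assms[unfolded unordered_def]])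
 then show thesis using that by simp
qed

lemma unordered_permute:
 assumes "p permutes {..<n}"
 shows "unordered n (%i. z (p i)) = unordered n z"
proof -
 have "image_mset p (mset_set {..<n}) = mset_set {..<n}"
 using assms by (simp add: image_mset_mset_set permutes_inj_on permutes_image)
 then have "image_mset z (image_mset p (mset_set {..<n})) = image_mset z (mset_set {..<n})" by simp
 then show ?thesis by (simp add: unordered_def multiset.map_comp comp_def)
qed

section \<open>Measurability of the roots\<close>

lemma cp_eq_prod_iff:
 fixes e :: "nat => complex"
 shows "cp n e = (\<Prod>i<n. [:- z i, 1:]) \<longleftrightarrow> proots (cp n e) = unordered n z"
proof
 assume "cp n e = (\<Prod>i<n. [:- z i, 1:])"
 then have "proots (cp n e) = (\<Sum>i<n. proots [:- z i, 1:])"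
 by (simp add: proots_prod)
 also have "... = unordered n z"
 by (simp add: unordered_def sum_unfold_sum_mset)
 finally show "proots (cp n e) = unordered n z" .
next
 assume "proots (cp n e) = unordered n z"
 then show "cp n e = (\<Prod>i<n. [:- z i, 1:])"
 using complex_poly_decompose_multiset[of "cp n e"]
 by (simp add: unordered_def prod_unfold_prod_mset image_mset.compositionality comp_def)
qed

lemma size_proots_cp [simp]: "size (proots (cp n (e :: nat => complex))) = n"
 using size_proots_complex[of "cp n e"] by simp

lemma ex_roots_cp: "\<exists>z. proots (cp n (e :: nat => complex)) = unordered n z"
 using ex_unordered[of "proots (cp n e)"] by (metis size_proots_cp)

definition orderings_in :: "nat => (nat => complex set) => (nat => complex) => (nat => nat) set" where
 "orderings_in n C z = {\<sigma>. \<sigma> permutes {..<n} & (ALL i<n. z (\<sigma> i) \<in> C i)}"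

lemma finite_orderings_in [simp]: "finite (orderings_in n C z)"
 unfolding orderings_in_def by (rule finite_subset[OF _ finite_permutations[of "{..<n}"]]) auto

lemma card_orderings_in_permute:
 assumes p: "p permutes {..<n}" and z: "!!i. i < n ==> z' i = z (p i)"
 shows "card (orderings_in n C z') <= card (orderings_in n C z)"
proof (rule card_inj_on_le[of "%\<sigma>. p \<circ> \<sigma>"])
 show "inj_on (%\<sigma>. p \<circ> \<sigma>) (orderings_in n C z')"
 using permutes_inj[OF p] by (intro inj_onI) (auto simp: fun_eq_iff inj_eq)
 show "(%\<sigma>. p \<circ> \<sigma>) ` orderings_in n C z' \<subseteq> orderings_in n C z"
 proof (clarsimp simp: orderings_in_def)
 fix \<sigma> assume s: "\<sigma> permutes {..<n}" "ALL i<n. z' (\<sigma> i) \<in> C i"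
 have "\<sigma> i < n" if "i < n" for i using permutes_in_image[OF s(1), of i] that by simp
 then show "p \<circ> \<sigma> permutes {..<n} & (ALL i<n. z (p (\<sigma> i)) \<in> C i)"
 using s p z by (metis permutes_compose)
 qed
qed simp

lemma card_orderings_in_cong:
 assumes "unordered n z = unordered n z'"
 shows "card (orderings_in n C z) = card (orderings_in n C z')"
proof -
 obtain p where p: "p permutes {..<n}" "!!i. i < n ==> z i = z' (p i)"
 using unordered_eq_imp_permutes[OF assms] by blast
 obtain q where q: "q permutes {..<n}" "!!i. i < n ==> z' i = z (q i)"
 using unordered_eq_imp_permutes[OF assms[symmetric]] by blast
 show ?thesis
 proof (rule antisym)
 show "card (orderings_in n C z) <= card (orderings_in n C z')"
 using p(1) by (rule card_orderings_in_permute) (rule p(2))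
 show "card (orderings_in n C z') <= card (orderings_in n C z)"
 using q(1) by (rule card_orderings_in_permute) (rule q(2))
 qed
qed

lemma norm_root_cp_le:
 fixes e :: "nat => complex"
 assumes "poly (cp n e) w = 0" and B: "!!j. j < n ==> norm (e j) <= B" and "B \<ge> 0"
 shows "norm w <= 1 + B"
proof (rule ccontr)
 assume w: "\<not> norm w <= 1 + B"
 have "norm (poly (cp m e) w) \<ge> 1" if "m <= n" for m
 using that
 proof (induction m)
 case (Suc m)
 have "norm (w * poly (cp m e) w) \<ge> (1 + B) * 1"
 unfolding norm_mult using w Suc \<open>B \<ge> 0\<close> by (intro mult_mono) auto
 moreover have "norm (w * poly (cp m e) w) - norm (- e m) <= norm (w * poly (cp m e) w - - e m)"
 by (rule norm_triangle_ineq2)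
 moreover have "norm (e m) <= B" using B Suc.prems by simp
 ultimately show ?case by (simp add: add.commute)
 qed simp
 from this[of n] assms(1) show False by simp
qed

lemma LIMSEQ_coordinate:
 fixes f :: "nat => 'b::countable => 'c::metric_space"
 assumes "f \<longlonglongrightarrow> l"
 shows "(%k. f k j) \<longlonglongrightarrow> l j"
proof -
 have "isCont (%x. x j) l"
 proof -
 have "continuous_on UNIV (%x::'b => 'c. x j)" by (rule continuous_on_product_coordinates)
 then show ?thesis unfolding continuous_on_eq_continuous_at[OF open_UNIV] by (rule bspec) (rule UNIV_I)
 qed
 from isCont_tendsto_compose[OF this assms] show ?thesis .
qed

text \<open>Roots stay bounded when coefficients converge, so a convergent subsequence of root tuples exists; infinitely many members of it share the same admissible permutations.\<close>
lemma closed_roots_in_box: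
 assumes C: "!!i. i < n ==> closed (C i)"
 shows "closed {e :: nat => complex. \<exists>z. proots (cp n e) = unordered n z & m <= card (orderings_in n C z)}"
 (is "closed ?K")
 unfolding closed_sequential_limits
proof (intro allI impI, elim conjE)
 fix x l assume xK: "ALL k. x k \<in> ?K" and xl: "x \<longlonglongrightarrow> l"
 have lim: "(%k. x k j) \<longlonglongrightarrow> l j" for j
 using xl by (rule LIMSEQ_coordinate)
 have "\<exists>B. ALL k. norm (x k j) <= B" for j
 using convergent_imp_Bseq[OF convergentI[OF lim[of j]]] unfolding Bseq_def by blast
 then have "ALL j. \<exists>B. ALL k. norm (x k j) <= B" by (rule allI)
 from choice[OF this] obtain b where b: "!!k j. norm (x k j) <= b j" by blast
 define B where "B = (\<Sum>j<n. \<bar>b j\<bar>)"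
 have B0: "B \<ge> 0" by (simp add: B_def sum_nonneg)
 have B: "norm (x k j) <= B" if "j < n" for k j
 proof -
 have "norm (x k j) <= \<bar>b j\<bar>" using b[of k j] by linarith
 also have "... <= B" unfolding B_def using that by (intro member_le_sum) auto
 finally show ?thesis .
 qed
 have "ALL k. \<exists>z. proots (cp n (x k)) = unordered n z & m <= card (orderings_in n C z)"
 using xK by blast
 from choice[OF this] obtain z where z: "ALL k. proots (cp n (x k)) = unordered n (z k) & m <= card (orderings_in n C (z k))"
 by blast
 define y where "y k i = (if i < n then z k i else 0)" for k i
 have y1: "proots (cp n (x k)) = unordered n (y k)" for k
 using z unordered_cong[of n "z k" "y k"] by (simp add: y_def)
 have y2: "m <= card (orderings_in n C (y k))" for k
 using z[THEN spec, of k] card_orderings_in_cong[of n "z k" "y k" C] y1[of k] by simp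
 have yB: "y k \<in> PiE UNIV (%i. cball 0 (1 + B))" for k
 proof -
 have "norm (y k i) <= 1 + B" for i
 proof (cases "i < n")
 case True
 then have "y k i \<in># unordered n (y k)" by (auto simp: unordered_def)
 then have "y k i \<in># proots (cp n (x k))" by (simp only: y1)
 then have "poly (cp n (x k)) (y k i) = 0" by (simp only: set_count_proots[OF cp_nonzero] mem_Collect_eq)
 then show ?thesis by (rule norm_root_cp_le) (use B B0 in auto)
 qed (use B0 in "simp add: y_def")
 then show ?thesis by auto
 qed
 have "compactin (product_topology (%i::nat. euclidean :: complex topology) UNIV) (PiE UNIV (%i. cball 0 (1 + B)))"
 by (subst compactin_PiE) auto
 then have "compact (PiE UNIV (%i::nat. cball (0::complex) (1 + B)))"
 by (simp add: euclidean_product_topology)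
 then have sc: "seq_compact (PiE UNIV (%i::nat. cball (0::complex) (1 + B)))"
 by (simp only: compact_eq_seq_compact_metric)
 obtain l' r where r: "strict_mono r" "(y \<circ> r) \<longlonglongrightarrow> l'"
 by (rule seq_compactE[OF sc, of y]) (use yB in blast)+
 have ylim: "(%k. y (r k) i) \<longlonglongrightarrow> l' i" for i
 using LIMSEQ_coordinate[OF r(2), of i] by (simp add: comp_def)
 have xlim: "(%k. x (r k) j) \<longlonglongrightarrow> l j" for j
 using LIMSEQ_subseq_LIMSEQ[OF lim r(1)] by (simp add: comp_def)
 have "poly (cp n l) w = poly (\<Prod>i<n. [:- l' i, 1:]) w" for w
 proof (rule LIMSEQ_unique)
 have "(%k. poly (cp p (x (r k))) w) \<longlonglongrightarrow> poly (cp p l) w" for p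
 by (induction p) (auto intro!: tendsto_intros xlim)
 then show "(%k. poly (cp n (x (r k))) w) \<longlonglongrightarrow> poly (cp n l) w" .
 have "(%k. \<Prod>i<n. w - y (r k) i) \<longlonglongrightarrow> (\<Prod>i<n. w - l' i)"
 by (intro tendsto_intros ylim)
 moreover have "poly (cp n (x (r k))) w = (\<Prod>i<n. w - y (r k) i)" for k
 using y1[of "r k"] unfolding cp_eq_prod_iff[symmetric] by (simp add: poly_prod)
 ultimately show "(%k. poly (cp n (x (r k))) w) \<longlonglongrightarrow> poly (\<Prod>i<n. [:- l' i, 1:]) w"
 by (simp add: poly_prod)
 qed
 then have "cp n l = (\<Prod>i<n. [:- l' i, 1:])" by (simp add: poly_eq_poly_eq_iff[symmetric] fun_eq_iff)
 then have l': "proots (cp n l) = unordered n l'" by (simp add: cp_eq_prod_iff)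
 define \<S> where "\<S> k = orderings_in n C (y (r k))" for k
 have "finite (range \<S>)"
 by (rule finite_subset[of _ "Pow {\<sigma>. \<sigma> permutes {..<n}}"])
 (auto simp: \<S>_def orderings_in_def finite_permutations)
 then obtain k0 where inf: "infinite {k. \<S> k = \<S> k0}"
 using pigeonhole_infinite[of "UNIV :: nat set" \<S>] by auto
 have "\<S> k0 \<subseteq> orderings_in n C l'"
 proof
 fix \<sigma> assume s: "\<sigma> \<in> \<S> k0"
 have "l' (\<sigma> i) \<in> C i" if i: "i < n" for i
 proof (rule ccontr)
 assume "l' (\<sigma> i) \<notin> C i"
 then have "\<forall>\<^sub>F k in sequentially. y (r k) (\<sigma> i) \<in> - C i"
  using topological_tendstoD[OF ylim, of "- C i"] C[OF i] by auto
 then obtain N where N: "!!k. k \<ge> N ==> y (r k) (\<sigma> i) \<notin> C i"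
  by (auto simp: eventually_sequentially)
 obtain k where "k \<ge> N" "\<S> k = \<S> k0"
  using inf unfolding infinite_nat_iff_unbounded_le by blast
 with s have "y (r k) (\<sigma> i) \<in> C i" using i by (auto simp: \<S>_def orderings_in_def)
 with N[OF \<open>k \<ge> N\<close>] show False by simp
 qed
 then show "\<sigma> \<in> orderings_in n C l'" using s by (simp add: \<S>_def orderings_in_def)
 qed
 then have "card (\<S> k0) <= card (orderings_in n C l')" by (intro card_mono) simp
 moreover have "m <= card (\<S> k0)" using y2 by (simp add: \<S>_def)
 ultimately show "l \<in> ?K" using l' by auto
qed

definition roots_tuple :: "nat => (nat => complex) => nat => complex" where
 "roots_tuple n e = (SOME z. proots (cp n e) = unordered n z)"

lemma roots_tuple: "proots (cp n e) = unordered n (roots_tuple n e)"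
 unfolding roots_tuple_def by (rule someI_ex[OF ex_roots_cp])

definition orderings_count :: "nat => (nat => complex) set => (nat => complex) => ennreal" where
 "orderings_count n B e = (\<Sum>\<sigma> | \<sigma> permutes {..<n}. indicator B (\<lambda>i\<in>{..<n}. roots_tuple n e (\<sigma> i)))"

lemma measurable_extend_by_zero: "(%e i. if i < n then e i else 0) \<in> ctuples n \<rightarrow>\<^sub>M (borel :: (nat => complex) measure)"
proof -
 have "(%e i. if i < n then e i else 0) \<in> ctuples n \<rightarrow>\<^sub>M PiM UNIV (%_. borel)"
 proof (rule measurable_PiM_single')
 fix i :: nat show "(%e. if i < n then e i else 0) \<in> borel_measurable (ctuples n)"
 by (cases "i < n") auto
 qed (auto simp: space_PiM)
 then show ?thesis by (subst (asm) measurable_cong_sets[OF refl sets_PiM_equal_borel])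
qed

text \<open>For closed boxes this follows from \<open>closed_roots_in_box\<close>. Closed boxes form a generating system closed under intersection, and a Dynkin argument extends the claim to all Borel sets, since the count is additive in the set.\<close>
lemma measurable_orderings_count:
 assumes B: "B \<in> sets (ctuples n)"
 shows "orderings_count n B \<in> borel_measurable (ctuples n)"
proof -
 define \<P> :: "(nat => complex) set set" where "\<P> = {PiE {..<n} F | F. \<forall>i\<in>{..<n}. F i \<in> Collect closed}"
 have gen: "sets (ctuples n) = sigma_sets (space (ctuples n)) \<P>"
 proof
 have PP: "\<P> \<subseteq> Pow (space (ctuples n))" by (auto simp: \<P>_def space_PiM)
 let ?N = "sigma (space (ctuples n)) \<P>"
 have "sets (ctuples n) \<subseteq> sets ?N"
 proof (rule sets_PiM_in_sets)
 show "space ?N = (\<Pi>\<^sub>E i\<in>{..<n}. space borel)" using PP by (simp add: space_PiM)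
 fix i and A :: "complex set" assume i: "i \<in> {..<n}" and A: "A \<in> sets borel"
 have "(%x. x i) \<in> borel_measurable ?N"
 proof (rule borel_measurableI)
  fix S :: "complex set" assume "open S"
  have "PiE {..<n} (%j. if j = i then - S else UNIV) \<in> \<P>"
  unfolding \<P>_def using \<open>open S\<close> by (intro CollectI exI[of _ "%j. if j = i then - S else UNIV"]) auto
  then have "PiE {..<n} (%j. if j = i then - S else UNIV) \<in> sets ?N" using PP by auto
  then have "space ?N - PiE {..<n} (%j. if j = i then - S else UNIV) \<in> sets ?N" by blast
  also have "space ?N - PiE {..<n} (%j. if j = i then - S else UNIV) = (%x. x i) -` S \<inter> space ?N"
  using PP i by (auto simp: space_PiM PiE_iff split: if_splits)
  finally show "(%x. x i) -` S \<inter> space ?N \<in> sets ?N" .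
 qed
 from measurable_sets[OF this A] have "(%x. x i) -` A \<inter> space ?N \<in> sets ?N" .
 also have "(%x. x i) -` A \<inter> space ?N = {x \<in> space ?N. x i \<in> A}" by blast
 finally show "{x \<in> space ?N. x i \<in> A} \<in> sets ?N" .
 qed
 then show "sets (ctuples n) \<subseteq> sigma_sets (space (ctuples n)) \<P>" using PP by simp
 show "sigma_sets (space (ctuples n)) \<P> \<subseteq> sets (ctuples n)"
 by (rule sets.sigma_sets_subset) (auto simp: \<P>_def intro!: sets_PiM_I_finite)
 qed
 have pt: "(\<lambda>i\<in>{..<n}. roots_tuple n e (\<sigma> i)) \<in> space (ctuples n)" for e \<sigma>
 by (simp add: space_PiM)
 have "B \<in> sigma_sets (space (ctuples n)) \<P>" using B gen by simp
 then show ?thesis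
 proof (induction rule: sigma_sets_induct_disjoint[rotated 2, consumes 1, case_names basic empty compl union Int Pow])
 case Int
 show ?case unfolding Int_stable_def \<P>_def
 proof safe
 fix F G :: "nat => complex set"
 assume F: "\<forall>i\<in>{..<n}. F i \<in> Collect closed" "\<forall>i\<in>{..<n}. G i \<in> Collect closed"
 show "\<exists>H. PiE {..<n} F \<inter> PiE {..<n} G = PiE {..<n} H & (\<forall>i\<in>{..<n}. H i \<in> Collect closed)"
  by (rule exI[of _ "%i. F i \<inter> G i"]) (use F in "auto simp: PiE_Int")
 qed
 next
 case Pow
 show ?case by (auto simp: \<P>_def space_PiM)
 next
 case empty
 show ?case by (simp add: orderings_count_def[abs_def])
 next
 case (basic A)
 then obtain C where A: "A = PiE {..<n} C" and C: "!!i. i < n ==> closed (C i)" by (auto simp: \<P>_def)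
 have eq: "orderings_count n A e = of_nat (card (orderings_in n C (roots_tuple n e)))" for e
 proof -
 have "orderings_count n A e = (\<Sum>\<sigma> | \<sigma> permutes {..<n}. indicator (orderings_in n C (roots_tuple n e)) \<sigma>)"
  unfolding orderings_count_def
  by (intro sum.cong refl) (auto simp: indicator_def A orderings_in_def PiE_iff)
 also have "... = of_nat (card (orderings_in n C (roots_tuple n e)))"
 proof -
  have "(\<Sum>\<sigma> | \<sigma> permutes {..<n}. indicator (orderings_in n C (roots_tuple n e)) \<sigma>) =
  (\<Sum>\<sigma>\<in>orderings_in n C (roots_tuple n e). 1 :: ennreal)"
  by (rule sum.mono_neutral_cong_right) (auto simp: finite_permutations orderings_in_def indicator_def)
  then show ?thesis by simp
 qed
 finally show ?thesis .
 qed
 have "(%e. card (orderings_in n C (roots_tuple n e))) \<in> ctuples n \<rightarrow>\<^sub>M count_space UNIV"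
 proof -
 have "{e \<in> space (ctuples n). m <= card (orderings_in n C (roots_tuple n e))} \<in> sets (ctuples n)" for m
 proof -
  let ?K = "{e :: nat => complex. \<exists>z. proots (cp n e) = unordered n z & m <= card (orderings_in n C z)}"
  have "?K \<in> sets borel" using closed_roots_in_box[OF C] by (rule borel_closed)
  then have "(%e i. if i < n then e i else 0) -` ?K \<inter> space (ctuples n) \<in> sets (ctuples n)"
  by (rule measurable_sets[OF measurable_extend_by_zero])
  also have "(%e i. if i < n then e i else 0) -` ?K \<inter> space (ctuples n) =
  {e \<in> space (ctuples n). m <= card (orderings_in n C (roots_tuple n e))}"
  proof -
  have "(\<exists>z. proots (cp n (%i. if i < n then e i else 0)) = unordered n z & m <= card (orderings_in n C z))
  \<longleftrightarrow> m <= card (orderings_in n C (roots_tuple n e))" for e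
  proof -
  have "cp n (%i. if i < n then e i else 0) = cp n e" by (rule cp_cong) simp
  then show ?thesis using roots_tuple[of n e] card_orderings_in_cong by metis
  qed
  then show ?thesis by blast
  qed
  finally show ?thesis .
 qed
 note [measurable] = this
 show ?thesis
  unfolding measurable_count_space_eq2_countable
 proof (intro conjI ballI)
  fix a
  have "(%e. card (orderings_in n C (roots_tuple n e))) -` {a} \<inter> space (ctuples n) =
  {e \<in> space (ctuples n). a <= card (orderings_in n C (roots_tuple n e))} -
  {e \<in> space (ctuples n). Suc a <= card (orderings_in n C (roots_tuple n e))}" by auto
  then show "(%e. card (orderings_in n C (roots_tuple n e))) -` {a} \<inter> space (ctuples n) \<in> sets (ctuples n)"
  by simp
 qed auto
 qed
 then show ?case unfolding eq[abs_def] by measurable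
 next
 case (compl A)
 have "orderings_count n (space (ctuples n) - A) e = of_nat (card {\<sigma>. \<sigma> permutes {..<n}}) - orderings_count n A e" for e
 proof -
 have "orderings_count n (space (ctuples n) - A) e + orderings_count n A e = (\<Sum>\<sigma> | \<sigma> permutes {..<n}. 1)"
  unfolding orderings_count_def sum.distrib[symmetric]
  by (intro sum.cong refl) (use pt in "auto simp: indicator_def")
 then have sum: "orderings_count n (space (ctuples n) - A) e + orderings_count n A e = of_nat (card {\<sigma>. \<sigma> permutes {..<n}})"
  by simp
 have "orderings_count n A e < top_class.top"
  unfolding orderings_count_def by (rule ennreal_sum_less_top[THEN iffD2]) (auto simp: indicator_def finite_permutations)
 then have "orderings_count n A e ~= top_class.top" by simp
 then have "orderings_count n (space (ctuples n) - A) e + orderings_count n A e - orderings_count n A e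
  = orderings_count n (space (ctuples n) - A) e"
  by (rule ennreal_add_diff_cancel_right)
 then show ?thesis unfolding sum by (rule sym)
 qed
 then have eq: "orderings_count n (space (ctuples n) - A) = (%e. of_nat (card {\<sigma>. \<sigma> permutes {..<n}}) - orderings_count n A e)"
 by (rule ext)
 note [measurable] = compl.IH
 show ?case unfolding eq by measurable
 next
 case (union A)
 have "orderings_count n (\<Union>i. A i) e = (\<Sum>i. orderings_count n (A i) e)" for e
 proof -
 have "orderings_count n (\<Union>i. A i) e = (\<Sum>\<sigma> | \<sigma> permutes {..<n}. \<Sum>i. indicator (A i) (\<lambda>i\<in>{..<n}. roots_tuple n e (\<sigma> i)))"
  unfolding orderings_count_def using suminf_indicator[OF union(1)] by simp
 also have "... = (\<Sum>i. orderings_count n (A i) e)"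
  unfolding orderings_count_def by (rule suminf_sum[symmetric]) simp
 finally show ?thesis .
 qed
 then have eq: "orderings_count n (\<Union>i. A i) = (%e. \<Sum>i. orderings_count n (A i) e)"
 by (rule ext)
 note [measurable] = union.IH
 show ?case unfolding eq by measurable
 qed
qed

text \<open>A set of multisets is hit by the roots exactly when all \<open>n!\<close> orderings are hit, so its preimage is a level set of a measurable count.\<close>
theorem measurable_proots_cp [measurable]:
 "(%e. proots (cp n e)) \<in> ctuples n \<rightarrow>\<^sub>M unordered_borel n"
proof (rule measurable_into_unordered_borel)
 fix A assume A: "A \<subseteq> {X. size X = n}" "{z \<in> space (ctuples n). unordered n z \<in> A} \<in> sets (ctuples n)"
 let ?B = "{z \<in> space (ctuples n). unordered n z \<in> A}"
 have "orderings_count n ?B e ~= 0 \<longleftrightarrow> proots (cp n e) \<in> A" for e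
 proof -
 have "(\<lambda>i\<in>{..<n}. roots_tuple n e (\<sigma> i)) \<in> ?B \<longleftrightarrow> proots (cp n e) \<in> A" if "\<sigma> permutes {..<n}" for \<sigma>
 proof -
 have "unordered n (\<lambda>i\<in>{..<n}. roots_tuple n e (\<sigma> i)) = unordered n (%i. roots_tuple n e (\<sigma> i))"
  by (rule unordered_cong) simp
 also have "... = proots (cp n e)" using that by (simp add: unordered_permute roots_tuple)
 finally show ?thesis by (simp add: space_PiM)
 qed
 then have "orderings_count n ?B e = (\<Sum>\<sigma> | \<sigma> permutes {..<n}. indicator A (proots (cp n e)))"
 unfolding orderings_count_def by (intro sum.cong refl) (simp add: indicator_def)
 moreover have "card {\<sigma>. \<sigma> permutes {..<n}} ~= 0" by (simp add: card_permutations)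
 ultimately show ?thesis by (simp add: indicator_def)
 qed
 then have "(%e. proots (cp n e)) -` A \<inter> space (ctuples n) = {e \<in> space (ctuples n). orderings_count n ?B e ~= 0}"
 by blast
 also have "... \<in> sets (ctuples n)"
 using measurable_orderings_count[OF A(2)] by measurable
 finally show "(%e. proots (cp n e)) -` A \<inter> space (ctuples n) \<in> sets (ctuples n)" .
qed simp

section \<open>From coefficients to roots: complex polynomials\<close>

lemma cp_synthetic_division:
 fixes p :: "nat => 'a::comm_ring_1"
 shows "cp (Suc n) p = [:- w, 1:] * cp n (%j. poly (cp (Suc j) p) w) + [:poly (cp (Suc n) p) w:]"
proof (induction n)
 case (Suc n)
 define Q where "Q = cp n (%j. poly (cp (Suc j) p) w)"
 define r where "r = poly (cp (Suc n) p) w"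
 have "cp (Suc (Suc n)) p = pCons (p (Suc n)) ([:- w, 1:] * Q + [:r:])"
 by (subst cp.simps(2), subst Suc) (simp only: Q_def r_def)
 also have "... = [:- w, 1:] * pCons r Q + [:p (Suc n) + w * r:]"
 by (simp add: algebra_simps)
 also have "pCons r Q = cp (Suc n) (%j. poly (cp (Suc j) p) w)"
 by (simp add: Q_def r_def)
 also have "p (Suc n) + w * r = poly (cp (Suc (Suc n)) p) w"
 by (simp add: r_def)
 finally show ?case .
qed simp

text \<open>The coefficients of the quotient in the division of a polynomial by \<open>x - w\<close>.\<close>
definition horner :: "nat => 'a::comm_ring_1 => (nat => 'a) => nat => 'a" where
 "horner n w p = (\<lambda>j\<in>{..<n}. poly (cp (Suc j) p) w)"

lemma cp_horner: "cp n (horner n w p) = cp n (%j. poly (cp (Suc j) p) w)"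
 by (rule cp_cong) (simp add: horner_def)

lemma cp_upd: "cp n (p(n := z)) = cp n p"
 by (rule cp_cong) simp

lemma horner_upd [simp]: "horner n w (p(n := z)) = horner n w p"
proof -
 have "cp (Suc j) (p(n := z)) = cp (Suc j) p" if "j < n" for j
 by (rule cp_cong) (use that in auto)
 then show ?thesis by (auto simp: horner_def fun_eq_iff simp del: cp.simps)
qed

lemma cp_root_factor:
 assumes "poly (cp (Suc n) p) w = 0"
 shows "cp (Suc n) p = [:- w, 1:] * cp n (horner n w p)"
 using cp_synthetic_division[of n p w] assms by (simp add: cp_horner del: cp.simps)

lemma poly_pderiv_cp:
 fixes p :: "nat => 'a::idom"
 shows "poly (pderiv (pCons z (cp n p))) w = poly (cp n (horner n w p)) w"
proof -
 have "pCons z (cp n p) = [:- w, 1:] * cp n (horner n w (p(n := z))) + [:poly (cp (Suc n) (p(n := z))) w:]"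
 unfolding cp_horner using cp_synthetic_division[of n "p(n := z)" w] by (simp add: cp_upd)
 then have "pderiv (pCons z (cp n p)) = pderiv ([:- w, 1:] * cp n (horner n w p) + [:poly (cp (Suc n) (p(n := z))) w:])"
 by simp
 also have "poly ... w = poly (cp n (horner n w p)) w"
 by (simp add: pderiv_add pderiv_mult pderiv_pCons del: mult_pCons_left)
 finally show ?thesis .
qed

lemma measurable_horner [measurable (raw)]:
 fixes f :: "'b => nat => 'a::{real_normed_field, euclidean_space}"
 assumes [measurable]: "f \<in> N \<rightarrow>\<^sub>M tuples n" "g \<in> borel_measurable N"
 shows "(%x. horner n (g x) (f x)) \<in> N \<rightarrow>\<^sub>M tuples n"
 unfolding horner_def
proof (rule measurable_restrict)
 fix j assume "j \<in> {..<n}"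
 then have j: "j < n" by simp
 show "(%x. poly (cp (Suc j) (f x)) (g x)) \<in> borel_measurable N"
 proof (rule poly_cp_measurable)
 fix i assume "i < Suc j"
 then have "i \<in> {..<n}" using j by simp
 then show "(%x. f x i) \<in> borel_measurable N" by measurable
 qed measurable
qed

lemma sets_PiM_lborel: "sets (PiM I (%_. lborel :: 'a::euclidean_space measure)) = sets (PiM I (%_. borel))"
 by (rule sets_PiM_cong) auto

lemma measurable_PiM_lborel1: "measurable (PiM I (%_. lborel :: 'a::euclidean_space measure)) N = measurable (PiM I (%_. borel)) N"
 by (rule measurable_cong_sets) (auto simp: sets_PiM_lborel)

text \<open>The quotient coefficients are obtained by adding to each coefficient a function of the earlier ones.\<close>
lemma nn_integral_horner:
 fixes h :: "(nat => 'a::{real_normed_field, euclidean_space}) => ennreal"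
 assumes h: "h \<in> borel_measurable (vol n)"
 shows "(\<integral>\<^sup>+p. h (horner n w p) \<partial>vol n) = (\<integral>\<^sup>+p. h p \<partial>vol n)" (is "?lhs = ?rhs")
proof -
 have "horner n w p = (\<lambda>j\<in>{..<n}. p j + w * poly (cp j (restrict p {..<j})) w)" for p
 unfolding horner_def
 proof (rule restrict_ext)
 fix j
 have "cp j (restrict p {..<j}) = cp j p" by (rule cp_cong) simp
 then show "poly (cp (Suc j) p) w = p j + w * poly (cp j (restrict p {..<j})) w" by simp
 qed
 then have "?lhs =
 (\<integral>\<^sup>+p. h (\<lambda>j\<in>{..<n}. p j + w * poly (cp j (restrict p {..<j})) w) \<partial>vol n)"
 by simp
 also have "... = (\<integral>\<^sup>+p. h p \<partial>vol n)"
 by (rule nn_integral_triangular_shift[OF _ h])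
 (auto simp: measurable_PiM_lborel1 intro!: borel_measurable_times poly_cp_measurable)
 finally show ?thesis .
qed

lemma sigma_finite_PiM_lborel: "sigma_finite_measure (PiM {..<n::nat} (%_. lborel :: 'a::euclidean_space measure))"
 by (rule lborels.sigma_finite) simp

lemma nn_integral_lborel_PiM_Fubini:
 fixes f :: "'b::euclidean_space => (nat => 'a::euclidean_space) => ennreal"
 assumes "case_prod f \<in> borel_measurable (borel \<Otimes>\<^sub>M tuples n)"
 shows "(\<integral>\<^sup>+w. \<integral>\<^sup>+x. f w x \<partial>vol n \<partial>lborel) = (\<integral>\<^sup>+x. \<integral>\<^sup>+w. f w x \<partial>lborel \<partial>vol n)"
proof -
 interpret P: sigma_finite_measure "PiM {..<n} (%_. lborel :: 'a measure)" by (rule sigma_finite_PiM_lborel)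
 interpret pair_sigma_finite "lborel :: 'b measure" "PiM {..<n} (%_. lborel :: 'a measure)" ..
 have "sets (lborel \<Otimes>\<^sub>M vol n) = sets ((borel :: 'b measure) \<Otimes>\<^sub>M PiM {..<n} (%_. borel :: 'a measure))"
 by (rule sets_pair_measure_cong) (auto simp: sets_PiM_lborel)
 then have "case_prod f \<in> borel_measurable (lborel \<Otimes>\<^sub>M vol n)"
 using assms measurable_cong_sets by blast
 then show ?thesis by (rule Fubini'[symmetric])
qed

lemma measurable_horner_pair:
 "(%x. horner n (fst x) (snd x)) \<in> (borel :: 'a::{real_normed_field, euclidean_space} measure) \<Otimes>\<^sub>M tuples n \<rightarrow>\<^sub>M tuples n"
 by (rule measurable_horner) measurable

lemma measurable_poly_horner_pair:
 "(%x. poly (cp n (horner n (fst x) (snd x))) (fst x)) \<in> borel_measurable ((borel :: 'a::{real_normed_field, euclidean_space} measure) \<Otimes>\<^sub>M tuples n)"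
proof (rule poly_cp_measurable)
 fix j assume "j < n"
 then show "(%x. horner n (fst x) (snd x) j) \<in> borel_measurable ((borel :: 'a measure) \<Otimes>\<^sub>M tuples n)"
 by (intro meas_o[OF measurable_horner_pair measurable_component_singleton]) simp
qed (rule measurable_fst)

lemma measurable_fun_horner_pair:
 assumes "case_prod g \<in> borel_measurable ((borel :: 'a::{real_normed_field, euclidean_space} measure) \<Otimes>\<^sub>M tuples n)"
 shows "(%x. g (fst x) (horner n (fst x) (snd x))) \<in> borel_measurable (borel \<Otimes>\<^sub>M tuples n)"
 using meas_o[OF measurable_Pair[OF measurable_fst measurable_horner_pair] assms] by simp

text \<open>For fixed quotient, the constant term \<open>z\<close> is a polynomial in the root \<open>w\<close>, and at the root its derivative is the value of the quotient. The area formula trades \<open>w\<close> for \<open>z\<close>.\<close>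
lemma add_root_complex:
 fixes g :: "complex => (nat => complex) => ennreal"
 assumes g [measurable]: "case_prod g \<in> borel_measurable (borel \<Otimes>\<^sub>M tuples n)"
 shows "(\<integral>\<^sup>+w. \<integral>\<^sup>+q. g w q * ennreal ((norm (poly (cp n q) w))\<^sup>2) \<partial>vol n \<partial>lborel) =
 (\<integral>\<^sup>+p. \<integral>\<^sup>+z. (\<Sum>w | poly (pCons z (cp n p)) w = 0. g w (horner n w p)) \<partial>lborel \<partial>vol n)" (is "?lhs = ?rhs")
proof -
 have [measurable]: "g w \<in> borel_measurable (tuples n)" for w
 using meas_o[OF measurable_Pair1' g, of w] by simp
 have "?lhs =
 (\<integral>\<^sup>+w. \<integral>\<^sup>+p. g w (horner n w p) * ennreal ((norm (poly (cp n (horner n w p)) w))\<^sup>2) \<partial>vol n \<partial>lborel)"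
 by (intro nn_integral_cong nn_integral_horner[symmetric]) (simp add: measurable_PiM_lborel1)
 also have "... = (\<integral>\<^sup>+p. \<integral>\<^sup>+w. g w (horner n w p) * ennreal ((norm (poly (cp n (horner n w p)) w))\<^sup>2) \<partial>lborel \<partial>vol n)"
 proof (rule nn_integral_lborel_PiM_Fubini)
 note [measurable] = measurable_fun_horner_pair[OF g] measurable_poly_horner_pair
 show "(%(w, p). g w (horner n w p) * ennreal ((norm (poly (cp n (horner n w p)) w))\<^sup>2)) \<in> borel_measurable (borel \<Otimes>\<^sub>M tuples n)"
 unfolding case_prod_unfold by measurable
 qed
 also have "... = ?rhs"
 proof (rule nn_integral_cong)
 fix p :: "nat => complex" assume "p \<in> space (vol n)"
 then have [measurable]: "p \<in> space (tuples n)" by (simp add: space_PiM)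
 define P where "P = - pCons 0 (cp n p)"
 have dP: "poly (pderiv P) w = - poly (cp n (horner n w p)) w" for w
 unfolding P_def pderiv_minus using poly_pderiv_cp[of 0 n p w] by simp
 have P: "pderiv P ~= 0" unfolding P_def by (simp add: pderiv_eq_0_iff)
 have [measurable]: "(%w. g w (horner n w p)) \<in> borel_measurable borel" by measurable
 have "(\<integral>\<^sup>+w. g w (horner n w p) * ennreal ((norm (poly (cp n (horner n w p)) w))\<^sup>2) \<partial>lborel) =
 (\<integral>\<^sup>+w. g w (horner n w p) * ennreal ((norm (poly (pderiv P) w))\<^sup>2) \<partial>lborel)"
 by (simp add: dP)
 also have "... = (\<integral>\<^sup>+z. (\<Sum>w | poly P w = z. g w (horner n w p)) \<partial>lborel)"
 by (rule area_formula_poly_complex[OF P]) measurable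
 also have "... = (\<integral>\<^sup>+z. (\<Sum>w | poly (pCons z (cp n p)) w = 0. g w (horner n w p)) \<partial>lborel)"
 proof -
 have "poly P w = z \<longleftrightarrow> poly (pCons z (cp n p)) w = 0" for w z
  unfolding P_def by (simp add: neg_eq_iff_add_eq_0 add.commute)
 then show ?thesis by simp
 qed
 finally show "(\<integral>\<^sup>+w. g w (horner n w p) * ennreal ((norm (poly (cp n (horner n w p)) w))\<^sup>2) \<partial>lborel) =
 (\<integral>\<^sup>+z. (\<Sum>w | poly (pCons z (cp n p)) w = 0. g w (horner n w p)) \<partial>lborel)" .
 qed
 finally show ?thesis .
qed

lemma add_root_real:
 fixes g :: "real => (nat => real) => ennreal"
 assumes g [measurable]: "case_prod g \<in> borel_measurable (borel \<Otimes>\<^sub>M tuples n)"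
 shows "(\<integral>\<^sup>+w. \<integral>\<^sup>+q. g w q * ennreal \<bar>poly (cp n q) w\<bar> \<partial>vol n \<partial>lborel) =
 (\<integral>\<^sup>+p. \<integral>\<^sup>+z. (\<Sum>w | poly (pCons z (cp n p)) w = 0. g w (horner n w p)) \<partial>lborel \<partial>vol n)" (is "?lhs = ?rhs")
proof -
 have [measurable]: "g w \<in> borel_measurable (tuples n)" for w
 using meas_o[OF measurable_Pair1' g, of w] by simp
 have "?lhs =
 (\<integral>\<^sup>+w. \<integral>\<^sup>+p. g w (horner n w p) * ennreal \<bar>poly (cp n (horner n w p)) w\<bar> \<partial>vol n \<partial>lborel)"
 by (intro nn_integral_cong nn_integral_horner[symmetric]) (simp add: measurable_PiM_lborel1)
 also have "... = (\<integral>\<^sup>+p. \<integral>\<^sup>+w. g w (horner n w p) * ennreal \<bar>poly (cp n (horner n w p)) w\<bar> \<partial>lborel \<partial>vol n)"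
 proof (rule nn_integral_lborel_PiM_Fubini)
 note [measurable] = measurable_fun_horner_pair[OF g] measurable_poly_horner_pair
 show "(%(w, p). g w (horner n w p) * ennreal \<bar>poly (cp n (horner n w p)) w\<bar>) \<in> borel_measurable (borel \<Otimes>\<^sub>M tuples n)"
 unfolding case_prod_unfold by measurable
 qed
 also have "... = ?rhs"
 proof (rule nn_integral_cong)
 fix p :: "nat => real" assume "p \<in> space (vol n)"
 then have [measurable]: "p \<in> space (tuples n)" by (simp add: space_PiM)
 define P where "P = - pCons 0 (cp n p)"
 have dP: "poly (pderiv P) w = - poly (cp n (horner n w p)) w" for w
 unfolding P_def pderiv_minus using poly_pderiv_cp[of 0 n p w] by simp
 have P: "pderiv P ~= 0" unfolding P_def by (simp add: pderiv_eq_0_iff)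
 have [measurable]: "(%w. g w (horner n w p)) \<in> borel_measurable borel" by measurable
 have "(\<integral>\<^sup>+w. g w (horner n w p) * ennreal \<bar>poly (cp n (horner n w p)) w\<bar> \<partial>lborel) =
 (\<integral>\<^sup>+w. g w (horner n w p) * ennreal \<bar>poly (pderiv P) w\<bar> \<partial>lborel)"
 by (simp add: dP)
 also have "... = (\<integral>\<^sup>+z. (\<Sum>w | poly P w = z. g w (horner n w p)) \<partial>lborel)"
 by (rule area_formula_poly_real[OF P]) measurable
 also have "... = (\<integral>\<^sup>+z. (\<Sum>w | poly (pCons z (cp n p)) w = 0. g w (horner n w p)) \<partial>lborel)"
 proof -
 have "poly P w = z \<longleftrightarrow> poly (pCons z (cp n p)) w = 0" for w z
  unfolding P_def by (simp add: neg_eq_iff_add_eq_0 add.commute)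
 then show ?thesis by simp
 qed
 finally show "(\<integral>\<^sup>+w. g w (horner n w p) * ennreal \<bar>poly (cp n (horner n w p)) w\<bar> \<partial>lborel) =
 (\<integral>\<^sup>+z. (\<Sum>w | poly (pCons z (cp n p)) w = 0. g w (horner n w p)) \<partial>lborel)" .
 qed
 finally show ?thesis .
qed

lemma AE_simple_roots:
 fixes P :: "'a::{real_normed_field, euclidean_space} poly"
 assumes "P ~= 0"
 shows "AE z in lborel. ALL w. poly (pCons z P) w = 0 --> poly (pderiv (pCons z P)) w ~= 0"
proof -
 have pd: "pderiv (pCons z P) = pderiv (pCons 0 P)" for z by (simp add: pderiv_pCons)
 have "pderiv (pCons 0 P) ~= 0" using assms by (simp add: pderiv_eq_0_iff)
 then have "finite {w. poly (pderiv (pCons 0 P)) w = 0}" by (rule poly_roots_finite)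
 then have "finite ((%w. - (w * poly P w)) ` {w. poly (pderiv (pCons 0 P)) w = 0})" by (rule finite_imageI)
 then have "AE z in lborel. z \<notin> (%w. - (w * poly P w)) ` {w. poly (pderiv (pCons 0 P)) w = 0}"
 by (intro AE_not_in finite_imp_null_set_lborel)
 then show ?thesis
 proof eventually_elim
 case (elim z)
 show ?case
 proof (intro allI impI notI)
 fix w assume "poly (pCons z P) w = 0" "poly (pderiv (pCons z P)) w = 0"
 then have "z = - (w * poly P w)" "poly (pderiv (pCons 0 P)) w = 0"
  using pd[of z] by (auto simp: eq_neg_iff_add_eq_0)
 with elim show False by blast
 qed
 qed
qed

lemma card_simple_roots:
 fixes P :: "complex poly"
 assumes "P ~= 0" and "ALL w. poly P w = 0 --> poly (pderiv P) w ~= 0"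
 shows "card {w. poly P w = 0} = degree P" "proots P = mset_set {w. poly P w = 0}"
proof -
 have "rsquarefree P" using assms by (auto simp: rsquarefree_roots)
 then have o: "order w P = (if poly P w = 0 then 1 else 0)" for w
 using assms(1) rsquarefree_root_order[of P w] by (auto simp: order_0I)
 show eq: "proots P = mset_set {w. poly P w = 0}"
 using assms(1) by (intro multiset_eqI) (auto simp: o poly_roots_finite count_mset_set')
 show "card {w. poly P w = 0} = degree P"
 using size_proots_complex[of P] unfolding eq by simp
qed

lemma measurable_proots_poly:
 assumes P: "!!x. x \<in> space N ==> degree (P x) = n & coeff (P x) n = (1::complex)"
 and c: "!!i. i < n ==> (%x. coeff (P x) i) \<in> borel_measurable N"
 shows "(%x. proots (P x)) \<in> N \<rightarrow>\<^sub>M unordered_borel n"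
proof -
 define e where "e x = (\<lambda>j\<in>{..<n}. coeff (P x) (n - 1 - j))" for x
 have e: "e \<in> N \<rightarrow>\<^sub>M ctuples n"
 unfolding e_def by (rule measurable_restrict) (rule c, auto)
 have "P x = cp n (e x)" if "x \<in> space N" for x
 proof -
 have "P x = cp n (%j. coeff (P x) (n - 1 - j))" using P[OF that] by (intro monic_eq_cp) auto
 also have "... = cp n (e x)" by (rule cp_cong) (simp add: e_def)
 finally show ?thesis .
 qed
 then show ?thesis
 using meas_o[OF e measurable_proots_cp] by (simp cong: measurable_cong)
qed

definition vdm2 :: "nat => (nat => complex) => real" where
 "vdm2 n z = (\<Prod>k<n. \<Prod>j<k. (norm (z k - z j))\<^sup>2)"

lemma measurable_vdm2 [measurable]: "vdm2 n \<in> borel_measurable (ctuples n)"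
 unfolding vdm2_def[abs_def]
 by (intro borel_measurable_prod) (auto intro!: borel_measurable_power borel_measurable_norm borel_measurable_diff)

lemma prod_mset_unordered: "(\<Prod>x\<in>#unordered n z. f x) = (\<Prod>j<n. f (z j))"
 by (simp add: unordered_def prod_unfold_prod_mset image_mset.compositionality comp_def)

lemma poly_eq_prod_proots_cp:
 "poly (cp n (q :: nat => complex)) w = (\<Prod>z\<in>#proots (cp n q). w - z)"
proof -
 have "poly (cp n q) w = poly (\<Prod>x\<in>#proots (cp n q). [:-x, 1:]) w"
 using complex_poly_decompose_multiset[of "cp n q"] by simp
 then show ?thesis by (simp add: poly_prod_mset image_mset.compositionality comp_def)
qed

text \<open>Induction on \<open>n\<close>: the last root contributes the squared modulus of the quotient at that root, which is the product of the squared distances to the other roots. Each polynomial with simple roots is reached once for every choice of the last root.\<close>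
theorem vieta_integral_complex:
 fixes G :: "complex multiset => ennreal"
 assumes G: "G \<in> borel_measurable (unordered_borel n)"
 shows "(\<integral>\<^sup>+z. G (unordered n z) * ennreal (vdm2 n z) \<partial>vol n) =
 fact n * (\<integral>\<^sup>+e. G (proots (cp n e)) \<partial>vol n)"
 using G
proof (induction n arbitrary: G)
 case 0
 then show ?case
 by (simp add: lborels.nn_integral_empty PiM_empty nn_integral_count_space_finite unordered_def vdm2_def)
next
 case (Suc n)
 note G[measurable] = Suc.prems
 let ?P = "PiM {..<n} (%_. lborel :: complex measure)"
 let ?W = "%y X. ennreal (\<Prod>z\<in>#X. (norm (y - z))\<^sup>2)"
 have up [measurable]: "(%z. add_mset y (unordered n z)) \<in> ctuples n \<rightarrow>\<^sub>M unordered_borel (Suc n)" for y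
 proof -
 have "(%z. unordered (Suc n) (z(n := y))) \<in> ctuples n \<rightarrow>\<^sub>M unordered_borel (Suc n)" by measurable
 moreover have "unordered (Suc n) (z(n := y)) = add_mset y (unordered n z)" for z
 using unordered_cong[of n "z(n := y)" z] by (simp add: unordered_Suc)
 ultimately show ?thesis by simp
 qed
 have add: "unordered (Suc n) (z(n := y)) = add_mset y (unordered n z)" for y and z :: "nat => complex"
 using unordered_cong[of n "z(n := y)" z] by (simp add: unordered_Suc)
 have vd: "vdm2 (Suc n) (z(n := y)) = vdm2 n z * (\<Prod>x\<in>#unordered n z. (norm (y - x))\<^sup>2)" for y z
 unfolding prod_mset_unordered vdm2_def by simp
 have IH: "(\<integral>\<^sup>+z. G (add_mset y (unordered n z)) * ?W y (unordered n z) * ennreal (vdm2 n z) \<partial>?P)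
 = fact n * (\<integral>\<^sup>+q. G (add_mset y (proots (cp n q))) * ?W y (proots (cp n q)) \<partial>?P)" for y
 by (rule Suc.IH) (rule measurable_from_unordered_borel, unfold prod_mset_unordered, measurable)
 have addm: "(%(y, q). add_mset y (proots (cp n q))) \<in> borel \<Otimes>\<^sub>M ctuples n \<rightarrow>\<^sub>M unordered_borel (Suc n)"
 proof -
 have "(%x. proots ([:- fst x, 1:] * cp n (snd x))) \<in> borel \<Otimes>\<^sub>M ctuples n \<rightarrow>\<^sub>M unordered_borel (Suc n)"
 proof (rule measurable_proots_poly)
 fix x :: "complex \<times> (nat => complex)"
 have "degree ([:- fst x, 1:] * cp n (snd x)) = Suc n" by (subst degree_mult_eq) auto
 moreover have "coeff ([:- fst x, 1:] * cp n (snd x)) (1 + n) = 1"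
  using coeff_mult_degree_sum[of "[:- fst x, 1:]" "cp n (snd x)"] by simp
 ultimately show "degree ([:- fst x, 1:] * cp n (snd x)) = Suc n & coeff ([:- fst x, 1:] * cp n (snd x)) (Suc n) = 1"
  by simp
 next
 fix i
 have c: "(%x. coeff (cp n (snd x)) k) \<in> borel_measurable (borel \<Otimes>\<^sub>M ctuples n)" for k
  unfolding coeff_cp by (cases "k < n"; cases "k = n") auto
 have "coeff ([:- fst x, 1:] * cp n (snd x)) i = (case i of 0 => 0 | Suc k => coeff (cp n (snd x)) k) - fst x * coeff (cp n (snd x)) i" for x :: "complex \<times> (nat => complex)"
  by (simp add: coeff_pCons split: nat.split)
 then show "(%x. coeff ([:- fst x, 1:] * cp n (snd x)) i) \<in> borel_measurable (borel \<Otimes>\<^sub>M ctuples n)"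
  using c by (cases i) (auto intro!: borel_measurable_diff borel_measurable_times)
 qed
 moreover have "proots ([:- y, 1:] * cp n q) = add_mset y (proots (cp n q))" for y and q :: "nat => complex"
 by (subst proots_mult) auto
 ultimately show ?thesis by (simp add: case_prod_unfold)
 qed
 have F: "(%e. G (proots (cp (Suc n) e))) \<in> borel_measurable (vol (Suc n))"
 unfolding measurable_PiM_lborel1 by (rule meas_o[OF measurable_proots_cp G])
 have "(\<integral>\<^sup>+z. G (unordered (Suc n) z) * ennreal (vdm2 (Suc n) z) \<partial>vol (Suc n)) =
 (\<integral>\<^sup>+y. \<integral>\<^sup>+z. G (unordered (Suc n) (z(n := y))) * ennreal (vdm2 (Suc n) (z(n := y))) \<partial>?P \<partial>lborel)"
 by (rule nn_integral_PiM_Suc_rev) (simp add: measurable_PiM_lborel1)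
 also have "... = (\<integral>\<^sup>+y. \<integral>\<^sup>+z. G (add_mset y (unordered n z)) * ?W y (unordered n z) * ennreal (vdm2 n z) \<partial>?P \<partial>lborel)"
 unfolding add vd
 by (intro nn_integral_cong) (simp add: ennreal_mult' mult_ac vdm2_def prod_nonneg prod_mset_unordered)
 also have "... = (\<integral>\<^sup>+y. fact n * (\<integral>\<^sup>+q. G (add_mset y (proots (cp n q))) * ennreal ((norm (poly (cp n q) y))\<^sup>2) \<partial>?P) \<partial>lborel)"
 proof -
 have "(\<Prod>z\<in>#X. (norm (y - z))\<^sup>2) = (norm (\<Prod>z\<in>#X. y - z))\<^sup>2" for y :: complex and X
 by (induction X) (auto simp: norm_mult power_mult_distrib)
 then show ?thesis unfolding IH poly_eq_prod_proots_cp by simp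
 qed
 also have "... = fact n * (\<integral>\<^sup>+y. \<integral>\<^sup>+q. G (add_mset y (proots (cp n q))) * ennreal ((norm (poly (cp n q) y))\<^sup>2) \<partial>?P \<partial>lborel)"
 proof (rule nn_integral_cmult)
 interpret P: sigma_finite_measure ?P by (rule sigma_finite_PiM_lborel)
 have s: "sets (borel \<Otimes>\<^sub>M ?P) = sets (borel \<Otimes>\<^sub>M ctuples n)"
 by (rule sets_pair_measure_cong) (auto simp: sets_PiM_lborel)
 have [measurable]: "(%x. G (add_mset (fst x) (proots (cp n (snd x))))) \<in> borel_measurable (borel \<Otimes>\<^sub>M ctuples n)"
 using meas_o[OF addm G] by (simp add: case_prod_unfold)
 have "(%x. G (add_mset (fst x) (proots (cp n (snd x)))) * ennreal ((norm (poly (cp n (snd x)) (fst x)))\<^sup>2)) \<in> borel_measurable (borel \<Otimes>\<^sub>M ctuples n)"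
 by measurable
 then have "(%(y, q). G (add_mset y (proots (cp n q))) * ennreal ((norm (poly (cp n q) y))\<^sup>2)) \<in> borel_measurable (lborel \<Otimes>\<^sub>M ?P)"
 using s by (simp add: case_prod_unfold measurable_cong_sets[of "lborel \<Otimes>\<^sub>M ?P" "borel \<Otimes>\<^sub>M ctuples n"] cong: sets_pair_measure_cong)
 then show "(%y. \<integral>\<^sup>+q. G (add_mset y (proots (cp n q))) * ennreal ((norm (poly (cp n q) y))\<^sup>2) \<partial>?P) \<in> borel_measurable lborel"
 by (rule P.borel_measurable_nn_integral)
 qed
 also have "(\<integral>\<^sup>+y. \<integral>\<^sup>+q. G (add_mset y (proots (cp n q))) * ennreal ((norm (poly (cp n q) y))\<^sup>2) \<partial>?P \<partial>lborel) =
 (\<integral>\<^sup>+p. \<integral>\<^sup>+z. (\<Sum>w | poly (pCons z (cp n p)) w = 0. G (add_mset w (proots (cp n (horner n w p))))) \<partial>lborel \<partial>?P)"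
 by (rule add_root_complex) (use meas_o[OF addm G] in "simp add: case_prod_unfold")
 also have "... = (\<integral>\<^sup>+p. \<integral>\<^sup>+z. of_nat (Suc n) * G (proots (cp (Suc n) (p(n := z)))) \<partial>lborel \<partial>?P)"
 proof (rule nn_integral_cong, rule nn_integral_cong_AE)
 fix p :: "nat => complex"
 show "AE z in lborel. (\<Sum>w | poly (pCons z (cp n p)) w = 0. G (add_mset w (proots (cp n (horner n w p))))) =
 of_nat (Suc n) * G (proots (cp (Suc n) (p(n := z))))"
 using AE_simple_roots[OF cp_nonzero[of n p]]
 proof eventually_elim
 case (elim z)
 have cp: "cp (Suc n) (p(n := z)) = pCons z (cp n p)" by (simp add: cp_upd)
 have "add_mset w (proots (cp n (horner n w p))) = proots (pCons z (cp n p))" if "poly (pCons z (cp n p)) w = 0" for w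
 proof -
  have "pCons z (cp n p) = [:- w, 1:] * cp n (horner n w p)"
  using cp_root_factor[of n "p(n := z)" w] that by (simp only: cp horner_upd)
  then show ?thesis by (simp add: proots_mult del: mult_pCons_left)
 qed
 then have "(\<Sum>w | poly (pCons z (cp n p)) w = 0. G (add_mset w (proots (cp n (horner n w p))))) =
  (\<Sum>w | poly (pCons z (cp n p)) w = 0. G (proots (pCons z (cp n p))))"
  by (intro sum.cong refl arg_cong[where f = G]) blast
 also have "... = of_nat (card {w. poly (pCons z (cp n p)) w = 0}) * G (proots (pCons z (cp n p)))"
  by (simp only: sum_constant)
 also have "card {w. poly (pCons z (cp n p)) w = 0} = Suc n"
  using card_simple_roots(1)[OF _ elim] by simp
 finally show ?case unfolding cp .
 qed
 qed
 also have "... = (\<integral>\<^sup>+e. of_nat (Suc n) * G (proots (cp (Suc n) e)) \<partial>vol (Suc n))"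
 proof (rule nn_integral_PiM_Suc[symmetric])
 note [measurable] = F
 show "(%e. of_nat (Suc n) * G (proots (cp (Suc n) e))) \<in> borel_measurable (vol (Suc n))"
 by measurable
 qed
 also have "... = of_nat (Suc n) * (\<integral>\<^sup>+e. G (proots (cp (Suc n) e)) \<partial>vol (Suc n))"
 using F by (rule nn_integral_cmult)
 finally show ?case by (simp add: mult_ac del: cp.simps)
qed

section \<open>Real polynomials with real roots\<close>

lemma sum_mset_unordered: "(\<Sum>x\<in>#unordered n z. f x) = (\<Sum>j<n. f (z j))"
 by (simp add: unordered_def sum_unfold_sum_mset image_mset.compositionality comp_def)

lemma set_mset_unordered: "set_mset (unordered n z) = z ` {..<n}"
 by (simp add: unordered_def)

text \<open>For product sets the sum is a count of orderings, and products generate the product algebra.\<close>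
lemma measurable_sum_mset_indicator:
 assumes X: "X \<in> N \<rightarrow>\<^sub>M unordered_borel n" and w: "w \<in> N \<rightarrow>\<^sub>M M'"
 and A: "A \<in> sets (M' \<Otimes>\<^sub>M borel)"
 shows "(%x. \<Sum>z\<in>#X x. indicator A (w x, z) :: ennreal) \<in> borel_measurable N"
proof -
 have sz: "size (X x) = n" if "x \<in> space N" for x
 using measurable_space[OF X that] by (simp add: space_unordered_borel)
 have A': "A \<in> sigma_sets (space M' \<times> space (borel :: complex measure)) {a \<times> b | a b. a \<in> sets M' & b \<in> sets borel}"
 using A by (simp add: sets_pair_measure)
 have ex: "\<exists>u. X x = unordered n u" if "x \<in> space N" for x
 using ex_unordered[of "X x"] sz[OF that] by metis
 show ?thesis
 using A'
 proof (induction rule: sigma_sets_induct_disjoint[rotated 2, consumes 1, case_names basic empty compl union Int Pow])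
 case Int
 show ?case by (rule Int_stable_pair_measure_generator)
 next
 case Pow
 show ?case by (rule pair_measure_closed)
 next
 case (basic A)
 then obtain a b where ab: "A = a \<times> b" "a \<in> sets M'" "b \<in> sets borel" by auto
 have "(%Y. \<Sum>z\<in>#Y. indicator b z :: ennreal) \<in> borel_measurable (unordered_borel n)"
 proof (rule measurable_from_unordered_borel)
 show "(%u. \<Sum>z\<in>#unordered n u. indicator b z :: ennreal) \<in> borel_measurable (ctuples n)"
  unfolding sum_mset_unordered using ab(3)
  by (intro borel_measurable_sum meas_o[OF measurable_component_singleton] borel_measurable_indicator) auto
 qed simp
 from meas_o[OF X this]
 have [measurable]: "(%x. \<Sum>z\<in>#X x. indicator b z :: ennreal) \<in> borel_measurable N" .
 have [measurable]: "(%x. indicator a (w x) :: ennreal) \<in> borel_measurable N"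
 using w ab(2) by measurable
 have eq: "(\<Sum>z\<in>#X x. indicator A (w x, z)) = indicator a (w x) * (\<Sum>z\<in>#X x. indicator b z :: ennreal)" for x
 proof -
 have d: "(\<Sum>z\<in>#Y. c * f z) = c * (\<Sum>z\<in>#Y. f z)" for Y and c :: ennreal and f :: "complex => ennreal"
  by (induction Y) (auto simp: distrib_left)
 show ?thesis unfolding ab(1) indicator_times fst_conv snd_conv by (rule d)
 qed
 show ?case unfolding eq by measurable
 next
 case empty
 then show ?case by simp
 next
 case (compl A)
 have "(\<Sum>z\<in>#X x. indicator (space M' \<times> space borel - A) (w x, z)) = of_nat n - (\<Sum>z\<in>#X x. indicator A (w x, z) :: ennreal)"
 if x: "x \<in> space N" for x
 proof -
 obtain u where u: "X x = unordered n u" using ex[OF x] by blast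
 have "w x \<in> space M'" using measurable_space[OF w x] .
 then have "(\<Sum>j<n. indicator (space M' \<times> space borel - A) (w x, u j)) + (\<Sum>j<n. indicator A (w x, u j)) = (\<Sum>j<n. 1 :: ennreal)"
  unfolding sum.distrib[symmetric] by (intro sum.cong refl) (simp add: indicator_def)
 then have s: "(\<Sum>j<n. indicator (space M' \<times> space borel - A) (w x, u j)) + (\<Sum>j<n. indicator A (w x, u j)) = (of_nat n :: ennreal)"
  by simp
 have "(\<Sum>j<n. indicator A (w x, u j)) < (top_class.top :: ennreal)"
  by (rule ennreal_sum_less_top[THEN iffD2]) (auto simp: indicator_def)
 then have "(\<Sum>j<n. indicator A (w x, u j)) ~= (top_class.top :: ennreal)" by (rule less_imp_neq)
 then show ?thesis unfolding u sum_mset_unordered s[symmetric] by (rule ennreal_add_diff_cancel_right[symmetric])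
 qed
 moreover have "(%x. of_nat n - (\<Sum>z\<in>#X x. indicator A (w x, z) :: ennreal)) \<in> borel_measurable N"
 using compl by measurable
 ultimately show ?case by (subst measurable_cong)
 next
 case (union A)
 have "(\<Sum>z\<in>#X x. indicator (\<Union>i. A i) (w x, z)) = (\<Sum>i. \<Sum>z\<in>#X x. indicator (A i) (w x, z) :: ennreal)"
 if x: "x \<in> space N" for x
 proof -
 obtain u where u: "X x = unordered n u" using ex[OF x] by blast
 have "(\<Sum>j<n. indicator (\<Union>i. A i) (w x, u j)) = (\<Sum>j<n. \<Sum>i. indicator (A i) (w x, u j) :: ennreal)"
  unfolding suminf_indicator[OF union(1)] ..
 also have "... = (\<Sum>i. \<Sum>j<n. indicator (A i) (w x, u j))"
  by (rule suminf_sum[symmetric]) simp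
 finally show ?thesis unfolding u sum_mset_unordered .
 qed
 moreover have "(%x. \<Sum>i. \<Sum>z\<in>#X x. indicator (A i) (w x, z) :: ennreal) \<in> borel_measurable N"
 using union.IH by measurable
 ultimately show ?case by (subst measurable_cong)
 qed
qed

lemma pred_Ball_mset:
 assumes X: "X \<in> N \<rightarrow>\<^sub>M unordered_borel n" and w: "w \<in> N \<rightarrow>\<^sub>M M'"
 and Q: "Measurable.pred (M' \<Otimes>\<^sub>M borel) (%(w, z). Q w z)"
 shows "Measurable.pred N (%x. \<forall>z\<in>#X x. Q (w x) z)"
proof -
 let ?A = "{y \<in> space (M' \<Otimes>\<^sub>M borel). \<not> (case y of (w, z) => Q w z)}"
 have "?A \<in> sets (M' \<Otimes>\<^sub>M borel)" using Q by measurable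
 from measurable_sum_mset_indicator[OF X w this]
 have m: "(%x. \<Sum>z\<in>#X x. indicator ?A (w x, z) :: ennreal) \<in> borel_measurable N" .
 have "(\<forall>z\<in>#X x. Q (w x) z) \<longleftrightarrow> (\<Sum>z\<in>#X x. indicator ?A (w x, z) :: ennreal) = 0" if x: "x \<in> space N" for x
 proof -
 have "w x \<in> space M'" using measurable_space[OF w x] .
 then show ?thesis by (auto simp: space_pair_measure indicator_def)
 qed
 moreover have "Measurable.pred N (%x. (\<Sum>z\<in>#X x. indicator ?A (w x, z) :: ennreal) = 0)"
 using m by measurable
 ultimately show ?thesis by (subst measurable_cong)
qed

text \<open>An order on the plane that singles out one root of a finite set, so that every polynomial is reached by exactly one choice of the pair that is added last.\<close>
definition lex_less :: "complex => complex => bool" where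
 "lex_less z w \<longleftrightarrow> Re z < Re w \<or> Re z = Re w & Im z < Im w"

lemma lex_max_unique:
 assumes "finite T" "T ~= {}"
 shows "\<exists>!w. w \<in> T & (\<forall>z\<in>T - {w}. lex_less z w)"
proof -
 have "\<exists>w. w \<in> T & (\<forall>z\<in>T - {w}. lex_less z w)"
 using assms
 proof (induction T rule: finite_ne_induct)
 case (insert x F)
 then obtain w where w: "w \<in> F" "\<forall>z\<in>F - {w}. lex_less z w" by blast
 have "lex_less x w \<or> lex_less w x" using w(1) insert(3) unfolding lex_less_def complex_eq_iff
 by (metis complex_eqI linorder_neqE_linordered_idom)
 then show ?case
 proof
 assume "lex_less x w"
 then show ?thesis using w by (intro exI[of _ w]) auto
 next
 assume wx: "lex_less w x"
 have "lex_less z x" if "z \<in> F" for z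
 proof (cases "z = w")
  case False
  then have "lex_less z w" using w that by auto
  with wx show ?thesis unfolding lex_less_def by auto
 qed (use wx in simp)
 then show ?thesis by (intro exI[of _ x]) auto
 qed
 qed simp
 then show ?thesis
 proof (rule ex_ex1I)
 fix u v assume u: "u \<in> T & (\<forall>z\<in>T - {u}. lex_less z u)" and v: "v \<in> T & (\<forall>z\<in>T - {v}. lex_less z v)"
 show "u = v"
 proof (rule ccontr)
 assume "u ~= v"
 then have "lex_less u v" "lex_less v u" using u v by auto
 then show False unfolding lex_less_def by auto
 qed
 qed
qed

lemma sum_lex_max:
 assumes "finite T" "T ~= {}"
 shows "(\<Sum>w\<in>T. if \<forall>z\<in>T - {w}. lex_less z w then c else 0) = (c :: ennreal)"
proof -
 obtain w where w: "w \<in> T" "\<forall>z\<in>T - {w}. lex_less z w" and uniq: "!!v. v \<in> T ==> \<forall>z\<in>T - {v}. lex_less z v ==> v = w"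
 using lex_max_unique[OF assms] by blast
 have "(\<Sum>v\<in>T. if \<forall>z\<in>T - {v}. lex_less z v then c else 0) = (\<Sum>v\<in>{w}. if \<forall>z\<in>T - {v}. lex_less z v then c else 0)"
 proof (rule sum.mono_neutral_right[OF assms(1)], use w(1) in blast, rule ballI)
 fix v assume "v \<in> T - {w}"
 then have "\<not> (\<forall>z\<in>T - {v}. lex_less z v)" using uniq[of v] by blast
 then show "(if \<forall>z\<in>T - {v}. lex_less z v then c else 0) = 0" by (rule if_not_P)
 qed
 also have "... = (if \<forall>z\<in>T - {w}. lex_less z w then c else 0)" by (simp only: sum.insert[OF finite.emptyI] sum.empty empty_iff not_False_eq_True add_0_right)
 also have "... = c" using w(2) by (rule if_P)
 finally show ?thesis .
qed

definition nreal :: "complex multiset => nat" where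
 "nreal X = size (filter_mset (%z. Im z = 0) X)"

definition rp :: "nat => (nat => real) => complex poly" where
 "rp n e = cp n (%j. complex_of_real (e j))"

lemma rp_simps [simp]: "rp 0 e = 1" "rp (Suc n) e = pCons (of_real (e n)) (rp n e)"
 by (simp_all add: rp_def)

lemma rp_cong: "(!!j. j < n ==> e j = e' j) ==> rp n e = rp n e'"
 unfolding rp_def by (rule cp_cong) simp

lemma rp_nonzero [simp]: "rp n e ~= 0" and degree_rp [simp]: "degree (rp n e) = n"
 and lead_coeff_rp [simp]: "coeff (rp n e) n = 1"
 by (simp_all add: rp_def)

lemma size_proots_rp [simp]: "size (proots (rp n e)) = n"
 by (simp add: rp_def)

lemma poly_rp_of_real: "poly (rp n e) (of_real w) = of_real (poly (cp n e) w)"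
 by (induction n) simp_all

lemma poly_rp_cnj: "poly (rp n e) (cnj z) = cnj (poly (rp n e) z)"
 by (induction n) simp_all

lemma measurable_proots_rp [measurable]:
 "(%e. proots (rp n e)) \<in> tuples n \<rightarrow>\<^sub>M unordered_borel n"
proof -
 have "(%e. \<lambda>j\<in>{..<n}. complex_of_real (e j)) \<in> tuples n \<rightarrow>\<^sub>M ctuples n"
 by (rule measurable_restrict) measurable
 from meas_o[OF this measurable_proots_cp]
 have "(%e. proots (cp n (\<lambda>j\<in>{..<n}. complex_of_real (e j)))) \<in> tuples n \<rightarrow>\<^sub>M unordered_borel n" .
 moreover have "cp n (\<lambda>j\<in>{..<n}. complex_of_real (e j)) = rp n e" for e
 unfolding rp_def by (rule cp_cong) simp
 ultimately show ?thesis by simp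
qed

lemma measurable_nreal [measurable]: "nreal \<in> unordered_borel n \<rightarrow>\<^sub>M count_space UNIV"
proof (rule measurable_from_unordered_borel)
 have "nreal (unordered n z) = (\<Sum>j<n. if Im (z j) = 0 then 1 else 0)" for z
 proof (induction n)
 case 0
 show ?case by (simp add: nreal_def unordered_def)
 next
 case (Suc n)
 then show ?case by (simp add: nreal_def unordered_Suc)
 qed
 then show "(%z. nreal (unordered n z)) \<in> ctuples n \<rightarrow>\<^sub>M count_space UNIV"
 by simp measurable
qed simp

lemma AE_simple_roots_of_real:
 fixes P :: "complex poly"
 assumes "P ~= 0"
 shows "AE z in lborel. ALL w. poly (pCons (of_real z) P) w = 0 --> poly (pderiv (pCons (of_real z) P)) w ~= 0"
proof -
 have pd: "pderiv (pCons z P) = pderiv (pCons 0 P)" for z by (simp add: pderiv_pCons)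
 have "pderiv (pCons 0 P) ~= 0" using assms by (simp add: pderiv_eq_0_iff)
 then have "finite {w. poly (pderiv (pCons 0 P)) w = 0}" by (rule poly_roots_finite)
 then have "finite ((%w. - Re (w * poly P w)) ` {w. poly (pderiv (pCons 0 P)) w = 0})" by (rule finite_imageI)
 then have "AE z in lborel. z \<notin> (%w. - Re (w * poly P w)) ` {w. poly (pderiv (pCons 0 P)) w = 0}"
 by (intro AE_not_in finite_imp_null_set_lborel)
 then show ?thesis
 proof eventually_elim
 case (elim z)
 show ?case
 proof (intro allI impI notI)
 fix w assume w: "poly (pCons (of_real z) P) w = 0" "poly (pderiv (pCons (of_real z) P)) w = 0"
 have "Re (poly (pCons (of_real z) P) w) = 0" using w(1) by simp
 then have "z = - Re (w * poly P w)" by simp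
 moreover have "poly (pderiv (pCons 0 P)) w = 0" using w(2) pd[of "of_real z"] by simp
 ultimately show False using elim by blast
 qed
 qed
qed

definition vdm :: "nat => (nat => complex) => real" where
 "vdm n z = (\<Prod>k<n. \<Prod>j<k. norm (z k - z j))"

lemma vdm_cong: "(!!j. j < n ==> z j = z' j) ==> vdm n z = vdm n z'"
 unfolding vdm_def by (intro prod.cong refl) auto

lemma vdm_nonneg [simp]: "vdm n z \<ge> 0"
 by (simp add: vdm_def prod_nonneg)

lemma measurable_vdm [measurable]: "vdm n \<in> borel_measurable (ctuples n)"
 unfolding vdm_def[abs_def]
 by (intro borel_measurable_prod) (auto intro!: borel_measurable_norm borel_measurable_diff)

lemma poly_rp_eq_prod: "poly (rp n q) w = (\<Prod>z\<in>#proots (rp n q). w - z)"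
 unfolding rp_def by (rule poly_eq_prod_proots_cp)

lemma norm_prod_mset: "norm (\<Prod>z\<in>#X. f z) = (\<Prod>z\<in>#X. norm (f z :: complex))"
 by (induction X) (auto simp: norm_mult)

lemma measurable_add_mset_proots:
 assumes f: "f \<in> borel_measurable N" and P: "!!x. x \<in> space N ==> degree (P x) = n & coeff (P x) n = (1::complex)"
 and c: "!!i. (%x. coeff (P x) i) \<in> borel_measurable N"
 shows "(%x. add_mset (f x) (proots (P x))) \<in> N \<rightarrow>\<^sub>M unordered_borel (Suc n)"
 "!!x. x \<in> space N ==> degree ([:- f x, 1:] * P x) = Suc n & coeff ([:- f x, 1:] * P x) (Suc n) = 1"
 "!!i. (%x. coeff ([:- f x, 1:] * P x) i) \<in> borel_measurable N"
 "!!x. x \<in> space N ==> proots ([:- f x, 1:] * P x) = add_mset (f x) (proots (P x))"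
proof -
 have nz: "P x ~= 0" if "x \<in> space N" for x using P[OF that] by auto
 show 1: "degree ([:- f x, 1:] * P x) = Suc n & coeff ([:- f x, 1:] * P x) (Suc n) = 1" if "x \<in> space N" for x
 proof
 show "degree ([:- f x, 1:] * P x) = Suc n" using nz[OF that] P[OF that] by (subst degree_mult_eq) auto
 show "coeff ([:- f x, 1:] * P x) (Suc n) = 1"
 using coeff_mult_degree_sum[of "[:- f x, 1:]" "P x"] P[OF that] by simp
 qed
 show 2: "(%x. coeff ([:- f x, 1:] * P x) i) \<in> borel_measurable N" for i
 proof -
 have "coeff ([:- f x, 1:] * P x) i = (case i of 0 => 0 | Suc k => coeff (P x) k) - f x * coeff (P x) i" for x
 by (simp add: coeff_pCons split: nat.split)
 then show ?thesis using c f by (cases i) (auto intro!: borel_measurable_diff borel_measurable_times)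
 qed
 show 3: "proots ([:- f x, 1:] * P x) = add_mset (f x) (proots (P x))" if "x \<in> space N" for x
 using nz[OF that] by (subst proots_mult) auto
 have "(%x. proots ([:- f x, 1:] * P x)) \<in> N \<rightarrow>\<^sub>M unordered_borel (Suc n)"
 using 1 2 by (rule measurable_proots_poly)
 then show "(%x. add_mset (f x) (proots (P x))) \<in> N \<rightarrow>\<^sub>M unordered_borel (Suc n)"
 by (rule measurable_cong[THEN iffD1, rotated]) (rule 3)
qed

lemma measurable_coeff_rp [measurable (raw)]:
 assumes "!!j. j < n ==> (%x. f x j) \<in> borel_measurable N"
 shows "(%x. coeff (rp n (f x)) i) \<in> borel_measurable N"
 unfolding rp_def coeff_cp using assms by (cases "i < n"; cases "i = n") auto

lemma nreal_eq_size_iff: "nreal X = size X \<longleftrightarrow> (\<forall>z\<in>#X. Im z = 0)"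
proof -
 have "size X = nreal X + size (filter_mset (%z. Im z ~= 0) X)"
 unfolding nreal_def size_union[symmetric] by (rule arg_cong[OF multiset_partition])
 then have "nreal X = size X \<longleftrightarrow> filter_mset (%z. Im z ~= 0) X = {#}"
 unfolding size_eq_0_iff_empty[symmetric] by linarith
 also have "... \<longleftrightarrow> set_mset (filter_mset (%z. Im z ~= 0) X) = {}"
 by (rule set_mset_eq_empty_iff[symmetric])
 also have "... \<longleftrightarrow> (\<forall>z\<in>#X. Im z = 0)"
 unfolding set_mset_filter by blast
 finally show ?thesis .
qed

abbreviation increasing_upto :: "nat => (nat => real) => bool" where
 "increasing_upto n x \<equiv> \<forall>i\<in>{..<n}. \<forall>j\<in>{..<n}. i < j --> x i < x j"

lemma increasing_upto_Suc: "increasing_upto (Suc n) (x(n := y)) \<longleftrightarrow> increasing_upto n x & (ALL j<n. x j < y)"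
proof
 assume *: "increasing_upto (Suc n) (x(n := y))"
 have "x i < x j" if "i < n" "j < n" "i < j" for i j
 using *[rule_format, of i j] that by simp
 moreover have "x j < y" if "j < n" for j
 using *[rule_format, of j n] that by simp
 ultimately show "increasing_upto n x & (ALL j<n. x j < y)" by simp
next
 assume *: "increasing_upto n x & (ALL j<n. x j < y)"
 show "increasing_upto (Suc n) (x(n := y))"
 proof (intro ballI impI)
 fix i j assume ij: "i \<in> {..<Suc n}" "j \<in> {..<Suc n}" "i < j"
 then have "i < n" by simp
 then show "(x(n := y)) i < (x(n := y)) j" using * ij by (cases "j = n") auto
 qed
qed

lemma pred_increasing_upto: "Measurable.pred (tuples n) (increasing_upto n)"
 by (intro pred_intros_finite pred_intros_logic borel_measurable_pred_less measurable_component_singleton) auto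

lemma measurable_of_real_tuple: "(%x. \<lambda>j\<in>{..<n}. complex_of_real (x j)) \<in> tuples n \<rightarrow>\<^sub>M ctuples n"
 by (rule measurable_restrict) measurable

lemma rp_horner:
 "rp n (horner n w p) = cp n (horner n (of_real w) (%j. of_real (p j)))"
proof -
 have "of_real (horner n w p j) = horner n (complex_of_real w) (%j. of_real (p j)) j" if "j < n" for j
 using that poly_rp_of_real[of "Suc j" p w] unfolding rp_def horner_def by (simp del: cp.simps)
 then show ?thesis unfolding rp_def by (intro cp_cong) simp
qed

lemma rp_real_root_factor:
 assumes "poly (cp (Suc n) p) w = 0"
 shows "rp (Suc n) p = [:- of_real w, 1:] * rp n (horner n w p)"
proof -
 have "poly (rp (Suc n) p) (of_real w) = of_real 0"
 unfolding poly_rp_of_real assms ..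
 then have "poly (cp (Suc n) (%j. complex_of_real (p j))) (of_real w) = 0" by (simp add: rp_def del: cp.simps)
 from cp_root_factor[OF this] show ?thesis unfolding rp_horner by (simp add: rp_def del: cp.simps)
qed

text \<open>As in the complex case, but only the largest root is allowed as the new one, which keeps the tuple increasing and removes the factorial.\<close>
theorem vieta_integral_real_roots:
 fixes G :: "complex multiset => ennreal"
 assumes G: "G \<in> borel_measurable (unordered_borel n)"
 shows "(\<integral>\<^sup>+x. (if increasing_upto n x then G (unordered n (%j. of_real (x j))) * ennreal (vdm n (%j. of_real (x j))) else 0) \<partial>vol n) =
 (\<integral>\<^sup>+e. (if nreal (proots (rp n e)) = n then G (proots (rp n e)) else 0) \<partial>vol n)"
 using G
proof (induction n arbitrary: G)
 case 0
 then show ?case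
 by (simp add: lborels.nn_integral_empty PiM_empty nn_integral_count_space_finite unordered_def vdm_def nreal_def)
next
 case (Suc n)
 note G[measurable] = Suc.prems
 let ?P = "PiM {..<n} (%_. lborel :: real measure)"
 let ?r = "%x j. complex_of_real (x j)"
 have ur: "unordered m (?r x) = unordered m (\<lambda>j\<in>{..<m}. ?r x j)" and vr: "vdm m (?r x) = vdm m (\<lambda>j\<in>{..<m}. ?r x j)" for m x
 by (rule unordered_cong vdm_cong; simp)+
 have uS: "unordered (Suc n) (?r (x(n := y))) = add_mset (of_real y) (unordered n (?r x))" for x y
 using unordered_cong[of n "?r (x(n := y))" "?r x"] by (simp add: unordered_Suc)
 have vS: "vdm (Suc n) (?r (x(n := y))) = vdm n (?r x) * (\<Prod>z\<in>#unordered n (?r x). norm (of_real y - z))" for x y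
 unfolding prod_mset_unordered vdm_def by simp
 define G' where "G' y X = (if \<forall>z\<in>#X. Re z < y then G (add_mset (of_real y) X) else 0) * ennreal (\<Prod>z\<in>#X. norm (of_real y - z))" for y X
 have G': "G' y \<in> borel_measurable (unordered_borel n)" for y
 proof (rule measurable_from_unordered_borel)
 have [measurable]: "(%z. unordered (Suc n) (z(n := of_real y))) \<in> ctuples n \<rightarrow>\<^sub>M unordered_borel (Suc n)" by measurable
 have eq: "unordered (Suc n) (z(n := of_real y)) = add_mset (of_real y) (unordered n z)" for z
 using unordered_cong[of n "z(n := of_real y)" z] by (simp add: unordered_Suc)
 have [measurable]: "(%z. G (add_mset (of_real y) (unordered n z))) \<in> borel_measurable (ctuples n)"
 unfolding eq[symmetric] by measurable
 have [measurable]: "Measurable.pred (ctuples n) (%z. \<forall>x\<in>z ` {..<n}. Re x < y)"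
 proof -
 have eq: "(\<forall>x\<in>z ` {..<n}. Re x < y) \<longleftrightarrow> (\<forall>j\<in>{..<n}. Re (z j) < y)" for z by blast
 show ?thesis unfolding eq
 proof (rule pred_intros_finite)
  fix j assume "j \<in> {..<n}"
  then show "Measurable.pred (ctuples n) (%z. Re (z j) < y)" by measurable
 qed simp
 qed
 show "(%z. G' y (unordered n z)) \<in> borel_measurable (ctuples n)"
 unfolding G'_def prod_mset_unordered set_mset_unordered by measurable
 qed simp
 have mL: "(%x. if increasing_upto (Suc n) x then G (unordered (Suc n) (?r x)) * ennreal (vdm (Suc n) (?r x)) else 0)
 \<in> borel_measurable (vol (Suc n))"
 proof -
 note [measurable] = measurable_of_real_tuple[of "Suc n"] pred_increasing_upto[of "Suc n"]
 show ?thesis unfolding ur vr measurable_PiM_lborel1 by measurable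
 qed
 have "(\<integral>\<^sup>+x. (if increasing_upto (Suc n) x then G (unordered (Suc n) (?r x)) * ennreal (vdm (Suc n) (?r x)) else 0) \<partial>vol (Suc n)) =
 (\<integral>\<^sup>+y. \<integral>\<^sup>+x. (if increasing_upto (Suc n) (x(n := y)) then G (unordered (Suc n) (?r (x(n := y)))) * ennreal (vdm (Suc n) (?r (x(n := y)))) else 0) \<partial>?P \<partial>lborel)"
 by (rule nn_integral_PiM_Suc_rev[OF mL])
 also have "... = (\<integral>\<^sup>+y. \<integral>\<^sup>+x. (if increasing_upto n x then G' y (unordered n (?r x)) * ennreal (vdm n (?r x)) else 0) \<partial>?P \<partial>lborel)"
 proof (intro nn_integral_cong)
 fix x y
 have c: "(\<forall>z\<in>#unordered n (?r x). Re z < y) \<longleftrightarrow> (ALL j<n. x j < y)"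
 unfolding set_mset_unordered by auto
 have nn: "0 <= (\<Prod>z\<in>#unordered n (?r x). norm (of_real y - z))"
 unfolding prod_mset_unordered by (simp add: prod_nonneg)
 have if_lem: "(if A & B then g * (v * p) else 0) = (if A then (if B then g else 0) * p * v else 0)" for A B and g v p :: ennreal
 by (simp add: mult_ac)
 show "(if increasing_upto (Suc n) (x(n := y)) then G (unordered (Suc n) (?r (x(n := y)))) * ennreal (vdm (Suc n) (?r (x(n := y)))) else 0) =
 (if increasing_upto n x then G' y (unordered n (?r x)) * ennreal (vdm n (?r x)) else 0)"
 unfolding increasing_upto_Suc uS vS G'_def c ennreal_mult''[OF nn] by (rule if_lem)
 qed
 also have "... = (\<integral>\<^sup>+y. \<integral>\<^sup>+q. (if nreal (proots (rp n q)) = n then G' y (proots (rp n q)) else 0) \<partial>?P \<partial>lborel)"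
 by (intro nn_integral_cong Suc.IH G')
 also have "... = (\<integral>\<^sup>+y. \<integral>\<^sup>+q. (if nreal (proots (rp n q)) = n & (\<forall>z\<in>#proots (rp n q). Re z < y) then G (add_mset (of_real y) (proots (rp n q))) else 0)
 * ennreal \<bar>poly (cp n q) y\<bar> \<partial>?P \<partial>lborel)"
 proof (intro nn_integral_cong)
 fix y q
 have "(\<Prod>z\<in>#proots (rp n q). norm (of_real y - z)) = \<bar>poly (cp n q) y\<bar>"
 unfolding norm_prod_mset[symmetric] poly_rp_eq_prod[symmetric] poly_rp_of_real by simp
 then show "(if nreal (proots (rp n q)) = n then G' y (proots (rp n q)) else 0) =
 (if nreal (proots (rp n q)) = n & (\<forall>z\<in>#proots (rp n q). Re z < y) then G (add_mset (of_real y) (proots (rp n q))) else 0) * ennreal \<bar>poly (cp n q) y\<bar>"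
 unfolding G'_def by simp
 qed
 also have "... = (\<integral>\<^sup>+p. \<integral>\<^sup>+z. (\<Sum>w | poly (pCons z (cp n p)) w = 0.
 (if nreal (proots (rp n (horner n w p))) = n & (\<forall>z\<in>#proots (rp n (horner n w p)). Re z < w) then G (add_mset (of_real w) (proots (rp n (horner n w p)))) else 0))
 \<partial>lborel \<partial>?P)"
 proof (rule add_root_real)
 let ?N = "borel \<Otimes>\<^sub>M PiM {..<n} (%_. borel :: real measure)"
 have snd: "snd \<in> ?N \<rightarrow>\<^sub>M tuples n" by (rule measurable_snd)
 have comp: "(%x. snd x j) \<in> borel_measurable ?N" if "j < n" for j
 by (rule meas_o[OF snd measurable_component_singleton]) (use that in simp)
 have a: "(%x. add_mset (complex_of_real (fst x)) (proots (rp n (snd x)))) \<in> ?N \<rightarrow>\<^sub>M unordered_borel (Suc n)"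
 by (rule measurable_add_mset_proots) (auto intro!: measurable_coeff_rp comp borel_measurable_of_real)
 have b: "(%x. proots (rp n (snd x))) \<in> ?N \<rightarrow>\<^sub>M unordered_borel n"
 by (rule meas_o[OF snd measurable_proots_rp])
 have c: "Measurable.pred ?N (%x. \<forall>z\<in>#proots (rp n (snd x)). Re z < fst x)"
 by (rule pred_Ball_mset[OF b measurable_fst]) measurable
 note [measurable] = a b c meas_o[OF a G]
 show "(%(y, q). if nreal (proots (rp n q)) = n & (\<forall>z\<in>#proots (rp n q). Re z < y) then G (add_mset (of_real y) (proots (rp n q))) else 0)
 \<in> borel_measurable ?N"
 unfolding case_prod_unfold by measurable
 qed
 also have "... = (\<integral>\<^sup>+p. \<integral>\<^sup>+z. (if nreal (proots (rp (Suc n) (p(n := z)))) = Suc n then G (proots (rp (Suc n) (p(n := z)))) else 0) \<partial>lborel \<partial>?P)"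
 proof (rule nn_integral_cong, rule nn_integral_cong_AE)
 fix p :: "nat => real"
 show "AE z in lborel. (\<Sum>w | poly (pCons z (cp n p)) w = 0.
 (if nreal (proots (rp n (horner n w p))) = n & (\<forall>z\<in>#proots (rp n (horner n w p)). Re z < w) then G (add_mset (of_real w) (proots (rp n (horner n w p)))) else 0))
 = (if nreal (proots (rp (Suc n) (p(n := z)))) = Suc n then G (proots (rp (Suc n) (p(n := z)))) else 0)"
 using AE_simple_roots_of_real[OF rp_nonzero[of n p]]
 proof eventually_elim
 case (elim z)
 define Q where "Q = rp (Suc n) (p(n := z))"
 define T where "T = {w. poly Q w = 0}"
 define S where "S = {w. poly (pCons z (cp n p)) w = 0}"
 define h where "h w = (if nreal (proots (rp n (horner n w p))) = n & (\<forall>z\<in>#proots (rp n (horner n w p)). Re z < w) then G (add_mset (of_real w) (proots (rp n (horner n w p)))) else 0)" for w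
 have Q: "Q = pCons (of_real z) (rp n p)"
  unfolding Q_def using rp_cong[of n "p(n := z)" p] by simp
 have Qnz: "Q ~= 0" unfolding Q_def by (rule rp_nonzero)
 have R: "proots Q = mset_set T" and cT: "card T = Suc n"
  unfolding T_def using card_simple_roots[OF Qnz] elim unfolding Q[symmetric] by (auto simp: Q_def simp del: rp_simps)
 have fT: "finite T" unfolding T_def using Qnz by (rule poly_roots_finite)
 have S_iff: "w \<in> S \<longleftrightarrow> of_real w \<in> T" for w
 proof -
  have "poly Q (of_real w) = of_real (poly (cp (Suc n) (p(n := z))) w)"
  unfolding Q_def by (rule poly_rp_of_real)
  then have "poly Q (of_real w) = 0 \<longleftrightarrow> poly (cp (Suc n) (p(n := z))) w = 0"
  by (simp only: of_real_eq_0_iff)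
  then show ?thesis unfolding S_def T_def mem_Collect_eq cp.simps cp_upd fun_upd_same by (rule sym)
 qed
 have fac: "proots Q = add_mset (of_real w) (proots (rp n (horner n w p)))" if "w \<in> S" for w
 proof -
  have "poly (cp (Suc n) (p(n := z))) w = 0" using that unfolding S_def by (simp add: cp_upd)
  from rp_real_root_factor[OF this] have "Q = [:- of_real w, 1:] * rp n (horner n w p)"
  unfolding Q_def horner_upd .
  then show ?thesis by (simp add: proots_mult del: mult_pCons_left)
 qed
 have rest: "proots (rp n (horner n w p)) = mset_set (T - {of_real w})" if "w \<in> S" for w
 proof -
  have "mset_set T = add_mset (of_real w) (mset_set (T - {of_real w}))"
  using fT that S_iff by (intro mset_set.remove) auto
  then show ?thesis using fac[OF that] R by simp
 qed
 have "(\<Sum>w\<in>S. h w) = (if nreal (proots Q) = Suc n then G (proots Q) else 0)"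
 proof (cases "nreal (proots Q) = Suc n")
  case True
  have "size (proots Q) = Suc n" unfolding R using cT by simp
  then have im: "Im z = 0" if "z \<in> T" for z
  using True nreal_eq_size_iff[of "proots Q"] that fT unfolding R by simp
  have "h w = (if \<forall>z\<in>T - {of_real w}. lex_less z (of_real w) then G (proots Q) else 0)" if "w \<in> S" for w
  proof -
  have "size (mset_set (T - {of_real w})) = n"
  using cT fT that S_iff by simp
  then have nr: "nreal (mset_set (T - {of_real w})) = n"
  using nreal_eq_size_iff[of "mset_set (T - {of_real w})"] im fT by simp
  have lx: "(\<forall>z\<in>T - {of_real w}. Re z < w) \<longleftrightarrow> (\<forall>z\<in>T - {of_real w}. lex_less z (of_real w))"
  using im by (auto simp: lex_less_def)
  have fr: "add_mset (of_real w) (mset_set (T - {of_real w})) = proots Q"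
  unfolding fac[OF that] rest[OF that] ..
  have fin: "finite (T - {of_real w})" using fT by simp
  show ?thesis
  unfolding h_def rest[OF that] fr finite_set_mset_mset_set[OF fin] nr lx by (simp only: simp_thms)
  qed
  then have "(\<Sum>w\<in>S. h w) = (\<Sum>w\<in>S. (%v. if \<forall>z\<in>T - {v}. lex_less z v then G (proots Q) else 0) (of_real w))"
  by (intro sum.cong refl) simp
  also have "... = (\<Sum>v\<in>T. if \<forall>z\<in>T - {v}. lex_less z v then G (proots Q) else 0)"
  proof (rule sum.reindex_bij_betw)
  have "of_real ` S = T"
  proof
  show "T \<subseteq> of_real ` S"
  proof
  fix v assume v: "v \<in> T"
  then have "v = of_real (Re v)" using im by (simp add: complex_eq_iff)
  then show "v \<in> of_real ` S" using v S_iff by (metis image_eqI)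
  qed
  qed (use S_iff in auto)
  then show "bij_betw of_real S T" by (auto simp: bij_betw_def inj_on_def)
  qed
  also have "... = G (proots Q)"
  by (rule sum_lex_max[OF fT]) (use cT in auto)
  finally show ?thesis using True by simp
 next
  case False
  have "h w = 0" if "w \<in> S" for w
  proof -
  have "nreal (proots Q) = Suc (nreal (proots (rp n (horner n w p))))"
  unfolding fac[OF that] by (simp add: nreal_def)
  then show ?thesis using False unfolding h_def by simp
  qed
  then show ?thesis using False by simp
 qed
 then show ?case unfolding h_def S_def Q_def .
 qed
 qed
 also have "... = (\<integral>\<^sup>+e. (if nreal (proots (rp (Suc n) e)) = Suc n then G (proots (rp (Suc n) e)) else 0) \<partial>vol (Suc n))"
 proof (rule nn_integral_PiM_Suc[symmetric])
 note [measurable] = meas_o[OF measurable_proots_rp G] meas_o[OF measurable_proots_rp[of "Suc n"] measurable_nreal]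
 show "(%e. if nreal (proots (rp (Suc n) e)) = Suc n then G (proots (rp (Suc n) e)) else 0) \<in> borel_measurable (vol (Suc n))"
 unfolding measurable_PiM_lborel1 by measurable
 qed
 finally show ?case .
qed

section \<open>Real polynomials with conjugate pairs of roots\<close>

text \<open>The recursion satisfied by the coefficients of the quotient in the division by \<open>x\<^sup>2 - s x + t\<close>, preceded by 0 and 1.\<close>
fun qd :: "'a::comm_ring_1 => 'a => (nat => 'a) => nat => 'a" where
 "qd s t p 0 = 0"
| "qd s t p (Suc 0) = 1"
| "qd s t p (Suc (Suc j)) = p j + s * qd s t p (Suc j) - t * qd s t p j"

lemma qd_cong: "(!!i. Suc i < j ==> p i = p' i) ==> qd s t p j = qd s t p' j"
 by (induction j rule: induct_nat_012) simp_all

lemma quadratic_division: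
 "pCons p1 (pCons p0 (cp n p)) = [:t, - s, 1:] * cp n (%j. qd s t p (Suc (Suc j)))
 + [:p1 - t * qd s t p (Suc n), p0 + s * qd s t p (Suc n) - t * qd s t p n:]"
proof (induction n arbitrary: p0 p1)
 case 0
 show ?case by (simp add: one_pCons)
next
 case (Suc n)
 define Q where "Q = cp n (%j. qd s t p (Suc (Suc j)))"
 define r where "r = qd s t p (Suc (Suc n))"
 have "pCons p1 (pCons p0 (cp (Suc n) p)) = pCons p1 ([:t, - s, 1:] * Q + [:p0 - t * qd s t p (Suc n), r:])"
 using Suc[of p0 "p n"] by (simp add: Q_def r_def)
 also have "... = [:p1, p0 - t * qd s t p (Suc n), r:] + pCons 0 ([:t, - s, 1:] * Q)"
 by (simp only: add_pCons add_0_right add_0 add.commute)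
 also have "[:p1, p0 - t * qd s t p (Suc n), r:] =
 Polynomial.smult r [:t, - s, 1:] + [:p1 - t * r, p0 + s * r - t * qd s t p (Suc n):]"
 by (simp add: mult.commute)
 also have "... + pCons 0 ([:t, - s, 1:] * Q) = [:t, - s, 1:] * pCons r Q + [:p1 - t * r, p0 + s * r - t * qd s t p (Suc n):]"
 unfolding mult_pCons_right by (simp only: add_ac)
 also have "pCons r Q = cp (Suc n) (%j. qd s t p (Suc (Suc j)))"
 by (simp only: cp.simps Q_def r_def)
 finally show ?case unfolding r_def .
qed

lemma of_real_qd: "complex_of_real (qd s t p j) = qd (of_real s) (of_real t) (%i. of_real (p i)) j"
 by (induction j rule: induct_nat_012) simp_all

definition quadq :: "nat => complex => (nat => real) => nat => real" where
 "quadq n w p = (\<lambda>j\<in>{..<n}. qd (2 * Re w) ((norm w)\<^sup>2) p (Suc (Suc j)))"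

lemma pair_factor:
 assumes w: "Im w > 0" and root: "poly (pCons (of_real t1) (pCons (of_real t0) (rp n p))) w = 0"
 shows "pCons (of_real t1) (pCons (of_real t0) (rp n p)) = [:- w, 1:] * ([:- cnj w, 1:] * rp n (quadq n w p))"
proof -
 let ?s = "2 * Re w" and ?t = "(norm w)\<^sup>2"
 have q: "rp n (quadq n w p) = cp n (%j. qd (of_real ?s) (of_real ?t) (%i. complex_of_real (p i)) (Suc (Suc j)))"
 unfolding rp_def by (rule cp_cong) (simp only: quadq_def restrict_apply lessThan_iff if_True of_real_qd)
 have quad: "[:- w, 1:] * [:- cnj w, 1:] = [:complex_of_real ?t, - of_real ?s, 1:]"
 using complex_norm_square[of w] complex_add_cnj[of w] by (simp add: algebra_simps)
 define r1 where "r1 = t1 - ?t * qd ?s ?t p (Suc n)"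
 define r0 where "r0 = t0 + ?s * qd ?s ?t p (Suc n) - ?t * qd ?s ?t p n"
 have div: "pCons (of_real t1) (pCons (of_real t0) (rp n p)) = ([:- w, 1:] * [:- cnj w, 1:]) * rp n (quadq n w p) + [:of_real r1, of_real r0:]"
 unfolding quad q r0_def r1_def of_real_diff of_real_add of_real_mult of_real_qd
 unfolding rp_def by (rule quadratic_division)
 have "of_real r1 + w * of_real r0 = 0"
 proof -
 have "poly ([:- w, 1:] * [:- cnj w, 1:] * rp n (quadq n w p)) w = 0"
 unfolding poly_mult by simp
 then show ?thesis using root unfolding div poly_add by simp
 qed
 then have "Re (of_real r1 + w * of_real r0) = 0" "Im (of_real r1 + w * of_real r0) = 0" by simp_all
 then have "r1 + Re w * r0 = 0" "Im w * r0 = 0" by simp_all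
 then have "r0 = 0" "r1 = 0" using w by auto
 then show ?thesis unfolding div by (simp only: of_real_0 pCons_0_0 add_0_right mult.assoc)
qed

lemma measurable_qd:
 assumes s: "s \<in> borel_measurable N" and t: "t \<in> borel_measurable N"
 and f: "!!i. Suc i < j ==> (%x. f x i) \<in> borel_measurable N"
 shows "(%x. qd (s x) (t x) (f x) j :: real) \<in> borel_measurable N"
 using f
proof (induction j rule: induct_nat_012)
 case (ge2 j)
 have "(%x. f x j) \<in> borel_measurable N" by (rule ge2.prems) simp
 moreover have "(%x. qd (s x) (t x) (f x) (Suc j)) \<in> borel_measurable N" by (rule ge2.IH(2)) (rule ge2.prems, simp)
 moreover have "(%x. qd (s x) (t x) (f x) j) \<in> borel_measurable N" by (rule ge2.IH(1)) (rule ge2.prems, simp)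
 ultimately show ?case using s t by simp
qed simp_all

lemma measurable_quadq_pair:
 "(%x. quadq n (fst x) (snd x)) \<in> borel \<Otimes>\<^sub>M tuples n \<rightarrow>\<^sub>M tuples n"
 unfolding quadq_def
proof (rule measurable_restrict)
 fix j assume j: "j \<in> {..<n}"
 show "(%x. qd (2 * Re (fst x)) ((norm (fst x))\<^sup>2) (snd x) (Suc (Suc j))) \<in> borel_measurable ((borel :: complex measure) \<Otimes>\<^sub>M tuples n)"
 proof (rule measurable_qd)
 fix i assume "Suc i < Suc (Suc j)"
 then show "(%x. snd x i) \<in> borel_measurable ((borel :: complex measure) \<Otimes>\<^sub>M tuples n)"
 by (intro meas_o[OF measurable_snd measurable_component_singleton]) (use j in auto)
 qed measurable
qed

text \<open>As for \<open>nn_integral_horner\<close>, the map is a triangular shift.\<close>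
lemma nn_integral_quadq:
 assumes h: "h \<in> borel_measurable (vol n)"
 shows "(\<integral>\<^sup>+p. h (quadq n w p) \<partial>vol n) = (\<integral>\<^sup>+p. h p \<partial>vol n)" (is "?lhs = ?rhs")
proof -
 let ?s = "2 * Re w" and ?t = "(norm w)\<^sup>2"
 define b where "b j x = ?s * qd ?s ?t x (Suc j) - ?t * qd ?s ?t x j" for j and x :: "nat => real"
 have "quadq n w p = (\<lambda>j\<in>{..<n}. p j + b j (restrict p {..<j}))" for p
 unfolding quadq_def
 proof (rule restrict_ext)
 fix j
 have "qd ?s ?t (restrict p {..<j}) j = qd ?s ?t p j" "qd ?s ?t (restrict p {..<j}) (Suc j) = qd ?s ?t p (Suc j)"
 by (rule qd_cong; simp)+
 then show "qd ?s ?t p (Suc (Suc j)) = p j + b j (restrict p {..<j})" by (simp add: b_def)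
 qed
 then have "?lhs =
 (\<integral>\<^sup>+p. h (\<lambda>j\<in>{..<n}. p j + b j (restrict p {..<j})) \<partial>vol n)"
 by simp
 also have "... = (\<integral>\<^sup>+p. h p \<partial>vol n)"
 proof (rule nn_integral_triangular_shift[OF _ h])
 fix j assume "j < n"
 have "(%x. qd ?s ?t x (Suc j)) \<in> borel_measurable (tuples j)"
 "(%x. qd ?s ?t x j) \<in> borel_measurable (tuples j)"
 by (rule measurable_qd; auto)+
 then show "b j \<in> borel_measurable (vol j)"
 unfolding b_def measurable_PiM_lborel1 by measurable
 qed
 finally show ?thesis .
qed

lemma measurable_poly_rp:
 assumes "!!j. j < n ==> (%x. f x j) \<in> borel_measurable N" "g \<in> borel_measurable N"
 shows "(%x. poly (rp n (f x)) (g x)) \<in> borel_measurable N"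
 unfolding rp_def by (rule poly_cp_measurable) (use assms in "auto intro: borel_measurable_of_real")

text \<open>For fixed quotient, the two lowest coefficients are the linear remainder as a function of the root \<open>w\<close>. The area formula for \<open>pair_remainder\<close> supplies the Jacobian; the derivative of the product at \<open>w\<close> is \<open>w - cnj w\<close> times the quotient at \<open>w\<close>, whence the factor \<open>4 Im w\<close>.\<close>
lemma add_conjugate_pair:
 fixes g :: "complex => (nat => real) => ennreal"
 assumes g: "case_prod g \<in> borel_measurable (borel \<Otimes>\<^sub>M tuples n)"
 shows "(\<integral>\<^sup>+w. (\<integral>\<^sup>+q. g w q * ennreal (4 * Im w * (norm (poly (rp n q) w))\<^sup>2) \<partial>vol n) * indicator {w. Im w > 0} w \<partial>lborel) =
 (\<integral>\<^sup>+p. \<integral>\<^sup>+z. (\<Sum>w | Im w > 0 & poly (pCons (of_real (Im z)) (pCons (of_real (Re z)) (rp n p))) w = 0. g w (quadq n w p)) \<partial>lborel \<partial>vol n)"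
proof -
 let ?N = "(borel :: complex measure) \<Otimes>\<^sub>M PiM {..<n} (%_. borel :: real measure)"
 let ?P = "PiM {..<n} (%_. lborel :: real measure)"
 have H[measurable]: "{w. Im w > 0} \<in> sets borel" by (intro borel_open open_halfspace_Im_gt)
 have gw: "g w \<in> borel_measurable (tuples n)" for w
 using meas_o[OF measurable_Pair1' g, of w] by simp
 have pw: "(%q. poly (rp n q) w) \<in> borel_measurable (tuples n)" for w
 by (rule measurable_poly_rp) auto
 have gm: "(%x. g (fst x) (quadq n (fst x) (snd x))) \<in> borel_measurable ?N"
 using meas_o[OF measurable_Pair[OF measurable_fst measurable_quadq_pair] g] by simp
 have pm: "(%x. poly (rp n (quadq n (fst x) (snd x))) (fst x)) \<in> borel_measurable ?N"
 by (rule measurable_poly_rp) (auto intro!: meas_o[OF measurable_quadq_pair measurable_component_singleton])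
 have "(\<integral>\<^sup>+w. (\<integral>\<^sup>+q. g w q * ennreal (4 * Im w * (norm (poly (rp n q) w))\<^sup>2) \<partial>?P) * indicator {w. Im w > 0} w \<partial>lborel) =
 (\<integral>\<^sup>+w. \<integral>\<^sup>+p. g w (quadq n w p) * ennreal (4 * Im w * (norm (poly (rp n (quadq n w p)) w))\<^sup>2) * indicator {w. Im w > 0} w \<partial>?P \<partial>lborel)"
 proof (rule nn_integral_cong)
 fix w
 note [measurable] = gw[of w] pw[of w]
 have m: "(%q. g w q * ennreal (4 * Im w * (norm (poly (rp n q) w))\<^sup>2)) \<in> borel_measurable ?P"
 unfolding measurable_PiM_lborel1 by measurable
 have "(\<integral>\<^sup>+q. g w q * ennreal (4 * Im w * (norm (poly (rp n q) w))\<^sup>2) \<partial>?P) * indicator {w. Im w > 0} w =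
 (\<integral>\<^sup>+q. g w q * ennreal (4 * Im w * (norm (poly (rp n q) w))\<^sup>2) * indicator {w. Im w > 0} w \<partial>?P)"
 by (rule nn_integral_multc[OF m, symmetric])
 also have "... = (\<integral>\<^sup>+p. g w (quadq n w p) * ennreal (4 * Im w * (norm (poly (rp n (quadq n w p)) w))\<^sup>2) * indicator {w. Im w > 0} w \<partial>?P)"
 using m by (intro nn_integral_quadq[symmetric]) measurable
 finally show "(\<integral>\<^sup>+q. g w q * ennreal (4 * Im w * (norm (poly (rp n q) w))\<^sup>2) \<partial>?P) * indicator {w. Im w > 0} w =
 (\<integral>\<^sup>+p. g w (quadq n w p) * ennreal (4 * Im w * (norm (poly (rp n (quadq n w p)) w))\<^sup>2) * indicator {w. Im w > 0} w \<partial>?P)" .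
 qed
 also have "... = (\<integral>\<^sup>+p. \<integral>\<^sup>+w. g w (quadq n w p) * ennreal (4 * Im w * (norm (poly (rp n (quadq n w p)) w))\<^sup>2) * indicator {w. Im w > 0} w \<partial>lborel \<partial>?P)"
 proof (rule nn_integral_lborel_PiM_Fubini)
 note [measurable] = gm pm
 show "(%(w, p). g w (quadq n w p) * ennreal (4 * Im w * (norm (poly (rp n (quadq n w p)) w))\<^sup>2) * indicator {w. Im w > 0} w) \<in> borel_measurable ?N"
 unfolding case_prod_unfold by measurable
 qed
 also have "... = (\<integral>\<^sup>+p. \<integral>\<^sup>+z. (\<Sum>w | Im w > 0 & poly (pCons (of_real (Im z)) (pCons (of_real (Re z)) (rp n p))) w = 0. g w (quadq n w p)) \<partial>lborel \<partial>?P)"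
 proof (rule nn_integral_cong)
 fix p :: "nat => real" assume "p \<in> space ?P"
 then have p: "p \<in> space (tuples n)" by (simp add: space_PiM)
 define W where "W = pCons 0 (pCons 0 (rp n p))"
 have dW: "degree W \<ge> 2" unfolding W_def by simp
 have Wz: "W + [:of_real (Im z), of_real (Re z):] = pCons (of_real (Im z)) (pCons (of_real (Re z)) (rp n p))" for z
 by (simp add: W_def)
 have "(%w. (w, p)) \<in> borel \<rightarrow>\<^sub>M ?N" using p by (intro measurable_Pair measurable_const) auto
 from meas_o[OF this gm] have gp: "(%w. g w (quadq n w p)) \<in> borel_measurable borel" by simp
 have "(\<integral>\<^sup>+w. g w (quadq n w p) * ennreal (4 * Im w * (norm (poly (rp n (quadq n w p)) w))\<^sup>2) * indicator {w. Im w > 0} w \<partial>lborel) =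
 (\<integral>\<^sup>+w. g w (quadq n w p) * ennreal ((norm (poly (pderiv W) w + of_real (Re (pair_remainder W w))))\<^sup>2 / Im w) * indicator {w. Im w > 0} w \<partial>lborel)"
 proof (rule nn_integral_cong)
 fix w :: complex
 show "g w (quadq n w p) * ennreal (4 * Im w * (norm (poly (rp n (quadq n w p)) w))\<^sup>2) * indicator {w. Im w > 0} w =
  g w (quadq n w p) * ennreal ((norm (poly (pderiv W) w + of_real (Re (pair_remainder W w))))\<^sup>2 / Im w) * indicator {w. Im w > 0} w"
 proof (cases "Im w > 0")
  case w: True
  define z where "z = pair_remainder W w"
  have root: "poly (pCons (of_real (Im z)) (pCons (of_real (Re z)) (rp n p))) w = 0"
  using pair_remainder_iff[OF w, of W z] unfolding Wz z_def by blast
  have pd1: "pderiv (W + [:of_real (Im z), of_real (Re z):]) = pderiv W + [:of_real (Re z):]"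
  by (simp add: pderiv_add pderiv_pCons)
  have "poly (pderiv W) w + of_real (Re z) = poly (pderiv (W + [:of_real (Im z), of_real (Re z):])) w"
  unfolding pd1 by simp
  also have "... = poly (pderiv ([:- w, 1:] * ([:- cnj w, 1:] * rp n (quadq n w p)))) w"
  unfolding Wz pair_factor[OF w root] ..
  also have "... = (w - cnj w) * poly (rp n (quadq n w p)) w"
  by (simp add: pderiv_mult pderiv_pCons del: mult_pCons_left)
  also have "w - cnj w = 2 * \<i> * of_real (Im w)" by (simp add: complex_eq_iff)
  finally have "(norm (poly (pderiv W) w + of_real (Re z)))\<^sup>2 / Im w = 4 * Im w * (norm (poly (rp n (quadq n w p)) w))\<^sup>2"
  using w by (simp add: norm_mult power_mult_distrib power2_eq_square)
  then show ?thesis unfolding z_def by simp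
 qed simp
 qed
 also have "... = (\<integral>\<^sup>+z. (\<Sum>w | Im w > 0 & poly (W + [:of_real (Im z), of_real (Re z):]) w = 0. g w (quadq n w p)) \<partial>lborel)"
 by (rule area_formula_pair_remainder[OF dW gp])
 finally show "(\<integral>\<^sup>+w. g w (quadq n w p) * ennreal (4 * Im w * (norm (poly (rp n (quadq n w p)) w))\<^sup>2) * indicator {w. Im w > 0} w \<partial>lborel) =
 (\<integral>\<^sup>+z. (\<Sum>w | Im w > 0 & poly (pCons (of_real (Im z)) (pCons (of_real (Re z)) (rp n p))) w = 0. g w (quadq n w p)) \<partial>lborel)"
 unfolding Wz .
 qed
 finally show ?thesis .
qed

text \<open>Upper roots are ordered lexicographically instead of strictly by real part. The two conditions differ on a null set only, and the lexicographic order is the one that survives adding a root.\<close>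
definition pair_chain :: "nat => nat => (nat => real) => (nat => real) => bool" where
 "pair_chain L M x y \<longleftrightarrow> increasing_upto L x & (\<forall>i\<in>{L..<L+M}. 0 < y i) &
 (\<forall>i\<in>{L..<L+M}. \<forall>j\<in>{L..<L+M}. i < j --> lex_less (Complex (x i) (y i)) (Complex (x j) (y j)))"

lemma pair_chain_Suc:
 "pair_chain L (Suc M) (x(L+M := a)) (y(L+M := b)) \<longleftrightarrow>
 pair_chain L M x y & 0 < b & (\<forall>i\<in>{L..<L+M}. lex_less (Complex (x i) (y i)) (Complex a b))"
 (is "?l \<longleftrightarrow> ?r")
proof -
 have S: "{L..<L + Suc M} = insert (L+M) {L..<L+M}" by auto
 have 1: "increasing_upto L (x(L+M := a)) \<longleftrightarrow> increasing_upto L x"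
 by auto
 have 2: "(\<forall>i\<in>{L..<L + Suc M}. 0 < (y(L+M := b)) i) \<longleftrightarrow> 0 < b & (\<forall>i\<in>{L..<L+M}. 0 < y i)"
 unfolding S by auto
 have 3: "(\<forall>i\<in>{L..<L + Suc M}. \<forall>j\<in>{L..<L + Suc M}. i < j --> lex_less (Complex ((x(L+M := a)) i) ((y(L+M := b)) i)) (Complex ((x(L+M := a)) j) ((y(L+M := b)) j)))
 \<longleftrightarrow> (\<forall>i\<in>{L..<L+M}. \<forall>j\<in>{L..<L+M}. i < j --> lex_less (Complex (x i) (y i)) (Complex (x j) (y j)))
 & (\<forall>i\<in>{L..<L+M}. lex_less (Complex (x i) (y i)) (Complex a b))"
 unfolding S by auto
 show ?thesis unfolding pair_chain_def 1 2 3 by blast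
qed

lemma conj_tuple_Suc:
 "j < L + 2 * M ==> conj_tuple L (Suc M) (x(L+M := a)) (y(L+M := b)) j = conj_tuple L M x y j"
 "conj_tuple L (Suc M) (x(L+M := a)) (y(L+M := b)) (L + 2 * M) = Complex a b"
 "conj_tuple L (Suc M) (x(L+M := a)) (y(L+M := b)) (Suc (L + 2 * M)) = Complex a (- b)"
proof -
 assume j: "j < L + 2 * M"
 show "conj_tuple L (Suc M) (x(L+M := a)) (y(L+M := b)) j = conj_tuple L M x y j"
 proof (cases "j < L")
 case False
 then have "(j - L) div 2 < M" using j by auto
 then show ?thesis using j False by (simp add: conj_tuple_def Let_def)
 qed (use j in "simp add: conj_tuple_def")
next
 show "conj_tuple L (Suc M) (x(L+M := a)) (y(L+M := b)) (L + 2 * M) = Complex a b"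
 by (simp add: conj_tuple_def Let_def)
 have "Suc (L + 2 * M) - L = Suc (2 * M)" by simp
 then show "conj_tuple L (Suc M) (x(L+M := a)) (y(L+M := b)) (Suc (L + 2 * M)) = Complex a (- b)"
 by (simp add: conj_tuple_def Let_def)
qed

lemma unordered_conj_tuple_Suc:
 "unordered (L + 2 * Suc M) (conj_tuple L (Suc M) (x(L+M := a)) (y(L+M := b))) =
 add_mset (Complex a b) (add_mset (cnj (Complex a b)) (unordered (L + 2 * M) (conj_tuple L M x y)))"
proof -
 have "L + 2 * Suc M = Suc (Suc (L + 2 * M))" by simp
 moreover have "unordered (L + 2 * M) (conj_tuple L (Suc M) (x(L+M := a)) (y(L+M := b))) = unordered (L + 2 * M) (conj_tuple L M x y)"
 by (rule unordered_cong) (rule conj_tuple_Suc)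
 moreover have "cnj (Complex a b) = Complex a (- b)" by (simp add: complex_eq_iff)
 ultimately show ?thesis by (simp only: unordered_Suc conj_tuple_Suc add_mset_commute)
qed

lemma vdm_conj_tuple_Suc:
 assumes "b > 0"
 shows "vdm (L + 2 * Suc M) (conj_tuple L (Suc M) (x(L+M := a)) (y(L+M := b))) =
 vdm (L + 2 * M) (conj_tuple L M x y) *
 (2 * b * (\<Prod>z\<in>#unordered (L + 2 * M) (conj_tuple L M x y). norm (Complex a b - z) * norm (cnj (Complex a b) - z)))"
proof -
 define n where "n = L + 2 * M"
 define z where "z = conj_tuple L (Suc M) (x(L+M := a)) (y(L+M := b))"
 define z' where "z' = conj_tuple L M x y"
 have zj: "z j = z' j" if "j < n" for j using that unfolding z_def z'_def n_def by (rule conj_tuple_Suc)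
 have zn: "z n = Complex a b" "z (Suc n) = Complex a (- b)" unfolding z_def n_def by (rule conj_tuple_Suc)+
 have c: "cnj (Complex a b) = Complex a (- b)" by (simp add: complex_eq_iff)
 have "vdm (Suc (Suc n)) z = vdm n z * (\<Prod>j<n. norm (z n - z j)) * ((\<Prod>j<n. norm (z (Suc n) - z j)) * norm (z (Suc n) - z n))"
 unfolding vdm_def by simp
 also have "vdm n z = vdm n z'" by (rule vdm_cong) (rule zj)
 also have "(\<Prod>j<n. norm (z n - z j)) = (\<Prod>j<n. norm (Complex a b - z' j))" unfolding zn by (intro prod.cong refl) (simp add: zj)
 also have "(\<Prod>j<n. norm (z (Suc n) - z j)) = (\<Prod>j<n. norm (cnj (Complex a b) - z' j))" unfolding zn c by (intro prod.cong refl) (simp add: zj)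
 also have "norm (z (Suc n) - z n) = 2 * b"
 proof -
 have "z (Suc n) - z n = of_real (- 2 * b) * \<i>" unfolding zn by (simp add: complex_eq_iff)
 then show ?thesis using assms by (simp add: norm_mult)
 qed
 finally show ?thesis
 unfolding prod_mset_unordered prod.distrib z_def z'_def n_def by (simp add: mult_ac)
qed

lemma pair_chain_lex_iff:
 assumes "\<forall>i\<in>{L..<L+M}. 0 < y i"
 shows "(\<forall>i\<in>{L..<L+M}. lex_less (Complex (x i) (y i)) w) \<longleftrightarrow>
 (\<forall>z\<in>#unordered (L + 2 * M) (conj_tuple L M x y). Im z > 0 --> lex_less z w)"
proof
 assume *: "\<forall>i\<in>{L..<L+M}. lex_less (Complex (x i) (y i)) w"
 show "\<forall>z\<in>#unordered (L + 2 * M) (conj_tuple L M x y). Im z > 0 --> lex_less z w"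
 proof (intro ballI impI)
 fix z assume "z \<in># unordered (L + 2 * M) (conj_tuple L M x y)" and im: "Im z > 0"
 then obtain j where j: "j < L + 2 * M" "z = conj_tuple L M x y j" by (auto simp: set_mset_unordered)
 have jL: "\<not> j < L" using j im by (auto simp: conj_tuple_def)
 define i where "i = L + (j - L) div 2"
 have i: "i \<in> {L..<L+M}" using j(1) jL by (auto simp: i_def)
 have z: "z = Complex (x i) (if even (j - L) then y i else - y i)"
 using j jL by (simp add: conj_tuple_def Let_def i_def)
 have "0 < y i" using assms i by blast
 then have "even (j - L)" using im z by (auto split: if_splits)
 then show "lex_less z w" using z * i by simp
 qed
next
 assume *: "\<forall>z\<in>#unordered (L + 2 * M) (conj_tuple L M x y). Im z > 0 --> lex_less z w"
 show "\<forall>i\<in>{L..<L+M}. lex_less (Complex (x i) (y i)) w"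
 proof
 fix i assume i: "i \<in> {L..<L+M}"
 define j where "j = L + 2 * (i - L)"
 have j: "j < L + 2 * M" using i by (auto simp: j_def)
 have "conj_tuple L M x y j = Complex (x i) (y i)"
 using j i by (simp add: conj_tuple_def Let_def j_def)
 moreover have "conj_tuple L M x y j \<in># unordered (L + 2 * M) (conj_tuple L M x y)"
 using j by (auto simp: set_mset_unordered)
 ultimately show "lex_less (Complex (x i) (y i)) w" using * assms i by auto
 qed
qed

abbreviation pair_coords :: "nat => nat => ((nat => real) \<times> (nat => real)) measure" where
 "pair_coords L M \<equiv> tuples (L+M) \<Otimes>\<^sub>M PiM {L..<L+M} (%_. borel)"

lemma measurable_pair_coords:
 "i \<in> {..<L+M} ==> (%p. fst p i) \<in> borel_measurable (pair_coords L M)"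
 "i \<in> {L..<L+M} ==> (%p. snd p i) \<in> borel_measurable (pair_coords L M)"
 by (intro meas_o[OF measurable_fst measurable_component_singleton]
  meas_o[OF measurable_snd measurable_component_singleton]; assumption)+

lemma measurable_conj_tuple:
 "(%p. conj_tuple L M (fst p) (snd p)) \<in> pair_coords L M \<rightarrow>\<^sub>M ctuples (L + 2 * M)"
 unfolding conj_tuple_def
proof (rule measurable_restrict)
 fix j assume j: "j \<in> {..<L + 2 * M}"
 show "(%p. if j < L then complex_of_real (fst p j) else let i = L + (j - L) div 2 in Complex (fst p i) (if even (j - L) then snd p i else - snd p i))
 \<in> borel_measurable (pair_coords L M)"
 proof (cases "j < L")
 case True
 then have "(%p. fst p j) \<in> borel_measurable (pair_coords L M)" by (intro measurable_pair_coords) auto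
 with True show ?thesis by simp
 next
 case False
 define i where "i = L + (j - L) div 2"
 have "i \<in> {L..<L+M}" using j False by (auto simp: i_def)
 then have [measurable]: "(%p. fst p i) \<in> borel_measurable (pair_coords L M)" "(%p. snd p i) \<in> borel_measurable (pair_coords L M)"
 by (intro measurable_pair_coords; auto)+
 have "(%p. Complex (fst p i) (if even (j - L) then snd p i else - snd p i)) \<in> borel_measurable (pair_coords L M)"
 by measurable
 with False show ?thesis by (simp only: if_False Let_def i_def[symmetric])
 qed
qed

lemma pred_lex_less:
 assumes [measurable]: "f \<in> borel_measurable N" "g \<in> borel_measurable N"
 shows "Measurable.pred N (%x. lex_less (f x) (g x))"
 unfolding lex_less_def by measurable

lemma pred_pair_chain: "Measurable.pred (pair_coords L M) (%p. pair_chain L M (fst p) (snd p))"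
 unfolding pair_chain_def
 by (intro pred_intros_logic pred_intros_finite borel_measurable_pred_less pred_lex_less measurable_Complex
 borel_measurable_const measurable_pair_coords) auto

lemma sigma_finite_PiM_lborel_on: "finite J ==> sigma_finite_measure (PiM (J::nat set) (%_. lborel :: 'a::euclidean_space measure))"
 by (rule lborels.sigma_finite)

lemma nn_integral_split_last_pair:
 fixes F :: "(nat => real) => (nat => real) => ennreal"
 assumes J: "finite J" "k \<notin> J"
 and F: "case_prod F \<in> borel_measurable (tuples (Suc k) \<Otimes>\<^sub>M PiM (insert k J) (%_. borel))"
 shows "(\<integral>\<^sup>+x. \<integral>\<^sup>+y. F x y \<partial>PiM (insert k J) (%_. lborel) \<partial>vol (Suc k)) =
 (\<integral>\<^sup>+a. \<integral>\<^sup>+b. \<integral>\<^sup>+x. \<integral>\<^sup>+y. F (x(k := a)) (y(k := b)) \<partial>PiM J (%_. lborel) \<partial>vol k \<partial>lborel \<partial>lborel)"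
proof -
 let ?J = "PiM J (%_. lborel :: real measure)" and ?J' = "PiM (insert k J) (%_. lborel :: real measure)"
 interpret J: sigma_finite_measure ?J by (rule sigma_finite_PiM_lborel_on[OF J(1)])
 interpret J': sigma_finite_measure ?J' by (rule sigma_finite_PiM_lborel_on) (simp add: J(1))
 have Fm: "(%p. F (fst p) (snd p)) \<in> borel_measurable (tuples (Suc k) \<Otimes>\<^sub>M PiM (insert k J) (%_. borel))"
 using F by (simp add: case_prod_unfold)
 have FJ': "case_prod F \<in> borel_measurable (tuples (Suc k) \<Otimes>\<^sub>M ?J')"
 using F by (subst measurable_cong_sets[OF sets_pair_measure_cong refl]) (auto simp: sets_PiM_lborel)
 have "(\<integral>\<^sup>+x. \<integral>\<^sup>+y. F x y \<partial>?J' \<partial>vol (Suc k)) =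
 (\<integral>\<^sup>+a. \<integral>\<^sup>+x. \<integral>\<^sup>+y. F (x(k := a)) y \<partial>?J' \<partial>vol k \<partial>lborel)"
 by (rule nn_integral_PiM_Suc_rev) (simp add: measurable_PiM_lborel1, rule J'.borel_measurable_nn_integral[OF FJ'])
 also have "... = (\<integral>\<^sup>+a. \<integral>\<^sup>+x. \<integral>\<^sup>+b. \<integral>\<^sup>+y. F (x(k := a)) (y(k := b)) \<partial>?J \<partial>lborel \<partial>vol k \<partial>lborel)"
 proof (intro nn_integral_cong lborels.product_nn_integral_insert_rev J)
 fix x :: "nat => real" and a :: real assume "x \<in> space (vol k)"
 then have "x(k := a) \<in> space (tuples (Suc k))"
 by (auto simp: space_PiM PiE_def extensional_def)
 from meas_o[OF measurable_Pair1'[OF this] F]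
 show "F (x(k := a)) \<in> borel_measurable ?J'"
 unfolding measurable_PiM_lborel1 by simp
 qed
 also have "... = (\<integral>\<^sup>+a. \<integral>\<^sup>+b. \<integral>\<^sup>+x. \<integral>\<^sup>+y. F (x(k := a)) (y(k := b)) \<partial>?J \<partial>vol k \<partial>lborel \<partial>lborel)"
 proof (rule nn_integral_cong)
 fix a :: real
 have m: "(%q. ((snd (fst q))(k := a), (snd q)(k := fst (fst q)))) \<in> ((borel :: real measure) \<Otimes>\<^sub>M tuples k) \<Otimes>\<^sub>M PiM J (%_. borel)
 \<rightarrow>\<^sub>M tuples (Suc k) \<Otimes>\<^sub>M PiM (insert k J) (%_. borel)"
 by (rule measurable_Pair) (auto intro!: measurable_fun_upd_Suc measurable_fun_upd[where J=J])
 have "(%q. F ((snd (fst q))(k := a)) ((snd q)(k := fst (fst q)))) \<in> borel_measurable (((borel :: real measure) \<Otimes>\<^sub>M tuples k) \<Otimes>\<^sub>M PiM J (%_. borel))"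
 using meas_o[OF m Fm] by simp
 then have "(%(p, y). F ((snd p)(k := a)) (y(k := fst p))) \<in> borel_measurable (((borel :: real measure) \<Otimes>\<^sub>M tuples k) \<Otimes>\<^sub>M ?J)"
 unfolding case_prod_unfold by (subst measurable_cong_sets[OF sets_pair_measure_cong refl]) (auto simp: sets_PiM_lborel)
 from J.borel_measurable_nn_integral[OF this]
 have "(%(b, x). \<integral>\<^sup>+y. F (x(k := a)) (y(k := b)) \<partial>?J) \<in> borel_measurable (borel \<Otimes>\<^sub>M tuples k)"
 by (simp add: case_prod_unfold)
 from nn_integral_lborel_PiM_Fubini[OF this]
 show "(\<integral>\<^sup>+x. \<integral>\<^sup>+b. \<integral>\<^sup>+y. F (x(k := a)) (y(k := b)) \<partial>?J \<partial>lborel \<partial>vol k) =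
 (\<integral>\<^sup>+b. \<integral>\<^sup>+x. \<integral>\<^sup>+y. F (x(k := a)) (y(k := b)) \<partial>?J \<partial>vol k \<partial>lborel)" by simp
 qed
 finally show ?thesis .
qed

text \<open>Among the upper roots exactly one is lexicographically largest, so precisely one summand survives.\<close>
lemma sum_largest_upper_root:
 fixes G :: "complex multiset => ennreal"
 assumes simple: "ALL w. poly (rp (Suc (Suc n)) e) w = 0 --> poly (pderiv (rp (Suc (Suc n)) e)) w ~= 0"
 and L: "L <= n"
 shows "(\<Sum>w | Im w > 0 & poly (rp (Suc (Suc n)) e) w = 0.
 (if nreal (proots (rp n (quadq n w e))) = L & (\<forall>z\<in>#proots (rp n (quadq n w e)). Im z > 0 --> lex_less z w)
 then G (add_mset w (add_mset (cnj w) (proots (rp n (quadq n w e))))) else 0))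
 = (if nreal (proots (rp (Suc (Suc n)) e)) = L then G (proots (rp (Suc (Suc n)) e)) else 0)"
proof -
 define Q where "Q = rp (Suc (Suc n)) e"
 define T where "T = {w. poly Q w = 0}"
 define U where "U = {w. Im w > 0 & poly Q w = 0}"
 define h where "h w = (if nreal (proots (rp n (quadq n w e))) = L & (\<forall>z\<in>#proots (rp n (quadq n w e)). Im z > 0 --> lex_less z w)
 then G (add_mset w (add_mset (cnj w) (proots (rp n (quadq n w e))))) else 0)" for w
 have Q: "Q = pCons (of_real (e (Suc n))) (pCons (of_real (e n)) (rp n e))" by (simp add: Q_def)
 have Qnz: "Q ~= 0" unfolding Q_def by (rule rp_nonzero)
 have R: "proots Q = mset_set T" and cT: "card T = Suc (Suc n)"
 unfolding T_def using card_simple_roots[OF Qnz] simple unfolding Q_def[symmetric] by (auto simp: Q_def simp del: rp_simps)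
 have fT: "finite T" unfolding T_def using Qnz by (rule poly_roots_finite)
 have fU: "finite U" by (rule finite_subset[OF _ fT]) (auto simp: U_def T_def)
 have cnjT: "cnj w \<in> T" if "w \<in> T" for w
 using that poly_rp_cnj[of "Suc (Suc n)" e w] unfolding T_def Q_def by simp
 have rest: "proots (rp n (quadq n w e)) = mset_set (T - {w, cnj w})"
 and fac: "add_mset w (add_mset (cnj w) (proots (rp n (quadq n w e)))) = proots Q" if "w \<in> U" for w
 proof -
 have w: "Im w > 0" "w \<in> T" using that by (auto simp: U_def T_def)
 have "Q = [:- w, 1:] * ([:- cnj w, 1:] * rp n (quadq n w e))"
 unfolding Q by (rule pair_factor) (use w in "auto simp: T_def Q")
 then show f: "add_mset w (add_mset (cnj w) (proots (rp n (quadq n w e)))) = proots Q"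
 by (simp add: proots_mult del: mult_pCons_left)
 have ne: "cnj w ~= w" using w by (auto simp: complex_eq_iff)
 have "mset_set T = add_mset w (mset_set (T - {w}))"
 using fT w by (intro mset_set.remove) auto
 also have "mset_set (T - {w}) = add_mset (cnj w) (mset_set (T - {w} - {cnj w}))"
 using fT w cnjT ne by (intro mset_set.remove) auto
 also have "T - {w} - {cnj w} = T - {w, cnj w}" by blast
 finally have "add_mset w (add_mset (cnj w) (proots (rp n (quadq n w e)))) = add_mset w (add_mset (cnj w) (mset_set (T - {w, cnj w})))"
 unfolding f R .
 then show "proots (rp n (quadq n w e)) = mset_set (T - {w, cnj w})" by simp
 qed
 have nr: "nreal (proots (rp n (quadq n w e))) = nreal (proots Q)" if "w \<in> U" for w
 unfolding fac[OF that, symmetric] using that by (simp add: nreal_def U_def)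
 have hw: "h w = (if nreal (proots Q) = L then (if \<forall>z\<in>U - {w}. lex_less z w then G (proots Q) else 0) else 0)" if "w \<in> U" for w
 proof -
 have "(\<forall>z\<in>T - {w, cnj w}. Im z > 0 --> lex_less z w) \<longleftrightarrow> (\<forall>z\<in>U - {w}. lex_less z w)"
 using that by (auto simp: U_def T_def)
 moreover have "set_mset (proots (rp n (quadq n w e))) = T - {w, cnj w}"
 unfolding rest[OF that] using fT by simp
 ultimately have lx: "(\<forall>z\<in>#proots (rp n (quadq n w e)). Im z > 0 --> lex_less z w) \<longleftrightarrow> (\<forall>z\<in>U - {w}. lex_less z w)"
 by (simp only:)
 show ?thesis unfolding h_def nr[OF that] fac[OF that] lx by (cases "nreal (proots Q) = L") (simp_all only: simp_thms if_True if_False)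
 qed
 have "(\<Sum>w\<in>U. h w) = (if nreal (proots Q) = L then G (proots Q) else 0)"
 proof (cases "nreal (proots Q) = L")
 case True
 have "U ~= {}"
 proof
 assume U: "U = {}"
 have "Im z = 0" if z: "z \<in> T" for z
 proof (rule ccontr)
  assume "Im z ~= 0"
  then have "z \<in> U \<or> cnj z \<in> U" using z cnjT[OF z] by (auto simp: U_def T_def)
  then show False using U by simp
 qed
 then have "nreal (proots Q) = size (proots Q)"
  unfolding nreal_eq_size_iff R using fT by simp
 also have "... = Suc (Suc n)" unfolding R using cT by simp
 finally show False using True L by simp
 qed
 have "(\<Sum>w\<in>U. h w) = (\<Sum>w\<in>U. if \<forall>z\<in>U - {w}. lex_less z w then G (proots Q) else 0)"
 by (rule sum.cong[OF refl]) (simp only: hw True simp_thms if_True)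
 also have "... = G (proots Q)" by (rule sum_lex_max[OF fU \<open>U ~= {}\<close>])
 finally show ?thesis using True by simp
 next
 case False
 have "(\<Sum>w\<in>U. h w) = (\<Sum>w\<in>U. 0)"
 by (rule sum.cong[OF refl]) (simp only: hw False if_False)
 with False show ?thesis by simp
 qed
 then show ?thesis unfolding h_def U_def Q_def .
qed

lemma measurable_pair_integrand:
 assumes G: "G \<in> borel_measurable (unordered_borel (L + 2 * M))"
 shows "(%(x, y). if pair_chain L M x y then G (unordered (L + 2 * M) (conj_tuple L M x y)) * ennreal (2 ^ M * vdm (L + 2 * M) (conj_tuple L M x y)) else 0)
 \<in> borel_measurable (pair_coords L M)"
proof -
 note [measurable] = measurable_conj_tuple[of L M] pred_pair_chain[of L M] G
 show ?thesis unfolding case_prod_unfold by measurable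
qed

text \<open>Induction on the number of pairs, removing the lexicographically largest one.\<close>
theorem vieta_integral_pairs:
 fixes G :: "complex multiset => ennreal"
 assumes G: "G \<in> borel_measurable (unordered_borel (L + 2 * M))"
 shows "(\<integral>\<^sup>+x. \<integral>\<^sup>+y. (if pair_chain L M x y then G (unordered (L + 2 * M) (conj_tuple L M x y)) *
  ennreal (2 ^ M * vdm (L + 2 * M) (conj_tuple L M x y)) else 0) \<partial>PiM {L..<L+M} (%_. lborel) \<partial>vol (L+M)) =
 (\<integral>\<^sup>+e. (if nreal (proots (rp (L + 2 * M) e)) = L then G (proots (rp (L + 2 * M) e)) else 0) \<partial>vol (L + 2 * M))"
 using G
proof (induction M arbitrary: G)
 case 0
 have ct: "unordered L (conj_tuple L 0 x y) = unordered L (%j. of_real (x j))" "vdm L (conj_tuple L 0 x y) = vdm L (%j. of_real (x j))" for x y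
 by (rule unordered_cong vdm_cong; simp add: conj_tuple_def)+
 have ch: "pair_chain L 0 x y \<longleftrightarrow> increasing_upto L x" for x y by (simp add: pair_chain_def)
 have "(\<integral>\<^sup>+x. \<integral>\<^sup>+y. (if pair_chain L 0 x y then G (unordered L (conj_tuple L 0 x y)) * ennreal (2 ^ 0 * vdm L (conj_tuple L 0 x y)) else 0) \<partial>PiM {} (%_. lborel) \<partial>vol L) =
 (\<integral>\<^sup>+x. (if increasing_upto L x then G (unordered L (%j. of_real (x j))) * ennreal (vdm L (%j. of_real (x j))) else 0) \<partial>vol L)"
 unfolding ct ch power_0 mult_1_left by (simp add: PiM_empty)
 also have "... = (\<integral>\<^sup>+e. (if nreal (proots (rp L e)) = L then G (proots (rp L e)) else 0) \<partial>vol L)"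
 by (rule vieta_integral_real_roots) (use 0 in simp)
 finally have *: "(\<integral>\<^sup>+x. \<integral>\<^sup>+y. (if pair_chain L 0 x y then G (unordered L (conj_tuple L 0 x y)) * ennreal (2 ^ 0 * vdm L (conj_tuple L 0 x y)) else 0) \<partial>PiM {} (%_. lborel) \<partial>vol L) =
 (\<integral>\<^sup>+e. (if nreal (proots (rp L e)) = L then G (proots (rp L e)) else 0) \<partial>vol L)" .
 have z: "L + 2 * 0 = L" "L + 0 = L" "{L..<L} = {}" by simp_all
 show ?case unfolding z by (rule *)
next
 case (Suc M)
 define n where "n = L + 2 * M"
 have n2: "L + 2 * Suc M = Suc (Suc n)" by (simp add: n_def)
 have k1: "L + Suc M = Suc (L + M)" by simp
 have k2: "{L..<Suc (L + M)} = insert (L+M) {L..<L+M}" by auto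
 note G[measurable] = Suc.prems[unfolded n2]
 let ?P = "PiM {..<n} (%_. lborel :: real measure)"
 define F where "F x y = (if pair_chain L (Suc M) x y then G (unordered (L + 2 * Suc M) (conj_tuple L (Suc M) x y)) *
  ennreal (2 ^ Suc M * vdm (L + 2 * Suc M) (conj_tuple L (Suc M) x y)) else 0)" for x y
 define G' where "G' w X = (if \<forall>z\<in>#X. Im z > 0 --> lex_less z w then G (add_mset w (add_mset (cnj w) X)) else 0) *
 ennreal (4 * Im w * (\<Prod>z\<in>#X. norm (w - z) * norm (cnj w - z)))" for w X
 have G': "G' w \<in> borel_measurable (unordered_borel n)" for w
 proof (rule measurable_from_unordered_borel)
 have [measurable]: "(%z. unordered (Suc (Suc n)) (z(n := cnj w, Suc n := w))) \<in> ctuples n \<rightarrow>\<^sub>M unordered_borel (Suc (Suc n))" by measurable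
 have eq: "unordered (Suc (Suc n)) (z(n := cnj w, Suc n := w)) = add_mset w (add_mset (cnj w) (unordered n z))" for z
 using unordered_cong[of n "z(n := cnj w, Suc n := w)" z] by (simp add: unordered_Suc)
 have [measurable]: "(%z. G (add_mset w (add_mset (cnj w) (unordered n z)))) \<in> borel_measurable (ctuples n)"
 unfolding eq[symmetric] by measurable
 have [measurable]: "Measurable.pred (ctuples n) (%z. \<forall>x\<in>z ` {..<n}. Im x > 0 --> lex_less x w)"
 proof -
 have eq: "(\<forall>x\<in>z ` {..<n}. Im x > 0 --> lex_less x w) \<longleftrightarrow> (\<forall>j\<in>{..<n}. Im (z j) > 0 --> lex_less (z j) w)" for z by blast
 show ?thesis unfolding eq
 proof (rule pred_intros_finite)
  fix j assume "j \<in> {..<n}"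
  then show "Measurable.pred (ctuples n) (%z. Im (z j) > 0 --> lex_less (z j) w)"
  unfolding lex_less_def by measurable
 qed simp
 qed
 show "(%z. G' w (unordered n z)) \<in> borel_measurable (ctuples n)"
 unfolding G'_def prod_mset_unordered set_mset_unordered by measurable
 qed simp
 define g where "g w q = (if nreal (proots (rp n q)) = L & (\<forall>z\<in>#proots (rp n q). Im z > 0 --> lex_less z w)
 then G (add_mset w (add_mset (cnj w) (proots (rp n q)))) else 0)" for w q
 let ?N = "(borel :: complex measure) \<Otimes>\<^sub>M PiM {..<n} (%_. borel :: real measure)"
 have g: "case_prod g \<in> borel_measurable ?N"
 proof -
 have comp: "(%x. snd x j) \<in> borel_measurable ?N" if "j < n" for j
 by (rule meas_o[OF measurable_snd measurable_component_singleton]) (use that in simp)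
 have cf: "(%x. coeff (rp n (snd x)) i) \<in> borel_measurable ?N" for i
 by (rule measurable_coeff_rp) (rule comp)
 have cn: "(%x. cnj (fst x)) \<in> borel_measurable ?N"
 by (rule meas_o[OF measurable_fst]) (intro borel_measurable_continuous_onI continuous_intros)
 have dg: "degree (rp n (snd x)) = n & coeff (rp n (snd x)) n = 1" for x :: "complex \<times> (nat => real)" by simp
 note s1 = measurable_add_mset_proots[OF cn dg cf]
 have "(%x. add_mset (fst x) (proots ([:- cnj (fst x), 1:] * rp n (snd x)))) \<in> ?N \<rightarrow>\<^sub>M unordered_borel (Suc (Suc n))"
 by (rule measurable_add_mset_proots(1)[OF measurable_fst s1(2,3)])
 then have a: "(%x. add_mset (fst x) (add_mset (cnj (fst x)) (proots (rp n (snd x))))) \<in> ?N \<rightarrow>\<^sub>M unordered_borel (Suc (Suc n))"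
 by (rule measurable_cong[THEN iffD1, rotated]) (simp only: s1(4))
 have b: "(%x. proots (rp n (snd x))) \<in> ?N \<rightarrow>\<^sub>M unordered_borel n"
 by (rule meas_o[OF measurable_snd measurable_proots_rp])
 have c: "Measurable.pred ?N (%x. \<forall>z\<in>#proots (rp n (snd x)). Im z > 0 --> lex_less z (fst x))"
 proof (rule pred_Ball_mset[OF b measurable_fst])
 show "Measurable.pred (borel \<Otimes>\<^sub>M borel) (%(w, z). Im z > 0 --> lex_less z w)"
  unfolding lex_less_def case_prod_unfold by measurable
 qed
 note [measurable] = a b c
 show ?thesis unfolding g_def case_prod_unfold by measurable
 qed
 define J where "J w q = g w q * ennreal (4 * Im w * (norm (poly (rp n q) w))\<^sup>2)" for w q
 define f where "f w = (\<integral>\<^sup>+q. J w q \<partial>?P) * indicator {w. Im w > 0} w" for w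
 have f: "f \<in> borel_measurable borel"
 proof -
 interpret P: sigma_finite_measure ?P by (rule sigma_finite_PiM_lborel)
 have H: "{w. Im w > 0} \<in> sets borel" by (intro borel_open open_halfspace_Im_gt)
 have [measurable]: "(%x. poly (rp n (snd x)) (fst x)) \<in> borel_measurable ?N"
 by (rule measurable_poly_rp) (auto intro: meas_o[OF measurable_snd measurable_component_singleton])
 have [measurable]: "(%x. g (fst x) (snd x)) \<in> borel_measurable ?N" using g by (simp add: case_prod_unfold)
 have "(%x. J (fst x) (snd x)) \<in> borel_measurable ?N" unfolding J_def by measurable
 then have "case_prod J \<in> borel_measurable (borel \<Otimes>\<^sub>M ?P)"
 unfolding case_prod_unfold by (subst measurable_cong_sets[OF sets_pair_measure_cong refl]) (auto simp: sets_PiM_lborel)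
 from P.borel_measurable_nn_integral[OF this] H show ?thesis unfolding f_def by measurable
 qed
 have inner: "(\<integral>\<^sup>+x. \<integral>\<^sup>+y. F (x(L+M := a)) (y(L+M := b)) \<partial>PiM {L..<L+M} (%_. lborel) \<partial>vol (L+M)) = f (Complex a b)" for a b
 proof (cases "b > 0")
 case False
 then have "F (x(L+M := a)) (y(L+M := b)) = 0" for x y unfolding F_def pair_chain_Suc by simp
 then show ?thesis using False by (simp add: f_def)
 next
 case b: True
 define w where "w = Complex a b"
 have "F (x(L+M := a)) (y(L+M := b)) = (if pair_chain L M x y then G' w (unordered n (conj_tuple L M x y)) * ennreal (2 ^ M * vdm n (conj_tuple L M x y)) else 0)" for x y
 proof (cases "pair_chain L M x y")
 case True
 let ?X = "unordered n (conj_tuple L M x y)"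
 have "\<forall>i\<in>{L..<L+M}. 0 < y i" using True by (simp add: pair_chain_def)
 from pair_chain_lex_iff[OF this, of x w]
 have c: "pair_chain L (Suc M) (x(L+M := a)) (y(L+M := b)) \<longleftrightarrow> (\<forall>z\<in>#?X. Im z > 0 --> lex_less z w)"
  unfolding pair_chain_Suc n_def w_def using True b by simp
 have e: "ennreal (2 ^ Suc M * (vdm n (conj_tuple L M x y) * (2 * b * (\<Prod>z\<in>#?X. norm (w - z) * norm (cnj w - z)))))
  = ennreal (4 * Im w * (\<Prod>z\<in>#?X. norm (w - z) * norm (cnj w - z))) * ennreal (2 ^ M * vdm n (conj_tuple L M x y))"
  unfolding prod_mset_unordered by (subst ennreal_mult[symmetric]) (use b in "auto simp: w_def mult_ac intro!: mult_nonneg_nonneg prod_nonneg")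
 have il: "(if A then G0 * (e1 * e2) else 0) = (if A then G0 else 0) * e1 * (e2 :: ennreal)" for A G0 e1 e2
  by (simp add: mult_ac)
 show ?thesis
  unfolding F_def c unordered_conj_tuple_Suc vdm_conj_tuple_Suc[OF b] w_def[symmetric] n_def[symmetric] e il G'_def
  using True by simp
 next
 case False
 then show ?thesis unfolding F_def pair_chain_Suc by simp
 qed
 then have "(\<integral>\<^sup>+x. \<integral>\<^sup>+y. F (x(L+M := a)) (y(L+M := b)) \<partial>PiM {L..<L+M} (%_. lborel) \<partial>vol (L+M)) =
 (\<integral>\<^sup>+x. \<integral>\<^sup>+y. (if pair_chain L M x y then G' w (unordered n (conj_tuple L M x y)) * ennreal (2 ^ M * vdm n (conj_tuple L M x y)) else 0) \<partial>PiM {L..<L+M} (%_. lborel) \<partial>vol (L+M))"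
 by (simp only:)
 also have "... = (\<integral>\<^sup>+q. (if nreal (proots (rp n q)) = L then G' w (proots (rp n q)) else 0) \<partial>?P)"
 unfolding n_def by (rule Suc.IH) (use G' in "simp add: n_def")
 also have "... = (\<integral>\<^sup>+q. J w q \<partial>?P)"
 proof (rule nn_integral_cong)
 fix q
 have "(\<Prod>z\<in>#proots (rp n q). norm (w - z) * norm (cnj w - z)) = (norm (poly (rp n q) w))\<^sup>2"
  unfolding prod_mset.distrib norm_prod_mset[symmetric] poly_rp_eq_prod[symmetric] poly_rp_cnj complex_mod_cnj
  by (simp add: power2_eq_square)
 then show "(if nreal (proots (rp n q)) = L then G' w (proots (rp n q)) else 0) = J w q"
  unfolding G'_def J_def g_def by simp
 qed
 finally show ?thesis using b by (simp add: f_def w_def)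
 qed
 have Fm: "case_prod F \<in> borel_measurable (tuples (Suc (L+M)) \<Otimes>\<^sub>M PiM (insert (L+M) {L..<L+M}) (%_. borel))"
 using measurable_pair_integrand[OF Suc.prems] unfolding F_def k1 k2 .
 have "(\<integral>\<^sup>+x. \<integral>\<^sup>+y. F x y \<partial>PiM {L..<L+Suc M} (%_. lborel) \<partial>vol (L+Suc M)) =
 (\<integral>\<^sup>+a. \<integral>\<^sup>+b. f (Complex a b) \<partial>lborel \<partial>lborel)"
 unfolding k1 k2 inner[symmetric] by (rule nn_integral_split_last_pair) (use Fm in auto)
 also have "... = (\<integral>\<^sup>+w. f w \<partial>lborel)"
 by (rule nn_integral_Complex[OF f, symmetric])
 also have "... = (\<integral>\<^sup>+p. \<integral>\<^sup>+z. (\<Sum>w | Im w > 0 & poly (pCons (of_real (Im z)) (pCons (of_real (Re z)) (rp n p))) w = 0. g w (quadq n w p)) \<partial>lborel \<partial>?P)"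
 unfolding f_def J_def by (rule add_conjugate_pair[OF g])
 also have "... = (\<integral>\<^sup>+p. \<integral>\<^sup>+z. (if nreal (proots (rp (Suc (Suc n)) (p(n := Re z, Suc n := Im z)))) = L
  then G (proots (rp (Suc (Suc n)) (p(n := Re z, Suc n := Im z)))) else 0) \<partial>lborel \<partial>?P)"
 proof (rule nn_integral_cong, rule nn_integral_cong_AE)
 fix p :: "nat => real"
 define W where "W = pCons 0 (pCons 0 (rp n p))"
 have "degree W \<ge> 2" unfolding W_def by simp
 from AE_affine_perturbation_squarefree[OF this]
 show "AE z in lborel. (\<Sum>w | Im w > 0 & poly (pCons (of_real (Im z)) (pCons (of_real (Re z)) (rp n p))) w = 0. g w (quadq n w p)) =
 (if nreal (proots (rp (Suc (Suc n)) (p(n := Re z, Suc n := Im z)))) = L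
  then G (proots (rp (Suc (Suc n)) (p(n := Re z, Suc n := Im z)))) else 0)"
 proof eventually_elim
 case (elim z)
 define e where "e = p(n := Re z, Suc n := Im z)"
 have re: "rp n e = rp n p" by (rule rp_cong) (simp add: e_def)
 have Q: "rp (Suc (Suc n)) e = pCons (of_real (Im z)) (pCons (of_real (Re z)) (rp n p))"
  by (simp add: re) (simp add: e_def)
 have QW: "rp (Suc (Suc n)) e = W + [:of_real (Im z), of_real (Re z):]"
  unfolding Q W_def by simp
 have qe: "quadq n w e = quadq n w p" for w
 proof -
  have "qd s t e (Suc (Suc j)) = qd s t p (Suc (Suc j))" if "j < n" for s t j
  by (rule qd_cong) (use that in "auto simp: e_def")
  then show ?thesis unfolding quadq_def by (intro restrict_ext) simp
 qed
 have "ALL w. poly (rp (Suc (Suc n)) e) w = 0 --> poly (pderiv (rp (Suc (Suc n)) e)) w ~= 0"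
  unfolding QW by (rule elim)
 from sum_largest_upper_root[OF this, of L G]
 show ?case unfolding qe Q[symmetric] g_def e_def[symmetric] by (simp add: n_def)
 qed
 qed
 also have "... = (\<integral>\<^sup>+e. (if nreal (proots (rp (Suc (Suc n)) e)) = L then G (proots (rp (Suc (Suc n)) e)) else 0) \<partial>vol (Suc (Suc n)))"
 proof -
 define K where "K e = (if nreal (proots (rp (Suc (Suc n)) e)) = L then G (proots (rp (Suc (Suc n)) e)) else 0)" for e
 note [measurable] = meas_o[OF measurable_proots_rp G] meas_o[OF measurable_proots_rp[of "Suc (Suc n)"] measurable_nreal]
 have K[measurable]: "K \<in> borel_measurable (tuples (Suc (Suc n)))"
 unfolding K_def by measurable
 have Kl: "K \<in> borel_measurable (vol (Suc (Suc n)))"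
 unfolding measurable_PiM_lborel1 by (rule K)
 note [measurable] = Kl
 have "(\<integral>\<^sup>+e. K e \<partial>vol (Suc (Suc n))) = (\<integral>\<^sup>+e. \<integral>\<^sup>+t. K (e(Suc n := t)) \<partial>lborel \<partial>vol (Suc n))"
 by (rule nn_integral_PiM_Suc[OF Kl])
 also have "... = (\<integral>\<^sup>+p. \<integral>\<^sup>+s. \<integral>\<^sup>+t. K (p(n := s, Suc n := t)) \<partial>lborel \<partial>lborel \<partial>?P)"
 by (rule nn_integral_PiM_Suc) measurable
 also have "... = (\<integral>\<^sup>+p. \<integral>\<^sup>+z. K (p(n := Re z, Suc n := Im z)) \<partial>lborel \<partial>?P)"
 proof (rule nn_integral_cong)
 fix p :: "nat => real" assume "p \<in> space ?P"
 then have [measurable]: "p \<in> space (tuples n)" by (simp add: space_PiM)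
 have "(%z. p(n := Re z, Suc n := Im z)) \<in> borel \<rightarrow>\<^sub>M tuples (Suc (Suc n))"
  by (intro measurable_fun_upd_Suc) auto
 from meas_o[OF this K]
 have "(%z. K (p(n := Re z, Suc n := Im z))) \<in> borel_measurable borel" .
 from nn_integral_Complex[OF this]
 show "(\<integral>\<^sup>+s. \<integral>\<^sup>+t. K (p(n := s, Suc n := t)) \<partial>lborel \<partial>lborel) = (\<integral>\<^sup>+z. K (p(n := Re z, Suc n := Im z)) \<partial>lborel)" by simp
 qed
 finally show ?thesis unfolding K_def by (rule sym)
 qed
 finally show ?case unfolding F_def n2 .
qed

lemma AE_PiM_neq:
 fixes i j n :: nat
 assumes "i < n" "j < n" "i ~= j"
 shows "AE x in PiM {..<n} (%_. lborel :: real measure). x i ~= x j"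
proof -
 let ?P = "PiM {..<n} (%_. lborel :: real measure)"
 let ?N = "{x \<in> space ?P. x i = x j}"
 have ij: "i \<in> {..<n}" "j \<in> {..<n}" using assms by auto
 have [measurable]: "(%x. x i) \<in> borel_measurable ?P" "(%x. x j) \<in> borel_measurable ?P"
 unfolding measurable_PiM_lborel1 using ij by (auto intro: measurable_component_singleton)
 have N: "?N \<in> sets ?P" by measurable
 have I: "{..<n} = insert i ({..<n} - {i})" using ij by auto
 have "emeasure ?P ?N = (\<integral>\<^sup>+x. indicator ?N x \<partial>PiM (insert i ({..<n} - {i})) (%_. lborel))"
 unfolding I[symmetric] using N by (rule nn_integral_indicator[symmetric])
 also have "... = (\<integral>\<^sup>+x. \<integral>\<^sup>+y. indicator ?N (x(i := y)) \<partial>lborel \<partial>PiM ({..<n} - {i}) (%_. lborel))"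
 proof -
 have M: "(indicator ?N :: _ => ennreal) \<in> borel_measurable (PiM (insert i ({..<n} - {i})) (%_. lborel))"
 unfolding I[symmetric] using N by (rule borel_measurable_indicator)
 have "finite ({..<n} - {i})" "i \<notin> {..<n} - {i}" by auto
 from lborels.product_nn_integral_insert[OF this M] show ?thesis .
 qed
 also have "... = (\<integral>\<^sup>+x. 0 \<partial>PiM ({..<n} - {i}) (%_. lborel :: real measure))"
 proof (rule nn_integral_cong)
 fix x :: "nat => real"
 have "(\<integral>\<^sup>+y. indicator ?N (x(i := y)) \<partial>lborel) <= (\<integral>\<^sup>+y. indicator {x j} y \<partial>lborel)"
 by (rule nn_integral_mono) (use assms(3) in "auto simp: indicator_def")
 then show "(\<integral>\<^sup>+y. indicator ?N (x(i := y)) \<partial>lborel) = 0" by simp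
 qed
 finally have "emeasure ?P ?N = 0" by simp
 then show ?thesis using N by (intro AE_I[where N = ?N]) auto
qed

text \<open>Outside the null set where two real parts agree, the lexicographic order is the order of the real parts.\<close>
lemma D_coords_iff:
 assumes x: "!!i j. [|i \<in> {L..<L+M}; j \<in> {L..<L+M}; i ~= j|] ==> x i ~= x j"
 shows "(x, y) \<in> D_coords L M \<longleftrightarrow> pair_chain L M x y & (\<forall>z\<in>#unordered (L + 2 * M) (conj_tuple L M x y). norm z < 1)"
proof -
 have nz: "(\<forall>z\<in>#unordered (L + 2 * M) (conj_tuple L M x y). norm z < 1) \<longleftrightarrow> (ALL j<L + 2 * M. norm (conj_tuple L M x y j) < 1)"
 unfolding set_mset_unordered by auto
 have a: "strict_mono_on {..<L} x \<longleftrightarrow> increasing_upto L x"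
 unfolding strict_mono_on_def by blast
 have b: "strict_mono_on {L..<L+M} x \<longleftrightarrow> (\<forall>i\<in>{L..<L+M}. \<forall>j\<in>{L..<L+M}. i < j --> lex_less (Complex (x i) (y i)) (Complex (x j) (y j)))"
 proof -
 have "lex_less (Complex (x i) (y i)) (Complex (x j) (y j)) \<longleftrightarrow> x i < x j"
 if "i \<in> {L..<L+M}" "j \<in> {L..<L+M}" "i < j" for i j
 proof -
 have "x i ~= x j" using x[OF that(1,2)] that(3) by simp
 then show ?thesis by (simp add: lex_less_def)
 qed
 then show ?thesis unfolding strict_mono_on_def by blast
 qed
 have c: "-1 < x i & x i < 1" if "ALL j<L + 2 * M. norm (conj_tuple L M x y j) < 1" "i < L + M" for i
 proof (cases "i < L")
 case True
 then have "norm (conj_tuple L M x y i) < 1" using that by simp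
 then have "\<bar>x i\<bar> < 1" using True by (simp add: conj_tuple_def)
 then show ?thesis by auto
 next
 case False
 define j where "j = L + 2 * (i - L)"
 have j: "j < L + 2 * M" using that(2) False by (auto simp: j_def)
 then have "norm (conj_tuple L M x y j) < 1" using that(1) by blast
 moreover have "conj_tuple L M x y j = Complex (x i) (y i)"
 using j False by (simp add: conj_tuple_def Let_def j_def)
 ultimately have "\<bar>x i\<bar> < 1" using abs_Re_le_cmod[of "Complex (x i) (y i)"] by simp
 then show ?thesis by auto
 qed
 have d: "(x, y) \<in> D_coords L M \<longleftrightarrow> (ALL i<L + M. -1 < x i & x i < 1) &
 strict_mono_on {..<L} x & strict_mono_on {L..<L + M} x & (\<forall>i\<in>{L..<L + M}. 0 < y i) &
 (ALL j<L + 2 * M. norm (conj_tuple L M x y j) < 1)"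
 unfolding D_coords_def by simp
 show ?thesis unfolding d pair_chain_def nz a[symmetric] b[symmetric] using c by blast
qed

theorem vieta_integral_real:
 fixes G :: "complex multiset => ennreal"
 assumes G: "G \<in> borel_measurable (unordered_borel (L + 2 * M))"
 shows "(\<integral>\<^sup>+x. \<integral>\<^sup>+y. (if (x, y) \<in> D_coords L M then G (unordered (L + 2 * M) (conj_tuple L M x y)) *
  ennreal (2 ^ M * vdm (L + 2 * M) (conj_tuple L M x y)) else 0) \<partial>PiM {L..<L+M} (%_. lborel) \<partial>vol (L+M)) =
 (\<integral>\<^sup>+e. (if nreal (proots (rp (L + 2 * M) e)) = L & (\<forall>z\<in>#proots (rp (L + 2 * M) e). norm z < 1)
 then G (proots (rp (L + 2 * M) e)) else 0) \<partial>vol (L + 2 * M))"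
proof -
 define G1 where "G1 X = (if \<forall>z\<in>#X. norm z < 1 then G X else 0)" for X
 have "Measurable.pred (unordered_borel (L + 2 * M)) (%X. \<forall>z\<in>#X. norm z < 1)"
 proof (rule pred_Ball_mset[where w = "%_. 0 :: real" and M' = borel and Q = "%_ z. norm z < 1"])
 show "Measurable.pred ((borel :: real measure) \<Otimes>\<^sub>M (borel :: complex measure)) (%(w, z). norm z < 1)"
 unfolding case_prod_unfold by measurable
 qed measurable
 note [measurable] = this G
 have G1: "G1 \<in> borel_measurable (unordered_borel (L + 2 * M))" unfolding G1_def by measurable
 have "AE x in PiM {..<L+M} (%_. lborel :: real measure). \<forall>i\<in>{L..<L+M}. \<forall>j\<in>{L..<L+M}. i ~= j --> x i ~= x j"
 by (intro AE_finite_allI finite_atLeastLessThan) (use AE_PiM_neq in auto)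
 then have "AE x in PiM {..<L+M} (%_. lborel :: real measure).
 (\<integral>\<^sup>+y. (if (x, y) \<in> D_coords L M then G (unordered (L + 2 * M) (conj_tuple L M x y)) *
  ennreal (2 ^ M * vdm (L + 2 * M) (conj_tuple L M x y)) else 0) \<partial>PiM {L..<L+M} (%_. lborel)) =
 (\<integral>\<^sup>+y. (if pair_chain L M x y then G1 (unordered (L + 2 * M) (conj_tuple L M x y)) *
  ennreal (2 ^ M * vdm (L + 2 * M) (conj_tuple L M x y)) else 0) \<partial>PiM {L..<L+M} (%_. lborel))"
 proof eventually_elim
 case (elim x)
 have "(x, y) \<in> D_coords L M \<longleftrightarrow> pair_chain L M x y & (\<forall>z\<in>#unordered (L + 2 * M) (conj_tuple L M x y). norm z < 1)" for y
 by (rule D_coords_iff) (use elim in blast)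
 then show ?case unfolding G1_def by (intro nn_integral_cong) simp
 qed
 then have "(\<integral>\<^sup>+x. \<integral>\<^sup>+y. (if (x, y) \<in> D_coords L M then G (unordered (L + 2 * M) (conj_tuple L M x y)) *
  ennreal (2 ^ M * vdm (L + 2 * M) (conj_tuple L M x y)) else 0) \<partial>PiM {L..<L+M} (%_. lborel) \<partial>vol (L+M)) =
 (\<integral>\<^sup>+x. \<integral>\<^sup>+y. (if pair_chain L M x y then G1 (unordered (L + 2 * M) (conj_tuple L M x y)) *
  ennreal (2 ^ M * vdm (L + 2 * M) (conj_tuple L M x y)) else 0) \<partial>PiM {L..<L+M} (%_. lborel) \<partial>vol (L+M))"
 by (rule nn_integral_cong_AE)
 also have "... = (\<integral>\<^sup>+e. (if nreal (proots (rp (L + 2 * M) e)) = L then G1 (proots (rp (L + 2 * M) e)) else 0) \<partial>vol (L + 2 * M))"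
 by (rule vieta_integral_pairs[OF G1])
 also have "... = (\<integral>\<^sup>+e. (if nreal (proots (rp (L + 2 * M) e)) = L & (\<forall>z\<in>#proots (rp (L + 2 * M) e). norm z < 1)
 then G (proots (rp (L + 2 * M) e)) else 0) \<partial>vol (L + 2 * M))"
 proof -
 have "(if A then if B then c else 0 else 0) = (if A & B then c else 0)" for A B and c :: ennreal by simp
 then show ?thesis unfolding G1_def by (simp only:)
 qed
 finally show ?thesis .
qed

section \<open>Volume under the Szego recursion\<close>

lemma measurable_update_coordinate:
 assumes i: "i \<in> I" and f: "f \<in> borel_measurable (PiM I (%_. borel))"
 shows "(%x. x(i := f x)) \<in> PiM I (%_. borel) \<rightarrow>\<^sub>M PiM I (%_. borel)"
proof -
 have "(%x. \<lambda>j\<in>I. if j = i then f x else x j) \<in> PiM I (%_. borel) \<rightarrow>\<^sub>M PiM I (%_. borel)"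
 proof (rule measurable_restrict)
 fix j assume "j \<in> I"
 then have "(%x. x j) \<in> borel_measurable (PiM I (%_. borel))" by (rule measurable_component_singleton)
 then show "(%x. if j = i then f x else x j) \<in> borel_measurable (PiM I (%_. borel))"
 using f by (cases "j = i") auto
 qed
 moreover have "(\<lambda>j\<in>I. if j = i then f x else x j) = x(i := f x)" if "x \<in> space (PiM I (%_. borel))" for x
 using that i by (auto simp: fun_eq_iff space_PiM PiE_def extensional_def)
 ultimately show ?thesis by (rule measurable_cong[THEN iffD1, rotated])
qed

text \<open>Fubini, with the changed coordinate integrated first.\<close>
lemma nn_integral_coordinate_change:
 fixes \<phi> :: "(nat => 'a::euclidean_space) => 'a => 'a"
 assumes I: "finite I" "i \<in> I"
 and \<phi>: "(%x. \<phi> x (x i)) \<in> borel_measurable (PiM I (%_. borel))"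
 and indep: "!!x y. \<phi> (x(i := y)) = \<phi> x"
 and s: "!!x g. g \<in> borel_measurable borel ==> s * (\<integral>\<^sup>+y. g (\<phi> x y) \<partial>lborel) = (\<integral>\<^sup>+y. g y \<partial>lborel)"
 and h: "h \<in> borel_measurable (PiM I (%_. borel))"
 shows "s * (\<integral>\<^sup>+x. h (x(i := \<phi> x (x i))) \<partial>PiM I (%_. lborel)) = (\<integral>\<^sup>+x. h x \<partial>PiM I (%_. lborel))" (is "?lhs = ?rhs")
proof -
 let ?K = "I - {i}"
 have II: "insert i ?K = I" using I by auto
 have U: "(%x. x(i := \<phi> x (x i))) \<in> PiM I (%_. borel) \<rightarrow>\<^sub>M PiM I (%_. borel)"
 by (rule measurable_update_coordinate[OF I(2) \<phi>])
 have hU: "(%x. h (x(i := \<phi> x (x i)))) \<in> borel_measurable (PiM I (%_. lborel))"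
 unfolding measurable_PiM_lborel1 by (rule meas_o[OF U h])
 have h': "h \<in> borel_measurable (PiM I (%_. lborel))" unfolding measurable_PiM_lborel1 by (rule h)
 interpret K: finite_product_sigma_finite "%_. lborel :: 'a measure" ?K by standard (use I in auto)
 have m: "(%x. \<integral>\<^sup>+y. h ((x(i := y))(i := \<phi> (x(i := y)) ((x(i := y)) i))) \<partial>lborel) \<in> borel_measurable (PiM ?K (%_. lborel))"
 proof (rule lborel.borel_measurable_nn_integral)
 have "(%p. (fst p)(i := snd p)) \<in> PiM ?K (%_. lborel :: 'a measure) \<Otimes>\<^sub>M lborel \<rightarrow>\<^sub>M PiM (insert i ?K) (%_. lborel)"
 by (rule measurable_fun_upd[where J = ?K]) auto
 then have "(%p. (fst p)(i := snd p)) \<in> PiM ?K (%_. lborel :: 'a measure) \<Otimes>\<^sub>M lborel \<rightarrow>\<^sub>M PiM I (%_. lborel)"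
 unfolding II .
 from meas_o[OF this hU]
 show "(%(x, y). h ((x(i := y))(i := \<phi> (x(i := y)) ((x(i := y)) i)))) \<in> borel_measurable (PiM ?K (%_. lborel) \<Otimes>\<^sub>M lborel)"
 by (simp add: case_prod_unfold)
 qed
 have "?lhs =
 s * (\<integral>\<^sup>+x. \<integral>\<^sup>+y. h ((x(i := y))(i := \<phi> (x(i := y)) ((x(i := y)) i))) \<partial>lborel \<partial>PiM ?K (%_. lborel))"
 using lborels.product_nn_integral_insert[of ?K i "%x. h (x(i := \<phi> x (x i)))"] hU I unfolding II by simp
 also have "... = (\<integral>\<^sup>+x. s * (\<integral>\<^sup>+y. h ((x(i := y))(i := \<phi> (x(i := y)) ((x(i := y)) i))) \<partial>lborel) \<partial>PiM ?K (%_. lborel))"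
 by (rule nn_integral_cmult[OF m, symmetric])
 also have "... = (\<integral>\<^sup>+x. \<integral>\<^sup>+y. h (x(i := y)) \<partial>lborel \<partial>PiM ?K (%_. lborel))"
 proof (rule nn_integral_cong)
 fix x :: "nat => 'a" assume x: "x \<in> space (PiM ?K (%_. lborel))"
 have "(%y. x(i := y)) \<in> borel \<rightarrow>\<^sub>M PiM (insert i ?K) (%_. borel)"
 by (rule measurable_fun_upd[where J = ?K]) (use x in "auto simp: space_PiM")
 then have "(%y. h (x(i := y))) \<in> borel_measurable borel"
 unfolding II using h by (rule meas_o)
 from s[OF this, of x]
 show "s * (\<integral>\<^sup>+y. h ((x(i := y))(i := \<phi> (x(i := y)) ((x(i := y)) i))) \<partial>lborel) = (\<integral>\<^sup>+y. h (x(i := y)) \<partial>lborel)"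
 by (simp add: indep)
 qed
 also have "... = ?rhs"
 using lborels.product_nn_integral_insert[of ?K i h] h' I unfolding II by simp
 finally show ?thesis .
qed

lemma nn_integral_coordinates_change:
 fixes \<phi> :: "nat => (nat => 'a::euclidean_space) => 'a => 'a"
 assumes I: "finite I" "K \<subseteq> I" "J \<subseteq> K"
 and \<phi>: "!!i. i \<in> K ==> (%x. \<phi> i x (x i)) \<in> borel_measurable (PiM I (%_. borel))"
 and indep: "!!i x x'. i \<in> K ==> (!!j. j \<notin> K ==> x j = x' j) ==> \<phi> i x = \<phi> i x'"
 and s: "!!i x g. i \<in> K ==> g \<in> borel_measurable borel ==> s * (\<integral>\<^sup>+y. g (\<phi> i x y) \<partial>lborel) = (\<integral>\<^sup>+y. g y \<partial>lborel)"
 and h: "h \<in> borel_measurable (PiM I (%_. borel))"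
 shows "s ^ card J * (\<integral>\<^sup>+x. h (%j. if j \<in> J then \<phi> j x (x j) else x j) \<partial>PiM I (%_. lborel)) = (\<integral>\<^sup>+x. h x \<partial>PiM I (%_. lborel))"
proof -
 have "finite J" using I by (meson finite_subset)
 then show ?thesis using I(3) h
 proof (induction J arbitrary: h rule: finite_induct)
 case empty
 then show ?case by simp
 next
 case (insert i J)
 have iK: "i \<in> K" and iI: "i \<in> I" using insert.prems I by auto
 have U: "(%x. x(i := \<phi> i x (x i))) \<in> PiM I (%_. borel) \<rightarrow>\<^sub>M PiM I (%_. borel)"
 by (rule measurable_update_coordinate[OF iI \<phi>[OF iK]])
 let ?T = "%x j. if j \<in> J then \<phi> j x (x j) else x j"
 have T: "(%j. if j \<in> insert i J then \<phi> j x (x j) else x j) = (?T x)(i := \<phi> i (?T x) (?T x i))" for x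
 proof -
 have "\<phi> i (?T x) = \<phi> i x" by (rule indep[OF iK]) (use insert.prems in auto)
 moreover have "?T x i = x i" using insert.hyps by simp
 ultimately show ?thesis by (auto simp: fun_eq_iff)
 qed
 have "s ^ card (insert i J) * (\<integral>\<^sup>+x. h (%j. if j \<in> insert i J then \<phi> j x (x j) else x j) \<partial>PiM I (%_. lborel)) =
 s * (s ^ card J * (\<integral>\<^sup>+x. h ((?T x)(i := \<phi> i (?T x) (?T x i))) \<partial>PiM I (%_. lborel)))"
 unfolding T using insert.hyps by (simp add: mult_ac)
 also have "s ^ card J * (\<integral>\<^sup>+x. h ((?T x)(i := \<phi> i (?T x) (?T x i))) \<partial>PiM I (%_. lborel)) =
 (\<integral>\<^sup>+x. h (x(i := \<phi> i x (x i))) \<partial>PiM I (%_. lborel))"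
 proof (rule insert.IH[where h = "%x. h (x(i := \<phi> i x (x i)))"])
 show "J \<subseteq> K" using insert.prems by simp
 show "(%x. h (x(i := \<phi> i x (x i)))) \<in> borel_measurable (PiM I (%_. borel))"
  by (rule meas_o[OF U insert.prems(2)])
 qed
 also have "s * ... = (\<integral>\<^sup>+x. h x \<partial>PiM I (%_. lborel))"
 by (rule nn_integral_coordinate_change[OF I(1) iI \<phi>[OF iK] _ s[OF iK] insert.prems(2)])
  (rule indep[OF iK], use iK in auto)
 finally show ?case .
 qed
qed

text \<open>A field with an isometric conjugation, covering the real and the complex numbers. \<open>sB\<close> and \<open>sM\<close> are the volume factors of \<open>y \<mapsto> (1 - a \<kappa> a) y\<close> and \<open>y \<mapsto> y - a \<kappa> y\<close>: the former acts on the pairs of coefficients that the recursion couples, the latter on a middle coefficient.\<close>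
locale szego_field =
 fixes \<kappa> :: "'a::{real_normed_field, euclidean_space} => 'a"
 and sB sM :: "'a => ennreal"
 assumes \<kappa>_add: "\<kappa> (x + y) = \<kappa> x + \<kappa> y" and \<kappa>_mult: "\<kappa> (x * y) = \<kappa> x * \<kappa> y"
 and \<kappa>_\<kappa> [simp]: "\<kappa> (\<kappa> x) = x" and norm_\<kappa> [simp]: "norm (\<kappa> x) = norm x"
 and measurable_\<kappa> [measurable]: "\<kappa> \<in> borel_measurable borel"
 and \<kappa>_reflect: "g \<in> borel_measurable borel ==> (\<integral>\<^sup>+y. g (- \<kappa> y) \<partial>lborel) = (\<integral>\<^sup>+y. g y \<partial>lborel)"
 and scale_both: "norm a < 1 ==> g \<in> borel_measurable borel ==>
 sB a * (\<integral>\<^sup>+y. g ((1 - a * \<kappa> a) * y + c) \<partial>lborel) = (\<integral>\<^sup>+y. g y \<partial>lborel)"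
 and scale_mid: "norm a < 1 ==> g \<in> borel_measurable borel ==>
 sM a * (\<integral>\<^sup>+y. g (y - a * \<kappa> y) \<partial>lborel) = (\<integral>\<^sup>+y. g y \<partial>lborel)"
 and measurable_factors [measurable]: "sB \<in> borel_measurable borel" "sM \<in> borel_measurable borel"
begin

lemma \<kappa>_minus: "\<kappa> (- x) = - \<kappa> x"
proof -
 have "\<kappa> 0 = 0" using \<kappa>_add[of 0 0] by simp
 then show ?thesis using \<kappa>_add[of x "- x"] by (simp add: eq_neg_iff_add_eq_0 add.commute)
qed

lemma \<kappa>_diff: "\<kappa> (x - y) = \<kappa> x - \<kappa> y"
 using \<kappa>_add[of x "- y"] by (simp add: \<kappa>_minus)

definition reflect_shift :: "nat => 'a => (nat => 'a) => nat => 'a" where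
 "reflect_shift k a x = (\<lambda>j\<in>{..<k}. x j - a * \<kappa> (x (k - 1 - j)))"

definition volume_factor :: "nat => 'a => ennreal" where
 "volume_factor k a = sB a ^ (k div 2) * sM a ^ (k mod 2)"

lemma measurable_volume_factor [measurable]: "volume_factor k \<in> borel_measurable borel"
 unfolding volume_factor_def[abs_def] by measurable

text \<open>Coordinates \<open>j\<close> and \<open>k - 1 - j\<close> are mixed by a 2-by-2 block. It factors into a shear of one coordinate and a scaling with shear of the other; a middle coordinate is treated on its own.\<close>
lemma nn_integral_reflect_shift:
 assumes a: "norm a < 1" and h: "h \<in> borel_measurable (tuples k)"
 shows "volume_factor k a * (\<integral>\<^sup>+x. h (reflect_shift k a x) \<partial>vol k) = (\<integral>\<^sup>+x. h x \<partial>vol k)"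
proof -
 let ?P = "PiM {..<k} (%_. borel :: 'a measure)" and ?Q = "PiM {..<k} (%_. lborel :: 'a measure)"
 define A where "A = {..<k div 2}"
 define B where "B = {k - k div 2..<k}"
 define C where "C = {k div 2..<k - k div 2}"
 define TA where "TA x j = (if j \<in> A then x j - a * \<kappa> (x (k - 1 - j)) else x j)" for x j
 define TB where "TB x j = (if j \<in> B then (1 - a * \<kappa> a) * x j + - a * \<kappa> (x (k - 1 - j)) else x j)" for x j
 define TC where "TC x j = (if j \<in> C then x j - a * \<kappa> (x j) else x j)" for x j
 have TAe: "TA x = (%j. if j \<in> A then x j + - a * \<kappa> (x (k - 1 - j)) else x j)" for x
 by (auto simp: TA_def fun_eq_iff)
 have TBe: "TB x = (%j. if j \<in> B then (1 - a * \<kappa> a) * x j + - a * \<kappa> (x (k - 1 - j)) else x j)" for x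
 by (auto simp: TB_def fun_eq_iff)
 have TCe: "TC x = (%j. if j \<in> C then x j - a * \<kappa> (x j) else x j)" for x
 by (auto simp: TC_def fun_eq_iff)
 have sub: "A \<subseteq> {..<k}" "B \<subseteq> {..<k}" "C \<subseteq> {..<k}" by (auto simp: A_def B_def C_def)
 have card: "card B = k div 2" "card C = k mod 2"
 by (auto simp: B_def C_def) (metis mod2_eq_if minus_div_mult_eq_mod mult_2_right diff_diff_left)
 have comp: "(%x. x j) \<in> borel_measurable ?P" if "j < k" for j
 by (rule measurable_component_singleton) (use that in simp)
 have mT: "T \<in> ?P \<rightarrow>\<^sub>M ?P" if T: "!!j. j < k ==> (%x. T x j) \<in> borel_measurable ?P" and ext: "!!x j. x \<in> space ?P ==> j \<ge> k ==> T x j = undefined" for T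
 proof -
 have "(%x. \<lambda>j\<in>{..<k}. T x j) \<in> ?P \<rightarrow>\<^sub>M ?P" by (rule measurable_restrict) (use T in auto)
 moreover have "(\<lambda>j\<in>{..<k}. T x j) = T x" if "x \<in> space ?P" for x
 using ext[OF that] by (auto simp: fun_eq_iff restrict_def)
 ultimately show ?thesis by (rule measurable_cong[THEN iffD1, rotated])
 qed
 have ext: "x j = undefined" if "x \<in> space ?P" "j \<ge> k" for x j
 using that by (auto simp: space_PiM PiE_def extensional_def)
 have mk: "(%x. \<kappa> (x j)) \<in> borel_measurable ?P" if "j < k" for j
 by (rule meas_o[OF comp[OF that] measurable_\<kappa>])
 have mTB: "TB \<in> ?P \<rightarrow>\<^sub>M ?P"
 proof (rule mT)
 fix j assume j: "j < k"
 then have "k - 1 - j < k" by simp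
 note [measurable] = comp[OF j] mk[OF this]
 show "(%x. TB x j) \<in> borel_measurable ?P" unfolding TB_def by measurable
 qed (use ext sub in "auto simp: TB_def")
 have mTC: "TC \<in> ?P \<rightarrow>\<^sub>M ?P"
 proof (rule mT)
 fix j assume j: "j < k"
 note [measurable] = comp[OF j] mk[OF j]
 show "(%x. TC x j) \<in> borel_measurable ?P" unfolding TC_def by measurable
 qed (use ext sub in "auto simp: TC_def")
 have T: "reflect_shift k a x = TC (TB (TA x))" if x: "x \<in> space ?P" for x
 proof
 fix j
 have "j \<in> A \<or> j \<in> B \<or> j \<in> C \<or> j \<ge> k"
 unfolding A_def B_def C_def lessThan_iff atLeastLessThan_iff by linarith
 then consider "j \<in> A" | "j \<in> B" | "j \<in> C" | "j \<ge> k" by blast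
 then show "reflect_shift k a x j = TC (TB (TA x)) j"
 proof cases
 case 1
 then have "j \<notin> B" "j \<notin> C" "j < k" by (auto simp: A_def B_def C_def)
 with 1 show ?thesis by (simp add: reflect_shift_def TA_def TB_def TC_def)
 next
 case 2
 then have j: "j \<notin> A" "j \<notin> C" "j < k" "k - 1 - j \<in> A" "k - 1 - (k - 1 - j) = j"
  by (auto simp: A_def B_def C_def)
 have "TC (TB (TA x)) j = (1 - a * \<kappa> a) * x j + - a * \<kappa> (x (k - 1 - j) - a * \<kappa> (x j))"
  using 2 j by (simp add: TA_def TB_def TC_def)
 also have "... = x j - a * \<kappa> (x (k - 1 - j))"
  by (simp add: \<kappa>_diff \<kappa>_mult algebra_simps)
 finally show ?thesis using j by (simp add: reflect_shift_def)
 next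
 case 3
 then have j: "j \<notin> A" "j \<notin> B" "j < k" "k - 1 - j = j" by (auto simp: A_def B_def C_def)
 with 3 show ?thesis by (simp add: reflect_shift_def TA_def TB_def TC_def)
 next
 case 4
 then have "j \<notin> A" "j \<notin> B" "j \<notin> C" "\<not> j < k" by (auto simp: A_def B_def C_def)
 with 4 ext[OF x] show ?thesis by (simp add: reflect_shift_def TA_def TB_def TC_def)
 qed
 qed
 have hC: "(%x. h (TC x)) \<in> borel_measurable ?P" by (rule meas_o[OF mTC h])
 have hBC: "(%x. h (TC (TB x))) \<in> borel_measurable ?P" by (rule meas_o[OF mTB hC])
 have "(\<integral>\<^sup>+x. h (reflect_shift k a x) \<partial>?Q) = (\<integral>\<^sup>+x. h (TC (TB (TA x))) \<partial>?Q)"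
 by (rule nn_integral_cong) (simp add: T space_PiM)
 also have "... = 1 ^ card A * (\<integral>\<^sup>+x. h (TC (TB (%j. if j \<in> A then x j + - a * \<kappa> (x (k - 1 - j)) else x j))) \<partial>?Q)"
 unfolding TAe by simp
 also have "... = (\<integral>\<^sup>+x. h (TC (TB x)) \<partial>?Q)"
 proof (rule nn_integral_coordinates_change[where K = A and \<phi> = "%j x y. y + - a * \<kappa> (x (k - 1 - j))" and h = "%x. h (TC (TB x))"])
 fix i assume i: "i \<in> A"
 then have ik: "i < k" "k - 1 - i < k" "k - 1 - i \<notin> A" by (auto simp: A_def)
 note [measurable] = comp[OF ik(1)] mk[OF ik(2)]
 show "(%x. x i + - a * \<kappa> (x (k - 1 - i))) \<in> borel_measurable ?P" by measurable
 show "(%y. y + - a * \<kappa> (x (k - 1 - i))) = (%y. y + - a * \<kappa> (x' (k - 1 - i)))"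
 if "!!j. j \<notin> A ==> x j = x' j" for x x'
 using that[OF ik(3)] by simp
 show "1 * (\<integral>\<^sup>+y. g (y + - a * \<kappa> (x (k - 1 - i))) \<partial>lborel) = (\<integral>\<^sup>+y. g y \<partial>lborel)" if "g \<in> borel_measurable borel" for x and g :: "'a => ennreal"
 using nn_integral_lborel_shift[OF that, of "- a * \<kappa> (x (k - 1 - i))"] by (simp only: mult_1)
 qed (use sub hBC in auto)
 finally have 1: "(\<integral>\<^sup>+x. h (reflect_shift k a x) \<partial>?Q) = (\<integral>\<^sup>+x. h (TC (TB x)) \<partial>?Q)" .
 have 2: "sB a ^ card B * (\<integral>\<^sup>+x. h (TC (TB x)) \<partial>?Q) = (\<integral>\<^sup>+x. h (TC x) \<partial>?Q)"
 unfolding TBe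
 proof (rule nn_integral_coordinates_change[where K = B and \<phi> = "%j x y. (1 - a * \<kappa> a) * y + - a * \<kappa> (x (k - 1 - j))" and h = "%x. h (TC x)"])
 fix i assume i: "i \<in> B"
 then have ik: "i < k" "k - 1 - i < k" "k - 1 - i \<notin> B" by (auto simp: B_def)
 note [measurable] = comp[OF ik(1)] mk[OF ik(2)]
 show "(%x. (1 - a * \<kappa> a) * x i + - a * \<kappa> (x (k - 1 - i))) \<in> borel_measurable ?P" by measurable
 show "(%y. (1 - a * \<kappa> a) * y + - a * \<kappa> (x (k - 1 - i))) = (%y. (1 - a * \<kappa> a) * y + - a * \<kappa> (x' (k - 1 - i)))"
 if "!!j. j \<notin> B ==> x j = x' j" for x x'
 using that[OF ik(3)] by simp
 show "sB a * (\<integral>\<^sup>+y. g ((1 - a * \<kappa> a) * y + - a * \<kappa> (x (k - 1 - i))) \<partial>lborel) = (\<integral>\<^sup>+y. g y \<partial>lborel)" if "g \<in> borel_measurable borel" for x and g :: "'a => ennreal"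
 by (rule scale_both[OF a that])
 qed (use sub hC in auto)
 have 3: "sM a ^ card C * (\<integral>\<^sup>+x. h (TC x) \<partial>?Q) = (\<integral>\<^sup>+x. h x \<partial>?Q)"
 unfolding TCe
 proof (rule nn_integral_coordinates_change[where K = C and \<phi> = "%j x y. y - a * \<kappa> y"])
 fix i assume i: "i \<in> C"
 then have ik: "i < k" by (auto simp: C_def)
 note [measurable] = comp[OF ik] mk[OF ik]
 show "(%x. x i - a * \<kappa> (x i)) \<in> borel_measurable ?P" by measurable
 show "sM a * (\<integral>\<^sup>+y. g (y - a * \<kappa> y) \<partial>lborel) = (\<integral>\<^sup>+y. g y \<partial>lborel)" if "g \<in> borel_measurable borel" for g :: "'a => ennreal"
 by (rule scale_mid[OF a that])
 qed (use sub h in auto)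
 have "volume_factor k a * (\<integral>\<^sup>+x. h (reflect_shift k a x) \<partial>?Q) = sM a ^ card C * (sB a ^ card B * (\<integral>\<^sup>+x. h (TC (TB x)) \<partial>?Q))"
 unfolding 1 volume_factor_def card by (simp add: mult_ac)
 then show ?thesis unfolding 2 3 .
qed

definition szego_step :: "nat => 'a => (nat => 'a) => nat => 'a" where
 "szego_step k \<alpha> e = (reflect_shift k (\<kappa> \<alpha>) e)(k := - \<kappa> \<alpha>)"

fun szego_coeffs :: "nat => (nat => 'a) => nat => 'a" where
 "szego_coeffs 0 \<alpha> = (%_. undefined)"
| "szego_coeffs (Suc k) \<alpha> = szego_step k (\<alpha> k) (szego_coeffs k \<alpha>)"

lemma szego_coeffs_cong: "(!!j. j < k ==> \<alpha> j = \<alpha>' j) ==> szego_coeffs k \<alpha> = szego_coeffs k \<alpha>'"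
 by (induction k) auto

lemma measurable_szego_step:
 assumes f: "f \<in> borel_measurable N" and g: "g \<in> N \<rightarrow>\<^sub>M tuples k"
 shows "(%x. szego_step k (f x) (g x)) \<in> N \<rightarrow>\<^sub>M tuples (Suc k)"
 unfolding szego_step_def
proof (rule measurable_fun_upd_Suc)
 note [measurable] = f
 show "(%x. - \<kappa> (f x)) \<in> borel_measurable N" by measurable
 show "(%x. reflect_shift k (\<kappa> (f x)) (g x)) \<in> N \<rightarrow>\<^sub>M tuples k"
 unfolding reflect_shift_def
 proof (rule measurable_restrict)
 fix j assume j: "j \<in> {..<k}"
 then have "k - 1 - j \<in> {..<k}" by auto
 note [measurable] = meas_o[OF g measurable_component_singleton[OF j]]
 meas_o[OF g measurable_component_singleton[OF this]]
 show "(%x. g x j - \<kappa> (f x) * \<kappa> (g x (k - 1 - j))) \<in> borel_measurable N" by measurable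
 qed
qed

lemma measurable_szego_coeffs: "szego_coeffs n \<in> tuples n \<rightarrow>\<^sub>M tuples n"
proof -
 have "(%\<alpha>. szego_coeffs k \<alpha>) \<in> tuples n \<rightarrow>\<^sub>M tuples k" if "k <= n" for k
 using that
 proof (induction k)
 case 0
 have "(%\<alpha> :: nat => 'a. (%_ :: nat. undefined :: 'a)) \<in> tuples n \<rightarrow>\<^sub>M tuples 0"
 by (rule measurable_const) (simp add: space_PiM)
 then show ?case by simp
 next
 case (Suc k)
 have "(%\<alpha>. \<alpha> k) \<in> borel_measurable (PiM {..<n} (%_. borel :: 'a measure))"
 by (rule measurable_component_singleton) (use Suc.prems in simp)
 from measurable_szego_step[OF this Suc.IH] Suc.prems show ?case by simp
 qed
 then show ?thesis by simp
qed

end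

context szego_field
begin

text \<open>Induction on \<open>n\<close>: the new last coefficient is \<open>- \<kappa> a\<close>, and for fixed \<open>a\<close> the old coefficients are transformed by \<open>reflect_shift\<close>. The sets \<open>D k\<close> are the images of the product of discs.\<close>
theorem szego_integral:
 fixes D :: "nat => (nat => 'a) set"
 assumes D0: "!!e. e \<in> D 0"
 and Dstep: "!!k a e. norm a < 1 ==> szego_step k a e \<in> D (Suc k) \<longleftrightarrow> e \<in> D k"
 and Dlast: "!!k e. e \<in> D (Suc k) ==> norm (e k) < 1"
 and Dm: "!!k. {e \<in> space (tuples k). e \<in> D k} \<in> sets (tuples k)"
 and h: "h \<in> borel_measurable (tuples n)"
 shows "(\<integral>\<^sup>+\<alpha>. h (szego_coeffs n \<alpha>) * (\<Prod>k<n. volume_factor k (\<kappa> (\<alpha> k)) * indicator (ball 0 1) (\<alpha> k)) \<partial>vol n) =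
 (\<integral>\<^sup>+e. (if e \<in> D n then h e else 0) \<partial>vol n)"
 using h
proof (induction n arbitrary: h)
 case 0
 then show ?case using D0 by (simp add: lborels.nn_integral_empty PiM_empty nn_integral_count_space_finite)
next
 case (Suc n)
 note h = Suc.prems
 let ?B = "PiM {..<n} (%_. borel :: 'a measure)" and ?P = "PiM {..<n} (%_. lborel :: 'a measure)"
 define w where "w k a = volume_factor k (\<kappa> a) * indicator (ball 0 1) a" for k and a :: 'a
 note [measurable] = borel_open[OF open_ball[of "0::'a" 1]]
 have w[measurable]: "w k \<in> borel_measurable borel" for k unfolding w_def by measurable
 have step: "(%p. szego_step n (fst p) (snd p)) \<in> borel \<Otimes>\<^sub>M ?B \<rightarrow>\<^sub>M tuples (Suc n)"
 by (rule measurable_szego_step) measurable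
 note hs = meas_o[OF step h]
 have hD: "(%e. if e \<in> D k then g e else 0) \<in> borel_measurable (tuples k)"
 if g: "g \<in> borel_measurable (tuples k)" for k and g :: "_ => ennreal"
 by (rule measurable_If[OF g]) (use Dm in auto)
 define h' where "h' e = (\<integral>\<^sup>+a. h (szego_step n a e) * w n a \<partial>lborel)" for e
 have swap: "(%p. (snd p, fst p)) \<in> ?B \<Otimes>\<^sub>M borel \<rightarrow>\<^sub>M borel \<Otimes>\<^sub>M ?B" by measurable
 have h': "h' \<in> borel_measurable ?B"
 unfolding h'_def
 proof (rule lborel.borel_measurable_nn_integral)
 have "(%p. h (szego_step n (snd p) (fst p)) * w n (snd p)) \<in> borel_measurable (?B \<Otimes>\<^sub>M borel)"
 using meas_o[OF swap hs] meas_o[OF measurable_snd w]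
 by (intro borel_measurable_times_ennreal) simp_all
 then show "(%(e, a). h (szego_step n a e) * w n a) \<in> borel_measurable (?B \<Otimes>\<^sub>M lborel)"
 unfolding case_prod_unfold by (subst measurable_cong_sets[OF sets_pair_measure_cong refl]) auto
 qed
 have wm: "(%\<alpha>. \<Prod>k<m. w k (\<alpha> k)) \<in> borel_measurable (tuples m)" for m
 proof (rule borel_measurable_prod_ennreal)
 fix k assume k: "k \<in> {..<m}"
 show "(%\<alpha>. w k (\<alpha> k)) \<in> borel_measurable (tuples m)"
 by (rule meas_o[OF _ w]) (rule measurable_component_singleton[OF k])
 qed
 have "(\<integral>\<^sup>+\<alpha>. h (szego_coeffs (Suc n) \<alpha>) * (\<Prod>k<Suc n. w k (\<alpha> k)) \<partial>vol (Suc n)) =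
 (\<integral>\<^sup>+\<alpha>. \<integral>\<^sup>+a. h (szego_coeffs (Suc n) (\<alpha>(n := a))) * (\<Prod>k<Suc n. w k ((\<alpha>(n := a)) k)) \<partial>lborel \<partial>?P)"
 by (rule nn_integral_PiM_Suc)
 (use meas_o[OF measurable_szego_coeffs h] wm[of "Suc n"] in "simp only: measurable_PiM_lborel1 borel_measurable_times_ennreal")
 also have "... = (\<integral>\<^sup>+\<alpha>. h' (szego_coeffs n \<alpha>) * (\<Prod>k<n. w k (\<alpha> k)) \<partial>?P)"
 proof (rule nn_integral_cong)
 fix \<alpha> :: "nat => 'a" assume "\<alpha> \<in> space ?P"
 then have \<alpha>: "\<alpha> \<in> space ?B" by (simp add: space_PiM)
 have "szego_coeffs n (\<alpha>(n := a)) = szego_coeffs n \<alpha>" for a by (rule szego_coeffs_cong) simp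
 then have eq: "h (szego_coeffs (Suc n) (\<alpha>(n := a))) * (\<Prod>k<Suc n. w k ((\<alpha>(n := a)) k)) =
 (h (szego_step n a (szego_coeffs n \<alpha>)) * w n a) * (\<Prod>k<n. w k (\<alpha> k))" for a
 by (simp add: mult_ac)
 have "(%a. (a, szego_coeffs n \<alpha>)) \<in> borel \<rightarrow>\<^sub>M borel \<Otimes>\<^sub>M ?B"
 by (intro measurable_Pair measurable_const) (use measurable_space[OF measurable_szego_coeffs \<alpha>] in auto)
 from meas_o[OF this hs]
 have m: "(%a. h (szego_step n a (szego_coeffs n \<alpha>)) * w n a) \<in> borel_measurable lborel"
 using w by (simp add: borel_measurable_times_ennreal)
 show "(\<integral>\<^sup>+a. h (szego_coeffs (Suc n) (\<alpha>(n := a))) * (\<Prod>k<Suc n. w k ((\<alpha>(n := a)) k)) \<partial>lborel) =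
 h' (szego_coeffs n \<alpha>) * (\<Prod>k<n. w k (\<alpha> k))"
 unfolding eq h'_def by (rule nn_integral_multc[OF m])
 qed
 also have "... = (\<integral>\<^sup>+e. (if e \<in> D n then h' e else 0) \<partial>?P)"
 unfolding w_def by (rule Suc.IH[OF h'])
 also have "... = (\<integral>\<^sup>+e. \<integral>\<^sup>+a. (if e \<in> D n then h (szego_step n a e) * w n a else 0) \<partial>lborel \<partial>?P)"
 unfolding h'_def by (rule nn_integral_cong) simp
 also have "... = (\<integral>\<^sup>+a. \<integral>\<^sup>+e. (if e \<in> D n then h (szego_step n a e) * w n a else 0) \<partial>?P \<partial>lborel)"
 proof (rule nn_integral_lborel_PiM_Fubini[symmetric])
 have "{p \<in> space (borel \<Otimes>\<^sub>M ?B). snd p \<in> D n} = snd -` {e \<in> space ?B. e \<in> D n} \<inter> space ((borel :: 'a measure) \<Otimes>\<^sub>M ?B)"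
 by (auto simp: space_pair_measure)
 also have "... \<in> sets (borel \<Otimes>\<^sub>M ?B)" by (rule measurable_sets[OF measurable_snd Dm])
 finally show "(%(a, e). if e \<in> D n then h (szego_step n a e) * w n a else 0) \<in> borel_measurable (borel \<Otimes>\<^sub>M ?B)"
 unfolding case_prod_unfold
 using hs meas_o[OF measurable_fst w]
 by (intro measurable_If borel_measurable_times_ennreal measurable_const) auto
 qed
 also have "... = (\<integral>\<^sup>+a. \<integral>\<^sup>+x. (if x(n := - \<kappa> a) \<in> D (Suc n) then h (x(n := - \<kappa> a)) else 0) \<partial>?P \<partial>lborel)"
 proof (rule nn_integral_cong)
 fix a :: 'a
 show "(\<integral>\<^sup>+e. (if e \<in> D n then h (szego_step n a e) * w n a else 0) \<partial>?P) =
 (\<integral>\<^sup>+x. (if x(n := - \<kappa> a) \<in> D (Suc n) then h (x(n := - \<kappa> a)) else 0) \<partial>?P)"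
 proof (cases "norm a < 1")
 case False
 have "x(n := - \<kappa> a) \<notin> D (Suc n)" for x :: "nat => 'a"
  using Dlast[of "x(n := - \<kappa> a)" n] False by auto
 moreover have "w n a = 0" using False by (simp add: w_def)
 ultimately show ?thesis by (simp cong: if_cong)
 next
 case True
 define g where "g x = (if x(n := - \<kappa> a) \<in> D (Suc n) then h (x(n := - \<kappa> a)) else 0)" for x
 have up: "(%x. x(n := - \<kappa> a)) \<in> ?B \<rightarrow>\<^sub>M tuples (Suc n)" by (rule measurable_fun_upd_Suc) auto
 have g: "g \<in> borel_measurable ?B"
  using meas_o[OF up hD[OF h]] unfolding g_def .
 have gs: "g (reflect_shift n (\<kappa> a) e) = (if e \<in> D n then h (szego_step n a e) else 0)" for e
  unfolding g_def szego_step_def[symmetric] Dstep[OF True] ..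
 have gm: "(%e. g (reflect_shift n (\<kappa> a) e)) \<in> borel_measurable ?P"
  unfolding gs measurable_PiM_lborel1
 proof (rule hD)
  have "(%e. (a, e)) \<in> ?B \<rightarrow>\<^sub>M borel \<Otimes>\<^sub>M ?B" by measurable
  from meas_o[OF this hs] show "(%e. h (szego_step n a e)) \<in> borel_measurable ?B" by simp
 qed
 have "(\<integral>\<^sup>+e. (if e \<in> D n then h (szego_step n a e) * w n a else 0) \<partial>?P) =
  (\<integral>\<^sup>+e. volume_factor n (\<kappa> a) * g (reflect_shift n (\<kappa> a) e) \<partial>?P)"
  unfolding gs w_def using True by (intro nn_integral_cong) (simp add: mult.commute)
 also have "... = volume_factor n (\<kappa> a) * (\<integral>\<^sup>+e. g (reflect_shift n (\<kappa> a) e) \<partial>?P)"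
  by (rule nn_integral_cmult[OF gm])
 also have "... = (\<integral>\<^sup>+x. g x \<partial>?P)"
  by (rule nn_integral_reflect_shift[OF _ g]) (use True in simp)
 finally show ?thesis unfolding g_def .
 qed
 qed
 also have "... = (\<integral>\<^sup>+y. \<integral>\<^sup>+x. (if x(n := y) \<in> D (Suc n) then h (x(n := y)) else 0) \<partial>?P \<partial>lborel)"
 proof (rule \<kappa>_reflect)
 interpret P: sigma_finite_measure ?P by (rule sigma_finite_PiM_lborel)
 have "(%p. (snd p)(n := fst p)) \<in> borel \<Otimes>\<^sub>M ?B \<rightarrow>\<^sub>M tuples (Suc n)"
 by (rule measurable_fun_upd_Suc) measurable
 from meas_o[OF this hD[OF h]]
 have "(%(y, x). if x(n := y) \<in> D (Suc n) then h (x(n := y)) else 0) \<in> borel_measurable (borel \<Otimes>\<^sub>M ?P)"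
 unfolding case_prod_unfold by (subst measurable_cong_sets[OF sets_pair_measure_cong refl]) (auto simp: sets_PiM_lborel)
 then show "(%y. \<integral>\<^sup>+x. (if x(n := y) \<in> D (Suc n) then h (x(n := y)) else 0) \<partial>?P) \<in> borel_measurable borel"
 by (rule P.borel_measurable_nn_integral)
 qed
 also have "... = (\<integral>\<^sup>+e. (if e \<in> D (Suc n) then h e else 0) \<partial>vol (Suc n))"
 by (rule nn_integral_PiM_Suc_rev[symmetric]) (use hD[OF h] in "simp only: measurable_PiM_lborel1")
 finally show ?case unfolding w_def .
qed

end

section \<open>The characteristic polynomial of a CMV matrix\<close>

text \<open>The Szego recursion for the monic orthogonal polynomials and their reversals.\<close>
fun Phi :: "nat => (nat => complex) => complex poly" and PhiS :: "nat => (nat => complex) => complex poly" where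
 "Phi 0 a = 1"
| "Phi (Suc k) a = pCons 0 (Phi k a) - Polynomial.smult (cnj (a k)) (PhiS k a)"
| "PhiS 0 a = 1"
| "PhiS (Suc k) a = PhiS k a - Polynomial.smult (a k) (pCons 0 (Phi k a))"

lemma degree_Phi_aux: "degree (PhiS n a) <= n & degree (Phi n a) <= n & coeff (Phi n a) n = 1"
proof (induction n)
 case (Suc n)
 then have 1: "degree (pCons 0 (Phi n a)) <= Suc n" by (simp add: degree_pCons_le le_trans)
 have "coeff (PhiS n a) (Suc n) = 0" using Suc by (intro coeff_eq_0) auto
 moreover have "degree (pCons 0 (Phi n a) - Polynomial.smult (cnj (a n)) (PhiS n a)) <= Suc n"
 using 1 Suc by (intro degree_diff_le) (auto intro: order_trans[OF degree_smult_le])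
 moreover have "degree (PhiS n a - Polynomial.smult (a n) (pCons 0 (Phi n a))) <= Suc n"
 using 1 Suc by (intro degree_diff_le order_trans[OF degree_smult_le]) auto
 ultimately show ?case using Suc by simp
qed simp

lemma degree_Phi [simp]: "degree (Phi n a) = n" and lead_coeff_Phi [simp]: "coeff (Phi n a) n = 1"
 using degree_Phi_aux[of n a] le_degree[of "Phi n a" n] by auto

lemma det_tridiagonal:
 fixes t :: "nat => nat => 'a::comm_ring_1"
 assumes t: "!!i j. i + 1 < j \<or> j + 1 < i ==> t i j = 0"
 shows "det (mat (k+2) (k+2) (%(i, j). t i j)) =
 t (k+1) (k+1) * det (mat (k+1) (k+1) (%(i, j). t i j)) - t k (k+1) * t (k+1) k * det (mat k k (%(i, j). t i j))"
proof -
 let ?A = "mat (k+2) (k+2) (%(i, j). t i j)"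
 define B where "B = mat_delete ?A (k+1) k"
 have B: "B \<in> carrier_mat (k+1) (k+1)" unfolding B_def by (auto simp: mat_delete_def)
 have Bij: "B $$ (i, j) = t i (if j < k then j else j + 1)" if "i < k+1" "j < k+1" for i j
 using that by (simp add: B_def mat_delete_def)
 have "det B = (\<Sum>i<k+1. B $$ (i, k) * cofactor B i k)"
 by (rule laplace_expansion_column[OF B]) simp
 also have "... = (\<Sum>i\<in>{k}. B $$ (i, k) * cofactor B i k)"
 by (rule sum.mono_neutral_right) (auto simp: Bij t)
 also have "... = t k (k+1) * det (mat_delete B k k)"
 by (simp add: Bij cofactor_def)
 also have "mat_delete B k k = mat k k (%(i, j). t i j)"
 using B by (intro eq_matI) (auto simp: mat_delete_def Bij)
 finally have dB: "det B = t k (k+1) * det (mat k k (%(i, j). t i j))" .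
 have "det ?A = (\<Sum>j<k+2. ?A $$ (k+1, j) * cofactor ?A (k+1) j)"
 by (rule laplace_expansion_row) auto
 also have "... = (\<Sum>j\<in>{k, k+1}. ?A $$ (k+1, j) * cofactor ?A (k+1) j)"
 by (rule sum.mono_neutral_right) (auto simp: t)
 also have "... = t (k+1) k * cofactor ?A (k+1) k + t (k+1) (k+1) * cofactor ?A (k+1) (k+1)"
 by simp
 also have "cofactor ?A (k+1) k = - det B"
 by (simp add: cofactor_def B_def)
 also have "cofactor ?A (k+1) (k+1) = det (mat_delete ?A (k+1) (k+1))"
 by (simp add: cofactor_def)
 also have "mat_delete ?A (k+1) (k+1) = mat (k+1) (k+1) (%(i, j). t i j)"
 by (intro eq_matI) (auto simp: mat_delete_def)
 finally show ?thesis unfolding dB by (simp add: algebra_simps)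
qed

definition rho :: "complex => complex" where "rho a = of_real (sqrt (1 - (norm a)\<^sup>2))"

lemma rho_cnj [simp]: "rho (cnj a) = rho a" by (simp add: rho_def)

lemma rho_square: "norm a <= 1 ==> rho a * rho a = 1 - a * cnj a"
proof -
 assume "norm a <= 1"
 then have "1 - (norm a)\<^sup>2 \<ge> 0" by (simp add: power_le_one)
 then have "rho a * rho a = of_real (1 - (norm a)\<^sup>2)"
 unfolding rho_def of_real_mult[symmetric] by simp
 then show ?thesis by (simp only: of_real_diff of_real_1 complex_norm_square)
qed

definition L_entry :: "(nat => complex) => nat => nat => complex" where
 "L_entry a i j = (if even i then (if j = i then cnj (a i) else if j = Suc i then rho (a i) else 0)
 else (if j = i then - a (i - 1) else if Suc j = i then rho (a (i - 1)) else 0))"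

definition M_entry :: "(nat => complex) => nat => nat => complex" where
 "M_entry a i j = (if i = 0 \<or> j = 0 then (if i = j then 1 else 0) else L_entry (a \<circ> Suc) (i - 1) (j - 1))"

lemma CMV_block_Suc: "CMV_block (Suc n) a (Suc k) = CMV_block n (a \<circ> Suc) k"
 unfolding CMV_block_def by (simp add: Let_def)

lemma L_entry_off_tridiagonal:
 assumes "i + 1 < j \<or> j + 1 < i"
 shows "L_entry a i j = 0"
proof -
 have "j ~= i" "j ~= Suc i" "Suc j ~= i" using assms by linarith+
 then show ?thesis by (simp add: L_entry_def)
qed

lemma M_entry_off_tridiagonal:
 assumes "i + 1 < j \<or> j + 1 < i"
 shows "M_entry a i j = 0"
proof (cases "i = 0 \<or> j = 0")
 case True
 have "i ~= j" using assms by linarith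
 with True show ?thesis by (simp add: M_entry_def)
next
 case False
 then have "i - 1 + 1 < j - 1 \<or> j - 1 + 1 < i - 1" using assms by linarith
 then have "L_entry (a \<circ> Suc) (i - 1) (j - 1) = 0" by (rule L_entry_off_tridiagonal)
 with False show ?thesis by (simp add: M_entry_def)
qed

lemma filter_even_Suc_Suc: "filter even [0..<Suc (Suc n)] = 0 # map (Suc \<circ> Suc) (filter even [0..<n])"
proof -
 have "[0..<Suc (Suc n)] = 0 # 1 # map (Suc \<circ> Suc) [0..<n]"
 by (simp add: upt_conv_Cons map_Suc_upt map_map[symmetric] del: map_map upt_Suc)
 then show ?thesis by (simp add: filter_map comp_def del: upt_Suc)
qed

lemma filter_odd_conv: "filter odd [0..<Suc n] = map Suc (filter even [0..<n])"
proof -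
 have "[0..<Suc n] = 0 # map Suc [0..<n]"
 by (simp add: upt_conv_Cons map_Suc_upt del: upt_Suc)
 then show ?thesis by (simp add: filter_map comp_def del: upt_Suc)
qed

lemma CMV_L_Suc_Suc:
 "CMV_L (Suc (Suc n)) a = (let B = CMV_block (Suc (Suc n)) a 0; C = CMV_L n (a \<circ> Suc \<circ> Suc) in
 four_block_mat B (0\<^sub>m (dim_row B) (dim_col C)) (0\<^sub>m (dim_row C) (dim_col B)) C)"
proof -
 have eq: "map (CMV_block (Suc (Suc n)) a \<circ> (Suc \<circ> Suc)) (filter even [0..<n]) =
 map (CMV_block n (a \<circ> Suc \<circ> Suc)) (filter even [0..<n])"
 by (rule map_cong) (simp_all add: CMV_block_Suc comp_assoc)
 show ?thesis unfolding CMV_L_def filter_even_Suc_Suc list.map map_map eq diag_block_mat.simps Let_def ..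
qed

lemma CMV_block_full: "Suc k < n ==> CMV_block n a k = mat 2 2 (%(i, j). if i = 0 then (if j = 0 then cnj (a k) else rho (a k)) else (if j = 0 then rho (a k) else - a k))"
 by (rule eq_matI) (auto simp: CMV_block_def mat_of_rows_list_def Let_def rho_def less_2_cases_iff)

lemma CMV_L_eq: "CMV_L n a = mat n n (%(i, j). L_entry a i j)"
proof (induction n arbitrary: a rule: induct_nat_012)
 case 0
 show ?case by (rule eq_matI) (auto simp: CMV_L_def)
next
 case 1
 have "CMV_L 1 a = mat 1 1 (%_. cnj (a 0))"
 by (rule eq_matI) (auto simp: CMV_L_def CMV_block_def mat_of_rows_list_def Let_def)
 then show ?case by (auto intro!: eq_matI simp: L_entry_def)
next
 case (ge2 n)
 have e: "L_entry a (Suc (Suc i)) (Suc (Suc j)) = L_entry (a \<circ> Suc \<circ> Suc) i j" for i j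
 by (cases i) (simp_all add: L_entry_def)
 have z: "L_entry a 0 (Suc (Suc j)) = 0" "L_entry a (Suc 0) (Suc (Suc j)) = 0"
 "L_entry a (Suc (Suc j)) 0 = 0" "L_entry a (Suc (Suc j)) (Suc 0) = 0" for j
 by (simp_all add: L_entry_def)
 have b: "L_entry a 0 0 = cnj (a 0)" "L_entry a 0 (Suc 0) = rho (a 0)" "L_entry a (Suc 0) 0 = rho (a 0)" "L_entry a (Suc 0) (Suc 0) = - a 0"
 by (simp_all add: L_entry_def)
 have c: "i = 0 \<or> i = Suc 0 \<or> (\<exists>i'. i = Suc (Suc i'))" for i
 by (metis not0_implies_Suc)
 have B: "CMV_block (Suc (Suc n)) a 0 = mat 2 2 (%(i, j). if i = 0 then (if j = 0 then cnj (a 0) else rho (a 0)) else (if j = 0 then rho (a 0) else - a 0))"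
 by (rule CMV_block_full) simp
 show ?case
 proof (rule eq_matI)
 fix i j assume "i < dim_row (mat (Suc (Suc n)) (Suc (Suc n)) (%(i, j). L_entry a i j))"
 "j < dim_col (mat (Suc (Suc n)) (Suc (Suc n)) (%(i, j). L_entry a i j))"
 then show "CMV_L (Suc (Suc n)) a $$ (i, j) = mat (Suc (Suc n)) (Suc (Suc n)) (%(i, j). L_entry a i j) $$ (i, j)"
 using c[of i] c[of j] unfolding CMV_L_Suc_Suc Let_def ge2(1) B
 by (elim disjE exE) (simp_all add: e z b)
 qed (simp_all add: CMV_L_Suc_Suc Let_def ge2(1) B)
qed

lemma CMV_M_eq: "n \<ge> 1 ==> CMV_M n a = mat n n (%(i, j). M_entry a i j)"
proof -
 assume "n \<ge> 1"
 then obtain m where n: "n = Suc m" by (cases n) auto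
 have eq: "map (CMV_block (Suc m) a \<circ> Suc) (filter even [0..<m]) =
 map (CMV_block m (a \<circ> Suc)) (filter even [0..<m])"
 by (rule map_cong) (simp_all add: CMV_block_Suc)
 have "CMV_M n a = (let C = CMV_L m (a \<circ> Suc) in
 four_block_mat (1\<^sub>m 1) (0\<^sub>m 1 (dim_col C)) (0\<^sub>m (dim_row C) 1) C)"
 unfolding CMV_M_def CMV_L_def n filter_odd_conv map_map eq diag_block_mat.simps Let_def by simp
 then show ?thesis unfolding n CMV_L_eq
 unfolding Let_def by (intro eq_matI) (simp_all add: M_entry_def)
qed

text \<open>Complete diagonal blocks occur for even \<open>n\<close> only. Conjugating all parameters gives the adjoint because the blocks are symmetric.\<close>
lemma CMV_L_unitary:
 assumes "even n" "!!k. k < n ==> norm (a k) <= 1"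
 shows "CMV_L n (%k. cnj (a k)) * CMV_L n a = 1\<^sub>m n"
proof (rule eq_matI)
 fix i j assume "i < dim_row (1\<^sub>m n)" "j < dim_col (1\<^sub>m n)"
 then have ij: "i < n" "j < n" by auto
 define p where "p = (if even i then Suc i else i - 1)"
 have p: "p < n" "p ~= i" using ij \<open>even n\<close> by (auto simp: p_def elim!: oddE evenE)
 have "(CMV_L n (%k. cnj (a k)) * CMV_L n a) $$ (i, j) = (\<Sum>k<n. L_entry (%k. cnj (a k)) i k * L_entry a k j)"
 using ij by (simp add: CMV_L_eq scalar_prod_def atLeast0LessThan)
 also have "... = (\<Sum>k\<in>{i, p}. L_entry (%k. cnj (a k)) i k * L_entry a k j)"
 by (rule sum.mono_neutral_right) (use ij p in "auto simp: L_entry_def p_def split: if_splits")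
 also have "... = L_entry (%k. cnj (a k)) i i * L_entry a i j + L_entry (%k. cnj (a k)) i p * L_entry a p j"
 using p by simp
 also have "... = (if i = j then 1 else 0)"
 proof (cases "even i")
 case True
 have "rho (a i) * rho (a i) = 1 - a i * cnj (a i)" using ij assms(2) by (intro rho_square) auto
 with True show ?thesis by (auto simp: L_entry_def p_def mult.commute)
 next
 case False
 then obtain m where i: "i = Suc m" "even m" by (cases i) auto
 have "rho (a m) * rho (a m) = 1 - a m * cnj (a m)" using ij i assms(2) by (intro rho_square) auto
 with i show ?thesis by (auto simp: L_entry_def p_def mult.commute)
 qed
 finally show "(CMV_L n (%k. cnj (a k)) * CMV_L n a) $$ (i, j) = 1\<^sub>m n $$ (i, j)"
 using ij by simp
qed (simp_all add: CMV_L_eq)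

lemma CMV_M_unitary:
 assumes "odd n" "!!k. k < n ==> norm (a k) <= 1"
 shows "CMV_M n (%k. cnj (a k)) * CMV_M n a = 1\<^sub>m n"
proof -
 obtain m where n: "n = Suc m" "even m" using assms(1) by (cases n) auto
 have L: "CMV_L m (%k. cnj (a (Suc k))) * CMV_L m (%k. a (Suc k)) = 1\<^sub>m m"
 by (rule CMV_L_unitary) (use n assms(2) in auto)
 show ?thesis
 proof (rule eq_matI)
 fix i j assume "i < dim_row (1\<^sub>m n)" "j < dim_col (1\<^sub>m n)"
 then have ij: "i < n" "j < n" by auto
 have "(CMV_M n (%k. cnj (a k)) * CMV_M n a) $$ (i, j) = (\<Sum>k<n. M_entry (%k. cnj (a k)) i k * M_entry a k j)"
 using ij by (simp add: CMV_M_eq scalar_prod_def atLeast0LessThan)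
 also have "... = M_entry (%k. cnj (a k)) i 0 * M_entry a 0 j + (\<Sum>k<m. M_entry (%k. cnj (a k)) i (Suc k) * M_entry a (Suc k) j)"
 unfolding n(1) by (rule sum.lessThan_Suc_shift)
 also have "... = (if i = j then 1 else 0)"
 proof (cases "i = 0 \<or> j = 0")
 case True
 then show ?thesis by (auto simp: M_entry_def)
 next
 case False
 then obtain i' j' where i': "i = Suc i'" "j = Suc j'" by (metis not0_implies_Suc)
 then have ij': "i' < m" "j' < m" using ij n by auto
 have "(\<Sum>k<m. M_entry (%k. cnj (a k)) i (Suc k) * M_entry a (Suc k) j) =
  (CMV_L m (%k. cnj (a (Suc k))) * CMV_L m (%k. a (Suc k))) $$ (i', j')"
  using ij' by (simp add: CMV_L_eq scalar_prod_def atLeast0LessThan i' M_entry_def comp_def)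
 then show ?thesis unfolding L using ij' by (simp add: i' M_entry_def)
 qed
 finally show "(CMV_M n (%k. cnj (a k)) * CMV_M n a) $$ (i, j) = 1\<^sub>m n $$ (i, j)"
 using ij by simp
 qed (use n in "simp_all add: CMV_M_eq")
qed

lemma det_mat_Suc_0: "det (mat (Suc 0) (Suc 0) f) = f (0, 0)"
proof -
 have "mat (Suc 0) (Suc 0) f \<in> carrier_mat 1 1"
 unfolding One_nat_def by (rule mat_carrier)
 from det_single[OF this] have "det (mat (Suc 0) (Suc 0) f) = mat (Suc 0) (Suc 0) f $$ (0, 0)" .
 also have "... = f (0, 0)" by (rule index_mat(1)) (rule zero_less_Suc)+
 finally show ?thesis .
qed

text \<open>The pencil is tridiagonal, so its leading minors satisfy a three-term recurrence. By the Szego recursion \<open>Phi\<close> and \<open>PhiS\<close>, taken alternately, satisfy it too.\<close>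
lemma det_CMV_pencil_even:
 assumes a: "!!k. Suc k < n ==> norm (a k) <= 1" and "k <= n"
 shows "det (mat k k (%(i, j). z * L_entry (%k. cnj (a k)) i j - M_entry a i j)) =
 (if even k then (-1) ^ (k div 2) * poly (Phi k a) z else (-1) ^ (Suc k div 2) * poly (PhiS k a) z)"
 using \<open>k <= n\<close>
proof (induction k rule: induct_nat_012)
 case 0
 show ?case by simp
next
 case 1
 have D1: "det (mat (Suc 0) (Suc 0) (%(i, j). z * L_entry (%k. cnj (a k)) i j - M_entry a i j)) = z * L_entry (%k. cnj (a k)) 0 0 - M_entry a 0 0"
 by (simp only: det_mat_Suc_0 prod.case)
 have v1: "L_entry (%k. cnj (a k)) 0 0 = a 0"
 by (simp add: L_entry_def)
 have v2: "M_entry a 0 0 = 1"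
 by (simp add: M_entry_def)
 have p: "poly (PhiS (Suc 0) a) z = 1 - a 0 * z"
 by (simp only: PhiS.simps Phi.simps poly_diff poly_smult poly_pCons poly_1 mult_1_right add_0)
 show ?case unfolding D1 v1 v2 p
 by simp
next
 case (ge2 m)
 define t where "t i j = z * L_entry (%k. cnj (a k)) i j - M_entry a i j" for i j
 have t0: "t i j = 0" if "i + 1 < j \<or> j + 1 < i" for i j
 unfolding t_def L_entry_off_tridiagonal[OF that] M_entry_off_tridiagonal[OF that] by simp
 have am: "rho (a m) * rho (a m) = 1 - a m * cnj (a m)" using a ge2.prems by (intro rho_square) auto
 have det: "det (mat (Suc (Suc m)) (Suc (Suc m)) (%(i, j). t i j)) =
 t (Suc m) (Suc m) * det (mat (Suc m) (Suc m) (%(i, j). t i j)) - t m (Suc m) * t (Suc m) m * det (mat m m (%(i, j). t i j))"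
 using det_tridiagonal[of t m] t0 by simp
 note IH = ge2.IH(1)[folded t_def] ge2.IH(2)[folded t_def]
 define u where "u = poly (Phi m a) z"
 define v where "v = poly (PhiS m a) z"
 define s where "s = ((-1) ^ (m div 2) :: complex)"
 define s' where "s' = ((-1) ^ (Suc m div 2) :: complex)"
 show ?case (is "_ = ?rhs")
 proof (cases "even m")
 case True
 have t: "t (Suc m) (Suc m) = - z * cnj (a m) - cnj (a (Suc m))" "t m (Suc m) = z * rho (a m)" "t (Suc m) m = z * rho (a m)"
 using True by (auto simp: t_def L_entry_def M_entry_def)
 have "t m (Suc m) * t (Suc m) m = z * z * (rho (a m) * rho (a m))"
 unfolding t by (simp add: mult_ac)
 then have tt: "t m (Suc m) * t (Suc m) m = z * z * (1 - a m * cnj (a m))"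
 unfolding am .
 have D0: "det (mat m m (%(i, j). t i j)) = s * u"
 using IH(1) True ge2.prems by (simp add: s_def u_def)
 have D1: "det (mat (Suc m) (Suc m) (%(i, j). t i j)) = - s * (v - a m * (z * u))"
 using IH(2) True ge2.prems by (simp add: s_def u_def v_def)
 have R: "?rhs = - s * (z * (z * u - cnj (a m) * v) - cnj (a (Suc m)) * (v - a m * (z * u)))"
 using True by (simp add: s_def u_def v_def)
 show ?thesis
 unfolding R unfolding t_def[symmetric] det D0 D1 tt t(1) by (simp add: algebra_simps)
 next
 case False
 then obtain l where m: "m = Suc l" by (cases m) auto
 have t: "t (Suc m) (Suc m) = z * a (Suc m) + a m" "t m (Suc m) = - rho (a m)" "t (Suc m) m = - rho (a m)"
 using False m by (auto simp: t_def L_entry_def M_entry_def)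
 have tt: "t m (Suc m) * t (Suc m) m = 1 - a m * cnj (a m)"
 unfolding t by (simp add: am)
 have D0: "det (mat m m (%(i, j). t i j)) = s' * v"
 using IH(1) False ge2.prems by (simp add: s'_def v_def)
 have D1: "det (mat (Suc m) (Suc m) (%(i, j). t i j)) = s' * (z * u - cnj (a m) * v)"
 using IH(2) False ge2.prems by (simp add: s'_def u_def v_def)
 have R: "?rhs = - s' * (v - a m * (z * u) - a (Suc m) * (z * (z * u - cnj (a m) * v)))"
 using False by (simp add: s'_def u_def v_def)
 show ?thesis
 unfolding R unfolding t_def[symmetric] det D0 D1 tt t(1) by (simp add: algebra_simps)
 qed
qed

lemma det_CMV_pencil_odd:
 assumes a: "!!k. Suc k < n ==> norm (a k) <= 1" and "k <= n"
 shows "det (mat k k (%(i, j). z * M_entry (%k. cnj (a k)) i j - L_entry a i j)) =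
 (if even k then (-1) ^ (k div 2) * poly (PhiS k a) z else (-1) ^ (k div 2) * poly (Phi k a) z)"
 using \<open>k <= n\<close>
proof (induction k rule: induct_nat_012)
 case 0
 show ?case by simp
next
 case 1
 have D1: "det (mat (Suc 0) (Suc 0) (%(i, j). z * M_entry (%k. cnj (a k)) i j - L_entry a i j)) = z * M_entry (%k. cnj (a k)) 0 0 - L_entry a 0 0"
 by (simp only: det_mat_Suc_0 prod.case)
 have v1: "L_entry a 0 0 = cnj (a 0)"
 by (simp add: L_entry_def)
 have v2: "M_entry (%k. cnj (a k)) 0 0 = 1"
 by (simp add: M_entry_def)
 have p: "poly (Phi (Suc 0) a) z = z - cnj (a 0)"
 by (simp only: PhiS.simps Phi.simps poly_diff poly_smult poly_pCons poly_1 mult_1_right add_0)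
 show ?case unfolding D1 v1 v2 p
 by simp
next
 case (ge2 m)
 define t where "t i j = z * M_entry (%k. cnj (a k)) i j - L_entry a i j" for i j
 have t0: "t i j = 0" if "i + 1 < j \<or> j + 1 < i" for i j
 unfolding t_def L_entry_off_tridiagonal[OF that] M_entry_off_tridiagonal[OF that] by simp
 have am: "rho (a m) * rho (a m) = 1 - a m * cnj (a m)" using a ge2.prems by (intro rho_square) auto
 have det: "det (mat (Suc (Suc m)) (Suc (Suc m)) (%(i, j). t i j)) =
 t (Suc m) (Suc m) * det (mat (Suc m) (Suc m) (%(i, j). t i j)) - t m (Suc m) * t (Suc m) m * det (mat m m (%(i, j). t i j))"
 using det_tridiagonal[of t m] t0 by simp
 note IH = ge2.IH(1)[folded t_def] ge2.IH(2)[folded t_def]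
 define u where "u = poly (Phi m a) z"
 define v where "v = poly (PhiS m a) z"
 define s where "s = ((-1) ^ (m div 2) :: complex)"
 define s' where "s' = ((-1) ^ (m div 2) :: complex)"
 show ?case (is "_ = ?rhs")
 proof (cases "even m")
 case True
 have t: "t (Suc m) (Suc m) = z * a (Suc m) + a m" "t m (Suc m) = - rho (a m)" "t (Suc m) m = - rho (a m)"
 using True by (auto simp: t_def L_entry_def M_entry_def)
 have tt: "t m (Suc m) * t (Suc m) m = 1 - a m * cnj (a m)"
 unfolding t by (simp add: am)
 have D0: "det (mat m m (%(i, j). t i j)) = s' * v"
 using IH(1) True ge2.prems by (simp add: s'_def v_def)
 have D1: "det (mat (Suc m) (Suc m) (%(i, j). t i j)) = s' * (z * u - cnj (a m) * v)"
 using IH(2) True ge2.prems by (simp add: s'_def u_def v_def)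
 have R: "?rhs = - s' * (v - a m * (z * u) - a (Suc m) * (z * (z * u - cnj (a m) * v)))"
 using True by (simp add: s'_def u_def v_def)
 show ?thesis
 unfolding R unfolding t_def[symmetric] det D0 D1 tt t(1) by (simp add: algebra_simps)
 next
 case False
 then obtain l where m: "m = Suc l" by (cases m) auto
 have t: "t (Suc m) (Suc m) = - z * cnj (a m) - cnj (a (Suc m))" "t m (Suc m) = z * rho (a m)" "t (Suc m) m = z * rho (a m)"
 using False m by (auto simp: t_def L_entry_def M_entry_def)
 have "t m (Suc m) * t (Suc m) m = z * z * (rho (a m) * rho (a m))"
 unfolding t by (simp add: mult_ac)
 then have tt: "t m (Suc m) * t (Suc m) m = z * z * (1 - a m * cnj (a m))"
 unfolding am .
 have D0: "det (mat m m (%(i, j). t i j)) = s * u"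
 using IH(1) False ge2.prems by (simp add: s_def u_def)
 have D1: "det (mat (Suc m) (Suc m) (%(i, j). t i j)) = - s * (v - a m * (z * u))"
 using IH(2) False ge2.prems by (simp add: s_def u_def v_def)
 have R: "?rhs = - s * (z * (z * u - cnj (a m) * v) - cnj (a (Suc m)) * (v - a m * (z * u)))"
 using False by (simp add: s_def u_def v_def)
 show ?thesis
 unfolding R unfolding t_def[symmetric] det D0 D1 tt t(1) by (simp add: algebra_simps)
 qed
qed

text \<open>One of the two factors is unitary, say \<open>L\<close>; multiplying \<open>z - L M\<close> by its adjoint turns the characteristic determinant into that of a tridiagonal pencil. The constant factor is found by comparing leading coefficients.\<close>
theorem char_poly_CMV:
 assumes n: "n \<ge> 1" and a: "!!k. k < n ==> norm (a k) <= 1"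
 shows "char_poly (CMV n a) = Phi n a"
proof -
 have carr: "CMV_L n b \<in> carrier_mat n n" "CMV_M n b \<in> carrier_mat n n" for b
 using n by (simp_all add: CMV_L_eq CMV_M_eq)
 then have C: "CMV n a \<in> carrier_mat n n" unfolding CMV_def by (rule mult_carrier_mat)
 have ev: "poly (char_poly (CMV n a)) z = det (z \<cdot>\<^sub>m 1\<^sub>m n - CMV n a)" for z
 unfolding char_poly_def
 by (rule poly_det_cong[of _ n]) (use C in "auto simp: char_poly_matrix_def")
 have Ma: "mat n n (%(i, j). L_entry b i j) = CMV_L n b" "mat n n (%(i, j). M_entry b i j) = CMV_M n b" for b
 using n by (simp_all add: CMV_L_eq CMV_M_eq)
 have dist: "mat n n (%(i, j). z * f i j - g i j) = z \<cdot>\<^sub>m mat n n (%(i, j). f i j) - mat n n (%(i, j). g i j)"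
 for z and f g :: "nat => nat => complex"
 by (rule eq_matI) auto
 obtain U s where U: "!!z. det U * poly (char_poly (CMV n a)) z = s * poly (Phi n a) z" and s: "s ~= 0"
 proof (cases "even n")
 case True
 let ?U = "CMV_L n (%k. cnj (a k))"
 have "det ?U * poly (char_poly (CMV n a)) z = (-1) ^ (n div 2) * poly (Phi n a) z" for z
 proof -
 have "det ?U * poly (char_poly (CMV n a)) z = det (?U * (z \<cdot>\<^sub>m 1\<^sub>m n - CMV n a))"
  unfolding ev using carr C by (intro det_mult[symmetric]) auto
 also have "?U * (z \<cdot>\<^sub>m 1\<^sub>m n - CMV n a) = z \<cdot>\<^sub>m ?U - ?U * CMV_L n a * CMV_M n a"
 proof -
  have "?U * (z \<cdot>\<^sub>m 1\<^sub>m n - CMV n a) = ?U * (z \<cdot>\<^sub>m 1\<^sub>m n) - ?U * CMV n a"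
  by (rule mult_minus_distrib_mat) (use carr C in auto)
  also have "?U * (z \<cdot>\<^sub>m 1\<^sub>m n) = z \<cdot>\<^sub>m ?U"
  unfolding mult_smult_distrib[OF carr(1) one_carrier_mat] right_mult_one_mat[OF carr(1)] ..
  also have "?U * CMV n a = ?U * CMV_L n a * CMV_M n a"
  unfolding CMV_def by (rule assoc_mult_mat[OF carr(1) carr(1) carr(2), symmetric])
  finally show ?thesis .
 qed
 also have "?U * CMV_L n a = 1\<^sub>m n" using True a by (rule CMV_L_unitary)
 also have "1\<^sub>m n * CMV_M n a = CMV_M n a" by (rule left_mult_one_mat[OF carr(2)])
 also have "z \<cdot>\<^sub>m ?U - CMV_M n a = mat n n (%(i, j). z * L_entry (%k. cnj (a k)) i j - M_entry a i j)"
  unfolding dist Ma ..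
 also have "det ... = (-1) ^ (n div 2) * poly (Phi n a) z"
  using det_CMV_pencil_even[of n a n z] a True by simp
 finally show ?thesis .
 qed
 then show thesis by (rule that) simp
 next
 case False
 let ?U = "CMV_M n (%k. cnj (a k))"
 have U: "?U * CMV_M n a = 1\<^sub>m n" using False a by (intro CMV_M_unitary) auto
 have U': "CMV_M n a * ?U = 1\<^sub>m n"
 by (rule mat_mult_left_right_inverse[OF _ _ U]) (use carr in auto)
 have "det ?U * poly (char_poly (CMV n a)) z = (-1) ^ (n div 2) * poly (Phi n a) z" for z
 proof -
 have "det ?U * poly (char_poly (CMV n a)) z = det ((z \<cdot>\<^sub>m 1\<^sub>m n - CMV n a) * ?U)"
  unfolding ev using carr C by (subst det_mult[of _ n]) (auto simp: mult.commute)
 also have "(z \<cdot>\<^sub>m 1\<^sub>m n - CMV n a) * ?U = z \<cdot>\<^sub>m ?U - CMV_L n a * (CMV_M n a * ?U)"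
 proof -
  have "(z \<cdot>\<^sub>m 1\<^sub>m n - CMV n a) * ?U = (z \<cdot>\<^sub>m 1\<^sub>m n) * ?U - CMV n a * ?U"
  by (rule minus_mult_distrib_mat) (use carr C in auto)
  also have "(z \<cdot>\<^sub>m 1\<^sub>m n) * ?U = z \<cdot>\<^sub>m ?U"
  unfolding mult_smult_assoc_mat[OF one_carrier_mat carr(2)] left_mult_one_mat[OF carr(2)] ..
  also have "CMV n a * ?U = CMV_L n a * (CMV_M n a * ?U)"
  unfolding CMV_def by (rule assoc_mult_mat[OF carr(1) carr(2) carr(2)])
  finally show ?thesis .
 qed
 also have "CMV_M n a * ?U = 1\<^sub>m n" by (rule U')
 also have "CMV_L n a * 1\<^sub>m n = CMV_L n a" by (rule right_mult_one_mat[OF carr(1)])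
 also have "z \<cdot>\<^sub>m ?U - CMV_L n a = mat n n (%(i, j). z * M_entry (%k. cnj (a k)) i j - L_entry a i j)"
  unfolding dist Ma ..
 also have "det ... = (-1) ^ (n div 2) * poly (Phi n a) z"
  using det_CMV_pencil_odd[of n a n z] a False by simp
 finally show ?thesis .
 qed
 then show thesis by (rule that) simp
 qed
 have "poly (Polynomial.smult (det U) (char_poly (CMV n a))) = poly (Polynomial.smult s (Phi n a))"
 using U by (simp add: fun_eq_iff)
 then have eq: "Polynomial.smult (det U) (char_poly (CMV n a)) = Polynomial.smult s (Phi n a)"
 by (simp add: poly_eq_poly_eq_iff)
 have "coeff (char_poly (CMV n a)) n = 1" using degree_monic_char_poly[OF C] by simp
 then have "det U = s" using arg_cong[OF eq, of "%p. coeff p n"] by simp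
 with eq s show ?thesis by (metis smult_cancel)
qed

section \<open>Roots in the disc and the Schur-Cohn determinant\<close>

text \<open>The linear change of variables formula in the plane.\<close>
lemma nn_integral_linear_complex:
 fixes P Q :: complex
 assumes d: "d = Re P * Im Q - Im P * Re Q" "d ~= 0" and g [measurable]: "g \<in> borel_measurable borel"
 shows "ennreal \<bar>d\<bar> * (\<integral>\<^sup>+y. g (of_real (Re y) * P + of_real (Im y) * Q) \<partial>lborel) = (\<integral>\<^sup>+z. g z \<partial>lborel)"
proof -
 define f where "f y = of_real (Re y) * P + of_real (Im y) * Q" for y
 define k where "k z = Complex ((Re z * Im Q - Im z * Re Q) / d) ((Re P * Im z - Im P * Re z) / d)" for z
 have fk: "f (k z) = z" for z
 proof -
 have "(Re z * Im Q - Im z * Re Q) * Re P + (Re P * Im z - Im P * Re z) * Re Q = Re z * d"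
  "(Re z * Im Q - Im z * Re Q) * Im P + (Re P * Im z - Im P * Re z) * Im Q = Im z * d"
 by (simp_all add: d(1) algebra_simps)
 then show ?thesis using d(2)
 by (simp add: f_def k_def complex_eq_iff flip: add_divide_distrib)
 qed
 have kf: "k (f y) = y" for y
 proof -
 have "(Re y * Re P + Im y * Re Q) * Im Q - (Re y * Im P + Im y * Im Q) * Re Q = Re y * d"
  "Re P * (Re y * Im P + Im y * Im Q) - Im P * (Re y * Re P + Im y * Re Q) = Im y * d"
 by (simp_all add: d(1) algebra_simps)
 then show ?thesis using d(2) by (simp add: f_def k_def complex_eq_iff)
 qed
 have fib: "{w. f w = z} = {k z}" for z using fk kf by auto
 have [measurable]: "f \<in> borel_measurable borel" unfolding f_def[abs_def]
 by (intro borel_measurable_continuous_onI continuous_intros)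
 have "(\<integral>\<^sup>+x. g (f x) * ennreal \<bar>Re P * Im Q - Im P * Re Q\<bar> * indicator UNIV x \<partial>lborel)
 = (\<integral>\<^sup>+z. (\<Sum>w\<in>{w \<in> UNIV. f w = z}. g (f w)) \<partial>lborel)"
 proof (rule area_formula_complex[OF open_UNIV])
 fix x :: complex
 have dR: "(Re has_derivative Re) (at x)" and dI: "(Im has_derivative Im) (at x)"
 by (intro bounded_linear_imp_has_derivative bounded_linear_Re bounded_linear_Im)+
 show "(f has_derivative (%v. of_real (Re v) * P + of_real (Im v) * Q)) (at x)"
 unfolding f_def[abs_def]
 by (intro has_derivative_add has_derivative_mult_left has_derivative_of_real dR dI)
 qed (use d fib in auto)
 then have "(\<integral>\<^sup>+x. g (f x) * ennreal \<bar>d\<bar> \<partial>lborel) = (\<integral>\<^sup>+z. g z \<partial>lborel)"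
 by (simp add: fib fk flip: d(1))
 also have "(\<integral>\<^sup>+x. g (f x) * ennreal \<bar>d\<bar> \<partial>lborel) = ennreal \<bar>d\<bar> * (\<integral>\<^sup>+x. g (f x) \<partial>lborel)"
 by (subst nn_integral_multc) (auto simp: mult.commute)
 finally show ?thesis unfolding f_def .
qed

interpretation cs: szego_field cnj "%a. ennreal ((1 - (norm a)\<^sup>2)\<^sup>2)" "%a. ennreal (1 - (norm a)\<^sup>2)"
proof
 fix g :: "complex => ennreal" and a c :: complex
 show "cnj \<in> borel_measurable borel" by (intro borel_measurable_continuous_onI continuous_intros)
 assume g: "g \<in> borel_measurable borel"
 show "(\<integral>\<^sup>+y. g (- cnj y) \<partial>lborel) = (\<integral>\<^sup>+y. g y \<partial>lborel)"
 proof -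
 have "of_real (Re y) * (- 1) + of_real (Im y) * \<i> = - cnj y" for y by (simp add: complex_eq_iff)
 then show ?thesis using nn_integral_linear_complex[of "- 1" "- 1" \<i>, OF _ _ g] by simp
 qed
 assume a: "norm a < 1"
 then have r: "1 - (norm a)\<^sup>2 > 0" by (simp add: power_less_one_iff)
 show "ennreal ((1 - (norm a)\<^sup>2)\<^sup>2) * (\<integral>\<^sup>+y. g ((1 - a * cnj a) * y + c) \<partial>lborel) = (\<integral>\<^sup>+y. g y \<partial>lborel)"
 proof -
 define s where "s = 1 - (norm a)\<^sup>2"
 have sa: "(1 - a * cnj a) = of_real s" unfolding s_def complex_norm_square[symmetric] by simp
 have "(\<integral>\<^sup>+y. g y \<partial>lborel) = ennreal \<bar>s\<^sup>2\<bar> * (\<integral>\<^sup>+y. g (of_real (Re y) * of_real s + of_real (Im y) * (\<i> * of_real s) + c) \<partial>lborel)"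
 proof -
 have "ennreal \<bar>s\<^sup>2\<bar> * (\<integral>\<^sup>+y. (%z. g (z + c)) (of_real (Re y) * of_real s + of_real (Im y) * (\<i> * of_real s)) \<partial>lborel) = (\<integral>\<^sup>+z. g (z + c) \<partial>lborel)"
  by (rule nn_integral_linear_complex) (use g r in "auto simp: s_def power2_eq_square")
 then show ?thesis using nn_integral_lborel_shift[OF g, of c] by simp
 qed
 moreover have "of_real (Re y) * of_real s + of_real (Im y) * (\<i> * of_real s) = of_real s * y" for y
 by (simp add: complex_eq_iff)
 ultimately show ?thesis unfolding sa s_def[symmetric] by simp
 qed
 show "ennreal (1 - (norm a)\<^sup>2) * (\<integral>\<^sup>+y. g (y - a * cnj y) \<partial>lborel) = (\<integral>\<^sup>+y. g y \<partial>lborel)"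
 proof -
 have e: "of_real (Re y) * (1 - a) + of_real (Im y) * (\<i> * (1 + a)) = y - a * cnj y" for y
 by (simp add: complex_eq_iff algebra_simps)
 have "ennreal \<bar>1 - (norm a)\<^sup>2\<bar> * (\<integral>\<^sup>+y. g (of_real (Re y) * (1 - a) + of_real (Im y) * (\<i> * (1 + a))) \<partial>lborel) = (\<integral>\<^sup>+y. g y \<partial>lborel)"
 proof (rule nn_integral_linear_complex[OF _ _ g])
 show "1 - (norm a)\<^sup>2 = Re (1 - a) * Im (\<i> * (1 + a)) - Im (1 - a) * Re (\<i> * (1 + a))"
  unfolding cmod_power2 by (simp add: power2_eq_square algebra_simps)
 qed (use r in simp)
 then show ?thesis unfolding e using r by simp
 qed
qed (auto simp: complex_eq_iff)

interpretation rs: szego_field "%x::real. x" "%a. ennreal (1 - a\<^sup>2)" "%a. ennreal (1 - a)"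
proof
 fix g :: "real => ennreal" and a c :: real
 assume g: "g \<in> borel_measurable borel"
 show "(\<integral>\<^sup>+y. g (- y) \<partial>lborel) = (\<integral>\<^sup>+y. g y \<partial>lborel)"
 using nn_integral_real_affine[OF g, of "- 1" 0] by simp
 assume a: "norm a < 1"
 have "a\<^sup>2 < 1" using a by (simp add: abs_square_less_1)
 then show "ennreal (1 - a\<^sup>2) * (\<integral>\<^sup>+y. g ((1 - a * a) * y + c) \<partial>lborel) = (\<integral>\<^sup>+y. g y \<partial>lborel)"
 using nn_integral_real_affine[OF g, of "1 - a\<^sup>2" c] by (simp add: power2_eq_square add.commute)
 have "a < 1" using a by auto
 then show "ennreal (1 - a) * (\<integral>\<^sup>+y. g (y - a * y) \<partial>lborel) = (\<integral>\<^sup>+y. g y \<partial>lborel)"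
 using nn_integral_real_affine[OF g, of "1 - a" 0] by (simp add: algebra_simps)
qed auto

text \<open>For the trivial conjugation these rules rewrite or decompose terms into themselves.\<close>
declare rs.measurable_\<kappa> [measurable del] rs.\<kappa>_\<kappa> [simp del] rs.norm_\<kappa> [simp del]

fun cps :: "nat => (nat => complex) => complex poly" where
 "cps 0 e = 1"
| "cps (Suc n) e = cps n e + monom (cnj (e n)) (Suc n)"

lemma coeff_cps: "coeff (cps n e) i = (if i = 0 then 1 else if i <= n then cnj (e (i - 1)) else 0)"
 by (induction n) (auto simp: le_Suc_eq)

lemma cp_szego_step:
 "cp (Suc k) (cs.szego_step k a e) = pCons 0 (cp k e) - Polynomial.smult (cnj a) (cps k e)"
proof (rule poly_eqI)
 fix i
 show "coeff (cp (Suc k) (cs.szego_step k a e)) i = coeff (pCons 0 (cp k e) - Polynomial.smult (cnj a) (cps k e)) i"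
 proof (cases i)
 case 0
 then show ?thesis by (simp add: coeff_cp coeff_cps cs.szego_step_def del: cp.simps)
 next
 case (Suc m)
 consider "m < k" | "m = k" | "m > k" by linarith
 then show ?thesis
 by cases (auto simp: Suc coeff_cp coeff_cps cs.szego_step_def cs.reflect_shift_def simp del: cp.simps)
 qed
qed

lemma cps_szego_step:
 "cps (Suc k) (cs.szego_step k a e) = cps k e - Polynomial.smult a (pCons 0 (cp k e))"
proof (rule poly_eqI)
 fix i
 show "coeff (cps (Suc k) (cs.szego_step k a e)) i = coeff (cps k e - Polynomial.smult a (pCons 0 (cp k e))) i"
 proof (cases i)
 case 0
 then show ?thesis by (simp add: coeff_cps del: cps.simps)
 next
 case (Suc m)
 consider "m < k" | "m = k" | "m > k" by linarith
 then show ?thesis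
 by cases (auto simp: Suc coeff_cp coeff_cps cs.szego_step_def cs.reflect_shift_def simp del: cps.simps)
 qed
qed

lemma Phi_eq_cp: "Phi n \<alpha> = cp n (cs.szego_coeffs n \<alpha>) & PhiS n \<alpha> = cps n (cs.szego_coeffs n \<alpha>)"
proof (induction n)
 case (Suc n)
 then show ?case
 unfolding cs.szego_coeffs.simps cp_szego_step cps_szego_step by simp
qed simp

text \<open>\<open>cps\<close> is the reversal of \<open>cp\<close>: coefficients are conjugated and listed backwards.\<close>
lemma poly_cps_inversion: "w ~= 0 ==> poly (cps n e) w = w ^ n * cnj (poly (cp n e) (1 / cnj w))"
 by (induction n) (auto simp: poly_monom algebra_simps)

lemma poly_cps: "poly (cps n e) w = (\<Prod>z\<in>#proots (cp n e). 1 - cnj z * w)"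
proof (cases "w = 0")
 case True
 have "poly (cps n e) 0 = 1" by (simp add: poly_0_coeff_0 coeff_cps)
 then show ?thesis using True by simp
next
 case False
 have "w ^ size X * cnj (\<Prod>z\<in>#X. 1 / cnj w - z) = (\<Prod>z\<in>#X. 1 - cnj z * w)" for X
 using False by (induction X) (auto simp: field_simps)
 from this[of "proots (cp n e)"] show ?thesis
 unfolding poly_cps_inversion[OF False] poly_eq_prod_proots_cp by simp
qed

abbreviation in_disc :: "nat => (nat => complex) => bool" where
 "in_disc n e \<equiv> \<forall>z\<in>#proots (cp n e). norm z < 1"

lemma in_disc_iff: "in_disc n e \<longleftrightarrow> (ALL w. norm w \<ge> 1 --> poly (cp n e) w ~= 0)"
 by (auto simp: not_le[symmetric])

text \<open>The quotient of the two polynomials is a Blaschke product, at most one in modulus outside the disc.\<close>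
lemma norm_cps_le:
 assumes "in_disc n e" "norm w \<ge> 1"
 shows "norm (poly (cps n e) w) <= norm (poly (cp n e) w)"
proof -
 have f: "norm (1 - cnj z * w) <= norm (w - z)" if "norm z < 1" for z
 proof -
 have "(norm (w - z))\<^sup>2 - (norm (1 - cnj z * w))\<^sup>2 = ((norm w)\<^sup>2 - 1) * (1 - (norm z)\<^sup>2)"
 unfolding cmod_power2 by (simp add: power2_eq_square algebra_simps)
 moreover have "(norm w)\<^sup>2 \<ge> 1" "(norm z)\<^sup>2 <= 1" using assms(2) that by (simp_all add: power_le_one)
 ultimately have "(norm (1 - cnj z * w))\<^sup>2 <= (norm (w - z))\<^sup>2"
 by (smt (verit) mult_nonneg_nonneg)
 then show ?thesis by (rule power2_le_imp_le) simp
 qed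
 have "(\<Prod>z\<in>#X. norm (1 - cnj z * w)) <= (\<Prod>z\<in>#X. norm (w - z)) & 0 <= (\<Prod>z\<in>#X. norm (1 - cnj z * w))"
 if "\<forall>z\<in>#X. norm z < 1" for X
 using that by (induction X) (auto intro!: mult_mono f order_trans[OF norm_ge_zero f])
 from this[OF assms(1)] show ?thesis
 unfolding poly_cps poly_eq_prod_proots_cp norm_prod_mset by blast
qed

lemma nonzero_combination:
 fixes u v a :: complex
 assumes "norm v <= norm u" "u ~= 0" "norm a < 1"
 shows "u + a * v ~= 0"
proof
 assume "u + a * v = 0"
 then have "u = - (a * v)" by (simp add: eq_neg_iff_add_eq_0)
 then have "norm u = norm a * norm v" by (simp add: norm_mult)
 also have "... <= norm a * norm u" using assms(1) by (intro mult_left_mono) auto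
 also have "... < 1 * norm u" using assms by (intro mult_strict_right_mono) auto
 finally show False by simp
qed

text \<open>Outside the disc the reversed polynomial never dominates, so a perturbation by less than its modulus creates no zero there. Conversely the step can be undone by a combination of the same kind.\<close>
theorem schur_cohn_step:
 assumes a: "norm a < 1"
 shows "in_disc (Suc k) (cs.szego_step k a e) \<longleftrightarrow> in_disc k e"
proof
 assume e: "in_disc k e"
 show "in_disc (Suc k) (cs.szego_step k a e)"
 unfolding in_disc_iff
 proof (intro allI impI)
 fix w :: complex assume w: "norm w \<ge> 1"
 have P: "poly (cp k e) w ~= 0" using e w unfolding in_disc_iff by blast
 have "norm (poly (cps k e) w) <= 1 * norm (poly (cp k e) w)" using norm_cps_le[OF e w] by simp
 also have "... <= norm w * norm (poly (cp k e) w)" using w by (intro mult_right_mono) auto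
 finally have "norm (poly (cps k e) w) <= norm (w * poly (cp k e) w)" by (simp add: norm_mult)
 moreover have "w * poly (cp k e) w ~= 0" using P w by auto
 ultimately have "w * poly (cp k e) w + (- cnj a) * poly (cps k e) w ~= 0"
 by (rule nonzero_combination) (use a in simp)
 then show "poly (cp (Suc k) (cs.szego_step k a e)) w ~= 0"
 unfolding cp_szego_step by simp
 qed
next
 assume e: "in_disc (Suc k) (cs.szego_step k a e)"
 show "in_disc k e"
 unfolding in_disc_iff
 proof (intro allI impI notI)
 fix w :: complex assume w: "norm w \<ge> 1" and P: "poly (cp k e) w = 0"
 have "poly (cp (Suc k) (cs.szego_step k a e)) w ~= 0" using e w unfolding in_disc_iff by blast
 from nonzero_combination[OF norm_cps_le[OF e w] this, of "cnj a"] a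
 have "poly (cp (Suc k) (cs.szego_step k a e)) w + cnj a * poly (cps (Suc k) (cs.szego_step k a e)) w ~= 0" by simp
 then show False unfolding cp_szego_step cps_szego_step using P by simp
 qed
qed

text \<open>The last coefficient is the product of the roots up to sign.\<close>
lemma in_disc_last:
 assumes "in_disc (Suc k) e"
 shows "norm (e k) < 1"
proof -
 have b: "(\<Prod>z\<in>#X. norm z) <= 1 & 0 <= (\<Prod>z\<in>#X. norm z) & (X ~= {#} --> (\<Prod>z\<in>#X. norm z) < 1)" if "\<forall>z\<in>#X. norm z < 1" for X :: "complex multiset"
 using that
 proof (induction X)
 case (add x X)
 then have IH: "(\<Prod>z\<in>#X. norm z) <= 1" "0 <= (\<Prod>z\<in>#X. norm z)" and x: "norm x < 1" by auto
 have "norm x * (\<Prod>z\<in>#X. norm z) <= norm x * 1" using IH by (intro mult_left_mono) auto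
 then show ?case using x IH by auto
 qed simp
 have "poly (cp (Suc k) e) 0 = (\<Prod>z\<in>#proots (cp (Suc k) e). 0 - z)" by (rule poly_eq_prod_proots_cp)
 then have "norm (e k) = (\<Prod>z\<in>#proots (cp (Suc k) e). norm (0 - z))"
 unfolding norm_prod_mset[symmetric] by (simp flip: norm_prod_mset)
 also have "... = (\<Prod>z\<in>#proots (cp (Suc k) e). norm z)" by simp
 also have "... < 1"
 proof -
 have "proots (cp (Suc k) e) ~= {#}"
 proof
 assume "proots (cp (Suc k) e) = {#}"
 from size_proots_cp[of "Suc k" e, unfolded this] show False by simp
 qed
 then show ?thesis using b[OF assms] by blast
 qed
 finally show ?thesis .
qed

text \<open>Up to normalisation this is the Schur-Cohn determinant, or the resultant of the polynomial and its reversal.\<close>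
definition schur_cohn_det :: "complex multiset => complex" where
 "schur_cohn_det X = (\<Prod>z\<in>#X. \<Prod>w\<in>#X. 1 - z * cnj w)"

lemma cnj_prod_mset: "cnj (\<Prod>z\<in>#X. f z) = (\<Prod>z\<in>#X. cnj (f z))"
 by (induction X) auto

lemma schur_cohn_det_eq: "schur_cohn_det (proots (cp n e)) = (\<Prod>z\<in>#proots (cp n e). poly (cps n e) z)"
 unfolding schur_cohn_det_def poly_cps by (simp add: mult.commute)

lemma cnj_schur_cohn_det: "cnj (schur_cohn_det X) = schur_cohn_det X"
 unfolding schur_cohn_det_def cnj_prod_mset
 by (subst prod_mset.swap) (simp add: mult.commute)

text \<open>Evaluate the reversed polynomial at the roots: there the recursion expresses it through the polynomial of lower degree. Exchanging the roles of the two root sets and applying the recursion once more lowers the degree.\<close>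
lemma schur_cohn_det_step:
 "schur_cohn_det (proots (cp (Suc k) (cs.szego_step k a e))) =
 of_real ((1 - (norm a)\<^sup>2) ^ Suc k) * schur_cohn_det (proots (cp k e))"
proof -
 define X where "X = proots (cp (Suc k) (cs.szego_step k a e))"
 define Y where "Y = proots (cp k e)"
 have r: "complex_of_real (1 - (norm a)\<^sup>2) = 1 - a * cnj a"
 by (simp only: of_real_diff of_real_1 complex_norm_square)
 have "schur_cohn_det X = (\<Prod>w\<in>#X. poly (cps (Suc k) (cs.szego_step k a e)) w)"
 unfolding X_def by (rule schur_cohn_det_eq)
 also have "... = (\<Prod>w\<in>#X. of_real (1 - (norm a)\<^sup>2) * poly (cps k e) w)"
 proof (rule arg_cong[where f = prod_mset], rule image_mset_cong)
 fix w assume "w \<in># X"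
 then have "poly (cp (Suc k) (cs.szego_step k a e)) w = 0" by (simp add: X_def del: cp.simps)
 then have "w * poly (cp k e) w = cnj a * poly (cps k e) w" unfolding cp_szego_step by simp
 then show "poly (cps (Suc k) (cs.szego_step k a e)) w = of_real (1 - (norm a)\<^sup>2) * poly (cps k e) w"
 unfolding cps_szego_step r by (simp add: algebra_simps)
 qed
 also have "... = of_real (1 - (norm a)\<^sup>2) ^ size X * (\<Prod>w\<in>#X. poly (cps k e) w)"
 by (simp add: prod_mset.distrib)
 also have "size X = Suc k" unfolding X_def by (rule size_proots_cp)
 also have "(\<Prod>w\<in>#X. poly (cps k e) w) = (\<Prod>z\<in>#Y. \<Prod>w\<in>#X. 1 - cnj z * w)"
 unfolding poly_cps Y_def by (rule prod_mset.swap)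
 also have "... = (\<Prod>z\<in>#Y. cnj (poly (cps (Suc k) (cs.szego_step k a e)) z))"
 unfolding poly_cps X_def cnj_prod_mset by (simp add: mult.commute del: cp.simps)
 also have "... = (\<Prod>z\<in>#Y. cnj (poly (cps k e) z))"
 proof (rule arg_cong[where f = prod_mset], rule image_mset_cong)
 fix z assume "z \<in># Y"
 then have "poly (cp k e) z = 0" by (simp add: Y_def)
 then show "cnj (poly (cps (Suc k) (cs.szego_step k a e)) z) = cnj (poly (cps k e) z)"
 unfolding cps_szego_step by simp
 qed
 also have "... = schur_cohn_det Y"
 unfolding cnj_prod_mset[symmetric] Y_def schur_cohn_det_eq[symmetric] by (rule cnj_schur_cohn_det)
 finally show ?thesis unfolding X_def Y_def by simp
qed

theorem schur_cohn_det_szego: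
 "schur_cohn_det (proots (cp n (cs.szego_coeffs n \<alpha>))) = of_real (\<Prod>k<n. (1 - (norm (\<alpha> k))\<^sup>2) ^ Suc k)"
proof (induction n)
 case 0
 show ?case by (simp add: schur_cohn_det_def)
next
 case (Suc n)
 then show ?case unfolding cs.szego_coeffs.simps schur_cohn_det_step by (simp add: mult.commute)
qed

lemma of_real_szego_step:
 "j < Suc k ==> complex_of_real (rs.szego_step k a e j) = cs.szego_step k (of_real a) (%i. of_real (e i)) j"
 by (auto simp: rs.szego_step_def cs.szego_step_def rs.reflect_shift_def cs.reflect_shift_def)

lemma rp_szego_step: "rp (Suc k) (rs.szego_step k a e) = cp (Suc k) (cs.szego_step k (of_real a) (%i. of_real (e i)))"
 unfolding rp_def by (rule cp_cong) (rule of_real_szego_step)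

lemma cs_szego_step_cong:
 "(!!i. i < k ==> e i = e' i) ==> cs.szego_step k a e = cs.szego_step k a e'"
 by (auto simp: cs.szego_step_def cs.reflect_shift_def fun_eq_iff)

lemma rp_szego_coeffs: "rp n (rs.szego_coeffs n \<alpha>) = cp n (cs.szego_coeffs n (%k. of_real (\<alpha> k)))"
proof -
 have "complex_of_real (rs.szego_coeffs n \<alpha> j) = cs.szego_coeffs n (%k. of_real (\<alpha> k)) j" if "j < n" for j
 using that
 proof (induction n arbitrary: j)
 case (Suc n)
 have "complex_of_real (rs.szego_coeffs (Suc n) \<alpha> j) = cs.szego_step n (of_real (\<alpha> n)) (%i. of_real (rs.szego_coeffs n \<alpha> i)) j"
 unfolding rs.szego_coeffs.simps by (rule of_real_szego_step[OF Suc.prems])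
 also have "cs.szego_step n (of_real (\<alpha> n)) (%i. of_real (rs.szego_coeffs n \<alpha> i)) = cs.szego_step n (of_real (\<alpha> n)) (cs.szego_coeffs n (%k. of_real (\<alpha> k)))"
 by (rule cs_szego_step_cong) (rule Suc.IH)
 finally show ?case by simp
 qed simp
 then show ?thesis unfolding rp_def by (rule cp_cong)
qed

definition real_axis_factor :: "complex multiset => complex" where
 "real_axis_factor X = (\<Prod>z\<in>#X. 1 - z\<^sup>2)"

lemma real_axis_factor_eq:
 "real_axis_factor (proots (cp n e)) = poly (cp n e) 1 * ((-1) ^ n * poly (cp n e) (-1))"
proof -
 have "(\<Prod>z\<in>#X. 1 - z\<^sup>2) = (\<Prod>z\<in>#X. 1 - z) * ((-1) ^ size X * (\<Prod>z\<in>#X. - 1 - z))" for X :: "complex multiset"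
 by (induction X) (auto simp: power2_eq_square algebra_simps)
 from this[of "proots (cp n e)"] show ?thesis
 unfolding real_axis_factor_def poly_eq_prod_proots_cp by simp
qed

text \<open>The product is, up to sign, the product of the values at \<open>1\<close> and \<open>-1\<close>. For real coefficients the polynomial and its reversal agree there up to sign, so each step multiplies the values by a scalar.\<close>
lemma real_axis_factor_szego:
 "real_axis_factor (proots (rp n (rs.szego_coeffs n \<alpha>))) = of_real (\<Prod>k<n. (1 - \<alpha> k) * (1 + (-1) ^ k * \<alpha> k))"
proof -
 have "poly (rp n (rs.szego_coeffs n \<alpha>)) 1 = of_real (\<Prod>k<n. 1 - \<alpha> k) &
 (-1) ^ n * poly (rp n (rs.szego_coeffs n \<alpha>)) (-1) = of_real (\<Prod>k<n. 1 + (-1) ^ k * \<alpha> k)"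
 proof (induction n)
 case (Suc n)
 let ?e = "rs.szego_coeffs n \<alpha>"
 have rp: "rp n ?e = cp n (%i. complex_of_real (?e i))" by (simp add: rp_def)
 have s1: "poly (cps n (%i. complex_of_real (?e i))) 1 = poly (rp n ?e) 1"
 using poly_cps_inversion[of 1 n "%i. complex_of_real (?e i)"] poly_rp_cnj[of n ?e 1] unfolding rp[symmetric] by simp
 have s2: "poly (cps n (%i. complex_of_real (?e i))) (-1) = (-1) ^ n * poly (rp n ?e) (-1)"
 using poly_cps_inversion[of "-1" n "%i. complex_of_real (?e i)"] poly_rp_cnj[of n ?e "-1"] unfolding rp[symmetric] by simp
 have "poly (rp (Suc n) (rs.szego_coeffs (Suc n) \<alpha>)) 1 = (1 - of_real (\<alpha> n)) * poly (rp n ?e) 1"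
 unfolding rs.szego_coeffs.simps rp_szego_step cp_szego_step rp[symmetric] by (simp add: s1 algebra_simps)
 moreover have "poly (rp (Suc n) (rs.szego_coeffs (Suc n) \<alpha>)) (-1) = - poly (rp n ?e) (-1) - of_real (\<alpha> n) * ((-1) ^ n * poly (rp n ?e) (-1))"
 unfolding rs.szego_coeffs.simps rp_szego_step cp_szego_step rp[symmetric] by (simp add: s2)
 then have "(-1) ^ Suc n * poly (rp (Suc n) (rs.szego_coeffs (Suc n) \<alpha>)) (-1) = (1 + (-1) ^ n * of_real (\<alpha> n)) * ((-1) ^ n * poly (rp n ?e) (-1))"
 by (simp only:) (simp add: algebra_simps del: rs.szego_coeffs.simps)
 ultimately show ?case using Suc by (simp add: mult.commute)
 qed simp
 note vals = conjunct1[OF this] conjunct2[OF this]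
 have "real_axis_factor (proots (rp n (rs.szego_coeffs n \<alpha>))) =
 poly (rp n (rs.szego_coeffs n \<alpha>)) 1 * ((-1) ^ n * poly (rp n (rs.szego_coeffs n \<alpha>)) (-1))"
 unfolding rp_def by (rule real_axis_factor_eq)
 then show ?thesis unfolding vals by (simp add: prod.distrib)
qed

lemma eigenvalue_mset_CMV:
 assumes "n \<ge> 1" "!!k. k < n ==> norm (\<alpha> k) <= 1"
 shows "eigenvalue_mset (CMV n \<alpha>) = proots (cp n (cs.szego_coeffs n \<alpha>))"
proof -
 have "char_poly (CMV n \<alpha>) = Phi n \<alpha>" by (rule char_poly_CMV) (rule assms)+
 then show ?thesis unfolding eigenvalue_mset_def Phi_eq_cp[THEN conjunct1] by (rule arg_cong)
qed

section \<open>The law of the reflection coefficients\<close>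

lemma indep_rv_compose:
 assumes "prob_space M" and ind: "indep_rv M N X N' Y" and f: "f \<in> N \<rightarrow>\<^sub>M N2"
 shows "indep_rv M N2 (%\<omega>. f (X \<omega>)) N' Y"
proof -
 interpret prob_space M by fact
 have X: "X \<in> M \<rightarrow>\<^sub>M N" and Y: "Y \<in> M \<rightarrow>\<^sub>M N'"
 and i: "indep_set {X -` A \<inter> space M |A. A \<in> sets N} {Y -` B \<inter> space M |B. B \<in> sets N'}"
 using ind unfolding indep_rv_def by auto
 have fX: "(%\<omega>. f (X \<omega>)) \<in> M \<rightarrow>\<^sub>M N2" by (rule meas_o[OF X f])
 have "indep_set {(%\<omega>. f (X \<omega>)) -` A \<inter> space M |A. A \<in> sets N2} {Y -` B \<inter> space M |B. B \<in> sets N'}"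
 proof (rule indep_setI)
 fix a b
 assume "a \<in> {(%\<omega>. f (X \<omega>)) -` A \<inter> space M |A. A \<in> sets N2}"
 then obtain A where A: "A \<in> sets N2" "a = (%\<omega>. f (X \<omega>)) -` A \<inter> space M" by blast
 have "a = X -` (f -` A \<inter> space N) \<inter> space M"
 using measurable_space[OF X] by (auto simp: A(2))
 moreover have "f -` A \<inter> space N \<in> sets N" using f A(1) by (rule measurable_sets)
 ultimately have "a \<in> {X -` A \<inter> space M |A. A \<in> sets N}" by blast
 moreover assume "b \<in> {Y -` B \<inter> space M |B. B \<in> sets N'}"
 ultimately show "prob (a \<inter> b) = prob a * prob b" by (rule indep_setD[OF i])
 qed (use fX Y in "auto intro: measurable_sets")
 with fX Y show ?thesis unfolding indep_rv_def by blast
qed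

lemma distr_indep_rv_pair:
 assumes "prob_space M" and ind: "indep_rv M N X N' Y"
 shows "distr M (N \<Otimes>\<^sub>M N') (%\<omega>. (X \<omega>, Y \<omega>)) = distr M N X \<Otimes>\<^sub>M distr M N' Y" (is "?lhs = ?rhs")
proof (rule pair_measure_eqI[symmetric])
 interpret prob_space M by fact
 have X: "X \<in> M \<rightarrow>\<^sub>M N" and Y: "Y \<in> M \<rightarrow>\<^sub>M N'"
 and i: "indep_set {X -` A \<inter> space M |A. A \<in> sets N} {Y -` B \<inter> space M |B. B \<in> sets N'}"
 using ind unfolding indep_rv_def by auto
 interpret X: prob_space "distr M N X" by (rule prob_space_distr[OF X])
 interpret Y: prob_space "distr M N' Y" by (rule prob_space_distr[OF Y])
 show "sigma_finite_measure (distr M N X)" "sigma_finite_measure (distr M N' Y)" by unfold_locales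
 show "sets (distr M N X \<Otimes>\<^sub>M distr M N' Y) = sets (?lhs)"
 by (simp cong: sets_pair_measure_cong)
 fix A B assume "A \<in> sets (distr M N X)" "B \<in> sets (distr M N' Y)"
 then have A: "A \<in> sets N" and B: "B \<in> sets N'" by auto
 let ?a = "X -` A \<inter> space M" and ?b = "Y -` B \<inter> space M"
 have "prob (?a \<inter> ?b) = prob ?a * prob ?b"
 by (rule indep_setD[OF i]) (use A B in blast)+
 moreover have "(%\<omega>. (X \<omega>, Y \<omega>)) -` (A \<times> B) \<inter> space M = ?a \<inter> ?b" by blast
 ultimately show "emeasure (distr M N X) A * emeasure (distr M N' Y) B =
 emeasure (?lhs) (A \<times> B)"
 using X Y A B by (simp add: emeasure_distr emeasure_eq_measure ennreal_mult)
qed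

lemma nn_integral_indep_rv_pair:
 assumes M: "prob_space M" and ind: "indep_rv M N X N' Y" and f: "f \<in> borel_measurable (N \<Otimes>\<^sub>M N')"
 shows "(\<integral>\<^sup>+\<omega>. f (X \<omega>, Y \<omega>) \<partial>M) = (\<integral>\<^sup>+x. \<integral>\<^sup>+y. f (x, y) \<partial>distr M N' Y \<partial>distr M N X)" (is "?lhs = ?rhs")
proof -
 interpret prob_space M by fact
 have X: "X \<in> M \<rightarrow>\<^sub>M N" and Y: "Y \<in> M \<rightarrow>\<^sub>M N'" using ind unfolding indep_rv_def by auto
 interpret Y: prob_space "distr M N' Y" by (rule prob_space_distr[OF Y])
 have f': "f \<in> borel_measurable (distr M N X \<Otimes>\<^sub>M distr M N' Y)"
 using f by (subst measurable_cong_sets[OF sets_pair_measure_cong refl]) auto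
 have "?lhs = (\<integral>\<^sup>+p. f p \<partial>distr M (N \<Otimes>\<^sub>M N') (%\<omega>. (X \<omega>, Y \<omega>)))"
 by (rule nn_integral_distr[symmetric]) (use f measurable_Pair[OF X Y] in simp_all)
 then show ?thesis
 unfolding distr_indep_rv_pair[OF M ind] Y.nn_integral_fst[OF f'] .
qed

lemma nn_integral_PiM_density:
 fixes h :: "nat => 'a::euclidean_space => ennreal"
 assumes D: "!!k. k < n ==> D k = density lborel (h k)" and h: "!!k. k < n ==> h k \<in> borel_measurable borel"
 and P: "!!k. prob_space (D k)"
 and g: "g \<in> borel_measurable (tuples n)"
 shows "(\<integral>\<^sup>+x. g x \<partial>PiM {..<n} D) = (\<integral>\<^sup>+x. g x * (\<Prod>k<n. h k (x k)) \<partial>vol n)"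
 using D h g
proof (induction n arbitrary: g)
 interpret product_sigma_finite D
 by (rule product_sigma_finite.intro) (rule prob_space_imp_sigma_finite[OF P])
 {
 case 0
 show ?case by (simp add: PiM_empty nn_integral_count_space_finite)
 next
 case (Suc n)
 note [measurable] = Suc.prems(3) and hm = Suc.prems(2)
 have hn[measurable]: "h n \<in> borel_measurable borel" by (rule hm) simp
 have prodm: "(%x. \<Prod>k<m. h k (x k)) \<in> borel_measurable (tuples m)" if "m <= Suc n" for m
 proof (rule borel_measurable_prod_ennreal)
 fix k assume k: "k \<in> {..<m}"
 show "(%x. h k (x k)) \<in> borel_measurable (tuples m)"
  by (rule meas_o[OF measurable_component_singleton[OF k]]) (use k that in "auto intro: hm")
 qed
 have sD: "sets (PiM {..<m} D) = sets (tuples m)" if "m <= Suc n" for m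
 by (rule sets_PiM_cong) (use that Suc.prems(1) in auto)
 have up: "(%p. (fst p)(n := snd p)) \<in> tuples n \<Otimes>\<^sub>M borel \<rightarrow>\<^sub>M PiM {..<Suc n} (%_. borel :: 'a measure)"
 by measurable
 have gm: "(%x. \<integral>\<^sup>+y. g (x(n := y)) * h n y \<partial>lborel) \<in> borel_measurable (tuples n)"
 proof (rule lborel.borel_measurable_nn_integral)
 have "(%p. g ((fst p)(n := snd p)) * h n (snd p)) \<in> borel_measurable (tuples n \<Otimes>\<^sub>M borel)"
  using meas_o[OF up Suc.prems(3)] meas_o[OF measurable_snd hn]
  by (intro borel_measurable_times_ennreal) simp_all
 then show "(%(x, y). g (x(n := y)) * h n y) \<in> borel_measurable (tuples n \<Otimes>\<^sub>M lborel)"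
  unfolding case_prod_unfold by (subst measurable_cong_sets[OF sets_pair_measure_cong refl]) auto
 qed
 have slice: "(%y. g (x(n := y))) \<in> borel_measurable borel" if x: "x \<in> space (PiM {..<n} (%_. borel :: 'a measure))" for x
 proof -
 have "(%y. (x, y)) \<in> borel \<rightarrow>\<^sub>M tuples n \<Otimes>\<^sub>M (borel :: 'a measure)"
  by (intro measurable_Pair measurable_const x measurable_ident_sets refl)
 from meas_o[OF this meas_o[OF up Suc.prems(3)]] show ?thesis
  unfolding fst_conv snd_conv .
 qed
 have "(\<integral>\<^sup>+x. g x \<partial>PiM {..<Suc n} D) = (\<integral>\<^sup>+x. \<integral>\<^sup>+y. g (x(n := y)) \<partial>D n \<partial>PiM {..<n} D)"
 unfolding lessThan_Suc
 proof (rule product_nn_integral_insert)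
 show "g \<in> borel_measurable (PiM (insert n {..<n}) D)"
  unfolding lessThan_Suc[symmetric] measurable_cong_sets[OF sD[OF order_refl] refl] by (rule Suc.prems(3))
 qed auto
 also have "... = (\<integral>\<^sup>+x. \<integral>\<^sup>+y. g (x(n := y)) * h n y \<partial>lborel \<partial>PiM {..<n} D)"
 proof (rule nn_integral_cong)
 fix x assume "x \<in> space (PiM {..<n} D)"
 then have x: "x \<in> space (PiM {..<n} (%_. borel :: 'a measure))"
  using sets_eq_imp_space_eq[OF sD[of n]] by simp
 have "D n = density lborel (h n)" by (rule Suc.prems(1)) simp
 then show "(\<integral>\<^sup>+y. g (x(n := y)) \<partial>D n) = (\<integral>\<^sup>+y. g (x(n := y)) * h n y \<partial>lborel)"
  using slice[OF x] by (simp add: nn_integral_density mult.commute)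
 qed
 also have "... = (\<integral>\<^sup>+x. (\<integral>\<^sup>+y. g (x(n := y)) * h n y \<partial>lborel) * (\<Prod>k<n. h k (x k)) \<partial>vol n)"
 by (rule Suc.IH[OF _ _ gm]) (use Suc.prems in auto)
 also have "... = (\<integral>\<^sup>+x. \<integral>\<^sup>+y. g (x(n := y)) * (\<Prod>k<Suc n. h k ((x(n := y)) k)) \<partial>lborel \<partial>vol n)"
 proof (rule nn_integral_cong)
 fix x :: "nat => 'a" assume "x \<in> space (vol n)"
 then have x: "x \<in> space (PiM {..<n} (%_. borel :: 'a measure))" by (simp add: space_PiM)
 have m: "(%y. g (x(n := y)) * h n y) \<in> borel_measurable lborel"
  using slice[OF x] by simp
 show "(\<integral>\<^sup>+y. g (x(n := y)) * h n y \<partial>lborel) * (\<Prod>k<n. h k (x k)) =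
  (\<integral>\<^sup>+y. g (x(n := y)) * (\<Prod>k<Suc n. h k ((x(n := y)) k)) \<partial>lborel)"
  unfolding nn_integral_multc[OF m, symmetric] by (intro nn_integral_cong) (simp add: mult_ac)
 qed
 also have "... = (\<integral>\<^sup>+x. g x * (\<Prod>k<Suc n. h k (x k)) \<partial>vol (Suc n))"
 proof (rule nn_integral_PiM_Suc[symmetric])
 show "(%x. g x * (\<Prod>k<Suc n. h k (x k))) \<in> borel_measurable (vol (Suc n))"
  unfolding measurable_PiM_lborel1 by (intro borel_measurable_times_ennreal prodm Suc.prems(3)) simp
 qed
 finally show ?case .
 }
qed

text \<open>Independence makes the law of the tuple and the last radius a product. The radius and the last phase enter through \<open>c\<close> only and are integrated out first, by the hypothesis on \<open>h m\<close>.\<close>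
theorem nn_integral_parameters:
 fixes \<alpha> :: "nat => 'w => 'a::euclidean_space" and R :: "'w => real" and \<psi> :: "'w => 'b::topological_space"
 assumes M: "prob_space M"
 and ind: "prob_space.indep_vars M (%_. borel) (\<alpha>(m := (%\<omega>. s (\<psi> \<omega>)))) {..<Suc m}"
 and s: "s \<in> borel_measurable borel"
 and indR: "indep_rv M (tuples m \<Otimes>\<^sub>M borel) (%\<omega>. (\<lambda>k\<in>{..<m}. \<alpha> k \<omega>, \<psi> \<omega>)) borel R"
 and dens: "!!k. k < m ==> distr M borel (\<alpha> k) = density lborel (h k)"
 and h: "!!k. k <= m ==> h k \<in> borel_measurable borel"
 and last: "!!q. q \<in> borel_measurable borel ==>
 (\<integral>\<^sup>+u. \<integral>\<^sup>+r. q (c r u) \<partial>distr M borel R \<partial>distr M borel (%\<omega>. s (\<psi> \<omega>))) = (\<integral>\<^sup>+y. q y * h m y \<partial>lborel)"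
 and c: "case_prod c \<in> borel_measurable (borel \<Otimes>\<^sub>M borel)"
 and H: "H \<in> borel_measurable (tuples (Suc m))"
 shows "(%\<omega>. \<lambda>k\<in>{..<Suc m}. if k = m then c (R \<omega>) (s (\<psi> \<omega>)) else \<alpha> k \<omega>) \<in> M \<rightarrow>\<^sub>M tuples (Suc m)"
 and "(\<integral>\<^sup>+\<omega>. H (\<lambda>k\<in>{..<Suc m}. if k = m then c (R \<omega>) (s (\<psi> \<omega>)) else \<alpha> k \<omega>) \<partial>M) =
 (\<integral>\<^sup>+x. H x * (\<Prod>k<Suc m. h k (x k)) \<partial>vol (Suc m))"
proof -
 interpret prob_space M by fact
 define X where "X \<omega> = (\<lambda>k\<in>{..<Suc m}. (\<alpha>(m := (%\<omega>. s (\<psi> \<omega>)))) k \<omega>)" for \<omega>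
 define f where "f p = (fst p)(m := s (snd p))" for p :: "(nat => 'a) \<times> 'b"
 have "(%p. s (snd p)) \<in> borel_measurable (PiM {..<m} (%_. borel :: 'a measure) \<Otimes>\<^sub>M borel)"
 by (rule meas_o[OF measurable_snd s])
 then have f: "f \<in> tuples m \<Otimes>\<^sub>M borel \<rightarrow>\<^sub>M PiM {..<Suc m} (%_. borel :: 'a measure)"
 unfolding f_def[abs_def] by (intro measurable_fun_upd_Suc measurable_fst)
 have fX: "f (\<lambda>k\<in>{..<m}. \<alpha> k \<omega>, \<psi> \<omega>) = X \<omega>" for \<omega>
 proof
 fix k
 consider "k < m" | "k = m" | "k > m" by linarith
 then show "f (\<lambda>k\<in>{..<m}. \<alpha> k \<omega>, \<psi> \<omega>) k = X \<omega> k"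
 unfolding f_def X_def by cases simp_all
 qed
 have iX: "indep_rv M (tuples (Suc m)) X borel R"
 using indep_rv_compose[OF M indR f] unfolding fX .
 have X: "X \<in> M \<rightarrow>\<^sub>M tuples (Suc m)" and R: "R \<in> borel_measurable M"
 using iX unfolding indep_rv_def by auto
 have rv: "(\<alpha>(m := (%\<omega>. s (\<psi> \<omega>)))) k \<in> borel_measurable M" if "k < Suc m" for k
 proof -
 have "(%\<omega>. X \<omega> k) \<in> borel_measurable M"
 by (rule meas_o[OF X measurable_component_singleton]) (use that in simp)
 then show ?thesis using that by (simp add: X_def del: fun_upd_apply)
 qed
 define D where "D k = (if k < Suc m then distr M borel ((\<alpha>(m := (%\<omega>. s (\<psi> \<omega>)))) k) else return borel 0)" for k
 have P: "prob_space (D k)" for k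
 proof (cases "k < Suc m")
 case True
 then show ?thesis unfolding D_def if_P[OF True] by (intro prob_space_distr rv)
 next
 case False
 then show ?thesis by (simp add: D_def prob_space_return)
 qed
 interpret product_sigma_finite D
 by (rule product_sigma_finite.intro) (rule prob_space_imp_sigma_finite[OF P])
 have "distr M (tuples (Suc m)) X = (\<Pi>\<^sub>M k\<in>{..<Suc m}. distr M borel ((\<alpha>(m := (%\<omega>. s (\<psi> \<omega>)))) k))"
 unfolding X_def
 by (rule indep_vars_iff_distr_eq_PiM'[THEN iffD1, OF _ _ ind]) (use rv in "auto simp del: fun_upd_apply")
 also have "... = PiM {..<Suc m} D" by (rule PiM_cong) (auto simp: D_def)
 finally have dX: "distr M (tuples (Suc m)) X = PiM {..<Suc m} D" .
 have Dm: "D m = distr M borel (%\<omega>. s (\<psi> \<omega>))" by (simp add: D_def)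
 have Dk: "D k = density lborel (h k)" if "k < m" for k using dens[OF that] that by (simp add: D_def)
 define U where "U p = (fst p)(m := c (snd p) (fst p m))" for p :: "(nat => 'a) \<times> real"
 have comp: "(%p. fst p m) \<in> tuples (Suc m) \<Otimes>\<^sub>M borel \<rightarrow>\<^sub>M (borel :: 'a measure)"
 by (rule meas_o[OF measurable_fst measurable_component_singleton]) simp
 have cm: "(%p. c (snd p) (fst p m)) \<in> tuples (Suc m) \<Otimes>\<^sub>M borel \<rightarrow>\<^sub>M borel"
 using meas_o[OF measurable_Pair[OF measurable_snd comp] c] by simp
 have restr: "(%p. restrict (fst p) {..<m}) \<in> tuples (Suc m) \<Otimes>\<^sub>M (borel :: real measure) \<rightarrow>\<^sub>M PiM {..<m} (%_. borel :: 'a measure)"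
 by (rule meas_o[OF measurable_fst measurable_restrict_subset]) auto
 have U: "U \<in> tuples (Suc m) \<Otimes>\<^sub>M borel \<rightarrow>\<^sub>M tuples (Suc m)"
 proof -
 have "(%p. (restrict (fst p) {..<m})(m := c (snd p) (fst p m))) \<in> tuples (Suc m) \<Otimes>\<^sub>M borel \<rightarrow>\<^sub>M tuples (Suc m)"
 by (rule measurable_fun_upd_Suc[OF restr cm])
 moreover have "(restrict (fst p) {..<m})(m := c (snd p) (fst p m)) = U p"
 if "p \<in> space (PiM {..<Suc m} (%_. borel :: 'a measure) \<Otimes>\<^sub>M (borel :: real measure))" for p
 proof
 fix k
 have "fst p \<in> extensional {..<Suc m}"
  using that by (auto simp: space_pair_measure space_PiM PiE_def)
 then show "((restrict (fst p) {..<m})(m := c (snd p) (fst p m))) k = U p k"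
  by (auto simp: U_def extensional_def)
 qed
 ultimately show ?thesis by (rule measurable_cong[THEN iffD1, rotated])
 qed
 have UX: "U (X \<omega>, R \<omega>) = (\<lambda>k\<in>{..<Suc m}. if k = m then c (R \<omega>) (s (\<psi> \<omega>)) else \<alpha> k \<omega>)" for \<omega>
 proof
 fix k
 consider "k < m" | "k = m" | "k > m" by linarith
 then show "U (X \<omega>, R \<omega>) k = (\<lambda>k\<in>{..<Suc m}. if k = m then c (R \<omega>) (s (\<psi> \<omega>)) else \<alpha> k \<omega>) k"
 unfolding U_def X_def by cases simp_all
 qed
 show "(%\<omega>. \<lambda>k\<in>{..<Suc m}. if k = m then c (R \<omega>) (s (\<psi> \<omega>)) else \<alpha> k \<omega>) \<in> M \<rightarrow>\<^sub>M tuples (Suc m)"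
 using meas_o[OF measurable_Pair[OF X R] U] unfolding UX .
 have HU: "(%p. H (U p)) \<in> borel_measurable (tuples (Suc m) \<Otimes>\<^sub>M borel)"
 by (rule meas_o[OF U H])
 interpret dR: prob_space "distr M borel R" by (rule prob_space_distr[OF R])
 have inner: "(%x. \<integral>\<^sup>+r. H (U (x, r)) \<partial>distr M borel R) \<in> borel_measurable (tuples (Suc m))"
 proof (rule dR.borel_measurable_nn_integral)
 show "(%(x, r). H (U (x, r))) \<in> borel_measurable (tuples (Suc m) \<Otimes>\<^sub>M distr M borel R)"
 using HU by (subst measurable_cong_sets[OF sets_pair_measure_cong refl]) auto
 qed
 have sD: "sets (PiM {..<k} D) = sets (tuples k)" for k
 by (rule sets_PiM_cong) (auto simp: D_def)
 have "(\<integral>\<^sup>+\<omega>. H (U (X \<omega>, R \<omega>)) \<partial>M) = (\<integral>\<^sup>+x. \<integral>\<^sup>+r. H (U (x, r)) \<partial>distr M borel R \<partial>PiM {..<Suc m} D)"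
 using nn_integral_indep_rv_pair[OF M iX HU] unfolding dX .
 also have "... = (\<integral>\<^sup>+t. \<integral>\<^sup>+u. \<integral>\<^sup>+r. H (U (t(m := u), r)) \<partial>distr M borel R \<partial>D m \<partial>PiM {..<m} D)"
 unfolding lessThan_Suc
 proof (rule product_nn_integral_insert)
 show "(%x. \<integral>\<^sup>+r. H (U (x, r)) \<partial>distr M borel R) \<in> borel_measurable (PiM (insert m {..<m}) D)"
 unfolding lessThan_Suc[symmetric] measurable_cong_sets[OF sD refl] by (rule inner)
 qed auto
 also have "... = (\<integral>\<^sup>+t. \<integral>\<^sup>+y. H (t(m := y)) * h m y \<partial>lborel \<partial>PiM {..<m} D)"
 proof (rule nn_integral_cong)
 fix t assume "t \<in> space (PiM {..<m} D)"
 then have t: "t \<in> space (PiM {..<m} (%_. borel :: 'a measure))"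
 using sets_eq_imp_space_eq[OF sD[of m]] by simp
 have "(%y. t(m := y)) \<in> borel \<rightarrow>\<^sub>M tuples (Suc m)"
 by (intro measurable_fun_upd_Suc measurable_const t measurable_ident_sets refl)
 from meas_o[OF this H] have q: "(%y. H (t(m := y))) \<in> borel_measurable borel" .
 have "U (t(m := u), r) = t(m := c r u)" for u r
 unfolding U_def fst_conv snd_conv fun_upd_upd fun_upd_same ..
 then show "(\<integral>\<^sup>+u. \<integral>\<^sup>+r. H (U (t(m := u), r)) \<partial>distr M borel R \<partial>D m) = (\<integral>\<^sup>+y. H (t(m := y)) * h m y \<partial>lborel)"
 unfolding Dm using last[OF q] by simp
 qed
 also have "... = (\<integral>\<^sup>+t. (\<integral>\<^sup>+y. H (t(m := y)) * h m y \<partial>lborel) * (\<Prod>k<m. h k (t k)) \<partial>vol m)"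
 proof (rule nn_integral_PiM_density[OF Dk _ P])
 have up: "(%p. (fst p)(m := snd p)) \<in> tuples m \<Otimes>\<^sub>M borel \<rightarrow>\<^sub>M PiM {..<Suc m} (%_. borel :: 'a measure)"
 by measurable
 have hm: "h m \<in> borel_measurable borel" by (rule h) simp
 show "(%t. \<integral>\<^sup>+y. H (t(m := y)) * h m y \<partial>lborel) \<in> borel_measurable (tuples m)"
 proof (rule lborel.borel_measurable_nn_integral)
 have "(%p. H ((fst p)(m := snd p)) * h m (snd p)) \<in> borel_measurable (tuples m \<Otimes>\<^sub>M borel)"
  using meas_o[OF up H] meas_o[OF measurable_snd hm]
  by (intro borel_measurable_times_ennreal) simp_all
 then show "(%(x, y). H (x(m := y)) * h m y) \<in> borel_measurable (tuples m \<Otimes>\<^sub>M lborel)"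
  unfolding case_prod_unfold by (subst measurable_cong_sets[OF sets_pair_measure_cong refl]) auto
 qed
 qed (use h in auto)
 also have "... = (\<integral>\<^sup>+t. \<integral>\<^sup>+y. H (t(m := y)) * (\<Prod>k<Suc m. h k ((t(m := y)) k)) \<partial>lborel \<partial>vol m)"
 proof (rule nn_integral_cong)
 fix t :: "nat => 'a" assume "t \<in> space (vol m)"
 then have t: "t \<in> space (PiM {..<m} (%_. borel :: 'a measure))" by (simp add: space_PiM)
 have "(%y. t(m := y)) \<in> borel \<rightarrow>\<^sub>M tuples (Suc m)"
 by (intro measurable_fun_upd_Suc measurable_const t measurable_ident_sets refl)
 from meas_o[OF this H] have q: "(%y. H (t(m := y)) * h m y) \<in> borel_measurable lborel"
 using h[of m] by simp
 show "(\<integral>\<^sup>+y. H (t(m := y)) * h m y \<partial>lborel) * (\<Prod>k<m. h k (t k)) =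
 (\<integral>\<^sup>+y. H (t(m := y)) * (\<Prod>k<Suc m. h k ((t(m := y)) k)) \<partial>lborel)"
 unfolding nn_integral_multc[OF q, symmetric] by (intro nn_integral_cong) (simp add: mult_ac)
 qed
 also have "... = (\<integral>\<^sup>+x. H x * (\<Prod>k<Suc m. h k (x k)) \<partial>vol (Suc m))"
 proof (rule nn_integral_PiM_Suc[symmetric])
 have "(%x. \<Prod>k<Suc m. h k (x k)) \<in> borel_measurable (tuples (Suc m))"
 proof (rule borel_measurable_prod_ennreal)
 fix k assume k: "k \<in> {..<Suc m}"
 show "(%x. h k (x k)) \<in> borel_measurable (tuples (Suc m))"
  by (rule meas_o[OF measurable_component_singleton[OF k]]) (use k in "auto intro: h")
 qed
 then show "(%x. H x * (\<Prod>k<Suc m. h k (x k))) \<in> borel_measurable (vol (Suc m))"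
 unfolding measurable_PiM_lborel1 by (intro borel_measurable_times_ennreal H)
 qed
 finally show "(\<integral>\<^sup>+\<omega>. H (\<lambda>k\<in>{..<Suc m}. if k = m then c (R \<omega>) (s (\<psi> \<omega>)) else \<alpha> k \<omega>) \<partial>M) =
 (\<integral>\<^sup>+x. H x * (\<Prod>k<Suc m. h k (x k)) \<partial>vol (Suc m))"
 unfolding UX .
qed

text \<open>Polar coordinates, from the area formula on a half strip. The fibre over a nonreal point is its modulus and argument.\<close>
lemma nn_integral_polar:
 fixes q :: "complex => ennreal"
 assumes q: "q \<in> borel_measurable borel"
 shows "(\<integral>\<^sup>+r. \<integral>\<^sup>+t. q (of_real r * cis t) * ennreal r * indicator {0<..} r * indicator {0<..<2 * pi} t \<partial>lborel \<partial>lborel) = (\<integral>\<^sup>+z. q z \<partial>lborel)"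
proof -
 define f where "f z = of_real (Re z) * cis (Im z)" for z
 define S where "S = {z. Re z > 0 & Im z > 0 & Im z < 2 * pi}"
 have S: "open S" unfolding S_def
 by (intro open_Collect_conj open_Collect_less continuous_intros)
 have ff: "f w = of_real (Re w) * exp (\<i> * of_real (Im w))" for w by (simp add: f_def cis_conv_exp)
 have Arg: "w = Complex (norm z) (Arg2pi z)" if "w \<in> S" "f w = z" for w z
 proof -
 have "Arg2pi z = Im w"
 by (rule Arg2pi_unique[of "Re w"]) (use that in "auto simp: ff S_def")
 moreover have "norm z = Re w" using that by (auto simp: f_def S_def norm_mult)
 ultimately show ?thesis by (simp add: complex_eq_iff)
 qed
 then have sub: "{w \<in> S. f w = z} \<subseteq> {Complex (norm z) (Arg2pi z)}" for z by blast
 have fib: "{w \<in> S. f w = z} = {Complex (norm z) (Arg2pi z)}" if "Im z ~= 0" for z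
 proof -
 have a: "0 <= Arg2pi z" "Arg2pi z < 2 * pi" "z = of_real (norm z) * exp (\<i> * of_real (Arg2pi z))"
 using Arg2pi[of z] by (auto simp: is_Arg_def)
 have "Arg2pi z ~= 0" using a(3) that by (metis Im_complex_of_real mult_zero_right of_real_0 exp_zero mult.right_neutral)
 with a that have "Complex (norm z) (Arg2pi z) \<in> S" by (auto simp: S_def)
 moreover have "f (Complex (norm z) (Arg2pi z)) = z" using a(3) by (simp add: ff)
 ultimately show ?thesis using sub[of z] by blast
 qed
 have [measurable]: "f \<in> borel_measurable borel" unfolding f_def[abs_def]
 by (intro borel_measurable_continuous_onI continuous_intros)
 have S_borel [measurable]: "S \<in> sets borel" using S by (rule borel_open)
 have J: "Re (cis (Im x)) * Im (of_real (Re x) * (\<i> * cis (Im x))) - Im (cis (Im x)) * Re (of_real (Re x) * (\<i> * cis (Im x))) = Re x" for x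
 proof -
 have aux: "c * (a * c) - s * (- (a * s)) = a * (c * c + s * s)" for a c s :: real by (simp add: algebra_simps)
 have "Re (cis (Im x)) * Im (of_real (Re x) * (\<i> * cis (Im x))) - Im (cis (Im x)) * Re (of_real (Re x) * (\<i> * cis (Im x))) = cos (Im x) * (Re x * cos (Im x)) - sin (Im x) * (- (Re x * sin (Im x)))"
 by simp
 also have "... = Re x" unfolding aux by simp
 finally show ?thesis .
 qed
 note [measurable] = q
 have "(\<integral>\<^sup>+x. q (f x) * ennreal \<bar>Re (cis (Im x)) * Im (of_real (Re x) * (\<i> * cis (Im x))) - Im (cis (Im x)) * Re (of_real (Re x) * (\<i> * cis (Im x)))\<bar> * indicator S x \<partial>lborel)
 = (\<integral>\<^sup>+z. (\<Sum>w\<in>{w \<in> S. f w = z}. q (f w)) \<partial>lborel)"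
 proof (rule area_formula_complex[OF S])
 fix x :: complex
 have dR: "(Re has_derivative Re) (at x)" and dI: "(Im has_derivative Im) (at x)"
 by (intro bounded_linear_imp_has_derivative bounded_linear_Re bounded_linear_Im)+
 have "((%z. exp (\<i> * of_real (Im z))) has_derivative (%v. exp (\<i> * of_real (Im x)) * (\<i> * of_real (Im v)))) (at x)"
 by (rule has_derivative_compose[OF _ DERIV_exp[THEN has_field_derivative_imp_has_derivative]])
  (intro has_derivative_mult_right has_derivative_of_real dI)
 from has_derivative_mult[OF has_derivative_of_real[OF dR] this]
 have "((%z. of_real (Re z) * exp (\<i> * of_real (Im z))) has_derivative
 (%v. of_real (Re x) * (exp (\<i> * of_real (Im x)) * (\<i> * of_real (Im v))) + of_real (Re v) * exp (\<i> * of_real (Im x)))) (at x)" .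
 then show "(f has_derivative (%v. of_real (Re v) * cis (Im x) + of_real (Im v) * (of_real (Re x) * (\<i> * cis (Im x))))) (at x)"
 unfolding f_def[abs_def] cis_conv_exp by (simp add: algebra_simps)
 next
 show "AE z in lborel. finite {w \<in> S. f w = z} & (\<forall>w\<in>S. f w = z -->
 Re (cis (Im w)) * Im (of_real (Re w) * (\<i> * cis (Im w))) - Im (cis (Im w)) * Re (of_real (Re w) * (\<i> * cis (Im w))) ~= 0)"
 proof (intro AE_I2 conjI ballI impI)
 fix z show "finite {w \<in> S. f w = z}" by (rule finite_subset[OF sub]) simp
 fix w assume "w \<in> S"
 then show "Re (cis (Im w)) * Im (of_real (Re w) * (\<i> * cis (Im w))) - Im (cis (Im w)) * Re (of_real (Re w) * (\<i> * cis (Im w))) ~= 0"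
  unfolding J by (simp add: S_def)
 qed
 qed (auto intro!: continuous_intros)
 also have "... = (\<integral>\<^sup>+z. q z \<partial>lborel)"
 proof (rule nn_integral_cong_AE)
 have "AE z in lborel. Im z ~= 0"
 proof (rule AE_Complex)
 show "AE x in lborel. AE y in lborel. Im (Complex x y) ~= 0"
  using AE_lborel_singleton[of "0::real"] by simp
 qed measurable
 then show "AE z in lborel. (\<Sum>w\<in>{w \<in> S. f w = z}. q (f w)) = q z"
 proof eventually_elim
 case (elim z)
 have "f (Complex (norm z) (Arg2pi z)) = z" using fib[OF elim] by blast
 then show ?case unfolding fib[OF elim] by simp
 qed
 qed
 finally have main: "(\<integral>\<^sup>+x. q (f x) * ennreal \<bar>Re (cis (Im x)) * Im (of_real (Re x) * (\<i> * cis (Im x))) - Im (cis (Im x)) * Re (of_real (Re x) * (\<i> * cis (Im x)))\<bar> * indicator S x \<partial>lborel) = (\<integral>\<^sup>+z. q z \<partial>lborel)" .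
 have "(\<integral>\<^sup>+x. q (f x) * ennreal \<bar>Re x\<bar> * indicator S x \<partial>lborel) =
 (\<integral>\<^sup>+r. \<integral>\<^sup>+t. q (f (Complex r t)) * ennreal \<bar>Re (Complex r t)\<bar> * indicator S (Complex r t) \<partial>lborel \<partial>lborel)"
 by (rule nn_integral_Complex) measurable
 also have "... = (\<integral>\<^sup>+r. \<integral>\<^sup>+t. q (of_real r * cis t) * ennreal r * indicator {0<..} r * indicator {0<..<2 * pi} t \<partial>lborel \<partial>lborel)"
 by (intro nn_integral_cong) (auto simp: f_def S_def split: split_indicator)
 finally show ?thesis using main unfolding J by simp
qed

lemma nn_integral_uniform_rotation:
 fixes q :: "complex => ennreal" and w :: "real => ennreal"
 assumes q [measurable]: "q \<in> borel_measurable borel" and w [measurable]: "w \<in> borel_measurable borel"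
 and w0: "!!r. r <= 0 ==> v r = 0" and v: "!!r. r > 0 ==> v r = w r * ennreal r" and vm [measurable]: "v \<in> borel_measurable borel"
 shows "(\<integral>\<^sup>+u. \<integral>\<^sup>+r. q (of_real r * u) \<partial>density lborel v \<partial>Theta_dist 1) =
 (\<integral>\<^sup>+z. q z * (w (norm z) * ennreal (1 / (2 * pi))) \<partial>lborel)" (is "?lhs = ?rhs")
proof -
 have c [measurable]: "cis \<in> borel_measurable borel"
 by (intro borel_measurable_continuous_onI continuous_intros)
 have inner [measurable]: "(%u. \<integral>\<^sup>+r. q (of_real r * u) \<partial>density lborel v) \<in> borel_measurable borel"
 proof -
 have slice: "(%r. q (of_real r * u)) \<in> borel_measurable lborel" for u
 using meas_o[OF _ q, of "%r. of_real r * u" borel] by simp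
 have "(%p. v (snd p) * q (of_real (snd p) * fst p)) \<in> borel_measurable (borel \<Otimes>\<^sub>M borel)"
 by (intro borel_measurable_times_ennreal meas_o[OF _ vm] meas_o[OF _ q]
  borel_measurable_times meas_o[OF measurable_snd borel_measurable_of_real]
  measurable_fst measurable_snd)
 then have m: "(%(u, r). v r * q (of_real r * u)) \<in> borel_measurable (borel \<Otimes>\<^sub>M lborel)"
 unfolding case_prod_unfold by (subst measurable_cong_sets[OF sets_pair_measure_cong refl]) auto
 have "(\<integral>\<^sup>+r. q (of_real r * u) \<partial>density lborel v) = (\<integral>\<^sup>+r. v r * q (of_real r * u) \<partial>lborel)" for u
 by (rule nn_integral_density[OF _ slice]) (simp add: vm)
 then show ?thesis using lborel.borel_measurable_nn_integral[OF m] by (simp only:)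
 qed
 have "?lhs =
 (\<integral>\<^sup>+t. \<integral>\<^sup>+r. q (of_real r * cis t) \<partial>density lborel v \<partial>uniform_measure lborel {0..<2 * pi})"
 unfolding Theta_dist_def if_P[OF refl]
 by (rule nn_integral_distr) (use c inner in simp_all)
 also have "... = (\<integral>\<^sup>+t. (\<integral>\<^sup>+r. q (of_real r * cis t) \<partial>density lborel v) * indicator {0..<2 * pi} t \<partial>lborel) / ennreal (2 * pi)"
 by (subst nn_integral_uniform_measure) auto
 also have "... = ennreal (1 / (2 * pi)) * (\<integral>\<^sup>+t. (\<integral>\<^sup>+r. q (of_real r * cis t) \<partial>density lborel v) * indicator {0..<2 * pi} t \<partial>lborel)"
 by (simp add: divide_ennreal_def inverse_ennreal mult.commute inverse_eq_divide)
 also have "(\<integral>\<^sup>+t. (\<integral>\<^sup>+r. q (of_real r * cis t) \<partial>density lborel v) * indicator {0..<2 * pi} t \<partial>lborel) =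
 (\<integral>\<^sup>+t. \<integral>\<^sup>+r. (q (of_real r * cis t) * w (norm (of_real r * cis t))) * ennreal r * indicator {0<..} r * indicator {0<..<2 * pi} t \<partial>lborel \<partial>lborel)"
 proof (rule nn_integral_cong_AE)
 show "AE t in lborel. (\<integral>\<^sup>+r. q (of_real r * cis t) \<partial>density lborel v) * indicator {0..<2 * pi} t =
 (\<integral>\<^sup>+r. (q (of_real r * cis t) * w (norm (of_real r * cis t))) * ennreal r * indicator {0<..} r * indicator {0<..<2 * pi} t \<partial>lborel)"
 using AE_lborel_singleton[of "0::real"]
 proof eventually_elim
 case (elim t)
 have [measurable]: "(%r. q (of_real r * cis t)) \<in> borel_measurable borel" by measurable
 have "(\<integral>\<^sup>+r. q (of_real r * cis t) \<partial>density lborel v) * indicator {0..<2 * pi} t =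
  (\<integral>\<^sup>+r. (v r * q (of_real r * cis t)) * indicator {0..<2 * pi} t \<partial>lborel)"
  by (subst nn_integral_density) (auto simp: nn_integral_multc)
 also have "... = (\<integral>\<^sup>+r. (q (of_real r * cis t) * w (norm (of_real r * cis t))) * ennreal r * indicator {0<..} r * indicator {0<..<2 * pi} t \<partial>lborel)"
 proof (rule nn_integral_cong)
  fix r :: real
  show "(v r * q (of_real r * cis t)) * indicator {0..<2 * pi} t = (q (of_real r * cis t) * w (norm (of_real r * cis t))) * ennreal r * indicator {0<..} r * indicator {0<..<2 * pi} t"
  proof (cases "r > 0")
  case True
  then show ?thesis using elim by (auto simp: v norm_mult mult_ac split: split_indicator)
  next
  case False
  then show ?thesis by (auto simp: w0)
  qed
 qed
 finally show ?case .
 qed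
 qed
 also have "... = (\<integral>\<^sup>+r. \<integral>\<^sup>+t. (q (of_real r * cis t) * w (norm (of_real r * cis t))) * ennreal r * indicator {0<..} r * indicator {0<..<2 * pi} t \<partial>lborel \<partial>lborel)"
 by (rule lborel_pair.Fubini') measurable
 also have "... = (\<integral>\<^sup>+z. q z * w (norm z) \<partial>lborel)"
 by (rule nn_integral_polar[where q = "%z. q z * w (norm z)"]) measurable
 also have "ennreal (1 / (2 * pi)) * ... = (\<integral>\<^sup>+z. ennreal (1 / (2 * pi)) * (q z * w (norm z)) \<partial>lborel)"
 by (rule nn_integral_cmult[symmetric]) measurable
 finally show ?thesis by (simp add: mult_ac)
qed

lemma nn_integral_random_sign:
 fixes q w :: "real => ennreal"
 assumes q [measurable]: "q \<in> borel_measurable borel" and w [measurable]: "w \<in> borel_measurable borel"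
 and w0: "!!r. r <= 0 ==> v r = 0" and v: "!!r. r > 0 ==> v r = w r" and vm [measurable]: "v \<in> borel_measurable borel"
 shows "(\<integral>\<^sup>+u. \<integral>\<^sup>+r. q (r * u) \<partial>density lborel v \<partial>B_dist 0 0) =
 (\<integral>\<^sup>+y. q y * (w \<bar>y\<bar> * ennreal (1 / 2)) \<partial>lborel)" (is "?lhs = ?rhs")
proof -
 have inner [measurable]: "(%u. \<integral>\<^sup>+r. q (r * u) \<partial>density lborel v) \<in> borel_measurable borel"
 proof -
 have slice: "(%r. q (r * u)) \<in> borel_measurable lborel" for u
 using meas_o[OF _ q, of "%r. r * u" borel] by simp
 have "(%p. v (snd p) * q (snd p * fst p)) \<in> borel_measurable (borel \<Otimes>\<^sub>M borel)"
 by (intro borel_measurable_times_ennreal meas_o[OF _ vm] meas_o[OF _ q]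
  borel_measurable_times measurable_fst measurable_snd)
 then have m: "(%(u, r). v r * q (r * u)) \<in> borel_measurable (borel \<Otimes>\<^sub>M lborel)"
 unfolding case_prod_unfold by (subst measurable_cong_sets[OF sets_pair_measure_cong refl]) auto
 have "(\<integral>\<^sup>+r. q (r * u) \<partial>density lborel v) = (\<integral>\<^sup>+r. v r * q (r * u) \<partial>lborel)" for u
 by (rule nn_integral_density[OF _ slice]) (simp add: vm)
 then show ?thesis using lborel.borel_measurable_nn_integral[OF m] by (simp only:)
 qed
 have "?lhs =
 (\<integral>\<^sup>+u. \<integral>\<^sup>+r. q (r * u) \<partial>density lborel v \<partial>measure_pmf (pmf_of_set {- 1, 1}))"
 unfolding B_dist_def if_P[OF conjI[OF refl refl]]
 by (rule nn_integral_distr) (use inner in simp_all)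
 also have "... = ((\<integral>\<^sup>+r. q (r * (- 1)) \<partial>density lborel v) + (\<integral>\<^sup>+r. q (r * 1) \<partial>density lborel v)) / 2"
 by (subst nn_integral_pmf_of_set) auto
 also have "(\<integral>\<^sup>+r. q (r * (- 1)) \<partial>density lborel v) = (\<integral>\<^sup>+r. v r * q (- r) \<partial>lborel)"
 by (subst nn_integral_density) auto
 also have "(\<integral>\<^sup>+r. q (r * 1) \<partial>density lborel v) = (\<integral>\<^sup>+r. v r * q r \<partial>lborel)"
 by (subst nn_integral_density) auto
 also have "(\<integral>\<^sup>+r. v r * q (- r) \<partial>lborel) = (\<integral>\<^sup>+r. v (- r) * q r \<partial>lborel)"
 by (subst nn_integral_real_affine[where c = "- 1" and t = 0]) auto
 also have "(\<integral>\<^sup>+r. v (- r) * q r \<partial>lborel) + (\<integral>\<^sup>+r. v r * q r \<partial>lborel) = (\<integral>\<^sup>+r. v (- r) * q r + v r * q r \<partial>lborel)"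
 by (rule nn_integral_add[symmetric]) measurable
 also have "... = (\<integral>\<^sup>+r. q r * w \<bar>r\<bar> \<partial>lborel)"
 proof (rule nn_integral_cong_AE)
 show "AE r in lborel. v (- r) * q r + v r * q r = q r * w \<bar>r\<bar>"
 using AE_lborel_singleton[of "0::real"]
 proof eventually_elim
 case (elim r)
 then consider "r > 0" | "r < 0" by linarith
 then show ?case by cases (auto simp: v w0 mult.commute)
 qed
 qed
 also have "(\<integral>\<^sup>+r. q r * w \<bar>r\<bar> \<partial>lborel) / 2 = (\<integral>\<^sup>+r. q r * w \<bar>r\<bar> * ennreal (1 / 2) \<partial>lborel)"
 proof -
 have "ennreal (1 / 2) = inverse 2" by (metis inverse_ennreal inverse_eq_divide ennreal_numeral zero_less_numeral zero_le_numeral)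
 then show ?thesis by (subst nn_integral_multc) (auto simp: divide_ennreal_def)
 qed
 finally show ?thesis by (simp add: mult_ac)
qed

section \<open>Measurable eigenvalues and principal powers\<close>

lemma measurable_L_entry:
 assumes "!!k. k <= i ==> (%x. a x k) \<in> borel_measurable N"
 shows "(%x. L_entry (a x) i j) \<in> borel_measurable N"
proof -
 have rho: "rho \<in> borel_measurable borel"
 unfolding rho_def[abs_def] by (intro borel_measurable_continuous_onI continuous_intros)
 have a: "(%x. a x i) \<in> borel_measurable N" "(%x. a x (i - 1)) \<in> borel_measurable N"
 by (simp_all add: assms)
 note meas_o[OF a(1) cs.measurable_\<kappa>] meas_o[OF a(1) rho]
 borel_measurable_uminus[OF a(2)] meas_o[OF a(2) rho]
 then show ?thesis
 unfolding L_entry_def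
 by (cases "even i"; cases "j = i"; cases "j = Suc i"; cases "Suc j = i") simp_all
qed

lemma measurable_M_entry:
 assumes a: "!!k. k <= i ==> (%x. a x k) \<in> borel_measurable N"
 shows "(%x. M_entry (a x) i j) \<in> borel_measurable N"
proof (cases "i = 0 \<or> j = 0")
 case True
 then show ?thesis by (simp add: M_entry_def)
next
 case False
 have "(%x. L_entry (a x \<circ> Suc) (i - 1) (j - 1)) \<in> borel_measurable N"
 by (rule measurable_L_entry) (use False in "auto intro!: a")
 with False show ?thesis by (simp add: M_entry_def)
qed

lemma measurable_coeff_mult:
 fixes p q :: "'x => complex poly"
 assumes "!!i. (%x. coeff (p x) i) \<in> borel_measurable N" "!!i. (%x. coeff (q x) i) \<in> borel_measurable N"
 shows "(%x. coeff (p x * q x) i) \<in> borel_measurable N"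
 unfolding coeff_mult by (intro borel_measurable_sum borel_measurable_times assms)

lemma measurable_coeff_prod:
 fixes p :: "'i => 'x => complex poly"
 assumes "finite I" "!!i j. i \<in> I ==> (%x. coeff (p i x) j) \<in> borel_measurable N"
 shows "(%x. coeff (\<Prod>i\<in>I. p i x) j) \<in> borel_measurable N"
 using assms
proof (induction I arbitrary: j rule: finite_induct)
 case (insert i I)
 have "(%x. coeff (p i x * (\<Prod>i\<in>I. p i x)) j) \<in> borel_measurable N"
 by (rule measurable_coeff_mult) (use insert in auto)
 then show ?case using insert.hyps by simp
qed simp

text \<open>The determinant is a polynomial expression in the entries.\<close>
lemma measurable_coeff_char_poly:
 fixes A :: "'x => complex mat"
 assumes A: "!!x. A x \<in> carrier_mat n n"
 and m: "!!i j. [|i < n; j < n|] ==> (%x. A x $$ (i, j)) \<in> borel_measurable N"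
 shows "(%x. coeff (char_poly (A x)) k) \<in> borel_measurable N"
proof -
 have dim: "dim_row (A x) = n" "dim_col (A x) = n" for x using A[of x] by auto
 have entry: "char_poly_matrix (A x) $$ (i, j) = [:- A x $$ (i, j), (if i = j then 1 else 0):]" if "i < n" "j < n" for x i j
 using that dim by (simp add: char_poly_matrix_def)
 have cp: "char_poly (A x) = (\<Sum>p | p permutes {0..<n}. signof p * (\<Prod>i = 0..<n. [:- A x $$ (i, p i), (if i = p i then 1 else 0):]))" for x
 proof -
 have "char_poly (A x) = (\<Sum>p | p permutes {0..<n}. signof p * (\<Prod>i = 0..<n. char_poly_matrix (A x) $$ (i, p i)))"
 unfolding char_poly_def Determinant.det_def by (simp add: char_poly_matrix_def dim)
 also have "... = (\<Sum>p | p permutes {0..<n}. signof p * (\<Prod>i = 0..<n. [:- A x $$ (i, p i), (if i = p i then 1 else 0):]))"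
 by (intro sum.cong prod.cong arg_cong2[where f = "(*)"] refl entry) (auto simp: permutes_in_image)
 finally show ?thesis .
 qed
 have e: "(%x. coeff [:- A x $$ (i, j), c:] l) \<in> borel_measurable N" if "i < n" "j < n" for i j l and c :: complex
 using m[OF that] by (cases l) (auto simp: coeff_pCons split: nat.split)
 show ?thesis
 unfolding cp coeff_sum
 proof (intro borel_measurable_sum measurable_coeff_mult measurable_coeff_prod)
 fix p i j assume "p \<in> {p. p permutes {0..<n}}" "i \<in> {0..<n}"
 then show "(%x. coeff [:- A x $$ (i, p i), (if i = p i then 1 else 0):] j) \<in> borel_measurable N"
 by (intro e) (auto simp: permutes_in_image[of p "{0..<n}"] dest: permutes_in_image)
 qed auto
qed

text \<open>No restriction on the moduli is imposed here: the map has to be measurable at all sample points, also on the null set where the matrix is not a contraction.\<close>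
lemma measurable_eigenvalue_mset_CMV:
 assumes n: "n \<ge> 1"
 shows "(%a. eigenvalue_mset (CMV n a)) \<in> ctuples n \<rightarrow>\<^sub>M unordered_borel n"
 unfolding eigenvalue_mset_def
proof (rule measurable_proots_poly)
 have carr: "CMV_L n a \<in> carrier_mat n n" "CMV_M n a \<in> carrier_mat n n" for a
 using n by (simp_all add: CMV_L_eq CMV_M_eq)
 then have C: "CMV n a \<in> carrier_mat n n" for a unfolding CMV_def by (rule mult_carrier_mat)
 show "degree (char_poly (CMV n a)) = n & coeff (char_poly (CMV n a)) n = 1" for a
 by (rule degree_monic_char_poly[OF C])
 show "(%a. coeff (char_poly (CMV n a)) i) \<in> borel_measurable (ctuples n)" for i
 proof (rule measurable_coeff_char_poly[OF C])
 fix i j assume ij: "i < n" "j < n"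
 have "CMV n a $$ (i, j) = (\<Sum>k<n. L_entry a i k * M_entry a k j)" for a
 unfolding CMV_def using ij n by (simp add: CMV_L_eq CMV_M_eq scalar_prod_def atLeast0LessThan)
 moreover have "(%a. \<Sum>k<n. L_entry a i k * M_entry a k j) \<in> borel_measurable (ctuples n)"
 by (intro borel_measurable_sum borel_measurable_times measurable_L_entry measurable_M_entry measurable_component_singleton)
  (use ij in auto)
 ultimately show "(%a. CMV n a $$ (i, j)) \<in> borel_measurable (ctuples n)" by simp
 qed
qed

text \<open>A product of principal powers is the exponential of a multiple of the sum of the logarithms. By symmetry this sum is real.\<close>
lemma prod_powr_conj_symmetric:
 fixes f :: "'i => complex"
 assumes I: "finite I" and f: "!!i. i \<in> I ==> Re (f i) > 0"
 and sym: "(\<Sum>i\<in>I. Ln (cnj (f i))) = (\<Sum>i\<in>I. Ln (f i))"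
 shows "(\<Prod>i\<in>I. f i powr complex_of_real s) = of_real ((\<Prod>i\<in>I. norm (f i)) powr s)"
proof -
 define S where "S = (\<Sum>i\<in>I. Ln (f i))"
 have nz: "f i ~= 0" if "i \<in> I" for i using f[OF that] by auto
 have "cnj S = (\<Sum>i\<in>I. Ln (cnj (f i)))"
 unfolding S_def cnj_sum
 proof (rule sum.cong[OF refl])
 fix i assume "i \<in> I"
 then have "f i \<notin> \<real>\<^sub>\<le>\<^sub>0" using f[of i] by (auto simp: complex_nonpos_Reals_iff)
 then show "cnj (Ln (f i)) = Ln (cnj (f i))" by (simp add: cnj_Ln)
 qed
 with sym have "cnj S = S" by (simp add: S_def)
 then have S: "S = of_real (Re S)" by (simp add: complex_eq_iff)
 have "Re S = (\<Sum>i\<in>I. ln (norm (f i)))"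
 unfolding S_def Re_sum by (intro sum.cong refl) (use nz in simp)
 also have "... = ln (\<Prod>i\<in>I. norm (f i))" by (rule ln_prod[symmetric]) (use nz I in auto)
 finally have R: "Re S = ln (\<Prod>i\<in>I. norm (f i))" .
 have "(\<Prod>i\<in>I. norm (f i)) ~= 0" using I nz by simp
 moreover have "(\<Prod>i\<in>I. f i powr complex_of_real s) = exp (of_real s * S)"
 proof -
 have "(\<Prod>i\<in>I. f i powr complex_of_real s) = (\<Prod>i\<in>I. exp (of_real s * Ln (f i)))"
 by (intro prod.cong refl) (use nz in "simp add: powr_def")
 also have "... = exp (of_real s * S)"
 unfolding S_def sum_distrib_left by (rule exp_sum[OF I, symmetric])
 finally show ?thesis .
 qed
 ultimately show ?thesis by (subst (asm) S) (simp add: R powr_def exp_of_real flip: of_real_mult)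
qed

lemma norm_schur_cohn_det_unordered:
 "norm (schur_cohn_det (unordered n z)) = (\<Prod>j<n. \<Prod>k<n. norm (1 - z j * cnj (z k)))"
 unfolding schur_cohn_det_def prod_mset_unordered prod_norm[symmetric] ..

lemma Re_one_minus_pos:
 fixes u :: complex
 assumes "norm u < 1" shows "Re (1 - u) > 0"
 using assms complex_Re_le_cmod[of u] by simp

lemma norm_mult_less_one:
 fixes u v :: complex
 assumes "norm u < 1" "norm v < 1" shows "norm (u * v) < 1"
proof -
 have "norm u * norm v <= norm u * 1" using assms by (intro mult_left_mono) auto
 then show ?thesis using assms by (simp add: norm_mult)
qed

lemma prod_schur_cohn_powr:
 assumes z: "!!j. j < n ==> norm (z j) < 1"
 shows "(\<Prod>j<n. \<Prod>k<n. (1 - z j * cnj (z k)) powr complex_of_real s) =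
 of_real (norm (schur_cohn_det (unordered n z)) powr s)"
proof -
 have "(\<Prod>p\<in>{..<n} \<times> {..<n}. (1 - z (fst p) * cnj (z (snd p))) powr complex_of_real s) =
 of_real ((\<Prod>p\<in>{..<n} \<times> {..<n}. norm (1 - z (fst p) * cnj (z (snd p)))) powr s)"
 proof (rule prod_powr_conj_symmetric)
 fix p assume "p \<in> {..<n} \<times> {..<n}"
 then show "Re (1 - z (fst p) * cnj (z (snd p))) > 0"
 by (intro Re_one_minus_pos norm_mult_less_one) (auto intro: z)
 next
 show "(\<Sum>p\<in>{..<n} \<times> {..<n}. Ln (cnj (1 - z (fst p) * cnj (z (snd p))))) =
 (\<Sum>p\<in>{..<n} \<times> {..<n}. Ln (1 - z (fst p) * cnj (z (snd p))))"
 by (rule sum.reindex_bij_witness[of _ prod.swap prod.swap]) (auto simp: mult.commute)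
 qed simp
 then show ?thesis
 unfolding norm_schur_cohn_det_unordered prod.cartesian_product case_prod_unfold .
qed

lemma norm_prod_proots_cp: "norm (prod_mset (proots (cp (Suc k) e))) = norm (e k :: complex)"
proof -
 have "norm (e k) = norm (poly (cp (Suc k) e) 0)" by simp
 also have "... = (\<Prod>z\<in>#proots (cp (Suc k) e). norm (0 - z))"
 unfolding poly_eq_prod_proots_cp by (rule norm_prod_mset)
 also have "... = (\<Prod>z\<in>#proots (cp (Suc k) e). norm z)" by simp
 also have "... = norm (\<Prod>z\<in>#proots (cp (Suc k) e). z)" by (rule norm_prod_mset[symmetric])
 finally show ?thesis by simp
qed

lemma szego_coeffs_last: "cs.szego_coeffs (Suc k) a k = - cnj (a k)"
 by (simp add: cs.szego_step_def)

lemma pred_in_disc: "Measurable.pred (unordered_borel n) (%X. \<forall>z\<in>#X. norm z < 1)"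
proof -
 have "Measurable.pred (count_space (UNIV :: unit set) \<Otimes>\<^sub>M (borel :: complex measure)) (%(w, z). norm z < 1)"
 by measurable
 from pred_Ball_mset[OF measurable_ident_sets[OF refl] measurable_const[of "()"] this]
 show ?thesis by simp
qed

section \<open>The circular density\<close>

definition circular_weight :: "nat => real => (real => real) => complex multiset => ennreal" where
 "circular_weight n \<beta> F X =
 ennreal (\<beta> ^ n / (2 * pi) ^ n * norm (schur_cohn_det X) powr (\<beta> / 2 - 1)) * ennreal (F (norm (prod_mset X)))"

definition Theta_density :: "real => nat => complex => real" where
 "Theta_density \<beta> k y = \<beta> * (real k + 1) / (2 * pi) * (1 - (norm y)\<^sup>2) powr (\<beta> / 2 * (real k + 1) - 1)"

lemma measurable_norm_schur_cohn_det:
 "(%X. norm (schur_cohn_det X)) \<in> borel_measurable (unordered_borel n)"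
proof (rule measurable_from_unordered_borel)
 show "(%z. norm (schur_cohn_det (unordered n z))) \<in> borel_measurable (ctuples n)"
 unfolding norm_schur_cohn_det_unordered
 by (intro borel_measurable_prod borel_measurable_norm borel_measurable_diff borel_measurable_const
  borel_measurable_times meas_o[OF _ cs.measurable_\<kappa>] measurable_component_singleton) auto
qed simp

lemma prod_mset_unordered_id: "prod_mset (unordered n z) = (\<Prod>j<n. z j)"
 using prod_mset_unordered[of "%z. z" n z] by simp

lemma measurable_norm_prod_mset: "(%X. norm (prod_mset X :: complex)) \<in> borel_measurable (unordered_borel n)"
proof (rule measurable_from_unordered_borel)
 show "(%z. norm (prod_mset (unordered n z))) \<in> borel_measurable (ctuples n)"
 unfolding prod_mset_unordered_id
 by (rule meas_o[OF borel_measurable_prod[where f = "%j z. z j"] borel_measurable_norm])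
 (rule measurable_component_singleton)
qed simp

lemma measurable_circular_weight:
 assumes F: "F \<in> borel_measurable borel"
 shows "circular_weight n \<beta> F \<in> borel_measurable (unordered_borel m)"
 unfolding circular_weight_def[abs_def]
 by (intro borel_measurable_times_ennreal meas_o[OF _ measurable_ennreal] borel_measurable_times
 borel_measurable_const powr_real_measurable measurable_norm_schur_cohn_det
 meas_o[OF measurable_norm_prod_mset F])

lemma circular_density_eq:
 assumes \<beta>: "\<beta> > 0" and z: "!!j. j < n ==> norm (z j) < 1"
 shows "ennreal (circular_density n \<beta> F z) = circular_weight n \<beta> F (unordered n z) * ennreal (vdm2 n z)"
proof -
 define c where "c = \<beta> ^ n / (2 * pi) ^ n * norm (schur_cohn_det (unordered n z)) powr (\<beta> / 2 - 1)"
 have c: "c \<ge> 0" using \<beta> by (simp add: c_def)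
 have v: "vdm2 n z \<ge> 0" by (simp add: vdm2_def prod_nonneg)
 have "circular_density n \<beta> F z = c * vdm2 n z * F (norm (\<Prod>j<n. z j))"
 proof -
 have "(\<Prod>j<n. \<Prod>k<n. (1 - z j * cnj (z k)) powr complex_of_real (\<beta> / 2 - 1)) =
  of_real (norm (schur_cohn_det (unordered n z)) powr (\<beta> / 2 - 1))"
 by (rule prod_schur_cohn_powr) (rule z)
 then show ?thesis unfolding circular_density_def c_def vdm2_def by (simp only: Re_complex_of_real)
 qed
 then have "ennreal (circular_density n \<beta> F z) = ennreal (c * vdm2 n z) * ennreal (F (norm (\<Prod>j<n. z j)))"
 using c v by (simp add: ennreal_mult')
 then show ?thesis
 unfolding circular_weight_def prod_mset_unordered_id c_def[symmetric] using c v
 by (simp add: ennreal_mult' mult_ac)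
qed

text \<open>Write \<open>r\<close> for \<open>1 - |x|\<^sup>2\<close>. The exponent of \<open>r\<close> in the density splits as \<open>(k + 1) (\<beta>/2 - 1) + k\<close>: the first part enters the Schur-Cohn determinant, the second is the volume factor. The constants leave \<open>n!\<close>, which counts the orderings of the roots.\<close>
lemma prod_Theta_density:
 assumes \<beta>: "\<beta> > 0" and n: "n = Suc m" and x: "!!k. k < n ==> norm (x k) < 1"
 shows "ennreal (\<Prod>k<n. Theta_density \<beta> k (x k)) * ennreal (F (norm (x m))) =
 ennreal (fact n) * circular_weight n \<beta> F (proots (cp n (cs.szego_coeffs n x))) *
 (\<Prod>k<n. cs.volume_factor k (cnj (x k)))"
proof -
 define r where "r k = 1 - (norm (x k))\<^sup>2" for k
 have r: "r k > 0" if "k < n" for k using x[OF that] by (simp add: r_def power_less_one_iff)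
 have vf: "cs.volume_factor k (cnj (x k)) = ennreal (r k ^ k)" if "k < n" for k
 proof -
 have "cs.volume_factor k (cnj (x k)) = ennreal (((r k)\<^sup>2) ^ (k div 2) * r k ^ (k mod 2))"
 unfolding cs.volume_factor_def using r[OF that] by (simp add: r_def ennreal_power ennreal_mult)
 also have "((r k)\<^sup>2) ^ (k div 2) * r k ^ (k mod 2) = r k ^ k"
 unfolding power_mult[symmetric] power_add[symmetric] by simp
 finally show ?thesis .
 qed
 have T: "Theta_density \<beta> k (x k) = \<beta> * (real k + 1) / (2 * pi) * ((r k ^ Suc k) powr (\<beta> / 2 - 1) * r k ^ k)" if "k < n" for k
 proof -
 have "(r k ^ Suc k) powr (\<beta> / 2 - 1) * r k ^ k = r k powr (real (Suc k) * (\<beta> / 2 - 1) + real k)"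
 using r[OF that] by (simp only: powr_realpow[symmetric] powr_powr powr_add)
 also have "real (Suc k) * (\<beta> / 2 - 1) + real k = \<beta> / 2 * (real k + 1) - 1" by (simp add: algebra_simps)
 finally show ?thesis by (simp add: Theta_density_def r_def)
 qed
 have fact: "(\<Prod>k<n. \<beta> * (real k + 1) / (2 * pi)) = fact n * (\<beta> ^ n / (2 * pi) ^ n)"
 by (induction n) (simp_all add: field_simps)
 define S where "S = norm (schur_cohn_det (proots (cp n (cs.szego_coeffs n x)))) powr (\<beta> / 2 - 1)"
 have "norm (schur_cohn_det (proots (cp n (cs.szego_coeffs n x)))) = (\<Prod>k<n. r k ^ Suc k)"
 unfolding schur_cohn_det_szego norm_of_real r_def[symmetric]
 by (rule abs_of_nonneg[OF prod_nonneg]) (use r in "simp add: less_imp_le del: power_Suc")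
 then have S: "S = (\<Prod>k<n. (r k ^ Suc k) powr (\<beta> / 2 - 1))"
 unfolding S_def by (simp only: prod_powr_distrib)
 have "(\<Prod>k<n. Theta_density \<beta> k (x k)) = (\<Prod>k<n. \<beta> * (real k + 1) / (2 * pi)) * (S * (\<Prod>k<n. r k ^ k))"
 unfolding S prod.distrib[symmetric] by (intro prod.cong refl T) simp
 also have "... = fact n * (\<beta> ^ n / (2 * pi) ^ n * S) * (\<Prod>k<n. r k ^ k)"
 unfolding fact by (simp only: mult.assoc)
 finally have E: "(\<Prod>k<n. Theta_density \<beta> k (x k)) = fact n * (\<beta> ^ n / (2 * pi) ^ n * S) * (\<Prod>k<n. r k ^ k)" .
 have b0: "0 <= \<beta> ^ n / (2 * pi) ^ n * S" using \<beta> by (simp add: S_def)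
 have c0: "0 <= (\<Prod>k<n. r k ^ k)" using r by (intro prod_nonneg) (simp add: less_imp_le)
 have "ennreal (\<Prod>k<n. Theta_density \<beta> k (x k)) =
 ennreal (fact n) * ennreal (\<beta> ^ n / (2 * pi) ^ n * S) * ennreal (\<Prod>k<n. r k ^ k)"
 unfolding E ennreal_mult[OF mult_nonneg_nonneg[OF fact_ge_zero b0] c0] ennreal_mult[OF fact_ge_zero b0] ..
 moreover have "ennreal (\<Prod>k<n. r k ^ k) = (\<Prod>k<n. cs.volume_factor k (cnj (x k)))"
 proof -
 have "(\<Prod>k<n. cs.volume_factor k (cnj (x k))) = (\<Prod>k<n. ennreal (r k ^ k))"
 by (rule prod.cong[OF refl]) (use vf in simp)
 also have "... = ennreal (\<Prod>k<n. r k ^ k)"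
 by (rule prod_ennreal) (use r in "simp add: less_imp_le")
 finally show ?thesis by (rule sym)
 qed
 moreover have "norm (prod_mset (proots (cp n (cs.szego_coeffs n x)))) = norm (x m)"
 unfolding n norm_prod_proots_cp szego_coeffs_last by simp
 ultimately show ?thesis
 unfolding circular_weight_def S_def by (simp add: mult_ac)
qed

theorem circular_change_of_variables:
 assumes \<beta>: "\<beta> > 0" and n: "n = Suc m" and F: "F \<in> borel_measurable borel"
 and A: "A \<in> sets (unordered_borel n)"
 shows "(\<integral>\<^sup>+x. indicator A (eigenvalue_mset (CMV n x)) *
 (\<Prod>k<n. if norm (x k) < 1 then ennreal (Theta_density \<beta> k (x k)) * (if k = m then ennreal (F (norm (x m))) else 1) else 0)
 \<partial>vol n) =
 (\<integral>\<^sup>+z. (if ALL j<n. norm (z j) < 1 then ennreal (circular_density n \<beta> F z) else 0) * indicator A (unordered n z) \<partial>vol n)" (is "?lhs = ?rhs")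
proof -
 define G where "G X = (if \<forall>z\<in>#X. norm z < 1 then indicator A X * circular_weight n \<beta> F X else 0)" for X
 have iA: "indicator A \<in> borel_measurable (unordered_borel n)" using A by (rule borel_measurable_indicator)
 have Gm: "G \<in> borel_measurable (unordered_borel n)"
 unfolding G_def[abs_def]
 by (rule measurable_If[OF borel_measurable_times_ennreal[OF iA measurable_circular_weight[OF F]] _ predE[OF pred_in_disc]]) simp
 define h where "h e = ennreal (fact n) * (indicator A (proots (cp n e)) * circular_weight n \<beta> F (proots (cp n e)))" for e
 have hm: "h \<in> borel_measurable (ctuples n)"
 unfolding h_def[abs_def]
 by (intro borel_measurable_times_ennreal borel_measurable_const
 meas_o[OF measurable_proots_cp iA] meas_o[OF measurable_proots_cp measurable_circular_weight[OF F]])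
 have "?lhs =
 (\<integral>\<^sup>+x. h (cs.szego_coeffs n x) * (\<Prod>k<n. cs.volume_factor k (cnj (x k)) * indicator (ball 0 1) (x k)) \<partial>vol n)"
 proof (rule nn_integral_cong)
 fix x :: "nat => complex"
 show "indicator A (eigenvalue_mset (CMV n x)) *
 (\<Prod>k<n. if norm (x k) < 1 then ennreal (Theta_density \<beta> k (x k)) * (if k = m then ennreal (F (norm (x m))) else 1) else 0) =
 h (cs.szego_coeffs n x) * (\<Prod>k<n. cs.volume_factor k (cnj (x k)) * indicator (ball 0 1) (x k))"
 proof (cases "ALL k<n. norm (x k) < 1")
 case False
 then obtain k where k: "k < n" "\<not> norm (x k) < 1" by blast
 have "(\<Prod>k<n. if norm (x k) < 1 then ennreal (Theta_density \<beta> k (x k)) * (if k = m then ennreal (F (norm (x m))) else 1) else 0) = 0"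
  by (rule prod_zero) (use k in auto)
 moreover have "(\<Prod>k<n. cs.volume_factor k (cnj (x k)) * indicator (ball 0 1) (x k)) = 0"
  by (rule prod_zero) (use k in "auto intro!: bexI[of _ k]")
 ultimately show ?thesis by (simp only: mult_zero_right)
 next
 case True
 have eig: "eigenvalue_mset (CMV n x) = proots (cp n (cs.szego_coeffs n x))"
  by (rule eigenvalue_mset_CMV) (use n True in "auto intro: less_imp_le")
 have "(\<Prod>k<n. if norm (x k) < 1 then ennreal (Theta_density \<beta> k (x k)) * (if k = m then ennreal (F (norm (x m))) else 1) else 0)
  = (\<Prod>k<n. ennreal (Theta_density \<beta> k (x k))) * (\<Prod>k<n. if k = m then ennreal (F (norm (x m))) else 1)"
  unfolding prod.distrib[symmetric] by (intro prod.cong refl) (use True in auto)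
 also have "(\<Prod>k<n. if k = m then ennreal (F (norm (x m))) else 1) = ennreal (F (norm (x m)))"
  by (subst prod.delta) (auto simp: n)
 also have "(\<Prod>k<n. ennreal (Theta_density \<beta> k (x k))) = ennreal (\<Prod>k<n. Theta_density \<beta> k (x k))"
  by (rule prod_ennreal) (use \<beta> in "auto simp: Theta_density_def")
 also have "... * ennreal (F (norm (x m))) = ennreal (fact n) * circular_weight n \<beta> F (proots (cp n (cs.szego_coeffs n x))) *
  (\<Prod>k<n. cs.volume_factor k (cnj (x k)))"
  by (rule prod_Theta_density[OF \<beta> n]) (use True in auto)
 also have "(\<Prod>k<n. cs.volume_factor k (cnj (x k))) = (\<Prod>k<n. cs.volume_factor k (cnj (x k)) * indicator (ball 0 1) (x k))"
  by (intro prod.cong refl) (use True in auto)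
 finally show ?thesis unfolding eig h_def by (simp only: mult_ac)
 qed
 qed
 also have "... = (\<integral>\<^sup>+e. (if e \<in> {e. in_disc n e} then h e else 0) \<partial>vol n)"
 proof (rule cs.szego_integral[where D = "%k. {e. in_disc k e}"])
 show "e \<in> {e. in_disc 0 e}" for e by simp
 show "cs.szego_step k a e \<in> {e. in_disc (Suc k) e} \<longleftrightarrow> e \<in> {e. in_disc k e}" if "norm a < 1" for k a e
 unfolding mem_Collect_eq by (rule schur_cohn_step[OF that])
 show "norm (e k) < 1" if "e \<in> {e. in_disc (Suc k) e}" for k e
 by (rule in_disc_last) (use that in blast)
 show "{e \<in> space (ctuples k). e \<in> {e. in_disc k e}} \<in> sets (ctuples k)" for k
 unfolding mem_Collect_eq by (rule predE[OF meas_o[OF measurable_proots_cp pred_in_disc]])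
 qed (rule hm)
 also have "... = (\<integral>\<^sup>+e. ennreal (fact n) * G (proots (cp n e)) \<partial>vol n)"
 by (simp only: h_def G_def mem_Collect_eq if_distrib[of "%u. ennreal (fact n) * u"] mult_zero_right)
 also have "... = ennreal (fact n) * (\<integral>\<^sup>+e. G (proots (cp n e)) \<partial>vol n)"
 by (rule nn_integral_cmult) (simp only: measurable_PiM_lborel1 meas_o[OF measurable_proots_cp Gm])
 also have "... = (\<integral>\<^sup>+z. G (unordered n z) * ennreal (vdm2 n z) \<partial>vol n)"
 proof -
 have "(fact n :: ennreal) = ennreal (fact n)"
 using ennreal_of_nat_eq_real_of_nat[of "fact n"] by (simp only: of_nat_fact)
 then show ?thesis unfolding vieta_integral_complex[OF Gm] by (simp only:)
 qed
 also have "... = ?rhs"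
 proof (rule nn_integral_cong)
 fix z :: "nat => complex"
 have iff: "(\<forall>w\<in>#unordered n z. norm w < 1) \<longleftrightarrow> (ALL j<n. norm (z j) < 1)"
 unfolding set_mset_unordered by auto
 show "G (unordered n z) * ennreal (vdm2 n z) = (if ALL j<n. norm (z j) < 1 then ennreal (circular_density n \<beta> F z) else 0) * indicator A (unordered n z)"
 proof (cases "ALL j<n. norm (z j) < 1")
 case True
 then have "ennreal (circular_density n \<beta> F z) = circular_weight n \<beta> F (unordered n z) * ennreal (vdm2 n z)"
  by (intro circular_density_eq[OF \<beta>]) auto
 with True show ?thesis unfolding G_def iff by (simp add: mult_ac)
 next
 case False
 show ?thesis unfolding G_def iff if_not_P[OF False] by simp
 qed
 qed
 finally show ?thesis .
qed

section \<open>The normalising constant and conjugation symmetry\<close>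

lemma prod_split_parity:
 fixes g :: "nat => real"
 shows "(\<Prod>k<n. g (Suc k)) = (\<Prod>j\<in>{..<Suc n div 2}. g (2 * j + 1)) * (\<Prod>j\<in>{..<n div 2}. g (2 * Suc j))"
proof (induction n)
 case (Suc n)
 show ?case
 proof (cases "even n")
 case True
 then obtain i where i: "n = 2 * i" by (auto elim: evenE)
 have d: "Suc (Suc n) div 2 = Suc i" "Suc n div 2 = i" "n div 2 = i" using i by auto
 show ?thesis unfolding prod.lessThan_Suc Suc.IH d by (simp add: i mult_ac)
 next
 case False
 then obtain i where i: "n = 2 * i + 1" by (auto elim: oddE)
 have d: "Suc (Suc n) div 2 = Suc i" "Suc n div 2 = Suc i" "n div 2 = i" using i by auto
 show ?thesis unfolding prod.lessThan_Suc Suc.IH d by (simp add: i mult_ac)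
 qed
qed simp

lemma prod_lessThan_add: "(\<Prod>k<a + b. h k) = (\<Prod>k<a. h k) * (\<Prod>j<b. h (a + j :: nat) :: real)"
 by (induction b) (simp_all add: mult.assoc)

definition B_const :: "real => real" where
 "B_const s = 2 powr (1 - s - s) * Gamma (s + s) / (Gamma s * Gamma s)"

text \<open>Legendre duplication. The factor one half comes from the random sign.\<close>
lemma B_const_eq:
 assumes s: "s > 0"
 shows "2 * Gamma (s + 1 / 2) / (sqrt pi * Gamma s) * (1 / 2) = B_const s" (is "?lhs = ?rhs")
proof -
 have pos: "Gamma s > 0" "Gamma (s + 1/2) > 0" "Gamma (2 * s) > 0" using s by (simp_all add: Gamma_real_pos)
 have ni: "complex_of_real s \<notin> \<int>\<^sub>\<le>\<^sub>0" "complex_of_real s + 1 / 2 \<notin> \<int>\<^sub>\<le>\<^sub>0"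
 using s by (auto elim!: nonpos_Ints_cases simp: complex_eq_iff)
 have "complex_of_real (Gamma s * Gamma (s + 1/2)) = Gamma (complex_of_real s) * Gamma (complex_of_real s + 1/2)"
 using Gamma_complex_of_real[of s] Gamma_complex_of_real[of "s + 1/2"] by simp
 also have "... = exp ((1 - 2 * complex_of_real s) * of_real (ln 2)) * of_real (sqrt pi) * Gamma (2 * complex_of_real s)"
 by (rule Gamma_legendre_duplication[OF ni])
 also have "... = complex_of_real (exp ((1 - 2 * s) * ln 2) * sqrt pi * Gamma (2 * s))"
 using Gamma_complex_of_real[of "2 * s"] by (simp add: exp_of_real[symmetric])
 finally have "Gamma s * Gamma (s + 1/2) = exp ((1 - 2 * s) * ln 2) * sqrt pi * Gamma (2 * s)"
 unfolding of_real_eq_iff .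
 also have "exp ((1 - 2 * s) * ln 2) = 2 powr (1 - s - s)" by (simp add: powr_def)
 finally have D: "Gamma s * Gamma (s + 1/2) = 2 powr (1 - s - s) * sqrt pi * Gamma (s + s)"
 unfolding mult_2 .
 have "?lhs = (Gamma s * Gamma (s + 1/2)) / (sqrt pi * (Gamma s * Gamma s))"
 using pos by (simp add: field_simps)
 also have "... = B_const s" unfolding D B_const_def using pos by (simp add: field_simps)
 finally show ?thesis .
qed

lemma B_const_pos: "s > 0 ==> B_const s > 0"
 unfolding B_const_def by (simp add: Gamma_real_pos)

text \<open>Gamma factors are separated by the parity of their index; those of even index cancel against half of the ones with doubled argument.\<close>
lemma prod_B_const:
 assumes \<beta>: "\<beta> > 0" and n: "n \<ge> 1"
 shows "(\<Prod>k<n. B_const (\<beta> * (real k + 1) / 4)) = 1 / P_const n \<beta>"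
proof -
 obtain m where m: "n = Suc m" using n by (cases n) auto
 define g where "g k = Gamma (\<beta> / 4 * real k)" for k
 have gpos: "g k > 0" if "k \<ge> 1" for k unfolding g_def using \<beta> that by (intro Gamma_real_pos) auto
 have B: "B_const (\<beta> * (real k + 1) / 4) = 2 powr (1 - \<beta> / 2 * real (Suc k)) * g (2 * Suc k) / (g (Suc k) * g (Suc k))" for k
 proof -
 have 1: "1 - \<beta> * (real k + 1) / 4 - \<beta> * (real k + 1) / 4 = 1 - \<beta> / 2 * real (Suc k)" by (simp add: field_simps)
 have 2: "\<beta> * (real k + 1) / 4 + \<beta> * (real k + 1) / 4 = \<beta> / 4 * real (2 * Suc k)" by (simp add: field_simps)
 have 3: "\<beta> * (real k + 1) / 4 = \<beta> / 4 * real (Suc k)" by (simp add: field_simps)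
 show ?thesis unfolding B_const_def g_def 1 2 unfolding 3 ..
 qed
 have pw: "(\<Prod>k<n. 2 powr (1 - \<beta> / 2 * real (Suc k))) = 2 powr (- (real n * (\<beta> / 2 - 1) + \<beta> / 4 * real n * (real n - 1)))"
 proof (induction n)
 case (Suc n)
 have "- (real n * (\<beta> / 2 - 1) + \<beta> / 4 * real n * (real n - 1)) + (1 - \<beta> / 2 * real (Suc n)) =
 - (real (Suc n) * (\<beta> / 2 - 1) + \<beta> / 4 * real (Suc n) * (real (Suc n) - 1))"
 by (simp add: field_simps)
 then show ?case using Suc by (simp only: prod.lessThan_Suc powr_add[symmetric])
 qed simp
 define A where "A = (\<Prod>j\<in>{..<Suc n div 2}. g (2 * j + 1) * g (2 * j + 1))"
 define E where "E = (\<Prod>j\<in>{..<n div 2}. g (2 * Suc j))"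
 define T where "T = (\<Prod>j\<in>{..<Suc n div 2}. g (2 * Suc (n div 2 + j)))"
 have Epos: "E > 0" and Tpos: "T > 0" and Apos: "A > 0"
 unfolding E_def T_def A_def by (intro prod_pos mult_pos_pos gpos; simp)+
 have sq: "(\<Prod>k<n. g (Suc k) * g (Suc k)) = A * (E * E)"
 proof -
 have "(\<Prod>k<n. g (Suc k) * g (Suc k)) = A * (\<Prod>j\<in>{..<n div 2}. g (2 * Suc j) * g (2 * Suc j))"
 unfolding A_def by (rule prod_split_parity[where g = "%k. g k * g k"])
 then show ?thesis unfolding E_def prod.distrib .
 qed
 have dbl: "(\<Prod>k<n. g (2 * Suc k)) = E * T"
 proof -
 have "n = n div 2 + Suc n div 2" by presburger
 then have "(\<Prod>k<n. g (2 * Suc k)) = (\<Prod>k<n div 2 + Suc n div 2. g (2 * Suc k))"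
 by (rule arg_cong[where f = "%m. \<Prod>k<m. g (2 * Suc k)"])
 also have "... = E * T" unfolding E_def T_def
 by (rule prod_lessThan_add)
 finally show ?thesis .
 qed
 have "(\<Prod>k<n. B_const (\<beta> * (real k + 1) / 4)) = (\<Prod>k<n. 2 powr (1 - \<beta> / 2 * real (Suc k))) * (\<Prod>k<n. g (2 * Suc k)) / (\<Prod>k<n. g (Suc k) * g (Suc k))"
 unfolding B prod_dividef prod.distrib ..
 also have "... = 2 powr (- (real n * (\<beta> / 2 - 1) + \<beta> / 4 * real n * (real n - 1))) * T / (A * E)"
 unfolding pw dbl sq using Epos by simp
 finally have L: "(\<Prod>k<n. B_const (\<beta> * (real k + 1) / 4)) = 2 powr (- (real n * (\<beta> / 2 - 1) + \<beta> / 4 * real n * (real n - 1))) * T / (A * E)" .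
 have r1: "{0..(n - 1) div 2} = {..<Suc n div 2}" using m by auto
 have P1: "(\<Prod>j=0..(n - 1) div 2. Gamma (- 1 + \<beta> / 4 + 1 + \<beta> / 2 * real j) * Gamma (- 1 + \<beta> / 4 + 1 + \<beta> / 2 * real j)
  / Gamma (- 1 + \<beta> / 4 + (- 1 + \<beta> / 4) + 2 + \<beta> / 2 * (real (n div 2) + real j))) = A / T"
 unfolding r1 A_def T_def prod_dividef[symmetric]
 proof (rule prod.cong[OF refl])
 fix j
 have 1: "- 1 + \<beta> / 4 + 1 + \<beta> / 2 * real j = \<beta> / 4 * real (2 * j + 1)" by (simp add: field_simps)
 have 2: "- 1 + \<beta> / 4 + (- 1 + \<beta> / 4) + 2 + \<beta> / 2 * (real (n div 2) + real j) = \<beta> / 4 * real (2 * Suc (n div 2 + j))" by (simp add: field_simps)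
 show "Gamma (- 1 + \<beta> / 4 + 1 + \<beta> / 2 * real j) * Gamma (- 1 + \<beta> / 4 + 1 + \<beta> / 2 * real j)
  / Gamma (- 1 + \<beta> / 4 + (- 1 + \<beta> / 4) + 2 + \<beta> / 2 * (real (n div 2) + real j)) = g (2 * j + 1) * g (2 * j + 1) / g (2 * Suc (n div 2 + j))"
 unfolding 1 2 g_def ..
 qed
 have P2: "(\<Prod>j=1..n div 2. Gamma (\<beta> / 2 * real j)) = E"
 proof -
 have "(\<Prod>j=1..n div 2. Gamma (\<beta> / 2 * real j)) = (\<Prod>j<n div 2. Gamma (\<beta> / 2 * real (Suc j)))"
 by (rule prod.reindex_bij_witness[of _ Suc "%j. j - 1"]) auto
 also have "... = E" unfolding E_def g_def by (intro prod.cong refl arg_cong[where f = Gamma]) (simp add: field_simps)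
 finally show ?thesis .
 qed
 have e: "real n * (- 1 + \<beta> / 4 + (- 1 + \<beta> / 4) + 1) + \<beta> / 4 * real n * (real n - 1) = real n * (\<beta> / 2 - 1) + \<beta> / 4 * real n * (real n - 1)"
 by (simp add: field_simps)
 have "P_const n \<beta> = 2 powr (real n * (\<beta> / 2 - 1) + \<beta> / 4 * real n * (real n - 1)) * (A / T) * E"
 unfolding P_const_def Let_def P1 P2 e ..
 moreover define p where "p = 2 powr (real n * (\<beta> / 2 - 1) + \<beta> / 4 * real n * (real n - 1))"
 ultimately have P: "P_const n \<beta> = p * (A / T) * E" by (simp only:)
 have "p > 0" by (simp add: p_def)
 then show ?thesis unfolding L powr_minus p_def[symmetric] P using Tpos Apos Epos by (simp add: field_simps)
qed

lemma unordered_conj_tuple_cnj: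
 "image_mset cnj (unordered (L + 2 * M) (conj_tuple L M x y)) = unordered (L + 2 * M) (conj_tuple L M x y)"
proof (induction M)
 case 0
 have "unordered L (conj_tuple L 0 x y) = unordered L (%j. of_real (x j))"
 by (rule unordered_cong) (simp add: conj_tuple_def)
 then show ?case by (simp add: unordered_def image_mset.compositionality comp_def)
next
 case (Suc M)
 have eq: "unordered (L + 2 * Suc M) (conj_tuple L (Suc M) x y) =
 add_mset (Complex (x (L + M)) (y (L + M))) (add_mset (cnj (Complex (x (L + M)) (y (L + M)))) (unordered (L + 2 * M) (conj_tuple L M x y)))"
 using unordered_conj_tuple_Suc[of L M x "x (L + M)" y "y (L + M)"] unfolding fun_upd_triv .
 show ?case unfolding eq using Suc.IH by (simp add: add_mset_commute)
qed

lemma proots_prod_linear: "proots (\<Prod>x\<in>#X. [:- f x, 1:]) = image_mset f (X :: complex multiset)"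
 for f :: "complex => complex"
proof (induction X)
 case (add x X)
 have "(\<Prod>x\<in>#X. [:- f x, 1:]) ~= 0" by (auto simp: prod_mset_zero_iff)
 then show ?case using add proots_mult[of "[:- f x, 1:]" "\<Prod>x\<in>#X. [:- f x, 1:]"] by simp
qed simp

lemma image_mset_cnj_proots_rp: "image_mset cnj (proots (rp n e)) = proots (rp n e)"
proof -
 have "(\<Prod>x\<in>#proots (rp n e). [:- cnj x, 1:]) = rp n e"
 proof (rule poly_eq_poly_eq_iff[THEN iffD1], rule ext)
 fix w
 have "poly (\<Prod>x\<in>#X. [:- cnj x, 1:]) w = cnj (\<Prod>x\<in>#X. cnj w - x)" for X
 by (induction X) (auto simp: algebra_simps)
 from this[of "proots (rp n e)"]
 have "poly (\<Prod>x\<in>#proots (rp n e). [:- cnj x, 1:]) w = cnj (poly (rp n e) (cnj w))"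
 unfolding poly_rp_eq_prod .
 then show "poly (\<Prod>x\<in>#proots (rp n e). [:- cnj x, 1:]) w = poly (rp n e) w"
 using poly_rp_cnj[of n e w] by simp
 qed
 then show ?thesis using proots_prod_linear[of cnj "proots (rp n e)"] by simp
qed

text \<open>Conjugation exchanges the roots in the upper and the lower half plane.\<close>
lemma nreal_parity:
 assumes X: "image_mset cnj X = X"
 shows "\<exists>M. size X = nreal X + 2 * M"
proof -
 have "filter_mset (%z. Im z < 0) X = filter_mset (%z. Im z < 0) (image_mset cnj X)" unfolding X ..
 also have "... = image_mset cnj (filter_mset (%z. Im z > 0) X)" by (induction X) auto
 finally have neg: "size (filter_mset (%z. Im z < 0) X) = size (filter_mset (%z. Im z > 0) X)" by simp
 have "size X = size (filter_mset (%z. Im z = 0) X) + size (filter_mset (%z. Im z > 0) X) + size (filter_mset (%z. Im z < 0) X)"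
 by (induction X) auto
 then show ?thesis unfolding neg nreal_def by (intro exI[where x = "size (filter_mset (%z. Im z > 0) X)"]) simp
qed

lemma norm_real_axis_factor_unordered: "norm (real_axis_factor (unordered n z)) = (\<Prod>j<n. norm (1 - (z j)\<^sup>2))"
 unfolding real_axis_factor_def prod_mset_unordered prod_norm[symmetric] ..

lemma prod_inverse_csqrt:
 assumes z: "!!j. j < n ==> norm (z j) < 1" and sym: "image_mset cnj (unordered n z) = unordered n z"
 shows "(\<Prod>j<n. 1 / csqrt (1 - (z j)\<^sup>2)) = of_real (norm (real_axis_factor (unordered n z)) powr (- (1 / 2)))"
proof -
 have pos: "Re (1 - (z j)\<^sup>2) > 0" if "j < n" for j
 unfolding power2_eq_square by (intro Re_one_minus_pos norm_mult_less_one z that)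
 have "(\<Prod>j<n. 1 / csqrt (1 - (z j)\<^sup>2)) = (\<Prod>j<n. (1 - (z j)\<^sup>2) powr complex_of_real (- (1 / 2)))"
 proof (rule prod.cong[OF refl])
 fix j assume "j \<in> {..<n}"
 then have nz: "1 - (z j)\<^sup>2 ~= 0" using pos[of j] by auto
 have "1 / csqrt (1 - (z j)\<^sup>2) = exp (- (Ln (1 - (z j)\<^sup>2) / 2))"
 unfolding csqrt_exp_Ln[OF nz] exp_minus by (simp add: inverse_eq_divide)
 also have "... = (1 - (z j)\<^sup>2) powr complex_of_real (- (1 / 2))" using nz by (simp add: powr_def)
 finally show "1 / csqrt (1 - (z j)\<^sup>2) = (1 - (z j)\<^sup>2) powr complex_of_real (- (1 / 2))" .
 qed
 also have "... = of_real ((\<Prod>j<n. norm (1 - (z j)\<^sup>2)) powr (- (1 / 2)))"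
 proof (rule prod_powr_conj_symmetric)
 have "(\<Sum>j<n. Ln (cnj (1 - (z j)\<^sup>2))) = (\<Sum>w\<in>#image_mset cnj (unordered n z). Ln (1 - w\<^sup>2))"
 by (simp add: image_mset.compositionality comp_def sum_mset_unordered)
 then show "(\<Sum>j<n. Ln (cnj (1 - (z j)\<^sup>2))) = (\<Sum>j<n. Ln (1 - (z j)\<^sup>2))"
 unfolding sym sum_mset_unordered .
 qed (use pos in auto)
 finally show ?thesis unfolding norm_real_axis_factor_unordered .
qed

section \<open>The orthogonal density\<close>

definition orthogonal_weight :: "nat => real => (real => real) => complex multiset => ennreal" where
 "orthogonal_weight n \<beta> G X =
 ennreal (1 / P_const n \<beta> * (norm (schur_cohn_det X) powr (\<beta> / 4 - 1 / 2) * norm (real_axis_factor X) powr (- (1 / 2))))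
 * ennreal (G (norm (prod_mset X)))"

definition B_density :: "real => nat => real => real" where
 "B_density \<beta> k y = B_const (\<beta> * (real k + 1) / 4) * (1 - y) powr (\<beta> * (real k + 1) / 4 - 1) * (1 + y) powr (\<beta> * (real k + 1) / 4 - 1)"

lemma P_const_pos: "\<beta> > 0 ==> n \<ge> 1 ==> P_const n \<beta> > 0"
proof -
 assume "\<beta> > 0" "n \<ge> 1"
 then have "1 / P_const n \<beta> > 0"
 unfolding prod_B_const[OF \<open>\<beta> > 0\<close> \<open>n \<ge> 1\<close>, symmetric] by (intro prod_pos B_const_pos) simp
 then show ?thesis by simp
qed

lemma measurable_orthogonal_weight:
 assumes G: "G \<in> borel_measurable borel"
 shows "orthogonal_weight n \<beta> G \<in> borel_measurable (unordered_borel m)"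
proof -
 have raf: "(%X. norm (real_axis_factor X)) \<in> borel_measurable (unordered_borel m)"
 proof (rule measurable_from_unordered_borel)
 show "(%z. norm (real_axis_factor (unordered m z))) \<in> borel_measurable (ctuples m)"
 unfolding norm_real_axis_factor_unordered
 by (intro borel_measurable_prod borel_measurable_norm borel_measurable_diff borel_measurable_const
  borel_measurable_power measurable_component_singleton) auto
 qed simp
 show ?thesis
 unfolding orthogonal_weight_def[abs_def]
 by (intro borel_measurable_times_ennreal meas_o[OF _ measurable_ennreal] borel_measurable_times
  borel_measurable_const powr_real_measurable measurable_norm_schur_cohn_det raf
  meas_o[OF measurable_norm_prod_mset G])
qed

lemma orthogonal_density_eq:
 assumes \<beta>: "\<beta> > 0" and n: "n \<ge> 1" and z: "!!j. j < n ==> norm (z j) < 1"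
 and sym: "image_mset cnj (unordered n z) = unordered n z"
 shows "ennreal (2 ^ M * orthogonal_density n \<beta> G z) = orthogonal_weight n \<beta> G (unordered n z) * ennreal (2 ^ M * vdm n z)" (is "?lhs = ?rhs")
proof -
 define s where "s = norm (schur_cohn_det (unordered n z)) powr (\<beta> / 4 - 1 / 2)"
 define a where "a = norm (real_axis_factor (unordered n z)) powr (- (1 / 2))"
 define c where "c = 1 / P_const n \<beta> * (s * a)"
 have c: "c \<ge> 0" using P_const_pos[OF \<beta> n] by (simp add: c_def s_def a_def)
 have v: "2 ^ M * vdm n z \<ge> 0" by simp
 have p1: "(\<Prod>j<n. \<Prod>k<n. (1 - z j * cnj (z k)) powr complex_of_real (\<beta> / 4 - 1 / 2)) = of_real s"
 unfolding s_def by (rule prod_schur_cohn_powr) (rule z)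
 have p2: "(\<Prod>j<n. 1 / csqrt (1 - (z j)\<^sup>2)) = of_real a"
 unfolding a_def by (rule prod_inverse_csqrt[OF z sym])
 have "orthogonal_density n \<beta> G z = c * vdm n z * G (norm (\<Prod>j<n. z j))"
 unfolding orthogonal_density_def p1 p2 of_real_mult[symmetric] Re_complex_of_real c_def vdm_def ..
 then have "2 ^ M * orthogonal_density n \<beta> G z = (c * (2 ^ M * vdm n z)) * G (norm (\<Prod>j<n. z j))"
 by (simp only: mult_ac)
 then have "?lhs = ennreal (c * (2 ^ M * vdm n z)) * ennreal (G (norm (\<Prod>j<n. z j)))"
 using ennreal_mult'[OF mult_nonneg_nonneg[OF c v]] by (simp only:)
 also have "ennreal (c * (2 ^ M * vdm n z)) = ennreal c * ennreal (2 ^ M * vdm n z)"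
 by (rule ennreal_mult[OF c v])
 finally show ?thesis
 unfolding orthogonal_weight_def prod_mset_unordered_id c_def[unfolded s_def a_def, symmetric] by (simp only: mult_ac)
qed

text \<open>For even \<open>k\<close> the middle factor is \<open>1 - y\<^sup>2\<close>; for odd \<open>k\<close> it is \<open>(1 - y)\<^sup>2\<close>, and its square root cancels the odd part of the volume factor.\<close>
lemma B_density_split:
 fixes y :: real
 assumes y: "\<bar>y\<bar> < 1"
 shows "(1 - y) powr (\<beta> * (real k + 1) / 4 - 1) * (1 + y) powr (\<beta> * (real k + 1) / 4 - 1) =
 ((1 - y\<^sup>2) ^ Suc k) powr (\<beta> / 4 - 1 / 2) * (((1 - y) * (1 + (-1) ^ k * y)) powr (- (1 / 2)) *
 ((1 - y\<^sup>2) ^ (k div 2) * (1 - y) ^ (k mod 2)))" (is "?lhs = ?rhs")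
proof -
 define r where "r = 1 - y\<^sup>2"
 have pos: "1 - y > 0" "1 + y > 0" using y by auto
 have rr: "r = (1 - y) * (1 + y)" by (simp add: r_def power2_eq_square algebra_simps)
 then have r: "r > 0" using pos by simp
 have "?lhs = r powr (\<beta> * (real k + 1) / 4 - 1)"
 unfolding rr using pos by (simp add: powr_mult)
 moreover have "((1 - y) * (1 + (-1) ^ k * y)) powr (- (1 / 2)) * (r ^ (k div 2) * (1 - y) ^ (k mod 2)) =
 r powr (\<beta> * (real k + 1) / 4 - 1 - real (Suc k) * (\<beta> / 4 - 1 / 2))"
 proof (cases "even k")
 case True
 then obtain i where i: "k = 2 * i" by (auto elim: evenE)
 have e: "\<beta> * (real k + 1) / 4 - 1 - real (Suc k) * (\<beta> / 4 - 1 / 2) = - (1 / 2) + real i"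
 by (simp add: i field_simps)
 have k: "(- 1) ^ k = (1::real)" "k div 2 = i" "k mod 2 = 0" by (simp_all add: i)
 show ?thesis unfolding e k powr_add powr_realpow[OF r] by (simp add: rr[symmetric])
 next
 case False
 then obtain i where i: "k = 2 * i + 1" by (auto elim: oddE)
 have e: "\<beta> * (real k + 1) / 4 - 1 - real (Suc k) * (\<beta> / 4 - 1 / 2) = real i"
 by (simp add: i field_simps)
 have k: "(- 1) ^ k = (- 1::real)" "k div 2 = i" "k mod 2 = 1" by (simp_all add: i)
 have "((1 - y) * (1 - y)) powr (- (1 / 2)) = (1 - y) powr (- (1 / 2)) * (1 - y) powr (- (1 / 2))"
 using pos by (simp add: powr_mult)
 also have "... = (1 - y) powr (- 1)" by (simp flip: powr_add)
 also have "... = 1 / (1 - y)" by (rule powr_neg_one[OF pos(1)])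
 finally have "((1 - y) * (1 + (- 1) * y)) powr (- (1 / 2)) = 1 / (1 - y)" by simp
 then show ?thesis unfolding e k powr_realpow[OF r] using pos by simp
 qed
 moreover have "r powr (\<beta> * (real k + 1) / 4 - 1) =
 (r ^ Suc k) powr (\<beta> / 4 - 1 / 2) * r powr (\<beta> * (real k + 1) / 4 - 1 - real (Suc k) * (\<beta> / 4 - 1 / 2))"
 unfolding powr_realpow[OF r, symmetric] powr_powr powr_add[symmetric] by simp
 ultimately show ?thesis unfolding r_def[symmetric] by (simp only:)
qed

lemma prod_B_density:
 assumes \<beta>: "\<beta> > 0" and n: "n = Suc m" and x: "!!k. k < n ==> \<bar>x k\<bar> < 1"
 shows "ennreal (\<Prod>k<n. B_density \<beta> k (x k)) * ennreal (G \<bar>x m\<bar>) =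
 orthogonal_weight n \<beta> G (proots (rp n (rs.szego_coeffs n x))) * (\<Prod>k<n. rs.volume_factor k (x k))"
proof -
 define X where "X = proots (rp n (rs.szego_coeffs n x))"
 define v where "v k = (1 - (x k)\<^sup>2) ^ (k div 2) * (1 - x k) ^ (k mod 2)" for k
 have r: "1 - (x k)\<^sup>2 > 0" and p: "1 - x k > 0" "1 + x k > 0" if "k < n" for k
 using x[OF that] by (auto simp: abs_square_less_1)
 have v0: "v k \<ge> 0" if "k < n" for k unfolding v_def using r[OF that] p[OF that] by (intro mult_nonneg_nonneg zero_le_power) auto
 have vf: "rs.volume_factor k (x k) = ennreal (v k)" if "k < n" for k
 unfolding rs.volume_factor_def v_def using r[OF that] p[OF that] by (simp add: ennreal_power ennreal_mult)
 have "schur_cohn_det X = complex_of_real (\<Prod>k<n. (1 - (x k)\<^sup>2) ^ Suc k)"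
 unfolding X_def rp_szego_coeffs schur_cohn_det_szego by simp
 then have sc: "norm (schur_cohn_det X) = (\<Prod>k<n. (1 - (x k)\<^sup>2) ^ Suc k)"
 apply (simp only: norm_of_real)
 apply (rule abs_of_nonneg[OF prod_nonneg])
 using r by (simp add: less_imp_le del: power_Suc)
 have pm: "(1 - x k) * (1 + (- 1) ^ k * x k) \<ge> 0" if "k < n" for k
 using p[OF that] by (cases "even k") auto
 have "real_axis_factor X = complex_of_real (\<Prod>k<n. (1 - x k) * (1 + (- 1) ^ k * x k))"
 unfolding X_def by (rule real_axis_factor_szego)
 then have ra: "norm (real_axis_factor X) = (\<Prod>k<n. (1 - x k) * (1 + (- 1) ^ k * x k))"
 using abs_of_nonneg[OF prod_nonneg, of "{..<n}" "%k. (1 - x k) * (1 + (- 1) ^ k * x k)"] pm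
 by (simp only: norm_of_real lessThan_iff)
 define c where "c = 1 / P_const n \<beta> * (norm (schur_cohn_det X) powr (\<beta> / 4 - 1 / 2) * norm (real_axis_factor X) powr (- (1 / 2)))"
 have n1: "n \<ge> 1" using n by simp
 have c0: "c \<ge> 0" using P_const_pos[OF \<beta> n1] by (simp add: c_def)
 have "(\<Prod>k<n. B_density \<beta> k (x k)) = (\<Prod>k<n. B_const (\<beta> * (real k + 1) / 4) * (((1 - (x k)\<^sup>2) ^ Suc k) powr (\<beta> / 4 - 1 / 2) *
 (((1 - x k) * (1 + (- 1) ^ k * x k)) powr (- (1 / 2)) * v k)))"
 proof (rule prod.cong[OF refl])
 fix k assume "k \<in> {..<n}"
 then have "\<bar>x k\<bar> < 1" using x by simp
 from B_density_split[OF this, of \<beta> k]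
 show "B_density \<beta> k (x k) = B_const (\<beta> * (real k + 1) / 4) * (((1 - (x k)\<^sup>2) ^ Suc k) powr (\<beta> / 4 - 1 / 2) *
 (((1 - x k) * (1 + (- 1) ^ k * x k)) powr (- (1 / 2)) * v k))"
 unfolding B_density_def v_def by (simp only: mult.assoc)
 qed
 also have "... = 1 / P_const n \<beta> * ((\<Prod>k<n. ((1 - (x k)\<^sup>2) ^ Suc k) powr (\<beta> / 4 - 1 / 2)) *
 ((\<Prod>k<n. ((1 - x k) * (1 + (- 1) ^ k * x k)) powr (- (1 / 2))) * (\<Prod>k<n. v k)))"
 unfolding prod.distrib prod_B_const[OF \<beta> n1] ..
 also have "... = c * (\<Prod>k<n. v k)"
 unfolding c_def sc ra prod_powr_distrib by (simp only: mult.assoc)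
 finally have E: "(\<Prod>k<n. B_density \<beta> k (x k)) = c * (\<Prod>k<n. v k)" .
 have V: "(\<Prod>k<n. rs.volume_factor k (x k)) = ennreal (\<Prod>k<n. v k)"
 proof -
 have "(\<Prod>k<n. rs.volume_factor k (x k)) = (\<Prod>k<n. ennreal (v k))"
 by (rule prod.cong[OF refl]) (use vf in simp)
 also have "... = ennreal (\<Prod>k<n. v k)" by (rule prod_ennreal) (use v0 in simp)
 finally show ?thesis .
 qed
 have "ennreal (\<Prod>k<n. B_density \<beta> k (x k)) = ennreal c * ennreal (\<Prod>k<n. v k)"
 unfolding E by (rule ennreal_mult[OF c0 prod_nonneg]) (use v0 in simp)
 moreover have "norm (prod_mset X) = \<bar>x m\<bar>"
 unfolding X_def rp_szego_coeffs n norm_prod_proots_cp szego_coeffs_last by simp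
 ultimately show ?thesis
 unfolding X_def[symmetric] orthogonal_weight_def c_def[symmetric] V by (simp only: mult_ac)
qed

abbreviation conj_pairs_integral :: "nat => nat => (complex multiset => ennreal) => ennreal" where
 "conj_pairs_integral L M W \<equiv>
 (\<integral>\<^sup>+x. \<integral>\<^sup>+y. (if (x, y) \<in> D_coords L M then W (unordered (L + 2 * M) (conj_tuple L M x y)) *
  ennreal (2 ^ M * vdm (L + 2 * M) (conj_tuple L M x y)) else 0) \<partial>PiM {L..<L+M} (%_. lborel) \<partial>vol (L+M))"

text \<open>The number of nonreal roots is even, so every real polynomial falls into exactly one of the classes counted by the sum over \<open>M\<close>.\<close>
theorem orthogonal_change_of_variables:
 assumes \<beta>: "\<beta> > 0" and n: "n = Suc m" and G: "G \<in> borel_measurable borel"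
 and A: "A \<in> sets (unordered_borel n)"
 shows "(\<integral>\<^sup>+x. indicator A (eigenvalue_mset (CMV n (%k. of_real (x k)))) *
 (\<Prod>k<n. if \<bar>x k\<bar> < 1 then ennreal (B_density \<beta> k (x k)) * (if k = m then ennreal (G \<bar>x m\<bar>) else 1) else 0)
 \<partial>vol n) =
 (\<Sum>M\<le>n div 2. conj_pairs_integral (n - 2 * M) M (%X. indicator A X * orthogonal_weight n \<beta> G X))" (is "?lhs = ?rhs")
proof -
 define W where "W X = indicator A X * orthogonal_weight n \<beta> G X" for X
 have iA: "indicator A \<in> borel_measurable (unordered_borel n)" using A by (rule borel_measurable_indicator)
 have Wm: "W \<in> borel_measurable (unordered_borel n)"
 unfolding W_def[abs_def] by (intro borel_measurable_times_ennreal iA measurable_orthogonal_weight[OF G])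
 define h where "h e = W (proots (rp n e))" for e
 have hm: "h \<in> borel_measurable (tuples n)"
 unfolding h_def[abs_def] by (rule meas_o[OF measurable_proots_rp Wm])
 have "?lhs =
 (\<integral>\<^sup>+x. h (rs.szego_coeffs n x) * (\<Prod>k<n. rs.volume_factor k (x k) * indicator (ball 0 1) (x k)) \<partial>vol n)"
 proof (rule nn_integral_cong)
 fix x :: "nat => real"
 show "indicator A (eigenvalue_mset (CMV n (%k. of_real (x k)))) *
 (\<Prod>k<n. if \<bar>x k\<bar> < 1 then ennreal (B_density \<beta> k (x k)) * (if k = m then ennreal (G \<bar>x m\<bar>) else 1) else 0) =
 h (rs.szego_coeffs n x) * (\<Prod>k<n. rs.volume_factor k (x k) * indicator (ball 0 1) (x k))"
 proof (cases "ALL k<n. \<bar>x k\<bar> < 1")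
 case False
 then obtain k where k: "k < n" "\<not> \<bar>x k\<bar> < 1" by blast
 have "(\<Prod>k<n. if \<bar>x k\<bar> < 1 then ennreal (B_density \<beta> k (x k)) * (if k = m then ennreal (G \<bar>x m\<bar>) else 1) else 0) = 0"
  by (rule prod_zero) (use k in auto)
 moreover have "(\<Prod>k<n. rs.volume_factor k (x k) * indicator (ball 0 1) (x k)) = 0"
  by (rule prod_zero) (use k in "auto intro!: bexI[of _ k]")
 ultimately show ?thesis by (simp only: mult_zero_right)
 next
 case True
 have eig: "eigenvalue_mset (CMV n (%k. of_real (x k))) = proots (rp n (rs.szego_coeffs n x))"
  unfolding rp_szego_coeffs by (rule eigenvalue_mset_CMV) (use n True in "auto intro: less_imp_le")
 have "(\<Prod>k<n. if \<bar>x k\<bar> < 1 then ennreal (B_density \<beta> k (x k)) * (if k = m then ennreal (G \<bar>x m\<bar>) else 1) else 0)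
  = (\<Prod>k<n. ennreal (B_density \<beta> k (x k))) * (\<Prod>k<n. if k = m then ennreal (G \<bar>x m\<bar>) else 1)"
  unfolding prod.distrib[symmetric] by (intro prod.cong refl) (use True in auto)
 also have "(\<Prod>k<n. if k = m then ennreal (G \<bar>x m\<bar>) else 1) = ennreal (G \<bar>x m\<bar>)"
  by (subst prod.delta) (auto simp: n)
 also have "(\<Prod>k<n. ennreal (B_density \<beta> k (x k))) = ennreal (\<Prod>k<n. B_density \<beta> k (x k))"
 proof (rule prod_ennreal)
  show "B_density \<beta> k (x k) \<ge> 0" for k
  unfolding B_density_def using B_const_pos[of "\<beta> * (real k + 1) / 4"] \<beta> by simp
 qed
 also have "... * ennreal (G \<bar>x m\<bar>) = orthogonal_weight n \<beta> G (proots (rp n (rs.szego_coeffs n x))) *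
  (\<Prod>k<n. rs.volume_factor k (x k))"
  by (rule prod_B_density[OF \<beta> n]) (use True in auto)
 also have "(\<Prod>k<n. rs.volume_factor k (x k)) = (\<Prod>k<n. rs.volume_factor k (x k) * indicator (ball 0 1) (x k))"
  by (intro prod.cong refl) (use True in auto)
 finally show ?thesis unfolding eig h_def W_def by (simp only: mult_ac)
 qed
 qed
 also have "... = (\<integral>\<^sup>+e. (if e \<in> {e. \<forall>z\<in>#proots (rp n e). norm z < 1} then h e else 0) \<partial>vol n)"
 proof (rule rs.szego_integral[where D = "%k. {e. \<forall>z\<in>#proots (rp k e). norm z < 1}"])
 show "e \<in> {e. \<forall>z\<in>#proots (rp 0 e). norm z < 1}" for e by simp
 show "rs.szego_step k a e \<in> {e. \<forall>z\<in>#proots (rp (Suc k) e). norm z < 1} \<longleftrightarrow> e \<in> {e. \<forall>z\<in>#proots (rp k e). norm z < 1}"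
 if "norm a < 1" for k a e
 unfolding mem_Collect_eq rp_szego_step unfolding rp_def by (rule schur_cohn_step) (use that in simp)
 show "norm (e k) < 1" if "e \<in> {e. \<forall>z\<in>#proots (rp (Suc k) e). norm z < 1}" for k e
 using in_disc_last[of k "%j. complex_of_real (e j)"] that unfolding mem_Collect_eq rp_def norm_of_real real_norm_def by blast
 show "{e \<in> space (tuples k). e \<in> {e. \<forall>z\<in>#proots (rp k e). norm z < 1}} \<in> sets (tuples k)" for k
 unfolding mem_Collect_eq by (rule predE[OF meas_o[OF measurable_proots_rp pred_in_disc]])
 qed (rule hm)
 also have "... = (\<integral>\<^sup>+e. (\<Sum>M\<le>n div 2. if nreal (proots (rp n e)) = n - 2 * M & (\<forall>z\<in>#proots (rp n e). norm z < 1)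
 then W (proots (rp n e)) else 0) \<partial>vol n)"
 proof (rule nn_integral_cong)
 fix e
 define X where "X = proots (rp n e)"
 obtain M0 where M0: "size X = nreal X + 2 * M0"
 using nreal_parity[OF image_mset_cnj_proots_rp[of n e]] unfolding X_def by blast
 have sX: "size X = n" unfolding X_def by (rule size_proots_rp)
 have M0n: "M0 <= n div 2" using M0 sX by linarith
 have iff: "nreal X = n - 2 * M \<longleftrightarrow> M0 = M" if "M <= n div 2" for M
 using M0 sX that by linarith
 have "(\<Sum>M\<le>n div 2. if nreal X = n - 2 * M & (\<forall>z\<in>#X. norm z < 1) then W X else 0) =
 (\<Sum>M\<le>n div 2. if M0 = M then (if \<forall>z\<in>#X. norm z < 1 then W X else 0) else 0)"
 by (intro sum.cong refl) (simp add: iff)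
 also have "... = (if \<forall>z\<in>#X. norm z < 1 then W X else 0)"
 by (subst sum.delta') (use M0n in auto)
 finally show "(if e \<in> {e. \<forall>z\<in>#proots (rp n e). norm z < 1} then h e else 0) =
 (\<Sum>M\<le>n div 2. if nreal (proots (rp n e)) = n - 2 * M & (\<forall>z\<in>#proots (rp n e). norm z < 1) then W (proots (rp n e)) else 0)"
 unfolding h_def mem_Collect_eq X_def by (rule sym)
 qed
 also have "... = (\<Sum>M\<le>n div 2. \<integral>\<^sup>+e. (if nreal (proots (rp n e)) = n - 2 * M & (\<forall>z\<in>#proots (rp n e). norm z < 1)
 then W (proots (rp n e)) else 0) \<partial>vol n)"
 proof (rule nn_integral_sum)
 fix M
 have "Measurable.pred (unordered_borel n) (%X. nreal X = n - 2 * M & (\<forall>z\<in>#X. norm z < 1))"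
 by (intro pred_intros_logic pred_in_disc meas_o[OF measurable_nreal]) simp
 then have "(%X. if nreal X = n - 2 * M & (\<forall>z\<in>#X. norm z < 1) then W X else 0) \<in> borel_measurable (unordered_borel n)"
 by (intro measurable_If Wm borel_measurable_const predE)
 from meas_o[OF measurable_proots_rp this]
 show "(%e. if nreal (proots (rp n e)) = n - 2 * M & (\<forall>z\<in>#proots (rp n e). norm z < 1) then W (proots (rp n e)) else 0)
 \<in> borel_measurable (vol n)"
 unfolding measurable_PiM_lborel1 .
 qed
 also have "... = (\<Sum>M\<le>n div 2. conj_pairs_integral (n - 2 * M) M W)"
 proof (rule sum.cong[OF refl])
 fix M assume "M \<in> {..n div 2}"
 then have e: "n - 2 * M + 2 * M = n" by auto
 from vieta_integral_real[of W "n - 2 * M" M] Wm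
 show "(\<integral>\<^sup>+e. (if nreal (proots (rp n e)) = n - 2 * M & (\<forall>z\<in>#proots (rp n e). norm z < 1)
 then W (proots (rp n e)) else 0) \<partial>vol n) = conj_pairs_integral (n - 2 * M) M W"
 unfolding e by (simp only:)
 qed
 finally show ?thesis unfolding W_def .
qed

text \<open>A finite sum of measures is countably additive.\<close>
lemma emeasure_wedge_measure:
 assumes A: "A \<in> sets (ctuples n)"
 shows "emeasure (wedge_measure n f) A = (\<Sum>M\<le>n div 2. emeasure (wedge_measure_part (n - 2 * M) M f) A)"
proof -
 have S: "sets (wedge_measure_part (n - 2 * M) M f) = sets (ctuples n)" if "M <= n div 2" for M
 proof -
 have "n - 2 * M + 2 * M = n" using that by linarith
 then show ?thesis unfolding wedge_measure_part_def sets_distr by (simp only:)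
 qed
 show ?thesis
 unfolding wedge_measure_def
 proof (rule emeasure_measure_of_sigma[OF sets.sigma_algebra_axioms _ _ A])
 show "positive (sets (ctuples n)) (%A. \<Sum>M\<le>n div 2. emeasure (wedge_measure_part (n - 2 * M) M f) A)"
 by (simp add: positive_def)
 show "countably_additive (sets (ctuples n)) (%A. \<Sum>M\<le>n div 2. emeasure (wedge_measure_part (n - 2 * M) M f) A)"
 proof (rule countably_additiveI)
 fix F :: "nat => (nat => complex) set"
 assume F: "range F \<subseteq> sets (ctuples n)" "disjoint_family F"
 have "(\<Sum>i. \<Sum>M\<le>n div 2. emeasure (wedge_measure_part (n - 2 * M) M f) (F i)) =
  (\<Sum>M\<le>n div 2. \<Sum>i. emeasure (wedge_measure_part (n - 2 * M) M f) (F i))"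
  by (rule suminf_sum) (rule summableI)
 also have "... = (\<Sum>M\<le>n div 2. emeasure (wedge_measure_part (n - 2 * M) M f) (\<Union>i. F i))"
  by (intro sum.cong refl suminf_emeasure) (use F S in auto)
 finally show "(\<Sum>i. \<Sum>M\<le>n div 2. emeasure (wedge_measure_part (n - 2 * M) M f) (F i)) =
  (\<Sum>M\<le>n div 2. emeasure (wedge_measure_part (n - 2 * M) M f) (\<Union>i. F i))" .
 qed
 qed
qed

lemma pred_D_coords: "Measurable.pred (pair_coords L M) (%p. p \<in> D_coords L M)"
proof -
 have eq: "p \<in> D_coords L M \<longleftrightarrow> (\<forall>i\<in>{..<L+M}. -1 < fst p i & fst p i < 1) &
 (\<forall>r\<in>{..<L}. \<forall>s\<in>{..<L}. r < s --> fst p r < fst p s) &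
 (\<forall>r\<in>{L..<L+M}. \<forall>s\<in>{L..<L+M}. r < s --> fst p r < fst p s) &
 (\<forall>i\<in>{L..<L+M}. 0 < snd p i) &
 (\<forall>z\<in>#unordered (L + 2 * M) (conj_tuple L M (fst p) (snd p)). norm z < 1)" for p
 unfolding D_coords_def set_mset_unordered strict_mono_on_def by (cases p) (auto simp: Ball_def)
 show ?thesis
 unfolding eq
 by (intro pred_intros_logic pred_intros_finite borel_measurable_pred_less borel_measurable_const measurable_pair_coords
  meas_o[OF meas_o[OF measurable_conj_tuple measurable_unordered] pred_in_disc]) auto
qed

text \<open>The density is replaced by an expression in the unordered tuple, whose measurability is clear; the principal powers in the original one need no separate treatment.\<close>
lemma emeasure_wedge_measure_part:
 assumes f: "!!x y. (x, y) \<in> D_coords L M ==> ennreal (2 ^ M * f (conj_tuple L M x y)) =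
 W (unordered (L + 2 * M) (conj_tuple L M x y)) * ennreal (2 ^ M * vdm (L + 2 * M) (conj_tuple L M x y))"
 and W: "W \<in> borel_measurable (unordered_borel (L + 2 * M))" and A: "A \<in> sets (unordered_borel (L + 2 * M))"
 shows "emeasure (wedge_measure_part L M f) (unordered (L + 2 * M) -` A \<inter> space (ctuples (L + 2 * M))) =
 conj_pairs_integral L M (%X. indicator A X * W X)" (is "?lhs = ?rhs")
proof -
 let ?n = "L + 2 * M"
 define P where "P = PiM {..<L + M} (%_. lborel :: real measure) \<Otimes>\<^sub>M PiM {L..<L + M} (%_. lborel :: real measure)"
 have sP: "sets P = sets (pair_coords L M)"
 unfolding P_def by (intro sets_pair_measure_cong sets_PiM_cong refl) auto
 define T where "T p = conj_tuple L M (fst p) (snd p)" for p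
 have T: "T \<in> P \<rightarrow>\<^sub>M ctuples ?n"
 unfolding T_def[abs_def] measurable_cong_sets[OF sP refl] by (rule measurable_conj_tuple)
 have uT: "(%p. unordered ?n (T p)) \<in> P \<rightarrow>\<^sub>M unordered_borel ?n"
 by (rule meas_o[OF T measurable_unordered])
 define d where "d p = (if p \<in> D_coords L M then W (unordered ?n (T p)) * ennreal (2 ^ M * vdm ?n (T p)) else 0)" for p
 have d_eq: "(%(x, y). if (x, y) \<in> D_coords L M then ennreal (2 ^ M * f (conj_tuple L M x y)) else 0) = d"
 by (rule ext) (auto simp: d_def T_def f)
 have pD: "{p \<in> space P. p \<in> D_coords L M} \<in> sets P"
 unfolding sP sets_eq_imp_space_eq[OF sP] by (rule predE[OF pred_D_coords])
 have vT: "(%p. ennreal (2 ^ M * vdm ?n (T p))) \<in> borel_measurable P"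
 by (intro meas_o[OF _ measurable_ennreal] borel_measurable_times borel_measurable_const
  meas_o[OF T measurable_vdm])
 have dm: "d \<in> borel_measurable P"
 unfolding d_def[abs_def]
 by (intro measurable_If borel_measurable_times_ennreal meas_o[OF uT W] vT borel_measurable_const pD)
 define B where "B = unordered ?n -` A \<inter> space (ctuples ?n)"
 have B: "B \<in> sets (ctuples ?n)" unfolding B_def by (rule measurable_sets[OF measurable_unordered A])
 have part: "wedge_measure_part L M f = distr (density P d) (ctuples ?n) T"
 unfolding wedge_measure_part_def d_eq P_def[symmetric] by (simp only: case_prod_unfold T_def[abs_def])
 have T': "T \<in> density P d \<rightarrow>\<^sub>M ctuples ?n"
 unfolding measurable_cong_sets[OF sets_density refl] by (rule T)
 have "emeasure (wedge_measure_part L M f) B = emeasure (density P d) (T -` B \<inter> space P)"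
 unfolding part using emeasure_distr[OF T' B] by simp
 also have "... = (\<integral>\<^sup>+p. d p * indicator (T -` B \<inter> space P) p \<partial>P)"
 by (rule emeasure_density[OF dm measurable_sets[OF T B]])
 also have "... = (\<integral>\<^sup>+p. (if p \<in> D_coords L M then (indicator A (unordered ?n (T p)) * W (unordered ?n (T p))) * ennreal (2 ^ M * vdm ?n (T p)) else 0) \<partial>P)"
 proof (rule nn_integral_cong)
 fix p assume p: "p \<in> space P"
 then have "T p \<in> space (ctuples ?n)" by (rule measurable_space[OF T])
 then have "indicator (T -` B \<inter> space P) p = (indicator A (unordered ?n (T p)) :: ennreal)"
 using p by (auto simp: B_def split: split_indicator)
 then show "d p * indicator (T -` B \<inter> space P) p = (if p \<in> D_coords L M then (indicator A (unordered ?n (T p)) * W (unordered ?n (T p))) * ennreal (2 ^ M * vdm ?n (T p)) else 0)"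
 by (simp add: d_def mult_ac)
 qed
 also have "... = ?rhs"
 proof -
 define q where "q p = (if p \<in> D_coords L M then (indicator A (unordered ?n (T p)) * W (unordered ?n (T p))) * ennreal (2 ^ M * vdm ?n (T p)) else 0)" for p
 interpret sigma_finite_measure "PiM {L..<L + M} (%_. lborel :: real measure)"
 by (rule sigma_finite_PiM_lborel_on) simp
 have "q \<in> borel_measurable P"
 unfolding q_def[abs_def]
 by (intro measurable_If borel_measurable_times_ennreal meas_o[OF uT borel_measurable_indicator[OF A]]
  meas_o[OF uT W] vT borel_measurable_const pD)
 from nn_integral_fst[OF this[unfolded P_def]]
 have "(\<integral>\<^sup>+p. q p \<partial>P) = (\<integral>\<^sup>+x. \<integral>\<^sup>+y. q (x, y) \<partial>PiM {L..<L + M} (%_. lborel) \<partial>vol (L + M))"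
 unfolding P_def by (rule sym)
 then show ?thesis unfolding q_def T_def fst_conv snd_conv .
 qed
 finally show ?thesis unfolding B_def .
qed

section \<open>The joint laws\<close>

lemma CMV_cong:
 assumes "!!k. k < n ==> a k = b k"
 shows "CMV n a = CMV n b"
proof -
 have "CMV_block n a k = CMV_block n b k" if "k < n" for k
 unfolding CMV_block_def assms[OF that] ..
 then have map_eq: "map (CMV_block n a) (filter Q [0..<n]) = map (CMV_block n b) (filter Q [0..<n])" for Q
 by (intro map_cong refl) auto
 show ?thesis unfolding CMV_def CMV_L_def CMV_M_def map_eq ..
qed

lemma norm_prod_less_one:
 fixes z :: "nat => complex"
 assumes "n \<ge> 1" "!!j. j < n ==> norm (z j) < 1"
 shows "norm (\<Prod>j<n. z j) < 1"
 using assms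
proof (induction n rule: nat_induct_at_least)
 case (Suc n)
 have "norm ((\<Prod>j<n. z j) * z n) < 1"
 by (rule norm_mult_less_one) (use Suc in auto)
 then show ?case by simp
qed simp

text \<open>The functions \<open>F\<close> and \<open>G\<close> are controlled on the open unit interval only. Keeping the value at 0 makes the densities agree at every point of the disc, also where a root vanishes.\<close>
definition cut_unit :: "(real => real) => real => real" where
 "cut_unit F r = (if 0 <= r & r < 1 then F r else 0)"

lemma measurable_cut_unit:
 assumes "F \<in> borel_measurable (restrict_space borel {0<..<1})"
 shows "cut_unit F \<in> borel_measurable borel"
proof -
 have "(%r. indicator {0<..<1} r *\<^sub>R F r) \<in> borel_measurable borel"
 using borel_measurable_restrict_space_iff[of "{0<..<1}" borel F] assms by simp
 then have "(%r. indicator {0<..<1} r *\<^sub>R F r + (if r = 0 then F 0 else 0)) \<in> borel_measurable borel"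
 by (intro borel_measurable_add measurable_If borel_measurable_const) auto
 also have "(%r. indicator {0<..<1} r *\<^sub>R F r + (if r = 0 then F 0 else 0)) = cut_unit F"
 by (rule ext) (auto simp: cut_unit_def split: split_indicator)
 finally show ?thesis .
qed

lemma emeasure_distr_indicator:
 assumes X: "X \<in> M \<rightarrow>\<^sub>M N" and A: "A \<in> sets N"
 shows "emeasure (distr M N X) A = (\<integral>\<^sup>+\<omega>. indicator A (X \<omega>) \<partial>M)" (is "?lhs = ?rhs")
proof -
 have "(\<integral>\<^sup>+y. indicator A y \<partial>distr M N X) = ?rhs"
 by (rule nn_integral_distr[OF X]) (use A in simp)
 then show ?thesis using A by simp
qed

lemma emeasure_circular_law:
 assumes \<beta>: "\<beta> > 0" and n: "n \<ge> 1" and F: "cut_unit F \<in> borel_measurable borel" and A: "A \<in> sets (unordered_borel n)"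
 shows "emeasure (distr (density (vol n) (%z. if ALL j<n. norm (z j) < 1
  then ennreal (circular_density n \<beta> F z) else 0)) (unordered_borel n) (unordered n)) A =
 (\<integral>\<^sup>+z. (if ALL j<n. norm (z j) < 1 then ennreal (circular_density n \<beta> (cut_unit F) z) else 0) * indicator A (unordered n z) \<partial>vol n)"
proof -
 let ?P = "PiM {..<n} (%_. lborel :: complex measure)"
 define D where "D z = (if ALL j<n. norm (z j) < 1 then ennreal (circular_density n \<beta> (cut_unit F) z) else 0)" for z
 have eq: "(%z. if ALL j<n. norm (z j) < 1 then ennreal (circular_density n \<beta> F z) else 0) = D"
 proof
 fix z :: "nat => complex"
 show "(if ALL j<n. norm (z j) < 1 then ennreal (circular_density n \<beta> F z) else 0) = D z"
 proof (cases "ALL j<n. norm (z j) < 1")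
 case True
 then have "norm (\<Prod>j<n. z j) < 1" by (intro norm_prod_less_one[OF n]) auto
 then have "cut_unit F (norm (\<Prod>j<n. z j)) = F (norm (\<Prod>j<n. z j))" unfolding cut_unit_def by simp
 then show ?thesis unfolding D_def circular_density_def by (simp only:)
 next
 case False
 show ?thesis unfolding D_def by (rule trans[OF if_not_P[OF False] if_not_P[OF False, symmetric]])
 qed
 qed
 have D2: "D = (%z. if \<forall>w\<in>#unordered n z. norm w < 1 then circular_weight n \<beta> (cut_unit F) (unordered n z) * ennreal (vdm2 n z) else 0)"
 proof
 fix z
 have iff: "(\<forall>w\<in>#unordered n z. norm w < 1) \<longleftrightarrow> (ALL j<n. norm (z j) < 1)"
 unfolding set_mset_unordered by auto
 show "D z = (if \<forall>w\<in>#unordered n z. norm w < 1 then circular_weight n \<beta> (cut_unit F) (unordered n z) * ennreal (vdm2 n z) else 0)"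
 proof (cases "ALL j<n. norm (z j) < 1")
 case True
 then show ?thesis unfolding D_def iff if_P[OF True] by (intro circular_density_eq[OF \<beta>]) auto
 next
 case False
 show ?thesis unfolding D_def iff if_not_P[OF False] ..
 qed
 qed
 have Dm: "D \<in> borel_measurable ?P"
 unfolding D2 measurable_PiM_lborel1
 by (intro measurable_If borel_measurable_times_ennreal borel_measurable_const
  meas_o[OF measurable_unordered measurable_circular_weight[OF F]]
  meas_o[OF measurable_vdm2 measurable_ennreal]
  predE[OF meas_o[OF measurable_unordered pred_in_disc]])
 have um: "unordered n \<in> density ?P D \<rightarrow>\<^sub>M unordered_borel n"
 unfolding measurable_cong_sets[OF sets_density refl] measurable_PiM_lborel1 by (rule measurable_unordered)
 have iu: "(%z. indicator A (unordered n z) :: ennreal) \<in> borel_measurable ?P"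
 unfolding measurable_PiM_lborel1
 by (rule meas_o[OF measurable_unordered borel_measurable_indicator[OF A]])
 show ?thesis
 unfolding eq emeasure_distr_indicator[OF um A] nn_integral_density[OF Dm iu] unfolding D_def ..
qed

theorem circular_part:
 fixes M :: "'w measure" and R \<phi> :: "'w => real" and \<alpha> :: "nat => 'w => complex" and F :: "real => real"
 assumes n: "n \<ge> 1" and \<beta>: "0 < \<beta>" and M: "prob_space M"
 and ind: "prob_space.indep_vars M (%_. borel) (\<alpha>(n - 1 := (%\<omega>. cis (\<phi> \<omega>)))) {..<n}"
 and \<alpha>: "ALL k<n - 1. distr M borel (\<alpha> k) = Theta_dist (\<beta> * (real k + 1) + 1)"
 and \<phi>: "distr M borel (%\<omega>. cis (\<phi> \<omega>)) = Theta_dist 1"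
 and indR: "indep_rv M (Pi\<^sub>M {..<n - 1} (%_. borel) \<Otimes>\<^sub>M borel) (%\<omega>. (\<lambda>k\<in>{..<n - 1}. \<alpha> k \<omega>, \<phi> \<omega>)) borel R"
 and F: "F \<in> borel_measurable (restrict_space borel {0<..<1})"
 and R: "distr M borel R = density lborel (%r. if r \<in> {0<..<1}
  then ennreal (F r * (\<beta> * real n) * (1 - r\<^sup>2) powr (\<beta> / 2 * real n - 1) * r) else 0)"
 defines "X \<equiv> (%\<omega>. eigenvalue_mset (CMV n (%k. if k = n - 1 then of_real (R \<omega>) * cis (\<phi> \<omega>) else \<alpha> k \<omega>)))"
 shows "X \<in> measurable M (unordered_borel n) &
 distr M (unordered_borel n) X = distr
 (density (Pi\<^sub>M {..<n} (%_. lborel)) (%z. if ALL j<n. norm (z j) < 1 then ennreal (circular_density n \<beta> F z) else 0))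
 (unordered_borel n) (unordered n)" (is "_ & _ = ?law")
proof -
 obtain m where m: "n = Suc m" using n by (cases n) auto
 have m1: "n - 1 = m" by (simp add: m)
 have cF: "cut_unit F \<in> borel_measurable borel" by (rule measurable_cut_unit[OF F])
 have cism: "cis \<in> borel_measurable borel"
 by (intro borel_measurable_continuous_onI continuous_intros)
 define h where "h k y = (if norm y < 1 then ennreal (Theta_density \<beta> k y) * (if k = m then ennreal (cut_unit F (norm y)) else 1) else 0)" for k and y :: complex
 have normm: "norm \<in> borel_measurable (borel :: complex measure)" by (rule borel_measurable_norm)
 have Tm: "Theta_density \<beta> k \<in> borel_measurable borel" for k
 unfolding Theta_density_def[abs_def] by measurable
 have hm: "h k \<in> borel_measurable borel" for k
 unfolding h_def[abs_def] using Tm[of k, measurable] cF[measurable] by measurable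
 have dens: "distr M borel (\<alpha> k) = density lborel (h k)" if k: "k < m" for k
 proof -
 have pos: "\<beta> * (real k + 1) > 0" using \<beta> by simp
 have "distr M borel (\<alpha> k) = Theta_dist (\<beta> * (real k + 1) + 1)" using \<alpha> k m1 by simp
 also have "... = density lborel (h k)"
 proof -
 have e: "(\<beta> * (real k + 1) + 1 - 3) / 2 = \<beta> / 2 * (real k + 1) - 1" by (simp add: field_simps)
 have "(%z. if norm z < 1 then ennreal ((\<beta> * (real k + 1) + 1 - 1) / (2 * pi) * (1 - (norm z)\<^sup>2) powr ((\<beta> * (real k + 1) + 1 - 3) / 2)) else 0) = h k"
  unfolding e h_def[abs_def] Theta_density_def using k by (intro ext) simp
 moreover have "\<beta> * (real k + 1) + 1 ~= 1" using pos by linarith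
 ultimately show ?thesis unfolding Theta_dist_def by (simp only: if_False)
 qed
 finally show ?thesis .
 qed
 define w where "w r = (if 0 <= r & r < 1 then ennreal (cut_unit F r * (\<beta> * real n * (1 - r\<^sup>2) powr (\<beta> / 2 * real n - 1))) else 0)" for r
 define v where "v r = (if r \<in> {0<..<1} then ennreal (F r * (\<beta> * real n) * (1 - r\<^sup>2) powr (\<beta> / 2 * real n - 1) * r) else 0)" for r
 have wm: "w \<in> borel_measurable borel" unfolding w_def[abs_def] using cF[measurable] by measurable
 have v0: "v r = 0" if "r <= 0" for r using that by (simp add: v_def)
 have vw: "v r = w r * ennreal r" if "r > 0" for r
 proof (cases "r < 1")
 case True
 then have "v r = ennreal (cut_unit F r * (\<beta> * real n * (1 - r\<^sup>2) powr (\<beta> / 2 * real n - 1)) * r)"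
 using that by (simp add: v_def cut_unit_def mult.assoc)
 also have "... = w r * ennreal r" using that True by (simp add: w_def ennreal_mult'')
 finally show ?thesis .
 qed (use that in "simp add: v_def w_def")
 have "v = (%r. if r > 0 then w r * ennreal r else 0)" using v0 vw by (intro ext) (simp add: not_less)
 then have vm: "v \<in> borel_measurable borel" using wm[measurable] by simp
 have last: "(\<integral>\<^sup>+u. \<integral>\<^sup>+r. q (of_real r * u) \<partial>distr M borel R \<partial>distr M borel (%\<omega>. cis (\<phi> \<omega>))) = (\<integral>\<^sup>+y. q y * h m y \<partial>lborel)"
 if q: "q \<in> borel_measurable borel" for q :: "complex => ennreal"
 proof -
 have "(\<integral>\<^sup>+u. \<integral>\<^sup>+r. q (of_real r * u) \<partial>distr M borel R \<partial>distr M borel (%\<omega>. cis (\<phi> \<omega>))) =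
 (\<integral>\<^sup>+z. q z * (w (norm z) * ennreal (1 / (2 * pi))) \<partial>lborel)"
 unfolding R \<phi> v_def[symmetric] by (rule nn_integral_uniform_rotation[OF q wm v0 vw vm])
 moreover have "w (norm z) * ennreal (1 / (2 * pi)) = h m z" for z
 proof (cases "norm z < 1")
 case True
 define p where "p = \<beta> * real n * (1 - (norm z)\<^sup>2) powr (\<beta> / 2 * real n - 1)"
 have p: "p \<ge> 0" using \<beta> by (simp add: p_def)
 have "w (norm z) = ennreal (cut_unit F (norm z)) * ennreal p"
  unfolding w_def p_def[symmetric] ennreal_mult''[OF p] using True by simp
 then have "w (norm z) * ennreal (1 / (2 * pi)) = ennreal (cut_unit F (norm z)) * (ennreal p * ennreal (1 / (2 * pi)))"
  by (simp only: mult.assoc)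
 also have "ennreal p * ennreal (1 / (2 * pi)) = ennreal (p * (1 / (2 * pi)))"
  by (rule ennreal_mult[symmetric]) (use p in auto)
 also have "p * (1 / (2 * pi)) = Theta_density \<beta> m z"
  unfolding p_def Theta_density_def m by (simp add: add.commute)
 finally show ?thesis using True by (simp add: h_def mult.commute)
 qed (simp add: w_def h_def)
 ultimately show ?thesis by (simp only:)
 qed
 have cm: "case_prod (%r u. complex_of_real r * u) \<in> borel_measurable (borel \<Otimes>\<^sub>M borel)"
 unfolding case_prod_unfold
 by (intro borel_measurable_times meas_o[OF measurable_fst borel_measurable_of_real] measurable_snd)
 define Y where "Y \<omega> = (\<lambda>k\<in>{..<Suc m}. if k = m then of_real (R \<omega>) * cis (\<phi> \<omega>) else \<alpha> k \<omega>)" for \<omega>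
 have X_eq: "X = (%\<omega>. eigenvalue_mset (CMV n (Y \<omega>)))"
 unfolding X_def m1 Y_def m[symmetric] by (intro ext arg_cong[where f = eigenvalue_mset] CMV_cong) simp
 note params = nn_integral_parameters[OF M ind[unfolded m1, unfolded m] cism indR[unfolded m1] dens hm last cm]
 have Ym: "Y \<in> M \<rightarrow>\<^sub>M ctuples n"
 unfolding Y_def m by (rule params(1)[of "%_. 0"]) simp_all
 have Xm: "X \<in> M \<rightarrow>\<^sub>M unordered_borel n"
 unfolding X_eq by (rule meas_o[OF Ym measurable_eigenvalue_mset_CMV[OF n]])
 have "distr M (unordered_borel n) X = ?law"
 proof (rule measure_eqI)
 fix A assume "A \<in> sets (distr M (unordered_borel n) X)"
 then have A: "A \<in> sets (unordered_borel n)" by simp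
 define H where "H x = (indicator A (eigenvalue_mset (CMV n x)) :: ennreal)" for x
 have Hm: "H \<in> borel_measurable (ctuples n)"
 unfolding H_def[abs_def]
 by (rule meas_o[OF measurable_eigenvalue_mset_CMV[OF n] borel_measurable_indicator[OF A]])
 have "emeasure (distr M (unordered_borel n) X) A = (\<integral>\<^sup>+\<omega>. H (Y \<omega>) \<partial>M)"
 unfolding emeasure_distr_indicator[OF Xm A] by (simp only: X_eq H_def)
 also have "... = (\<integral>\<^sup>+x. H x * (\<Prod>k<n. h k (x k)) \<partial>vol n)"
 unfolding Y_def m by (rule params(2)) (use Hm m in simp_all)
 also have "... = (\<integral>\<^sup>+x. indicator A (eigenvalue_mset (CMV n x)) *
 (\<Prod>k<n. if norm (x k) < 1 then ennreal (Theta_density \<beta> k (x k)) * (if k = m then ennreal (cut_unit F (norm (x m))) else 1) else 0)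
 \<partial>vol n)"
 unfolding H_def h_def by (intro nn_integral_cong arg_cong2[where f = "(*)"] prod.cong refl) simp
 also have "... = emeasure (?law) A"
 unfolding emeasure_circular_law[OF \<beta> n cF A] by (rule circular_change_of_variables[OF \<beta> m cF A])
 finally show "emeasure (distr M (unordered_borel n) X) A = emeasure (?law) A" .
 qed simp
 with Xm show ?thesis ..
qed

lemma sets_wedge_measure: "sets (wedge_measure n f) = sets (ctuples n)"
 unfolding wedge_measure_def by (rule sets.sets_measure_of_eq)

lemma emeasure_orthogonal_law:
 assumes \<beta>: "\<beta> > 0" and n: "n \<ge> 1" and G: "cut_unit G \<in> borel_measurable borel" and A: "A \<in> sets (unordered_borel n)"
 shows "emeasure (distr (wedge_measure n (orthogonal_density n \<beta> G)) (unordered_borel n) (unordered n)) A =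
 (\<Sum>M\<le>n div 2. conj_pairs_integral (n - 2 * M) M (%X. indicator A X * orthogonal_weight n \<beta> (cut_unit G) X))" (is "?lhs = ?rhs")
proof -
 have um: "unordered n \<in> wedge_measure n (orthogonal_density n \<beta> G) \<rightarrow>\<^sub>M unordered_borel n"
 unfolding measurable_cong_sets[OF sets_wedge_measure refl] by (rule measurable_unordered)
 have B: "unordered n -` A \<inter> space (ctuples n) \<in> sets (ctuples n)"
 by (rule measurable_sets[OF measurable_unordered A])
 have "?lhs =
 emeasure (wedge_measure n (orthogonal_density n \<beta> G)) (unordered n -` A \<inter> space (ctuples n))"
 unfolding emeasure_distr[OF um A] sets_eq_imp_space_eq[OF sets_wedge_measure] ..
 also have "... = (\<Sum>M\<le>n div 2. emeasure (wedge_measure_part (n - 2 * M) M (orthogonal_density n \<beta> G)) (unordered n -` A \<inter> space (ctuples n)))"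
 by (rule emeasure_wedge_measure[OF B])
 also have "... = ?rhs"
 proof (rule sum.cong[OF refl])
 fix M assume "M \<in> {..n div 2}"
 then have e: "n - 2 * M + 2 * M = n" by auto
 have f: "ennreal (2 ^ M * orthogonal_density n \<beta> G (conj_tuple (n - 2 * M) M x y)) =
 orthogonal_weight n \<beta> (cut_unit G) (unordered n (conj_tuple (n - 2 * M) M x y)) * ennreal (2 ^ M * vdm n (conj_tuple (n - 2 * M) M x y))"
 if D: "(x, y) \<in> D_coords (n - 2 * M) M" for x y
 proof -
 define z where "z = conj_tuple (n - 2 * M) M x y"
 have z: "norm (z j) < 1" if "j < n" for j
  using D that e unfolding D_coords_def z_def by auto
 have sym: "image_mset cnj (unordered n z) = unordered n z"
  using unordered_conj_tuple_cnj[of "n - 2 * M" M x y] unfolding e z_def .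
 have "norm (\<Prod>j<n. z j) < 1" by (rule norm_prod_less_one[OF n z])
 then have "cut_unit G (norm (\<Prod>j<n. z j)) = G (norm (\<Prod>j<n. z j))" unfolding cut_unit_def by simp
 then have "orthogonal_density n \<beta> G z = orthogonal_density n \<beta> (cut_unit G) z"
  unfolding orthogonal_density_def by (simp only:)
 then show ?thesis using orthogonal_density_eq[OF \<beta> n z sym, of M "cut_unit G"] unfolding z_def by (simp only:)
 qed
 show "emeasure (wedge_measure_part (n - 2 * M) M (orthogonal_density n \<beta> G)) (unordered n -` A \<inter> space (ctuples n)) =
 conj_pairs_integral (n - 2 * M) M (%X. indicator A X * orthogonal_weight n \<beta> (cut_unit G) X)"
 using emeasure_wedge_measure_part[of "n - 2 * M" M "orthogonal_density n \<beta> G" "orthogonal_weight n \<beta> (cut_unit G)" A]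
 unfolding e using f measurable_orthogonal_weight[OF G] A by blast
 qed
 finally show ?thesis .
qed

theorem orthogonal_part:
 fixes M :: "'w measure" and R \<sigma> :: "'w => real" and \<alpha> :: "nat => 'w => real" and G :: "real => real"
 assumes n: "n \<ge> 1" and \<beta>: "0 < \<beta>" and M: "prob_space M"
 and ind: "prob_space.indep_vars M (%_. borel) (\<alpha>(n - 1 := \<sigma>)) {..<n}"
 and \<alpha>: "ALL k<n - 1. distr M borel (\<alpha> k) = B_dist (\<beta> * (real k + 1) / 4) (\<beta> * (real k + 1) / 4)"
 and \<sigma>: "distr M borel \<sigma> = B_dist 0 0"
 and indR: "indep_rv M (Pi\<^sub>M {..<n - 1} (%_. borel) \<Otimes>\<^sub>M borel) (%\<omega>. (\<lambda>k\<in>{..<n - 1}. \<alpha> k \<omega>, \<sigma> \<omega>)) borel R"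
 and G: "G \<in> borel_measurable (restrict_space borel {0<..<1})"
 and R: "distr M borel R = density lborel (%r. if r \<in> {0<..<1}
  then ennreal (G r * (2 * Gamma (\<beta> / 4 * real n + 1 / 2) / (sqrt pi * Gamma (\<beta> / 4 * real n)))
  * (1 - r\<^sup>2) powr (\<beta> / 4 * real n - 1)) else 0)"
 defines "X \<equiv> (%\<omega>. eigenvalue_mset (CMV n (%k. of_real (if k = n - 1 then R \<omega> * \<sigma> \<omega> else \<alpha> k \<omega>))))"
 shows "X \<in> measurable M (unordered_borel n) &
 distr M (unordered_borel n) X = distr (wedge_measure n (orthogonal_density n \<beta> G)) (unordered_borel n) (unordered n)" (is "_ & _ = ?law")
proof -
 obtain m where m: "n = Suc m" using n by (cases n) auto
 have m1: "n - 1 = m" by (simp add: m)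
 have cG: "cut_unit G \<in> borel_measurable borel" by (rule measurable_cut_unit[OF G])
 define h where "h k y = (if \<bar>y\<bar> < 1 then ennreal (B_density \<beta> k y) * (if k = m then ennreal (cut_unit G \<bar>y\<bar>) else 1) else 0)" for k y
 have Bm: "B_density \<beta> k \<in> borel_measurable borel" for k
 unfolding B_density_def[abs_def] by measurable
 have hm: "h k \<in> borel_measurable borel" for k
 unfolding h_def[abs_def] using Bm[of k, measurable] cG[measurable] by measurable
 have dens: "distr M borel (\<alpha> k) = density lborel (h k)" if k: "k < m" for k
 proof -
 have pos: "\<beta> * (real k + 1) / 4 > 0" using \<beta> by simp
 have "distr M borel (\<alpha> k) = B_dist (\<beta> * (real k + 1) / 4) (\<beta> * (real k + 1) / 4)" using \<alpha> k m1 by simp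
 also have "... = density lborel (h k)"
 proof -
 define s where "s = \<beta> * (real k + 1) / 4"
 have s: "s > 0" unfolding s_def by (rule pos)
 have "(%x. if -1 < x & x < 1 then ennreal (2 powr (1 - s - s) * Gamma (s + s) / (Gamma s * Gamma s)
  * (1 - x) powr (s - 1) * (1 + x) powr (s - 1)) else 0) = h k"
 proof
  fix x :: real
  have "(-1 < x & x < 1) \<longleftrightarrow> \<bar>x\<bar> < 1" by linarith
  then show "(if -1 < x & x < 1 then ennreal (2 powr (1 - s - s) * Gamma (s + s) / (Gamma s * Gamma s)
  * (1 - x) powr (s - 1) * (1 + x) powr (s - 1)) else 0) = h k x"
  unfolding h_def B_density_def B_const_def s_def[symmetric] using k by simp
 qed
 moreover have "\<not> (s = 0 & s = 0)" using s by simp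
 ultimately show ?thesis unfolding s_def[symmetric] B_dist_def by (simp only: if_False)
 qed
 finally show ?thesis .
 qed
 define s where "s = \<beta> / 4 * real n"
 have s: "s > 0" unfolding s_def using \<beta> m by simp
 define C where "C = 2 * Gamma (s + 1 / 2) / (sqrt pi * Gamma s)"
 have C0: "C \<ge> 0" unfolding C_def using s by (simp add: Gamma_real_pos less_imp_le)
 define w where "w r = (if 0 <= r & r < 1 then ennreal (cut_unit G r * (C * (1 - r\<^sup>2) powr (s - 1))) else 0)" for r
 define v where "v r = (if r \<in> {0<..<1} then ennreal (G r * C * (1 - r\<^sup>2) powr (s - 1)) else 0)" for r
 have wm: "w \<in> borel_measurable borel" unfolding w_def[abs_def] using cG[measurable] by measurable
 have v0: "v r = 0" if "r <= 0" for r using that by (simp add: v_def)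
 have vw: "v r = w r" if "r > 0" for r
 using that by (simp add: v_def w_def cut_unit_def mult.assoc)
 have "v = (%r. if r > 0 then w r else 0)" using v0 vw by (intro ext) (simp add: not_less)
 then have vm: "v \<in> borel_measurable borel" using wm[measurable] by simp
 have last: "(\<integral>\<^sup>+u. \<integral>\<^sup>+r. q (r * u) \<partial>distr M borel R \<partial>distr M borel (%\<omega>. \<sigma> \<omega>)) = (\<integral>\<^sup>+y. q y * h m y \<partial>lborel)"
 if q: "q \<in> borel_measurable borel" for q :: "real => ennreal"
 proof -
 have "(\<integral>\<^sup>+u. \<integral>\<^sup>+r. q (r * u) \<partial>distr M borel R \<partial>distr M borel (%\<omega>. \<sigma> \<omega>)) =
 (\<integral>\<^sup>+y. q y * (w \<bar>y\<bar> * ennreal (1 / 2)) \<partial>lborel)"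
 unfolding R \<sigma> s_def[symmetric] C_def[symmetric] v_def[symmetric] by (rule nn_integral_random_sign[OF q wm v0 vw vm])
 moreover have "w \<bar>y\<bar> * ennreal (1 / 2) = h m y" for y
 proof (cases "\<bar>y\<bar> < 1")
 case True
 define p where "p = C * (1 - y\<^sup>2) powr (s - 1)"
 have p: "p \<ge> 0" using C0 by (simp add: p_def)
 have sq: "\<bar>y\<bar>\<^sup>2 = y\<^sup>2" by simp
 have "w \<bar>y\<bar> = ennreal (cut_unit G \<bar>y\<bar>) * ennreal p"
  unfolding w_def sq p_def[symmetric] ennreal_mult''[OF p] using True by simp
 then have "w \<bar>y\<bar> * ennreal (1 / 2) = ennreal (cut_unit G \<bar>y\<bar>) * (ennreal p * ennreal (1 / 2))"
  by (simp only: mult.assoc)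
 also have "ennreal p * ennreal (1 / 2) = ennreal (p * (1 / 2))"
  by (rule ennreal_mult[symmetric]) (use p in auto)
 also have "p * (1 / 2) = B_density \<beta> m y"
 proof -
  have sm: "\<beta> * (real m + 1) / 4 = s" by (simp add: s_def m add.commute)
  have "1 - y\<^sup>2 = (1 - y) * (1 + y)" by (simp add: power2_eq_square algebra_simps)
  then have "(1 - y\<^sup>2) powr (s - 1) = (1 - y) powr (s - 1) * (1 + y) powr (s - 1)"
  using True by (simp add: powr_mult)
  then have "p * (1 / 2) = (C * (1 / 2)) * ((1 - y) powr (s - 1) * (1 + y) powr (s - 1))"
  unfolding p_def by (simp only: mult_ac)
  also have "C * (1 / 2) = B_const s" unfolding C_def by (rule B_const_eq[OF s])
  finally show ?thesis unfolding B_density_def sm by (simp only: mult.assoc)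
 qed
 finally show ?thesis using True by (simp add: h_def mult.commute)
 qed (simp add: w_def h_def)
 ultimately show ?thesis by (simp only:)
 qed
 have cm: "case_prod (%r u :: real. r * u) \<in> borel_measurable (borel \<Otimes>\<^sub>M borel)"
 unfolding case_prod_unfold by (intro borel_measurable_times measurable_fst measurable_snd)
 define Y where "Y \<omega> = (\<lambda>k\<in>{..<Suc m}. if k = m then R \<omega> * \<sigma> \<omega> else \<alpha> k \<omega>)" for \<omega>
 define E where "E x = eigenvalue_mset (CMV n (%k. complex_of_real (x k)))" for x
 have Em: "E \<in> tuples n \<rightarrow>\<^sub>M unordered_borel n"
 proof -
 have "(%x. \<lambda>k\<in>{..<n}. complex_of_real (x k)) \<in> tuples n \<rightarrow>\<^sub>M ctuples n"
 by (rule measurable_restrict, rule meas_o[OF _ borel_measurable_of_real],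
  rule measurable_component_singleton)
 from meas_o[OF this measurable_eigenvalue_mset_CMV[OF n]]
 have "(%x. eigenvalue_mset (CMV n (\<lambda>k\<in>{..<n}. complex_of_real (x k)))) \<in> tuples n \<rightarrow>\<^sub>M unordered_borel n" .
 moreover have "CMV n (\<lambda>k\<in>{..<n}. complex_of_real (x k)) = CMV n (%k. complex_of_real (x k))" for x
 by (rule CMV_cong) simp
 ultimately show ?thesis unfolding E_def[abs_def] by (simp only:)
 qed
 have X_eq: "X = (%\<omega>. E (Y \<omega>))"
 unfolding X_def m1 Y_def m[symmetric] E_def by (intro ext arg_cong[where f = eigenvalue_mset] CMV_cong) simp
 have id: "(%u :: real. u) \<in> borel_measurable borel" by (rule measurable_ident_sets[OF refl])
 note params = nn_integral_parameters[where s = "%u. u", OF M ind[unfolded m1, unfolded m] id indR[unfolded m1] dens hm last cm]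
 have Ym: "Y \<in> M \<rightarrow>\<^sub>M tuples n"
 unfolding Y_def m by (rule params(1)[of "%_. 0"]) simp_all
 have Xm: "X \<in> M \<rightarrow>\<^sub>M unordered_borel n"
 unfolding X_eq by (rule meas_o[OF Ym Em])
 have "distr M (unordered_borel n) X = ?law"
 proof (rule measure_eqI)
 fix A assume "A \<in> sets (distr M (unordered_borel n) X)"
 then have A: "A \<in> sets (unordered_borel n)" by simp
 define H where "H x = (indicator A (E x) :: ennreal)" for x
 have Hm: "H \<in> borel_measurable (tuples n)"
 unfolding H_def[abs_def] by (rule meas_o[OF Em borel_measurable_indicator[OF A]])
 have "emeasure (distr M (unordered_borel n) X) A = (\<integral>\<^sup>+\<omega>. H (Y \<omega>) \<partial>M)"
 unfolding emeasure_distr_indicator[OF Xm A] by (simp only: X_eq H_def)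
 also have "... = (\<integral>\<^sup>+x. H x * (\<Prod>k<n. h k (x k)) \<partial>vol n)"
 unfolding Y_def m by (rule params(2)) (use Hm m in simp_all)
 also have "... = (\<integral>\<^sup>+x. indicator A (eigenvalue_mset (CMV n (%k. of_real (x k)))) *
 (\<Prod>k<n. if \<bar>x k\<bar> < 1 then ennreal (B_density \<beta> k (x k)) * (if k = m then ennreal (cut_unit G \<bar>x m\<bar>) else 1) else 0)
 \<partial>vol n)"
 unfolding H_def h_def E_def by (intro nn_integral_cong arg_cong2[where f = "(*)"] prod.cong refl) simp
 also have "... = emeasure (?law) A"
 unfolding emeasure_orthogonal_law[OF \<beta> n cG A] by (rule orthogonal_change_of_variables[OF \<beta> m cG A])
 finally show "emeasure (distr M (unordered_borel n) X) A = emeasure (?law) A" .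
 qed simp
 with Xm show ?thesis ..
qed

theorem proposition7p2:
  fixes n :: nat and \<beta> :: real and M :: "'w measure" and R :: "'w \<Rightarrow> real"
  assumes "n \<ge> 1" and "0 < \<beta>" and "prob_space M"
  shows
    "(\<forall>(\<alpha> :: nat \<Rightarrow> 'w \<Rightarrow> complex) (\<phi> :: 'w \<Rightarrow> real) (F :: real \<Rightarrow> real).
        prob_space.indep_vars M (\<lambda>_. borel) (\<alpha>(n - 1 := (\<lambda>\<omega>. cis (\<phi> \<omega>)))) {..<n} \<and>
        (\<forall>k<n - 1. distr M borel (\<alpha> k) = Theta_dist (\<beta> * (real k + 1) + 1)) \<and>
        distr M borel (\<lambda>\<omega>. cis (\<phi> \<omega>)) = Theta_dist 1 \<and>
        indep_rv M
          (Pi\<^sub>M {..<n - 1} (\<lambda>_. borel) \<Otimes>\<^sub>M borel) (\<lambda>\<omega>. (\<lambda>k\<in>{..<n - 1}. \<alpha> k \<omega>, \<phi> \<omega>))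
          borel R \<and>
        F \<in> borel_measurable (restrict_space borel {0<..<1}) \<and>
        (AE r in lborel. r \<in> {0<..<1} \<longrightarrow> 0 \<le> F r) \<and>
        distr M borel R = density lborel (\<lambda>r. if r \<in> {0<..<1}
          then ennreal (F r * (\<beta> * real n) * (1 - r\<^sup>2) powr (\<beta> / 2 * real n - 1) * r) else 0)
      \<longrightarrow>
        (\<lambda>\<omega>. eigenvalue_mset (CMV n (\<lambda>k. if k = n - 1 then of_real (R \<omega>) * cis (\<phi> \<omega>) else \<alpha> k \<omega>)))
          \<in> measurable M (unordered_borel n) \<and>
        distr M (unordered_borel n)
          (\<lambda>\<omega>. eigenvalue_mset (CMV n (\<lambda>k. if k = n - 1 then of_real (R \<omega>) * cis (\<phi> \<omega>) else \<alpha> k \<omega>)))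
        = distr
            (density (Pi\<^sub>M {..<n} (\<lambda>_. lborel)) (\<lambda>z. if \<forall>j<n. norm (z j) < 1
               then ennreal (circular_density n \<beta> F z) else 0))
            (unordered_borel n) (unordered n))
     \<and>
     (\<forall>(\<alpha> :: nat \<Rightarrow> 'w \<Rightarrow> real) (\<sigma> :: 'w \<Rightarrow> real) (G :: real \<Rightarrow> real).
        prob_space.indep_vars M (\<lambda>_. borel) (\<alpha>(n - 1 := \<sigma>)) {..<n} \<and>
        (\<forall>k<n - 1. distr M borel (\<alpha> k) = B_dist (\<beta> * (real k + 1) / 4) (\<beta> * (real k + 1) / 4)) \<and>
        distr M borel \<sigma> = B_dist 0 0 \<and>
        indep_rv M
          (Pi\<^sub>M {..<n - 1} (\<lambda>_. borel) \<Otimes>\<^sub>M borel) (\<lambda>\<omega>. (\<lambda>k\<in>{..<n - 1}. \<alpha> k \<omega>, \<sigma> \<omega>))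
          borel R \<and>
        G \<in> borel_measurable (restrict_space borel {0<..<1}) \<and>
        (AE r in lborel. r \<in> {0<..<1} \<longrightarrow> 0 \<le> G r) \<and>
        distr M borel R = density lborel (\<lambda>r. if r \<in> {0<..<1}
          then ennreal (G r * (2 * Gamma (\<beta> / 4 * real n + 1 / 2) / (sqrt pi * Gamma (\<beta> / 4 * real n)))
                 * (1 - r\<^sup>2) powr (\<beta> / 4 * real n - 1)) else 0)
      \<longrightarrow>
        (\<lambda>\<omega>. eigenvalue_mset (CMV n (\<lambda>k. of_real (if k = n - 1 then R \<omega> * \<sigma> \<omega> else \<alpha> k \<omega>))))
          \<in> measurable M (unordered_borel n) \<and>
        distr M (unordered_borel n)
          (\<lambda>\<omega>. eigenvalue_mset (CMV n (\<lambda>k. of_real (if k = n - 1 then R \<omega> * \<sigma> \<omega> else \<alpha> k \<omega>))))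
        = distr (wedge_measure n (orthogonal_density n \<beta> G)) (unordered_borel n) (unordered n))"
proof (rule conjI, goal_cases)
  case 1
  show ?case
    by (intro allI impI, elim conjE) (rule circular_part[OF assms]; assumption)
next
  case 2
  show ?case
    by (intro allI impI, elim conjE) (rule orthogonal_part[OF assms]; assumption)
qed

end
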